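(* Let $\mathcal{EL} = \{\mathcal{E}_{1}, \ldots, \mathcal{E}_{k},\ell_{1}, \ldots, \ell_{d}\}\subset \mathbb{P}^{2}_{\mathbb{C}}$ be an arrangement consisting of $k\geq 1$ smooth cubic curves and $d\geq 1$ lines whose union has as singularities only nodes ($A_1$), singular points of type $A_{5}$ (local normal form $x^2+y^6=0$), and ordinary triple points ($D_4$). If $\mathcal{EL}$ is free, then $3k+d \in \{6,7,9\}$.
   Context: The curves are pairwise distinct, so the union $C$ is a reduced plane curve of degree $m=3k+d$, defined by a reduced homogeneous polynomial $f\in S=\mathbb{C}[x,y,z]$ of degree $m$. Let $J_f$ be the Jacobian ideal generated by $\partial f/\partial x,\partial f/\partial y,\partial f/\partial z$, and let $\mathrm{Syz}(J_f)$ be the $S$-module of triples $(a,b,c)\in S^3$ with $a f_x+bf_y+cf_z=0$. The curve $C$ is called free if $\mathrm{Syz}(J_f)$ is minimally generated by two homogeneous syzygies of degrees $d_1\le d_2$ with $1\le d_1$ and $d_1+d_2=m-1$. The arrangement $\mathcal{EL}$ is called free if $C$ is free. *)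

theory Defs
  imports "HOL-Complex_Analysis.Complex_Analysis"
begin

type_synonym pt = "complex \<times> complex \<times> complex"

text \<open>Homogeneous polynomials of degree n in C[x,y,z], represented as polynomial
  functions on C^3 (faithful since C is infinite).  The zero polynomial is included.\<close>
definition hpoly :: "nat \<Rightarrow> (pt \<Rightarrow> complex) \<Rightarrow> bool" where
  "hpoly n f \<longleftrightarrow> (\<exists>c :: nat \<Rightarrow> nat \<Rightarrow> complex. \<forall>x y z.
     f (x, y, z) = (\<Sum>i\<le>n. \<Sum>j\<le>n - i. c i j * x ^ i * y ^ j * z ^ (n - i - j)))"

definition polyfun :: "(pt \<Rightarrow> complex) \<Rightarrow> bool" where
  "polyfun f \<longleftrightarrow> (\<exists>N g. (\<forall>n\<le>N. hpoly n (g n)) \<and> (\<forall>v. f v = (\<Sum>n\<le>N. g n v)))"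

definition dX :: "(pt \<Rightarrow> complex) \<Rightarrow> pt \<Rightarrow> complex" where
  "dX f = (\<lambda>(x, y, z). deriv (\<lambda>t. f (t, y, z)) x)"
definition dY :: "(pt \<Rightarrow> complex) \<Rightarrow> pt \<Rightarrow> complex" where
  "dY f = (\<lambda>(x, y, z). deriv (\<lambda>t. f (x, t, z)) y)"
definition dZ :: "(pt \<Rightarrow> complex) \<Rightarrow> pt \<Rightarrow> complex" where
  "dZ f = (\<lambda>(x, y, z). deriv (\<lambda>t. f (x, y, t)) z)"

definition sing_point :: "(pt \<Rightarrow> complex) \<Rightarrow> pt \<Rightarrow> bool" where
  "sing_point f p \<longleftrightarrow> p \<noteq> (0, 0, 0) \<and> f p = 0 \<and> dX f p = 0 \<and> dY f p = 0 \<and> dZ f p = 0"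

definition smooth_cubic :: "(pt \<Rightarrow> complex) \<Rightarrow> bool" where
  "smooth_cubic F \<longleftrightarrow> hpoly 3 F \<and> F \<noteq> (\<lambda>_. 0) \<and> (\<forall>p. \<not> sing_point F p)"

definition line_form :: "(pt \<Rightarrow> complex) \<Rightarrow> bool" where
  "line_form L \<longleftrightarrow> hpoly 1 L \<and> L \<noteq> (\<lambda>_. 0)"

definition zero_set :: "(pt \<Rightarrow> complex) \<Rightarrow> pt set" where
  "zero_set F = {p. p \<noteq> (0, 0, 0) \<and> F p = 0}"

definition holo2 :: "(complex \<times> complex) set \<Rightarrow> (complex \<times> complex \<Rightarrow> complex) \<Rightarrow> bool" where
  "holo2 U g \<longleftrightarrow> open U \<and> (\<forall>z\<in>U. \<exists>a b.
      (g has_derivative (\<lambda>h. a * fst h + b * snd h)) (at z))"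

definition biholo_on :: "(complex \<times> complex) set \<Rightarrow> (complex \<times> complex \<Rightarrow> complex)
    \<Rightarrow> (complex \<times> complex \<Rightarrow> complex) \<Rightarrow> bool" where
  "biholo_on U \<phi>1 \<phi>2 \<longleftrightarrow> (0, 0) \<in> U \<and> holo2 U \<phi>1 \<and> holo2 U \<phi>2 \<and>
     \<phi>1 (0, 0) = 0 \<and> \<phi>2 (0, 0) = 0 \<and>
     inj_on (\<lambda>z. (\<phi>1 z, \<phi>2 z)) U \<and> open ((\<lambda>z. (\<phi>1 z, \<phi>2 z)) ` U) \<and>
     (\<exists>\<psi>1 \<psi>2. holo2 ((\<lambda>z. (\<phi>1 z, \<phi>2 z)) ` U) \<psi>1 \<and> holo2 ((\<lambda>z. (\<phi>1 z, \<phi>2 z)) ` U) \<psi>2 \<and>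
        (\<forall>z\<in>U. (\<psi>1 (\<phi>1 z, \<phi>2 z), \<psi>2 (\<phi>1 z, \<phi>2 z)) = z))"

definition germ_equiv :: "(complex \<times> complex \<Rightarrow> complex) \<Rightarrow> (complex \<times> complex \<Rightarrow> complex) \<Rightarrow> bool" where
  "germ_equiv g h \<longleftrightarrow> (\<exists>U \<phi>1 \<phi>2 u. biholo_on U \<phi>1 \<phi>2 \<and> holo2 U u \<and> u (0, 0) \<noteq> 0 \<and>
      (\<forall>w\<in>U. g (\<phi>1 w, \<phi>2 w) = u w * h w))"

definition tadd :: "pt \<Rightarrow> pt \<Rightarrow> pt" where
  "tadd a b = (fst a + fst b, fst (snd a) + fst (snd b), snd (snd a) + snd (snd b))"
definition tsmul :: "complex \<Rightarrow> pt \<Rightarrow> pt" where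
  "tsmul c a = (c * fst a, c * fst (snd a), c * snd (snd a))"
definition det3 :: "pt \<Rightarrow> pt \<Rightarrow> pt \<Rightarrow> complex" where
  "det3 a b c = (case a of (a1, a2, a3) \<Rightarrow> case b of (b1, b2, b3) \<Rightarrow> case c of (c1, c2, c3) \<Rightarrow>
      a1 * (b2 * c3 - b3 * c2) - a2 * (b1 * c3 - b3 * c1) + a3 * (b1 * c2 - b2 * c1))"

text \<open>The curve f = 0 has at the point p a singularity analytically equivalent to the
  germ h = 0: in an affine chart (u,v) |-> p + u e1 + v e2 (p, e1, e2 a basis of C^3)
  the local equation of f at p is contact-equivalent to h.\<close>
definition sing_type :: "(pt \<Rightarrow> complex) \<Rightarrow> pt \<Rightarrow> (complex \<times> complex \<Rightarrow> complex) \<Rightarrow> bool" where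
  "sing_type f p h \<longleftrightarrow> (\<exists>e1 e2. det3 p e1 e2 \<noteq> 0 \<and>
     germ_equiv (\<lambda>w. f (tadd p (tadd (tsmul (fst w) e1) (tsmul (snd w) e2)))) h)"

definition nf_A1 :: "complex \<times> complex \<Rightarrow> complex" where "nf_A1 w = fst w ^ 2 + snd w ^ 2"
definition nf_A5 :: "complex \<times> complex \<Rightarrow> complex" where "nf_A5 w = fst w ^ 2 + snd w ^ 6"
definition nf_D4 :: "complex \<times> complex \<Rightarrow> complex" where "nf_D4 w = fst w ^ 2 * snd w + snd w ^ 3"

definition syz :: "(pt \<Rightarrow> complex) \<Rightarrow> ((pt \<Rightarrow> complex) \<times> (pt \<Rightarrow> complex) \<times> (pt \<Rightarrow> complex)) set" where
  "syz f = {(a, b, c). polyfun a \<and> polyfun b \<and> polyfun c \<and>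
      (\<forall>v. a v * dX f v + b v * dY f v + c v * dZ f v = 0)}"

definition hsyz :: "nat \<Rightarrow> ((pt \<Rightarrow> complex) \<times> (pt \<Rightarrow> complex) \<times> (pt \<Rightarrow> complex)) \<Rightarrow> bool" where
  "hsyz n r \<longleftrightarrow> hpoly n (fst r) \<and> hpoly n (fst (snd r)) \<and> hpoly n (snd (snd r))"

definition lin2 :: "(pt \<Rightarrow> complex) \<Rightarrow> ((pt \<Rightarrow> complex) \<times> (pt \<Rightarrow> complex) \<times> (pt \<Rightarrow> complex))
    \<Rightarrow> (pt \<Rightarrow> complex) \<Rightarrow> ((pt \<Rightarrow> complex) \<times> (pt \<Rightarrow> complex) \<times> (pt \<Rightarrow> complex))
    \<Rightarrow> ((pt \<Rightarrow> complex) \<times> (pt \<Rightarrow> complex) \<times> (pt \<Rightarrow> complex))" where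
  "lin2 p r q s = ((\<lambda>v. p v * fst r v + q v * fst s v),
                   (\<lambda>v. p v * fst (snd r) v + q v * fst (snd s) v),
                   (\<lambda>v. p v * snd (snd r) v + q v * snd (snd s) v))"

definition lin1 :: "(pt \<Rightarrow> complex) \<Rightarrow> ((pt \<Rightarrow> complex) \<times> (pt \<Rightarrow> complex) \<times> (pt \<Rightarrow> complex))
    \<Rightarrow> ((pt \<Rightarrow> complex) \<times> (pt \<Rightarrow> complex) \<times> (pt \<Rightarrow> complex))" where
  "lin1 p r = ((\<lambda>v. p v * fst r v), (\<lambda>v. p v * fst (snd r) v), (\<lambda>v. p v * snd (snd r) v))"

text \<open>Freeness of the curve f = 0 of degree m: Syz(J_f) minimally generated by two
  homogeneous syzygies of degrees d1 <= d2, 1 <= d1, d1 + d2 = m - 1.\<close>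
definition free_curve :: "nat \<Rightarrow> (pt \<Rightarrow> complex) \<Rightarrow> bool" where
  "free_curve m f \<longleftrightarrow> (\<exists>r1 r2 d1 d2. 1 \<le> d1 \<and> d1 \<le> d2 \<and> d1 + d2 = m - 1 \<and>
      hsyz d1 r1 \<and> hsyz d2 r2 \<and> r1 \<in> syz f \<and> r2 \<in> syz f \<and>
      (\<forall>s\<in>syz f. \<exists>p q. polyfun p \<and> polyfun q \<and> s = lin2 p r1 q r2) \<and>
      \<not> (\<exists>p. polyfun p \<and> r1 = lin1 p r2) \<and> \<not> (\<exists>p. polyfun p \<and> r2 = lin1 p r1))"

end

theory Submission
  imports Defs "HOL-Computational_Algebra.Polynomial_Factorial"
    "HOL-Computational_Algebra.Field_as_Ring" "HOL-Computational_Algebra.Fundamental_Theorem_Algebra"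
begin

text \<open>A syzygy \<open>(a, b, c)\<close> of minimal degree \<open>r \<le> (m - 1)/2\<close> is a vector field \<open>\<theta>\<close> with \<open>\<theta> f = 0\<close>, and it preserves every component:
  \<open>\<theta> G\<^sub>j = c\<^sub>j G\<^sub>j\<close>. The singularities \<open>A\<^sub>1\<close>, \<open>A\<^sub>5\<close>, \<open>D\<^sub>4\<close> all have log canonical threshold at least 2/3, so
  \<open>|f|^(-2b)\<close> is locally integrable away from 0 for \<open>b < 2/3\<close>. Integration by parts against the weight
  \<open>|f|^(-2\<beta>\<^sub>1) |G\<^sub>j|^(-2\<beta>\<^sub>2)\<close> then gives \<open>div \<theta> = \<beta>\<^sub>2 c\<^sub>j\<close> whenever \<open>\<beta>\<^sub>1, \<beta>\<^sub>2 \<ge> 0\<close>,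
  \<open>\<beta>\<^sub>1 m + \<beta>\<^sub>2 deg G\<^sub>j = r + 2\<close> and \<open>\<beta>\<^sub>1 + \<beta>\<^sub>2 < 2/3\<close>. If \<open>r + 2 < 2m/3\<close>, which covers \<open>m = 8\<close> and \<open>m \<ge> 10\<close>, the exponent
  \<open>\<beta>\<^sub>2\<close> can be varied, so \<open>c\<^sub>j = 0\<close> for all \<open>j\<close>. But no nonzero field annihilates a smooth cubic and two lines, and one that
  annihilates three smooth cubics and a line would force a point of multiplicity 4. The remaining degrees are 4 and 5. There a linear
  field preserving the cubic is a multiple of the Euler field, and two quadratic fields that preserve a smooth cubic and two lines are
  dependent modulo the Euler field.\<close>

section \<open>Polynomial functions\<close>

text \<open>The constant 2/3 is the threshold of A5 (1/2 + 1/6) and of D4; A1 has threshold 1. Near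
  the origin of C^3 the weight has total degree -2(r + 2) and stops being integrable at r = 1, so
  everything happens in a spherical shell. The field is projected to be tangent to the spheres, so
  that the cutoff contributes nothing, and the degree condition is exactly what cancels the
  divergence created by this projection. On the curve itself the weight is not differentiable, so
  |f|^2 is replaced by |f|^2 + eps; the strict inequality below 2/3 pays for a positive power of eps
  in the error. The exceptional degrees are arithmetic: r + 2 < 2m/3 holds for every r up to (m -
  1)/2 if m = 8 or m is at least 10. The largest possible r violates it for m = 6, 7, 9 (r = 2, 3,
  4), and also for m = 4, 5 (r = 1, 2), which is why the last two need separate algebra. What
  freeness supplies is a syzygy of degree at most (m - 1)/2 and, for m = 5, a pair of degree 2 that
  is independent over C.\<close>

inductive pfun :: "(pt \<Rightarrow> complex) \<Rightarrow> bool" where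
  pfun_const: "pfun (\<lambda>_. c)"
| pfun_X: "pfun (\<lambda>v. fst v)"
| pfun_Y: "pfun (\<lambda>v. fst (snd v))"
| pfun_Z: "pfun (\<lambda>v. snd (snd v))"
| pfun_add: "pfun f \<Longrightarrow> pfun g \<Longrightarrow> pfun (\<lambda>v. f v + g v)"
| pfun_mult: "pfun f \<Longrightarrow> pfun g \<Longrightarrow> pfun (\<lambda>v. f v * g v)"

lemma pfun_uminus: "pfun f \<Longrightarrow> pfun (\<lambda>v. - f v)"
  using pfun_mult[OF pfun_const[of "-1"]] by simp

lemma pfun_diff: "pfun f \<Longrightarrow> pfun g \<Longrightarrow> pfun (\<lambda>v. f v - g v)"
  using pfun_add[OF _ pfun_uminus] by simp

lemma pfun_sum: "(\<And>i. i \<in> I \<Longrightarrow> pfun (f i)) \<Longrightarrow> pfun (\<lambda>v. \<Sum>i\<in>I. f i v)"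
  by (induction I rule: infinite_finite_induct) (auto intro: pfun_const pfun_add)

lemma pfun_prod: "(\<And>i. i \<in> I \<Longrightarrow> pfun (f i)) \<Longrightarrow> pfun (\<lambda>v. \<Prod>i\<in>I. f i v)"
  by (induction I rule: infinite_finite_induct) (auto intro: pfun_const pfun_mult)

lemma pfun_power: "pfun f \<Longrightarrow> pfun (\<lambda>v. f v ^ n)"
  by (induction n) (auto intro: pfun_const pfun_mult)

lemmas pfun_intros = pfun_const pfun_X pfun_Y pfun_Z pfun_add pfun_mult pfun_uminus pfun_diff
  pfun_sum pfun_prod pfun_power

lemma pfun_comp:
  assumes "pfun f" and "pfun a" "pfun b" "pfun c"
  shows "pfun (\<lambda>v. f (a v, b v, c v))"
  using assms(1) by induction (use assms in \<open>auto intro: pfun_intros\<close>)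

lemma tsmul_simps [simp]: "tsmul c (x, y, z) = (c * x, c * y, c * z)"
  "fst (tsmul c v) = c * fst v" "fst (snd (tsmul c v)) = c * fst (snd v)"
  "snd (snd (tsmul c v)) = c * snd (snd v)"
  by (auto simp: tsmul_def)

lemma tadd_eq: "tadd a b = a + b"
  by (simp add: tadd_def prod_eq_iff)

lemma tsmul_1 [simp]: "tsmul 1 v = v" and tsmul_0 [simp]: "tsmul 0 v = 0" "tsmul c 0 = 0"
  by (auto simp: tsmul_def prod_eq_iff)

lemma tsmul_add: "tsmul c (v + w) = tsmul c v + tsmul c w"
  and tsmul_add_left: "tsmul (c + d) v = tsmul c v + tsmul d v"
  and tsmul_tsmul: "tsmul c (tsmul d v) = tsmul (c * d) v"
  by (auto simp: tsmul_def prod_eq_iff algebra_simps)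

lemma pfun_affine:
  assumes "pfun f" shows "pfun (\<lambda>v. f (p + tsmul (fst v) e1 + tsmul (fst (snd v)) e2 + tsmul (snd (snd v)) e3))"
proof -
  have "(\<lambda>v. f (p + tsmul (fst v) e1 + tsmul (fst (snd v)) e2 + tsmul (snd (snd v)) e3)) =
    (\<lambda>v. f (fst p + fst v * fst e1 + fst (snd v) * fst e2 + snd (snd v) * fst e3,
            fst (snd p) + fst v * fst (snd e1) + fst (snd v) * fst (snd e2) + snd (snd v) * fst (snd e3),
            snd (snd p) + fst v * snd (snd e1) + fst (snd v) * snd (snd e2) + snd (snd v) * snd (snd e3)))"
    by (rule ext, rule arg_cong[where f = f]) (simp add: tsmul_def prod_eq_iff)
  then show ?thesis
    by (simp only:) (rule pfun_comp[OF assms]; intro pfun_intros)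
qed

text \<open>Restriction to lines is the standard way below to reduce a statement about three
  variables to roots and degrees of one-variable polynomials.\<close>

lemma pfun_line: assumes "pfun f" shows "\<exists>p. \<forall>t. f (v + tsmul t w) = poly p t"
  using assms
proof induction
  case (pfun_const c) show ?case by (rule exI[of _ "[:c:]"]) simp
next
  case pfun_X show ?case by (rule exI[of _ "[:fst v, fst w:]"]) simp
next
  case pfun_Y show ?case by (rule exI[of _ "[:fst (snd v), fst (snd w):]"]) simp
next
  case pfun_Z show ?case by (rule exI[of _ "[:snd (snd v), snd (snd w):]"]) simp
next
  case (pfun_add f g) then show ?case by (metis poly_add)
next
  case (pfun_mult f g) then show ?case by (metis poly_mult)
qed

text \<open>On the line joining a point where f is nonzero to one where g is nonzero, neither
  restriction is the zero polynomial, hence neither is their product.\<close>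

lemma pfun_domain:
  assumes "pfun f" "pfun g" "\<And>v. f v * g v = 0"
  shows "(\<forall>v. f v = 0) \<or> (\<forall>v. g v = 0)"
proof (rule ccontr)
  assume "\<not> ?thesis"
  then obtain v w where v: "f v \<noteq> 0" and w: "g w \<noteq> 0" by auto
  obtain p q where p: "\<And>t. f (v + tsmul t (w - v)) = poly p t" and q: "\<And>t. g (v + tsmul t (w - v)) = poly q t"
    using pfun_line assms(1,2) by meson
  have "p \<noteq> 0" using p[of 0] v by auto
  moreover have "q \<noteq> 0" using q[of 1] w by auto
  moreover have "poly (p * q) t = 0" for t using assms(3) p q by (metis poly_mult)
  then have "p * q = 0" using poly_all_0_iff_0 by blast
  ultimately show False by simp
qed

text \<open>Zariski density: a polynomial identity may be checked where some nonzero polynomial h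
  does not vanish.\<close>

lemma pfun_eqI_mult:
  assumes "pfun f" "pfun g" "pfun h" "h v0 \<noteq> 0" and "\<And>v. h v \<noteq> 0 \<Longrightarrow> f v = g v"
  shows "f v = g v"
proof -
  have "(\<forall>v. f v - g v = 0) \<or> (\<forall>v. h v = 0)"
    by (rule pfun_domain) (use assms in \<open>auto intro: pfun_intros\<close>)
  then show ?thesis using assms(4) by (metis eq_iff_diff_eq_0)
qed

section \<open>Partial derivatives, and the action \<open>dd f v (a v, b v, c v)\<close> of a vector
  field on f\<close>

definition dd :: "(pt \<Rightarrow> complex) \<Rightarrow> pt \<Rightarrow> pt \<Rightarrow> complex" where
  "dd f v d = dX f v * fst d + dY f v * fst (snd d) + dZ f v * snd (snd d)"

lemma partials_eqI:
  assumes D: "(f has_derivative (\<lambda>d. fx * fst d + fy * fst (snd d) + fz * snd (snd d))) (at v)"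
  shows "dX f v = fx" "dY f v = fy" "dZ f v = fz"
proof -
  obtain x y z where v: "v = (x, y, z)" by (cases v)
  have *: "((\<lambda>t. f (t, y, z)) has_derivative (\<lambda>d. fx * d)) (at x)"
    using has_derivative_compose[of "\<lambda>t. (t, y, z)" "\<lambda>d. (d, 0, 0)" x UNIV f, OF _ D[unfolded v]]
    by (simp add: has_derivative_Pair)
  moreover have "((\<lambda>t. f (x, t, z)) has_derivative (\<lambda>d. fy * d)) (at y)"
    using has_derivative_compose[of "\<lambda>t. (x, t, z)" "\<lambda>d. (0, d, 0)" y UNIV f, OF _ D[unfolded v]]
    by (simp add: has_derivative_Pair)
  moreover have "((\<lambda>t. f (x, y, t)) has_derivative (\<lambda>d. fz * d)) (at z)"
    using has_derivative_compose[of "\<lambda>t. (x, y, t)" "\<lambda>d. (0, 0, d)" z UNIV f, OF _ D[unfolded v]]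
    by (simp add: has_derivative_Pair)
  ultimately show "dX f v = fx" "dY f v = fy" "dZ f v = fz"
    by (auto simp: v dX_def dY_def dZ_def has_field_derivative_def intro!: DERIV_imp_deriv)
qed

text \<open>The partials \<open>dX\<close>, \<open>dY\<close>, \<open>dZ\<close> are limits, so the
  induction first builds polynomial candidates with a total derivative; \<open>partials_eqI\<close>
  then identifies the two.\<close>

lemma pfun_has_derivative_ex:
  assumes "pfun f"
  shows "\<exists>fx fy fz. pfun fx \<and> pfun fy \<and> pfun fz \<and> (\<forall>v. (f has_derivative
     (\<lambda>d. fx v * fst d + fy v * fst (snd d) + fz v * snd (snd d))) (at v))"
  using assms
proof induction
  case (pfun_const c) show ?case
    by (rule exI[of _ "\<lambda>_. 0"], rule exI[of _ "\<lambda>_. 0"], rule exI[of _ "\<lambda>_. 0"])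
       (auto intro: pfun.intros simp: zero_prod_def)
next
  case pfun_X show ?case
    by (rule exI[of _ "\<lambda>_. 1"], rule exI[of _ "\<lambda>_. 0"], rule exI[of _ "\<lambda>_. 0"])
       (auto intro: pfun.intros intro!: derivative_eq_intros)
next
  case pfun_Y show ?case
    by (rule exI[of _ "\<lambda>_. 0"], rule exI[of _ "\<lambda>_. 1"], rule exI[of _ "\<lambda>_. 0"])
       (auto intro: pfun.intros intro!: derivative_eq_intros)
next
  case pfun_Z show ?case
    by (rule exI[of _ "\<lambda>_. 0"], rule exI[of _ "\<lambda>_. 0"], rule exI[of _ "\<lambda>_. 1"])
       (auto intro: pfun.intros intro!: derivative_eq_intros)
next
  case (pfun_add f g)
  from pfun_add.IH(1) obtain fx fy fz where 1: "pfun fx" "pfun fy" "pfun fz" and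
    D1: "\<And>v. (f has_derivative (\<lambda>d. fx v * fst d + fy v * fst (snd d) + fz v * snd (snd d))) (at v)" by blast
  from pfun_add.IH(2) obtain gx gy gz where 2: "pfun gx" "pfun gy" "pfun gz" and
    D2: "\<And>v. (g has_derivative (\<lambda>d. gx v * fst d + gy v * fst (snd d) + gz v * snd (snd d))) (at v)" by blast
  note * = 1 2 and D = D1 D2
  show ?case
    by (rule exI[of _ "\<lambda>v. fx v + gx v"], rule exI[of _ "\<lambda>v. fy v + gy v"], rule exI[of _ "\<lambda>v. fz v + gz v"])
       (use * in \<open>auto intro: pfun_intros intro!: has_derivative_eq_rhs[OF has_derivative_add[OF D]] simp: algebra_simps\<close>)
next
  case (pfun_mult f g)
  from pfun_mult.IH(1) obtain fx fy fz where 1: "pfun fx" "pfun fy" "pfun fz" and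
    D1: "\<And>v. (f has_derivative (\<lambda>d. fx v * fst d + fy v * fst (snd d) + fz v * snd (snd d))) (at v)" by blast
  from pfun_mult.IH(2) obtain gx gy gz where 2: "pfun gx" "pfun gy" "pfun gz" and
    D2: "\<And>v. (g has_derivative (\<lambda>d. gx v * fst d + gy v * fst (snd d) + gz v * snd (snd d))) (at v)" by blast
  note * = 1 2 and D = D1 D2
  show ?case
    by (rule exI[of _ "\<lambda>v. f v * gx v + fx v * g v"], rule exI[of _ "\<lambda>v. f v * gy v + fy v * g v"], rule exI[of _ "\<lambda>v. f v * gz v + fz v * g v"])
       (use * pfun_mult in \<open>auto intro: pfun_intros intro!: has_derivative_eq_rhs[OF has_derivative_mult[OF D]] simp: algebra_simps\<close>)
qed

lemma pfun_partials:
  assumes "pfun f"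
  shows "pfun (dX f)" "pfun (dY f)" "pfun (dZ f)" and pfun_has_derivative: "(f has_derivative dd f v) (at v)"
proof -
  from pfun_has_derivative_ex[OF assms] obtain fx fy fz where *: "pfun fx" "pfun fy" "pfun fz" and
    D: "\<And>v. (f has_derivative (\<lambda>d. fx v * fst d + fy v * fst (snd d) + fz v * snd (snd d))) (at v)" by blast
  have eq: "dX f = fx" "dY f = fy" "dZ f = fz"
    using partials_eqI[OF D] by auto
  show "pfun (dX f)" "pfun (dY f)" "pfun (dZ f)" using * eq by auto
  have "dd f v = (\<lambda>d. fx v * fst d + fy v * fst (snd d) + fz v * snd (snd d))"
    by (auto simp: dd_def eq)
  then show "(f has_derivative dd f v) (at v)" using D by simp
qed

lemma dd_eqI:
  assumes "(f has_derivative (\<lambda>d. fx * fst d + fy * fst (snd d) + fz * snd (snd d))) (at v)"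
  shows "dd f v d = fx * fst d + fy * fst (snd d) + fz * snd (snd d)"
  using partials_eqI[OF assms] by (simp add: dd_def)

lemma dd_lin: "dd f v (d + e) = dd f v d + dd f v e" "dd f v (tsmul c d) = c * dd f v d"
  "dd f v (d - e) = dd f v d - dd f v e" "dd f v (- d) = - dd f v d" "dd f v 0 = 0"
  by (auto simp: dd_def algebra_simps)

lemma dd_add: assumes "pfun f" "pfun g" shows "dd (\<lambda>v. f v + g v) v d = dd f v d + dd g v d"
  by (subst dd_eqI[where fx = "dX f v + dX g v" and fy = "dY f v + dY g v" and fz = "dZ f v + dZ g v"])
     (auto simp: dd_def algebra_simps intro!: has_derivative_eq_rhs[OF has_derivative_add[OF pfun_has_derivative[OF assms(1)] pfun_has_derivative[OF assms(2)]]])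

lemma dd_mult: assumes "pfun f" "pfun g" shows "dd (\<lambda>v. f v * g v) v d = f v * dd g v d + dd f v d * g v"
  by (subst dd_eqI[where fx = "f v * dX g v + dX f v * g v" and fy = "f v * dY g v + dY f v * g v" and fz = "f v * dZ g v + dZ f v * g v"])
     (auto simp: dd_def algebra_simps intro!: has_derivative_eq_rhs[OF has_derivative_mult[OF pfun_has_derivative[OF assms(1)] pfun_has_derivative[OF assms(2)]]])

lemma dd_const: "dd (\<lambda>_. c) v d = 0"
  by (subst dd_eqI[where fx = 0 and fy = 0 and fz = 0]) (auto simp: zero_prod_def)

lemma pfun_continuous: "pfun f \<Longrightarrow> continuous_on S f"
  by (meson continuous_at_imp_continuous_on has_derivative_continuous pfun_has_derivative)

lemma pfun_isCont: "pfun f \<Longrightarrow> isCont f v"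
  by (meson has_derivative_continuous pfun_has_derivative)

lemma dd_pfun: "pfun f \<Longrightarrow> pfun a \<Longrightarrow> pfun b \<Longrightarrow> pfun c \<Longrightarrow> pfun (\<lambda>v. dd f v (a v, b v, c v))"
  unfolding dd_def by (auto intro!: pfun_intros pfun_partials)

lemma pfun_dd_dir: "pfun f \<Longrightarrow> pfun (\<lambda>v. dd f v e)"
  unfolding dd_def by (auto intro!: pfun_intros pfun_partials)

lemma has_derivative_tsmul: "((\<lambda>t. v + tsmul t w) has_derivative (\<lambda>h. tsmul h w)) (at t)"
proof -
  have "((\<lambda>t. v + (t * fst w, t * fst (snd w), t * snd (snd w))) has_derivative
    (\<lambda>h. 0 + (h * fst w, h * fst (snd w), h * snd (snd w)))) (at t)"
    by (intro derivative_intros has_derivative_Pair has_derivative_mult_left)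
  then show ?thesis by (simp add: tsmul_def)
qed

lemma pfun_line_deriv: assumes "pfun f"
  shows "((\<lambda>t. f (v + tsmul t w)) has_field_derivative dd f (v + tsmul t w) w) (at t)"
  using has_derivative_compose[OF has_derivative_tsmul, OF pfun_has_derivative[OF assms]]
  by (simp add: has_field_derivative_def dd_lin mult.commute[of _ "dd _ _ _"])

section \<open>Homogeneity, expressed by scaling; the zero function has every degree\<close>

definition hom :: "nat \<Rightarrow> (pt \<Rightarrow> complex) \<Rightarrow> bool" where
  "hom n f \<longleftrightarrow> (\<forall>t v. f (tsmul t v) = t ^ n * f v)"

lemma homD: "hom n f \<Longrightarrow> f (tsmul t v) = t ^ n * f v"
  unfolding hom_def by blast

lemma euler: assumes "pfun f" "hom n f" shows "dd f v v = of_nat n * f v"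
proof -
  have "((\<lambda>t. f (0 + tsmul t v)) has_field_derivative dd f (0 + tsmul 1 v) v) (at 1)"
    by (rule pfun_line_deriv[OF assms(1)])
  moreover have "((\<lambda>t. t ^ n * f v) has_field_derivative of_nat n * f v) (at 1)"
    by (auto intro!: derivative_eq_intros)
  ultimately show ?thesis
    by (simp add: homD[OF assms(2)]) (rule DERIV_unique)
qed

text \<open>Both sides of f(tv + ste) = t^(n+1) f(v + se) are differentiated in s at 0. This gives
  the claim multiplied by t.\<close>

lemma hom_dd: assumes "pfun f" "hom (Suc n) f" shows "hom n (\<lambda>v. dd f v e)"
  unfolding hom_def
proof (intro allI)
  fix t :: complex and v
  have "t * dd f (tsmul t v) e = t * (t ^ n * dd f v e)" for t
  proof -
    have "((\<lambda>s. f (tsmul t v + tsmul s (tsmul t e))) has_field_derivative dd f (tsmul t v + tsmul 0 (tsmul t e)) (tsmul t e)) (at 0)"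
      by (rule pfun_line_deriv[OF assms(1)])
    moreover have "((\<lambda>s. t ^ Suc n * f (v + tsmul s e)) has_field_derivative t ^ Suc n * dd f (v + tsmul 0 e) e) (at 0)"
      by (intro DERIV_cmult pfun_line_deriv[OF assms(1)])
    moreover have "f (tsmul t v + tsmul s (tsmul t e)) = t ^ Suc n * f (v + tsmul s e)" for s
      unfolding homD[OF assms(2), symmetric] by (simp add: tsmul_add tsmul_tsmul mult.commute)
    ultimately have "dd f (tsmul t v) (tsmul t e) = t ^ Suc n * dd f v e"
      by simp (rule DERIV_unique)
    then show ?thesis by (simp add: dd_lin)
  qed
  \<comment> \<open>The factor t cancels only for nonzero t; the value at t = 0 follows because both
    sides are polynomial in t.\<close>
  then have *: "dd f (tsmul t v) e = t ^ n * dd f v e" if "t \<noteq> 0" for t using that by (metis mult_left_cancel)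
  have p1: "pfun (\<lambda>w. dd f (tsmul (fst w) v) e)"
    using pfun_affine[OF pfun_dd_dir[OF assms(1), of e], of 0 v 0 0] by simp
  have p2: "pfun (\<lambda>w. fst w ^ n * dd f v e)" by (intro pfun_intros)
  show "dd f (tsmul t v) e = t ^ n * dd f v e"
    using pfun_eqI_mult[OF p1 p2 pfun_X, of "(1,0,0)" "(t,0,0)"] * by auto
qed

lemma hpoly_pfun: assumes "hpoly n f" shows "pfun f"
proof -
  obtain c where c: "\<And>x y z. f (x, y, z) = (\<Sum>i\<le>n. \<Sum>j\<le>n - i. c i j * x ^ i * y ^ j * z ^ (n - i - j))"
    using assms unfolding hpoly_def by blast
  have "f = (\<lambda>v. \<Sum>i\<le>n. \<Sum>j\<le>n - i. c i j * fst v ^ i * fst (snd v) ^ j * snd (snd v) ^ (n - i - j))"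
    using c by (auto simp: fun_eq_iff)
  then show ?thesis by (simp only:) (intro pfun_intros)
qed

lemma hpoly_hom: assumes "hpoly n f" shows "hom n f"
proof -
  obtain c where c: "\<And>x y z. f (x, y, z) = (\<Sum>i\<le>n. \<Sum>j\<le>n - i. c i j * x ^ i * y ^ j * z ^ (n - i - j))"
    using assms unfolding hpoly_def by blast
  have "f (t * x, t * y, t * z) = t ^ n * f (x, y, z)" for t x y z
  proof -
    have "f (t * x, t * y, t * z) = (\<Sum>i\<le>n. \<Sum>j\<le>n - i. t ^ n * (c i j * x ^ i * y ^ j * z ^ (n - i - j)))"
      unfolding c
    proof (intro sum.cong refl)
      fix i j assume ij: "i \<in> {..n}" "j \<in> {..n - i}"
      have "t ^ n = t ^ i * t ^ j * t ^ (n - i - j)" using ij by (simp flip: power_add)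
      then show "c i j * (t * x) ^ i * (t * y) ^ j * (t * z) ^ (n - i - j) = t ^ n * (c i j * x ^ i * y ^ j * z ^ (n - i - j))"
        by (simp add: power_mult_distrib)
    qed
    also have "\<dots> = t ^ n * f (x, y, z)" unfolding c by (simp add: sum_distrib_left)
    finally show ?thesis .
  qed
  then show ?thesis by (auto simp: hom_def tsmul_def)
qed

lemma hom_0_const: assumes "pfun f" "hom 0 f" shows "f v = f 0"
  using homD[OF assms(2), of 0 v] by simp

text \<open>The gradient of a form of degree 1 is constant, so the Euler identity already expresses
  the form through its gradient at 0.\<close>

lemma hom_1_linear: assumes "pfun f" "hom (Suc 0) f" shows "f v = dd f 0 v"
proof -
  have h: "hom 0 (\<lambda>v. dd f v w)" for w by (rule hom_dd[OF assms])
  have "f v = dd f v v" using euler[OF assms, of v] by simp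
  also have "\<dots> = dd f 0 v" using hom_0_const[OF pfun_dd_dir[OF assms(1)] h] .
  finally show ?thesis .
qed

lemma hom_0 [simp]: "hom (Suc n) f \<Longrightarrow> f 0 = 0"
  using homD[of "Suc n" f 0 0] by simp

section \<open>Lipschitz images and negative powers\<close>

text \<open>The gauge at a point of A is chosen so small that every cube of the covering lemma
  tagged there stays inside T.\<close>

lemma cube_cover:
  fixes A :: "'a::euclidean_space set"
  assumes "bounded A" "A \<subseteq> T" "open T"
  obtains D where "countable D"
    "\<And>K. K \<in> D \<Longrightarrow> \<exists>u v s. K = cbox u v \<and> s > 0 \<and> (\<forall>i\<in>Basis. v \<bullet> i - u \<bullet> i = s) \<and> K \<subseteq> T \<and> A \<inter> K \<noteq> {}"
    "pairwise (\<lambda>A B. interior A \<inter> interior B = {}) D" "A \<subseteq> \<Union>D"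
proof -
  obtain c where c: "A \<subseteq> cbox (-c *\<^sub>R One) (c *\<^sub>R One)" "c > 0"
  proof -
    obtain B where B: "\<And>x. x \<in> A \<Longrightarrow> norm x \<le> B"
      using \<open>bounded A\<close> bounded_iff by blast
    show ?thesis
    proof (rule that[of "abs B + 1"])
      show "A \<subseteq> cbox (- (\<bar>B\<bar> + 1) *\<^sub>R One) ((\<bar>B\<bar> + 1) *\<^sub>R One)"
        using norm_bound_Basis_le Basis_le_norm
        by (fastforce simp: mem_box dest!: B intro: order_trans)
    qed auto
  qed
  have c2: "box (-c *\<^sub>R One:: 'a) (c *\<^sub>R One) \<noteq> {}"
    using c(2) by (simp add: box_eq_empty)
  have "\<exists>r>0. x \<in> A \<longrightarrow> ball x r \<subseteq> T" for x
    using assms by (metis openE subsetD zero_less_one)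
  then obtain R where R: "\<And>x. R x > 0" "\<And>x. x \<in> A \<Longrightarrow> ball x (R x) \<subseteq> T" by metis
  have g: "gauge (\<lambda>x. ball x (R x))" using R by (simp add: gauge_def)
  obtain D where D: "countable D" "\<And>K. K \<in> D \<Longrightarrow> interior K \<noteq> {} \<and> (\<exists>c d. K = cbox c d)"
    "pairwise (\<lambda>A B. interior A \<inter> interior B = {}) D"
    "\<And>K. K \<in> D \<Longrightarrow> \<exists>x \<in> A \<inter> K. K \<subseteq> (\<lambda>x. ball x (R x)) x"
    "\<And>u v. cbox u v \<in> D \<Longrightarrow> \<exists>n. \<forall>i \<in> Basis. v \<bullet> i - u \<bullet> i = ((c *\<^sub>R One) \<bullet> i - (-c *\<^sub>R One) \<bullet> i) / 2^n"
    "A \<subseteq> \<Union>D"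
    using covering_lemma[OF c(1) c2 g] by metis
  show ?thesis
  proof (rule that[of D])
    fix K assume K: "K \<in> D"
    obtain u v where uv: "K = cbox u v" using D(2)[OF K] by auto
    obtain n where n: "\<forall>i \<in> Basis. v \<bullet> i - u \<bullet> i = ((c *\<^sub>R One) \<bullet> i - (-c *\<^sub>R One) \<bullet> i) / 2^n"
      using D(5) K uv by blast
    obtain x where "x \<in> A \<inter> K" "K \<subseteq> ball x (R x)" using D(4)[OF K] by auto
    then have "K \<subseteq> T" "A \<inter> K \<noteq> {}" using R(2) by blast+
    then show "\<exists>u v s. K = cbox u v \<and> s > 0 \<and> (\<forall>i\<in>Basis. v \<bullet> i - u \<bullet> i = s) \<and> K \<subseteq> T \<and> A \<inter> K \<noteq> {}"
      using uv n c(2) by (intro exI[of _ u] exI[of _ v] exI[of _ "2 * c / 2 ^ n"]) auto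
  qed (use D in auto)
qed

lemma emeasure_cube:
  fixes u v :: "'a::euclidean_space"
  assumes "\<And>i. i \<in> Basis \<Longrightarrow> v \<bullet> i - u \<bullet> i = s" "s \<ge> 0"
  shows "emeasure lborel (cbox u v) = ennreal (s ^ DIM('a))"
    and "emeasure lborel (box u v) = ennreal (s ^ DIM('a))"
proof -
  have "u \<bullet> i \<le> v \<bullet> i" if "i \<in> Basis" for i using assms(1)[OF that] assms(2) by linarith
  moreover have "(\<Prod>b\<in>Basis. (v - u) \<bullet> b) = s ^ DIM('a)"
    using assms(1) by (simp add: inner_diff_left)
  ultimately show "emeasure lborel (cbox u v) = ennreal (s ^ DIM('a))"
    "emeasure lborel (box u v) = ennreal (s ^ DIM('a))" by simp_all
qed

text \<open>Only finiteness of integrals matters later, so a one-sided estimate replaces the change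
  of variables formula. A is covered by nonoverlapping cubes inside an open T of almost the same
  measure, and each piece of image fits into a cube whose volume is a fixed multiple of the original
  one. B is a Borel part of the image because the image itself need not be Borel.\<close>

lemma emeasure_lipschitz_image_le:
  fixes f :: "'a::euclidean_space \<Rightarrow> 'a"
  assumes A: "A \<in> sets borel" "bounded A" and L: "L > 0"
    and lip: "\<And>x y. x \<in> A \<Longrightarrow> y \<in> A \<Longrightarrow> norm (f x - f y) \<le> L * norm (x - y)"
    and B: "B \<in> sets borel" "B \<subseteq> f ` A"
  shows "emeasure lborel B \<le> ennreal ((2 * L * DIM('a)) ^ DIM('a)) * emeasure lborel A"
proof -
  define C where "C = (2 * L * DIM('a)) ^ DIM('a)"
  have C: "C \<ge> 0" using L by (simp add: C_def)
  have "emeasure lborel B \<le> ennreal C * emeasure lborel A + ennreal e" if "e > 0" for e :: real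
  proof -
    define e' where "e' = e / (C + 1)"
    have e': "e' > 0" using that C by (simp add: e'_def)
    obtain T where T: "open T" "A \<subseteq> T" "emeasure lborel (T - A) < e'"
      using outer_regular_lborel[OF A(1) e'] by blast
    obtain D where D: "countable D"
      "\<And>K. K \<in> D \<Longrightarrow> \<exists>u v s. K = cbox u v \<and> s > 0 \<and> (\<forall>i\<in>Basis. v \<bullet> i - u \<bullet> i = s) \<and> K \<subseteq> T \<and> A \<inter> K \<noteq> {}"
      "pairwise (\<lambda>A B. interior A \<inter> interior B = {}) D" "A \<subseteq> \<Union>D"
      using cube_cover[OF A(2) T(2,1)] by metis
    have "\<exists>W. K \<in> D \<longrightarrow> (W \<in> sets borel \<and> f ` (A \<inter> K) \<subseteq> W \<and> emeasure lborel W \<le> ennreal C * emeasure lborel (interior K) \<and> K \<subseteq> T)" for K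
    proof (cases "K \<in> D")
      case True
      then obtain u v s where K: "K = cbox u v" "s > 0" "\<And>i. i\<in>Basis \<Longrightarrow> v \<bullet> i - u \<bullet> i = s" "K \<subseteq> T" "A \<inter> K \<noteq> {}"
        using D(2) by metis
      obtain z where z: "z \<in> A" "z \<in> K" using K(5) by auto
      \<comment> \<open>Two points of a cube of side s differ by at most DIM times s in norm,
        through the l1 norm. The image cube has half side \<rho>, which yields the factor 2 L DIM
        per dimension.\<close>
      define \<rho> where "\<rho> = L * DIM('a) * s"
      define W where "W = cbox (f z - \<rho> *\<^sub>R One) (f z + \<rho> *\<^sub>R One)"
      have em: "emeasure lborel W = ennreal ((2 * \<rho>) ^ DIM('a))"
        unfolding W_def using K(2) L by (intro emeasure_cube) (auto simp: inner_diff_left inner_add_left \<rho>_def)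
      have "emeasure lborel (interior K) = ennreal (s ^ DIM('a))"
        unfolding K(1) interior_cbox using K(2,3) by (intro emeasure_cube) auto
      then have "emeasure lborel W = ennreal C * emeasure lborel (interior K)"
        unfolding em C_def \<rho>_def using K(2) L
        by (simp add: power_mult_distrib flip: ennreal_mult)
      moreover have "f y \<in> W" if y: "y \<in> A" "y \<in> K" for y
      proof -
        have "norm (y - z) \<le> (\<Sum>i\<in>Basis. \<bar>(y - z) \<bullet> i\<bar>)" by (rule norm_le_l1)
        also have "\<dots> \<le> of_nat (card (Basis::'a set)) * s"
        proof (rule sum_bounded_above)
          fix i :: 'a assume i: "i \<in> Basis"
          show "\<bar>(y - z) \<bullet> i\<bar> \<le> s"
            using y(2) z(2) K(3)[OF i] i unfolding K(1) mem_box inner_diff_left by (smt (verit))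
        qed
        finally have "L * norm (y - z) \<le> \<rho>" using L by (simp add: \<rho>_def mult.assoc)
        then have n: "norm (f y - f z) \<le> \<rho>" using lip[OF y(1) z(1)] by linarith
        show ?thesis unfolding W_def mem_box
        proof safe
          fix i :: 'a assume i: "i \<in> Basis"
          have "\<bar>(f y - f z) \<bullet> i\<bar> \<le> \<rho>" using n Basis_le_norm[OF i] order_trans by blast
          then show "(f z - \<rho> *\<^sub>R One) \<bullet> i \<le> f y \<bullet> i" "f y \<bullet> i \<le> (f z + \<rho> *\<^sub>R One) \<bullet> i"
            using i by (auto simp: inner_diff_left inner_add_left)
        qed
      qed
      moreover have "W \<in> sets borel" by (simp add: W_def)
      ultimately show ?thesis using K(4) by auto
    qed auto
    then obtain W where W: "\<And>K. K \<in> D \<Longrightarrow> W K \<in> sets borel" "\<And>K. K \<in> D \<Longrightarrow> f ` (A \<inter> K) \<subseteq> W K"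
      "\<And>K. K \<in> D \<Longrightarrow> emeasure lborel (W K) \<le> ennreal C * emeasure lborel (interior K)" "\<And>K. K \<in> D \<Longrightarrow> K \<subseteq> T"
      by metis
    define h where "h n = (if n \<in> to_nat_on D ` D then from_nat_into D n else {})" for n
    define W' where "W' n = (if n \<in> to_nat_on D ` D then W (from_nat_into D n) else {})" for n
    have hD: "n \<in> to_nat_on D ` D \<Longrightarrow> from_nat_into D n \<in> D" for n
      using D(1) by (auto simp: from_nat_into_to_nat_on)
    have "B \<subseteq> (\<Union>n. W' n)"
    proof
      fix b assume "b \<in> B"
      then obtain a where a: "a \<in> A" "b = f a" using B(2) by auto
      then obtain K where K: "K \<in> D" "a \<in> K" using D(4) by auto
      then have "b \<in> W' (to_nat_on D K)" using W(2)[OF K(1)] a D(1) by (auto simp: W'_def from_nat_into_to_nat_on)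
      then show "b \<in> (\<Union>n. W' n)" by auto
    qed
    moreover have Wm: "range W' \<subseteq> sets lborel" using W(1) hD by (auto simp: W'_def)
    ultimately have "emeasure lborel B \<le> emeasure lborel (\<Union>n. W' n)"
      by (intro emeasure_mono) auto
    also have "\<dots> \<le> (\<Sum>n. emeasure lborel (W' n))"
      by (rule emeasure_subadditive_countably[OF Wm])
    also have "\<dots> \<le> (\<Sum>n. ennreal C * emeasure lborel (interior (h n)))"
      by (rule suminf_le) (use W(3) hD in \<open>auto simp: W'_def h_def\<close>)
    also have "\<dots> = ennreal C * (\<Sum>n. emeasure lborel (interior (h n)))"
      by simp
    also have "(\<Sum>n. emeasure lborel (interior (h n))) = emeasure lborel (\<Union>n. interior (h n))"
    proof (rule suminf_emeasure)
      show "range (\<lambda>n. interior (h n)) \<subseteq> sets lborel" by auto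
      show "disjoint_family (\<lambda>n. interior (h n))"
        unfolding disjoint_family_on_def
      proof (intro ballI impI)
        fix m n :: nat assume mn: "m \<noteq> n"
        show "interior (h m) \<inter> interior (h n) = {}"
        proof (cases "m \<in> to_nat_on D ` D \<and> n \<in> to_nat_on D ` D")
          case True
          then obtain K K' where K: "K \<in> D" "K' \<in> D" "m = to_nat_on D K" "n = to_nat_on D K'" by auto
          then have "K \<noteq> K'" using mn by auto
          then have "interior K \<inter> interior K' = {}" using D(3) K by (auto simp: pairwise_def)
          then show ?thesis using K D(1) by (auto simp: h_def from_nat_into_to_nat_on)
        qed (auto simp: h_def)
      qed
    qed
    also have "\<dots> \<le> emeasure lborel T"
    proof (rule emeasure_mono)
      have "h n \<subseteq> T" for n using W(4) hD by (auto simp: h_def)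
      then show "(\<Union>n. interior (h n)) \<subseteq> T" using interior_subset by blast
    qed (use T in auto)
    also have "emeasure lborel T \<le> emeasure lborel A + emeasure lborel (T - A)"
    proof -
      have "emeasure lborel (A \<union> (T - A)) \<le> emeasure lborel A + emeasure lborel (T - A)"
        using A(1) T(1) by (intro emeasure_subadditive) auto
      moreover have "A \<union> (T - A) = T" using T(2) by auto
      ultimately show ?thesis by simp
    qed
    also have "\<dots> \<le> emeasure lborel A + ennreal e'"
      using T(3) by (intro add_left_mono) auto
    finally have "emeasure lborel B \<le> ennreal C * (emeasure lborel A + ennreal e')"
      by (simp add: mult_left_mono)
    also have "\<dots> = ennreal C * emeasure lborel A + ennreal (C * e')"
      using C e' by (simp add: distrib_left ennreal_mult)
    also have "\<dots> \<le> ennreal C * emeasure lborel A + ennreal e"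
    proof (intro add_left_mono ennreal_leI)
      have "C * e \<le> (C + 1) * e" using that by simp
      then show "C * e' \<le> e" using C by (simp add: e'_def field_simps)
    qed
    finally show ?thesis .
  qed
  then have "emeasure lborel B \<le> ennreal C * emeasure lborel A"
    by (rule ennreal_le_epsilon)
  then show ?thesis by (simp add: C_def)
qed

text \<open>The previous estimate, applied to every Borel part of N, says that Lebesgue measure on N
  is at most a multiple of the pushforward of Lebesgue measure on A; integrating g against both
  gives the claim.\<close>

lemma nn_integral_lipschitz_image_le:
  fixes f :: "'a::euclidean_space \<Rightarrow> 'a"
  assumes A: "A \<in> sets borel" "bounded A" and L: "L > 0"
    and lip: "\<And>x y. x \<in> A \<Longrightarrow> y \<in> A \<Longrightarrow> norm (f x - f y) \<le> L * norm (x - y)"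
    and N: "N \<in> sets borel" "N \<subseteq> f ` A" and g: "g \<in> borel_measurable borel"
  shows "(\<integral>\<^sup>+x\<in>N. g x \<partial>lborel) \<le> ennreal ((2 * L * DIM('a)) ^ DIM('a)) * (\<integral>\<^sup>+x\<in>A. g (f x) \<partial>lborel)"
proof -
  define C where "C = ennreal ((2 * L * DIM('a)) ^ DIM('a))"
  have "continuous_on A f"
  proof (rule continuous_onI)
    fix x e assume "x \<in> A" "(e::real) > 0"
    moreover have "norm (f x' - f x) \<le> e" if "x' \<in> A" "norm (x' - x) < e / L" for x'
    proof -
      have "L * norm (x' - x) \<le> e" using that(2) L by (simp add: field_simps)
      then show ?thesis using lip[OF that(1) \<open>x \<in> A\<close>] by linarith
    qed
    ultimately show "\<exists>d>0. \<forall>x'\<in>A. dist x' x < d \<longrightarrow> dist (f x') (f x) \<le> e"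
      using L by (intro exI[of _ "e / L"]) (auto simp: dist_norm)
  qed
  then have fm: "f \<in> measurable (restrict_space lborel A) borel"
    using borel_measurable_continuous_on_restrict by (simp add: measurable_def sets_restrict_space space_restrict_space)
  let ?R = "restrict_space lborel N" and ?D = "scale_measure C (distr (restrict_space lborel A) borel f)"
  let ?M = "density lborel (indicator N)"
  have "(\<integral>\<^sup>+x\<in>N. g x \<partial>lborel) = (\<integral>\<^sup>+x. g x \<partial>?M)"
    using g N by (subst nn_integral_density) (auto simp: mult.commute)
  also have "\<dots> \<le> nn_integral ?D g"
  proof (rule nn_integral_mono_measure)
    have "emeasure ?M X \<le> emeasure ?D X" for X
    proof (cases "X \<in> sets borel")
      case True
      have Y: "f -` X \<inter> A \<in> sets borel"
        using measurable_sets[OF fm True] A(1) by (auto simp: sets_restrict_space space_restrict_space)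
      have "emeasure ?M X = emeasure lborel (N \<inter> X)"
        using N(1) True by (subst emeasure_density) (auto simp flip: indicator_inter_arith)
      also have "\<dots> \<le> C * emeasure lborel (f -` X \<inter> A)"
        unfolding C_def
        by (rule emeasure_lipschitz_image_le[where f = f]) (use A L lip N True Y in \<open>auto intro: bounded_subset\<close>)
      also have "\<dots> = emeasure ?D X"
        using True fm A(1) by (simp add: emeasure_distr space_restrict_space emeasure_restrict_space)
      finally show ?thesis .
    qed (simp add: emeasure_notin_sets)
    then show "?M \<le> ?D" by (subst le_measure) (auto simp: le_fun_def)
  qed auto
  also have "\<dots> = C * (\<integral>\<^sup>+x. g (f x) \<partial>restrict_space lborel A)"
    using g fm by (simp add: nn_integral_scale_measure nn_integral_distr)
  also have "\<dots> = C * (\<integral>\<^sup>+x\<in>A. g (f x) \<partial>lborel)"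
    using A by (simp add: nn_integral_restrict_space)
  finally show ?thesis by (simp add: C_def)
qed

text \<open>Infinite at 0, unlike \<^term>\<open>x powr (- p)\<close>: finiteness of an integral then includes that the zero set is null.\<close>
definition ipow :: "real \<Rightarrow> real \<Rightarrow> ennreal" where
  "ipow p x = (if x = 0 then \<infinity> else ennreal (x powr (- p)))"

lemma measurable_ipow [measurable]: "ipow p \<in> borel_measurable borel"
  unfolding ipow_def by measurable

text \<open>Dyadic discs: the value at t is charged to the index k with R'/2^(k+1) < |t| <= R'/2^k.
  There the power is at most 2^((k+1)p) while the area is proportional to 4^(-k), so the sum is
  geometric with ratio 2^(p-2).\<close>

lemma nn_integral_ipow_cball:
  assumes "0 \<le> p" "p < 2"
  shows "(\<integral>\<^sup>+t\<in>cball (0::complex) R. ipow p (norm t) \<partial>lborel) < \<infinity>"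
proof -
  \<comment> \<open>With R' at least 1, the lower bound R'/2^(k+1) on |t| may be weakened to
    1/2^(k+1), which keeps R' out of the power.\<close>
  define R' where "R' = max R 1"
  have R': "R' \<ge> 1" "R \<le> R'" by (auto simp: R'_def)
  define q where "q = 2 powr (p - 2)"
  have q: "0 < q" "q < 1" using assms by (auto simp: q_def powr_less_one)
  have sm: "summable (\<lambda>k. 2 powr p * pi * R'\<^sup>2 * q ^ k)"
    using q by (intro summable_mult[of "\<lambda>k. q ^ k"] summable_geometric) auto
  let ?t = "\<lambda>k t. ennreal (2 powr (real (Suc k) * p)) * indicator (cball (0::complex) (R' / 2 ^ k)) t"
  have "(\<integral>\<^sup>+t\<in>cball (0::complex) R. ipow p (norm t) \<partial>lborel) \<le> (\<integral>\<^sup>+t. (\<Sum>k. ?t k t) \<partial>lborel)"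
  proof (rule nn_integral_mono_AE)
    have "AE t in lborel. t \<noteq> (0::complex)" by (rule AE_lborel_singleton)
    then show "AE t in lborel. ipow p (norm t) * indicator (cball 0 R) t \<le> (\<Sum>k. ?t k t)"
    proof eventually_elim
      case (elim t)
      show ?case
      proof (cases "norm t \<le> R")
        case True
        have "\<exists>k. R' / 2 ^ Suc k < norm t"
        proof -
          have "(\<lambda>k. R' / 2 ^ Suc k) \<longlonglongrightarrow> 0" by real_asymp
          then have "\<forall>\<^sub>F k in sequentially. R' / 2 ^ Suc k < norm t"
            using elim by (intro order_tendstoD) auto
          then show ?thesis by (auto simp: eventually_sequentially)
        qed
        define k where "k = (LEAST k. R' / 2 ^ Suc k < norm t)"
        have k: "R' / 2 ^ Suc k < norm t" unfolding k_def by (rule LeastI_ex) fact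
        have k': "norm t \<le> R' / 2 ^ k"
        proof (cases k)
          case 0 then show ?thesis using True R' by simp
        next
          case (Suc j)
          then have "\<not> R' / 2 ^ Suc j < norm t" using not_less_Least[of j "\<lambda>k. R' / 2 ^ Suc k < norm t"] unfolding k_def by auto
          then show ?thesis using Suc by simp
        qed
        have "1 / 2 ^ Suc k < norm t" using k R'(1) by (meson divide_right_mono le_less_trans zero_le_numeral zero_le_power)
        then have "norm t powr (- p) \<le> (1 / 2 ^ Suc k) powr (- p)"
          using assms by (intro powr_mono2') auto
        also have "(1 / 2 ^ Suc k :: real) = 2 powr (- real (Suc k))"
          by (metis powr_minus_divide powr_realpow zero_less_numeral)
        finally have "norm t powr (- p) \<le> 2 powr (real (Suc k) * p)"
          unfolding powr_powr by (simp add: algebra_simps)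
        then have "ipow p (norm t) * indicator (cball 0 R) t \<le> ?t k t"
          using True k' elim by (simp add: ipow_def ennreal_leI)
        also have "?t k t \<le> (\<Sum>k. ?t k t)"
        proof -
          have "sum (\<lambda>k. ?t k t) {k} \<le> (\<Sum>k. ?t k t)" by (rule sum_le_suminf) auto
          then show ?thesis by (simp only: sum.insert sum.empty finite.emptyI empty_iff not_False_eq_True add_0_right)
        qed
        finally show ?thesis .
      qed simp
    qed
  qed
  also have "\<dots> = (\<Sum>k. \<integral>\<^sup>+t. ?t k t \<partial>lborel)"
    by (rule nn_integral_suminf[where f = ?t and M = lborel])
       (intro borel_measurable_times_ennreal borel_measurable_const borel_measurable_indicator, simp)
  also have "\<dots> = (\<Sum>k. ennreal (2 powr p * pi * R'\<^sup>2 * q ^ k))"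
  proof (intro suminf_cong)
    fix k
    have "emeasure lborel (cball (0::complex) (R' / 2 ^ k)) = ennreal (pi * (R' / 2 ^ k)\<^sup>2)"
      using R' by (subst emeasure_cball) (auto simp: unit_ball_vol_2)
    moreover have "(\<integral>\<^sup>+t. ?t k t \<partial>lborel) = ennreal (2 powr (real (Suc k) * p)) * emeasure lborel (cball (0::complex) (R' / 2 ^ k))"
      by (rule nn_integral_cmult_indicator) simp
    ultimately have "(\<integral>\<^sup>+t. ?t k t \<partial>lborel) = ennreal (2 powr (real (Suc k) * p) * (pi * (R' / 2 ^ k)\<^sup>2))"
      by (simp only: ennreal_mult' powr_ge_zero)
    also have "2 powr (real (Suc k) * p) * (pi * (R' / 2 ^ k)\<^sup>2) = 2 powr p * pi * R'\<^sup>2 * (2 powr (real k * p) / (2 ^ k)\<^sup>2)"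
      by (simp add: distrib_right powr_add power_divide)
    also have "2 powr (real k * p) / (2 ^ k)\<^sup>2 = q ^ k"
    proof -
      have "q ^ k = q powr real k" using q by (simp add: powr_realpow)
      also have "\<dots> = 2 powr (real k * p - 2 * real k)" by (simp add: q_def powr_powr algebra_simps)
      also have "\<dots> = 2 powr (real k * p) / 2 powr (2 * real k)" by (rule powr_diff)
      also have "2 powr (2 * real k) = (2 ^ k)\<^sup>2"
      proof -
        have "(2::real) powr (2 * real k) = 2 powr real (k * 2)" by (simp add: mult.commute)
        also have "\<dots> = 2 ^ (k * 2)" by (rule powr_realpow) simp
        finally show ?thesis by (simp only: power_mult)
      qed
      finally show ?thesis by simp
    qed
    finally show "(\<integral>\<^sup>+t. ?t k t \<partial>lborel) = ennreal (2 powr p * pi * R'\<^sup>2 * q ^ k)" .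
  qed
  also have "\<dots> = ennreal (\<Sum>k. 2 powr p * pi * R'\<^sup>2 * q ^ k)"
    by (rule suminf_ennreal2[OF _ sm]) (use q in auto)
  also have "\<dots> < \<infinity>" by simp
  finally show ?thesis .
qed

lemma nn_integral_ipow_cball_shift:
  fixes a :: complex
  assumes "norm a \<le> M"
  shows "(\<integral>\<^sup>+t\<in>cball (0::complex) R. ipow p (norm (t - a)) \<partial>lborel) \<le> (\<integral>\<^sup>+t\<in>cball (0::complex) (R + M). ipow p (norm t) \<partial>lborel)"
proof -
  have "(\<integral>\<^sup>+t\<in>cball (0::complex) (R + M). ipow p (norm t) \<partial>lborel) =
    (\<integral>\<^sup>+t. ipow p (norm t) * indicator (cball 0 (R + M)) t \<partial>distr lborel borel ((+) (- a)))"
    by (simp add: lborel_distr_plus)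
  also have "\<dots> = (\<integral>\<^sup>+t. ipow p (norm (- a + t)) * indicator (cball 0 (R + M)) (- a + t) \<partial>lborel)"
    by (subst nn_integral_distr) (auto intro!: borel_measurable_times_ennreal borel_measurable_indicator)
  also have "\<dots> \<ge> (\<integral>\<^sup>+t\<in>cball (0::complex) R. ipow p (norm (t - a)) \<partial>lborel)"
  proof (rule nn_integral_mono)
    fix t :: complex
    have "norm (t - a) \<le> R + M" if "norm t \<le> R"
      using norm_triangle_ineq4[of t a] that assms by linarith
    then show "ipow p (norm (t - a)) * indicator (cball 0 R) t \<le> ipow p (norm (- a + t)) * indicator (cball 0 (R + M)) (- a + t)"
      by (auto simp: indicator_def)
  qed
  finally show ?thesis .
qed

section \<open>Integrability of negative powers of the normal forms\<close>

lemma ipow_pos: "ipow p x > 0"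
  by (auto simp: ipow_def)

lemma ipow_0 [simp]: "ipow p 0 = \<infinity>" by (simp add: ipow_def)

lemma ipow_mult: assumes "0 \<le> x" "0 \<le> y" shows "ipow p (x * y) = ipow p x * ipow p y"
  using assms ipow_pos[of p x] ipow_pos[of p y]
  by (auto simp: ipow_def powr_mult ennreal_mult ennreal_top_mult ennreal_mult_top)

lemma ipow_antimono: assumes "0 \<le> p" "0 \<le> x" "x \<le> y" shows "ipow p y \<le> ipow p x"
  using assms by (auto simp: ipow_def intro!: ennreal_leI powr_mono2')

lemma ipow_add: assumes "0 \<le> x" shows "ipow (p + q) x = ipow p x * ipow q x"
  using assms powr_add[of x "- p" "- q"] by (auto simp: ipow_def ennreal_mult ennreal_top_mult)

lemma ipow_power: assumes "0 \<le> x" "n > 0" shows "ipow p (x ^ n) = ipow (real n * p) x"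
  using assms by (auto simp: ipow_def powr_powr simp flip: powr_realpow)

lemma ipow_mono_exp: assumes "0 \<le> x" "x \<le> 1" "p \<le> q" shows "ipow p x \<le> ipow q x"
  using assms by (auto simp: ipow_def intro!: ennreal_leI powr_mono')

text \<open>Let s be the smaller and M the larger of |X - a| and |X + a|. Then M is at least |a| and
  at least s, so one half of the power 2b of M is spent on |a| and the other on s. The sum on the
  right covers both orders of the factors.\<close>

lemma ipow_factor_bound:
  fixes X a :: complex
  assumes "0 \<le> b"
  shows "ipow (2 * b) (norm (X\<^sup>2 - a\<^sup>2)) \<le> ipow b (norm a) * (ipow (3 * b) (norm (X - a)) + ipow (3 * b) (norm (X + a)))"
proof -
  have *: "ipow (2 * b) (s * M) \<le> ipow b r * ipow (3 * b) s" if "0 \<le> s" "s \<le> M" "0 \<le> r" "r \<le> M" for s M r :: real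
  proof -
    have "ipow (2 * b) (s * M) = ipow (2 * b) s * (ipow b M * ipow b M)"
      using that ipow_add[of M b b] by (simp add: ipow_mult)
    also have "\<dots> \<le> ipow (2 * b) s * (ipow b r * ipow b s)"
      using that assms by (intro mult_left_mono mult_mono ipow_antimono) auto
    also have "\<dots> = ipow b r * (ipow (2 * b) s * ipow b s)" by (simp add: ac_simps)
    also have "ipow (2 * b) s * ipow b s = ipow (3 * b) s" using that ipow_add[of s "2 * b" b] by simp
    finally show ?thesis .
  qed
  have "norm (2 * a) \<le> norm (X - a) + norm (X + a)"
    using norm_triangle_ineq4[of "X + a" "X - a"] by (simp add: add.commute)
  then have t: "2 * norm a \<le> norm (X - a) + norm (X + a)" by (simp add: norm_mult)
  have f: "norm (X\<^sup>2 - a\<^sup>2) = norm (X - a) * norm (X + a)"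
    unfolding norm_mult[symmetric] by (simp add: power2_eq_square algebra_simps)
  show ?thesis
  proof (cases "norm (X - a) \<le> norm (X + a)")
    case True
    then have "ipow (2 * b) (norm (X\<^sup>2 - a\<^sup>2)) \<le> ipow b (norm a) * ipow (3 * b) (norm (X - a))"
      unfolding f using t by (intro *) auto
    also have "\<dots> \<le> ipow b (norm a) * (ipow (3 * b) (norm (X - a)) + ipow (3 * b) (norm (X + a)))"
      by (intro mult_left_mono) auto
    finally show ?thesis .
  next
    case False
    then have "ipow (2 * b) (norm (X + a) * norm (X - a)) \<le> ipow b (norm a) * ipow (3 * b) (norm (X + a))"
      using t by (intro *) auto
    also have "\<dots> \<le> ipow b (norm a) * (ipow (3 * b) (norm (X - a)) + ipow (3 * b) (norm (X + a)))"
      by (intro mult_left_mono) auto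
    finally show ?thesis unfolding f by (simp add: mult.commute)
  qed
qed

text \<open>The normal forms factor as \<open>(X - a Y) (X + a Y)\<close>, for \<open>D\<^sub>4\<close> times \<open>Y\<close>, with \<open>a Y = iY\<close> or \<open>a Y = iY\<^sup>3\<close>. The larger of the
  two factors dominates the geometric mean of the smaller one and \<open>|a Y|\<close>, hence the exponent \<open>3b < 2\<close>, which is integrable in
  each complex variable.\<close>
definition tame_nf :: "(complex \<times> complex \<Rightarrow> complex) \<Rightarrow> bool" where
  "tame_nf h \<longleftrightarrow> continuous_on UNIV h \<and> (\<exists>a. continuous_on UNIV a \<and> (\<forall>Y. norm Y \<le> 1 \<longrightarrow> norm (a Y) \<le> 1) \<and>
     (\<forall>b\<ge>0. \<forall>X Y. norm Y \<le> 1 \<longrightarrow> ipow (2 * b) (norm (h (X, Y))) \<le>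
        ipow (3 * b) (norm Y) * (ipow (3 * b) (norm (X - a Y)) + ipow (3 * b) (norm (X + a Y)))))"

lemma tame_A1: "tame_nf nf_A1"
  unfolding tame_nf_def
proof (intro conjI exI[of _ "\<lambda>Y. \<i> * Y"] allI impI)
  fix b :: real and X Y :: complex assume b: "0 \<le> b" "norm Y \<le> 1"
  have "nf_A1 (X, Y) = X\<^sup>2 - (\<i> * Y)\<^sup>2" by (simp add: nf_A1_def power_mult_distrib)
  then have "ipow (2 * b) (norm (nf_A1 (X, Y))) \<le> ipow b (norm (\<i> * Y)) * (ipow (3 * b) (norm (X - \<i> * Y)) + ipow (3 * b) (norm (X + \<i> * Y)))"
    using ipow_factor_bound[OF b(1)] by simp
  also have "\<dots> \<le> ipow (3 * b) (norm Y) * (ipow (3 * b) (norm (X - \<i> * Y)) + ipow (3 * b) (norm (X + \<i> * Y)))"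
    using b by (intro mult_right_mono) (auto simp: norm_mult intro!: ipow_mono_exp)
  finally show "ipow (2 * b) (norm (nf_A1 (X, Y))) \<le> ipow (3 * b) (norm Y) * (ipow (3 * b) (norm (X - \<i> * Y)) + ipow (3 * b) (norm (X + \<i> * Y)))" .
qed (auto simp: nf_A1_def norm_mult intro!: continuous_intros)

lemma tame_A5: "tame_nf nf_A5"
  unfolding tame_nf_def
proof (intro conjI exI[of _ "\<lambda>Y. \<i> * Y ^ 3"] allI impI)
  fix b :: real and X Y :: complex assume b: "0 \<le> b" "norm Y \<le> 1"
  have "nf_A5 (X, Y) = X\<^sup>2 - (\<i> * Y ^ 3)\<^sup>2" by (simp add: nf_A5_def power_mult_distrib flip: power_mult)
  then have "ipow (2 * b) (norm (nf_A5 (X, Y))) \<le> ipow b (norm (\<i> * Y ^ 3)) * (ipow (3 * b) (norm (X - \<i> * Y ^ 3)) + ipow (3 * b) (norm (X + \<i> * Y ^ 3)))"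
    using ipow_factor_bound[OF b(1)] by simp
  also have "ipow b (norm (\<i> * Y ^ 3)) = ipow (3 * b) (norm Y)"
    using ipow_power[of "norm Y" 3 b] by (simp add: norm_mult norm_power)
  finally show "ipow (2 * b) (norm (nf_A5 (X, Y))) \<le> ipow (3 * b) (norm Y) * (ipow (3 * b) (norm (X - \<i> * Y ^ 3)) + ipow (3 * b) (norm (X + \<i> * Y ^ 3)))" .
qed (auto simp: nf_A5_def norm_mult norm_power power_le_one intro!: continuous_intros)

lemma tame_D4: "tame_nf nf_D4"
  unfolding tame_nf_def
proof (intro conjI exI[of _ "\<lambda>Y. \<i> * Y"] allI impI)
  fix b :: real and X Y :: complex assume b: "0 \<le> b" "norm Y \<le> 1"
  have "nf_D4 (X, Y) = Y * (X\<^sup>2 - (\<i> * Y)\<^sup>2)"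
    by (simp add: nf_D4_def power_mult_distrib algebra_simps power2_eq_square power3_eq_cube)
  then have "ipow (2 * b) (norm (nf_D4 (X, Y))) = ipow (2 * b) (norm Y) * ipow (2 * b) (norm (X\<^sup>2 - (\<i> * Y)\<^sup>2))"
    by (simp add: norm_mult ipow_mult del: norm_ii)
  also have "\<dots> \<le> ipow (2 * b) (norm Y) * (ipow b (norm (\<i> * Y)) * (ipow (3 * b) (norm (X - \<i> * Y)) + ipow (3 * b) (norm (X + \<i> * Y))))"
    using ipow_factor_bound[OF b(1)] by (intro mult_left_mono) auto
  also have "\<dots> = ipow (3 * b) (norm Y) * (ipow (3 * b) (norm (X - \<i> * Y)) + ipow (3 * b) (norm (X + \<i> * Y)))"
    using ipow_add[of "norm Y" "2 * b" b] by (simp add: norm_mult ac_simps)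
  finally show "ipow (2 * b) (norm (nf_D4 (X, Y))) \<le> ipow (3 * b) (norm Y) * (ipow (3 * b) (norm (X - \<i> * Y)) + ipow (3 * b) (norm (X + \<i> * Y)))" .
qed (auto simp: nf_D4_def norm_mult intro!: continuous_intros)

text \<open>X is innermost because the bound on the normal forms is integrated in X for fixed
  Y.\<close>

lemma nn_integral_pt:
  fixes F :: "pt \<Rightarrow> ennreal"
  assumes F: "F \<in> borel_measurable borel"
  shows "(\<integral>\<^sup>+v. F v \<partial>lborel) = (\<integral>\<^sup>+\<alpha>. (\<integral>\<^sup>+Y. (\<integral>\<^sup>+X. F (\<alpha>, X, Y) \<partial>lborel) \<partial>lborel) \<partial>lborel)"
proof -
  have F': "F \<in> borel_measurable (lborel \<Otimes>\<^sub>M lborel)"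
    using F by (simp add: lborel_prod)
  have "(\<integral>\<^sup>+v. F v \<partial>lborel) = (\<integral>\<^sup>+v. F v \<partial>(lborel \<Otimes>\<^sub>M lborel))"
    by (simp add: lborel_prod)
  also have "\<dots> = (\<integral>\<^sup>+\<alpha>. (\<integral>\<^sup>+w. F (\<alpha>, w) \<partial>lborel) \<partial>lborel)"
    by (rule lborel.nn_integral_fst[symmetric, OF F'])
  also have "\<dots> = (\<integral>\<^sup>+\<alpha>. (\<integral>\<^sup>+Y. (\<integral>\<^sup>+X. F (\<alpha>, X, Y) \<partial>lborel) \<partial>lborel) \<partial>lborel)"
  proof (rule nn_integral_cong)
    fix \<alpha> :: complex
    have "(\<lambda>w. F (\<alpha>, w)) \<in> borel_measurable (lborel \<Otimes>\<^sub>M lborel)"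
      unfolding lborel_prod by (rule measurable_compose[OF _ F]) (auto intro!: borel_measurable_continuous_onI continuous_intros)
    from lborel_pair.nn_integral_snd[OF this]
    show "(\<integral>\<^sup>+w. F (\<alpha>, w) \<partial>lborel) = (\<integral>\<^sup>+Y. (\<integral>\<^sup>+X. F (\<alpha>, X, Y) \<partial>lborel) \<partial>lborel)"
      by (simp add: lborel_prod)
  qed
  finally show ?thesis .
qed

lemma measurable_ipow_indicator:
  fixes g :: "'a::euclidean_space \<Rightarrow> complex"
  assumes "g \<in> borel_measurable borel" "S \<in> sets borel"
  shows "(\<lambda>s. ipow p (norm (g s)) * indicator S s) \<in> borel_measurable borel"
  using assms by measurable

text \<open>The first coordinate will be the scaling factor of a cone over an affine chart, hence
  the disc around 1. Since |a Y| <= 1, translation bounds the X-integral by the same I for all Y;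
  what remains is the power 3b < 2 of |Y|.\<close>

lemma integrable_tame_nf:
  assumes h: "tame_nf h" and b: "0 \<le> b" "b < 2 / 3"
  shows "(\<integral>\<^sup>+s\<in>cball (1::complex) (1/2) \<times> (cball (0::complex) 1 \<times> cball (0::complex) 1). ipow (2 * b) (norm (h (snd s))) \<partial>lborel) < \<infinity>"
proof -
  from h obtain a where hc: "continuous_on UNIV h" and ac: "continuous_on UNIV a" and a: "\<And>Y. norm Y \<le> 1 \<Longrightarrow> norm (a Y) \<le> 1"
    and bd: "\<And>X Y. norm Y \<le> 1 \<Longrightarrow> ipow (2 * b) (norm (h (X, Y))) \<le>
        ipow (3 * b) (norm Y) * (ipow (3 * b) (norm (X - a Y)) + ipow (3 * b) (norm (X + a Y)))"
    unfolding tame_nf_def using b by metis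
  define I where "I = (\<integral>\<^sup>+t\<in>cball (0::complex) 2. ipow (3 * b) (norm t) \<partial>lborel)"
  have I: "I < \<infinity>" unfolding I_def using b by (intro nn_integral_ipow_cball) auto
  have I1: "(\<integral>\<^sup>+t\<in>cball (0::complex) 1. ipow (3 * b) (norm (t - c)) \<partial>lborel) \<le> I" if "norm c \<le> 1" for c
    using nn_integral_ipow_cball_shift[OF that, of "3 * b" 1] by (simp add: I_def)
  have hm: "h \<in> borel_measurable borel" using hc by (rule borel_measurable_continuous_onI)
  have m: "(\<lambda>s::pt. ipow (2 * b) (norm (h (snd s))) * indicator (cball (1::complex) (1/2) \<times> (cball (0::complex) 1 \<times> cball (0::complex) 1)) s) \<in> borel_measurable borel"
    by (rule measurable_ipow_indicator) (auto intro!: measurable_compose[OF _ hm] borel_measurable_continuous_onI[of snd] continuous_intros closed_Times borel_closed)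
  have "(\<integral>\<^sup>+s\<in>cball (1::complex) (1/2) \<times> (cball (0::complex) 1 \<times> cball (0::complex) 1). ipow (2 * b) (norm (h (snd s))) \<partial>lborel)
     = (\<integral>\<^sup>+\<alpha>. (\<integral>\<^sup>+Y. (\<integral>\<^sup>+X. ipow (2 * b) (norm (h (X, Y))) * indicator (cball (1::complex) (1/2) \<times> (cball (0::complex) 1 \<times> cball (0::complex) 1)) (\<alpha>, X, Y) \<partial>lborel) \<partial>lborel) \<partial>lborel)"
    by (subst nn_integral_pt[OF m]) simp
  also have "\<dots> \<le> (\<integral>\<^sup>+\<alpha>. indicator (cball (1::complex) (1/2)) \<alpha> * (\<integral>\<^sup>+Y\<in>cball (0::complex) 1. ipow (3 * b) (norm Y) * (2 * I) \<partial>lborel) \<partial>lborel)"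
  proof (rule nn_integral_mono)
    fix \<alpha> :: complex
    have "(\<integral>\<^sup>+Y. (\<integral>\<^sup>+X. ipow (2 * b) (norm (h (X, Y))) * indicator (cball (1::complex) (1/2) \<times> (cball (0::complex) 1 \<times> cball (0::complex) 1)) (\<alpha>, X, Y) \<partial>lborel) \<partial>lborel)
      \<le> (\<integral>\<^sup>+Y. indicator (cball (1::complex) (1/2)) \<alpha> * (ipow (3 * b) (norm Y) * (2 * I) * indicator (cball (0::complex) 1) Y) \<partial>lborel)"
    proof (rule nn_integral_mono)
      fix Y :: complex
      show "(\<integral>\<^sup>+X. ipow (2 * b) (norm (h (X, Y))) * indicator (cball (1::complex) (1/2) \<times> (cball (0::complex) 1 \<times> cball (0::complex) 1)) (\<alpha>, X, Y) \<partial>lborel)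
        \<le> indicator (cball (1::complex) (1/2)) \<alpha> * (ipow (3 * b) (norm Y) * (2 * I) * indicator (cball (0::complex) 1) Y)"
      proof (cases "\<alpha> \<in> cball (1::complex) (1/2) \<and> Y \<in> cball (0::complex) 1")
        case True
        then have Y: "norm Y \<le> 1" by simp
        have "(\<integral>\<^sup>+X. ipow (2 * b) (norm (h (X, Y))) * indicator (cball (1::complex) (1/2) \<times> (cball (0::complex) 1 \<times> cball (0::complex) 1)) (\<alpha>, X, Y) \<partial>lborel)
          \<le> (\<integral>\<^sup>+X. ipow (3 * b) (norm Y) * (ipow (3 * b) (norm (X - a Y)) * indicator (cball (0::complex) 1) X + ipow (3 * b) (norm (X - (- a Y))) * indicator (cball (0::complex) 1) X) \<partial>lborel)"
          using bd[OF Y] by (intro nn_integral_mono) (auto simp: indicator_def)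
        also have "\<dots> = ipow (3 * b) (norm Y) * ((\<integral>\<^sup>+X\<in>cball (0::complex) 1. ipow (3 * b) (norm (X - a Y)) \<partial>lborel) + (\<integral>\<^sup>+X\<in>cball (0::complex) 1. ipow (3 * b) (norm (X - (- a Y))) \<partial>lborel))"
        proof -
          have m: "(\<lambda>X. ipow (3 * b) (norm (X - c)) * indicator (cball 0 1) X) \<in> borel_measurable lborel" for c :: complex
            using measurable_ipow_indicator[of "\<lambda>X::complex. X - c" "cball 0 1"] by simp
          show ?thesis
            by (subst nn_integral_cmult, intro borel_measurable_add m, subst nn_integral_add) (rule m refl)+
        qed
        also have "\<dots> \<le> ipow (3 * b) (norm Y) * (I + I)"
          using a[OF Y] by (intro mult_left_mono add_mono I1) auto
        finally show ?thesis using True unfolding mult_2[symmetric] by simp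
      next
        case False
        then show ?thesis by (auto simp: indicator_def)
      qed
    qed
    also have "\<dots> = indicator (cball (1::complex) (1/2)) \<alpha> * (\<integral>\<^sup>+Y\<in>cball (0::complex) 1. ipow (3 * b) (norm Y) * (2 * I) \<partial>lborel)"
      by (rule nn_integral_cmult)
         (intro borel_measurable_times_ennreal borel_measurable_indicator measurable_compose[OF _ measurable_ipow] borel_measurable_const, auto)
    finally show "(\<integral>\<^sup>+Y. (\<integral>\<^sup>+X. ipow (2 * b) (norm (h (X, Y))) * indicator (cball (1::complex) (1/2) \<times> (cball (0::complex) 1 \<times> cball (0::complex) 1)) (\<alpha>, X, Y) \<partial>lborel) \<partial>lborel)
      \<le> indicator (cball (1::complex) (1/2)) \<alpha> * (\<integral>\<^sup>+Y\<in>cball (0::complex) 1. ipow (3 * b) (norm Y) * (2 * I) \<partial>lborel)" .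
  qed
  also have "\<dots> = (\<integral>\<^sup>+Y\<in>cball (0::complex) 1. (2 * I) * ipow (3 * b) (norm Y) \<partial>lborel) * emeasure lborel (cball (1::complex) (1/2))"
    by (subst nn_integral_multc) (auto simp: mult.commute intro!: borel_measurable_indicator)
  also have "(\<integral>\<^sup>+Y\<in>cball (0::complex) 1. (2 * I) * ipow (3 * b) (norm Y) \<partial>lborel) = (2 * I) * (\<integral>\<^sup>+Y\<in>cball (0::complex) 1. ipow (3 * b) (norm Y) \<partial>lborel)"
    unfolding mult.assoc[of "2 * I"] by (rule nn_integral_cmult) (use measurable_ipow_indicator[of "\<lambda>x::complex. x" "cball 0 1" "3 * b"] in simp)
  also have "\<dots> * emeasure lborel (cball (1::complex) (1/2)) < \<infinity>"
  proof -
    have "(\<integral>\<^sup>+Y\<in>cball (0::complex) 1. ipow (3 * b) (norm Y) \<partial>lborel) < \<infinity>"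
      using I1[of 0] I by simp
    then show ?thesis
      using I emeasure_lborel_cball_finite[of "1::complex" "1/2"] by (auto simp: ennreal_mult_less_top)
  qed
  finally show ?thesis .
qed

text \<open>The model of a smooth point, where f itself serves as the first coordinate.\<close>

lemma integrable_fst:
  assumes b: "0 \<le> b" "b < 2 / 3"
  shows "(\<integral>\<^sup>+s\<in>cball (0::complex) R \<times> (cball (0::complex) R \<times> cball (0::complex) R). ipow (2 * b) (norm (fst s)) \<partial>lborel) < \<infinity>"
proof -
  let ?B = "cball (0::complex) R"
  have "(\<integral>\<^sup>+s\<in>?B \<times> (?B \<times> ?B). ipow (2 * b) (norm (fst s)) \<partial>lborel)
     = (\<integral>\<^sup>+\<alpha>. (\<integral>\<^sup>+Y. (\<integral>\<^sup>+X. ipow (2 * b) (norm \<alpha>) * indicator (?B \<times> (?B \<times> ?B)) (\<alpha>, X, Y) \<partial>lborel) \<partial>lborel) \<partial>lborel)"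
    by (subst nn_integral_pt[OF measurable_ipow_indicator])
       (auto intro!: borel_measurable_continuous_onI[of fst] continuous_intros closed_Times borel_closed)
  also have "\<dots> = (\<integral>\<^sup>+\<alpha>. (\<integral>\<^sup>+Y. (\<integral>\<^sup>+X. (ipow (2 * b) (norm \<alpha>) * indicator ?B \<alpha>) * (indicator ?B Y * indicator ?B X) \<partial>lborel) \<partial>lborel) \<partial>lborel)"
    by (intro nn_integral_cong) (auto simp: indicator_def)
  also have "\<dots> = (\<integral>\<^sup>+\<alpha>\<in>?B. ipow (2 * b) (norm \<alpha>) \<partial>lborel) * (emeasure lborel ?B * emeasure lborel ?B)"
  proof -
    have "(\<integral>\<^sup>+X. c * (d * indicator ?B X) \<partial>lborel) = c * (d * emeasure lborel ?B)" for c d :: ennreal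
      unfolding mult.assoc[symmetric] by (rule nn_integral_cmult_indicator) simp
    moreover have "(\<integral>\<^sup>+Y. c * (indicator ?B Y * e) \<partial>lborel) = c * (emeasure lborel ?B * e)" for c e :: ennreal
      unfolding mult.assoc[symmetric] by (subst nn_integral_multc) (auto simp: nn_integral_cmult_indicator intro!: borel_measurable_times_ennreal borel_measurable_indicator)
    moreover have "(\<integral>\<^sup>+\<alpha>. (ipow (2 * b) (norm \<alpha>) * indicator ?B \<alpha>) * c \<partial>lborel) = (\<integral>\<^sup>+\<alpha>\<in>?B. ipow (2 * b) (norm \<alpha>) \<partial>lborel) * c" for c
      by (rule nn_integral_multc) (auto intro!: measurable_ipow_indicator[where g = "\<lambda>s. s"])
    ultimately show ?thesis by simp
  qed
  also have "\<dots> < \<infinity>"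
    using nn_integral_ipow_cball[of "2 * b" R] b emeasure_lborel_cball_finite[of "0::complex" R]
    by (simp add: ennreal_mult_less_top)
  finally show ?thesis .
qed

lemma integrable_transfer:
  fixes \<Psi> :: "pt \<Rightarrow> pt"
  assumes b: "0 \<le> b" and f: "pfun f"
    and S: "S \<in> sets borel" "bounded S" "L > 0"
    and lip: "\<And>x y. x \<in> S \<Longrightarrow> y \<in> S \<Longrightarrow> norm (\<Psi> x - \<Psi> y) \<le> L * norm (x - y)"
    and N: "N \<in> sets borel" "N \<subseteq> \<Psi> ` S"
    and c: "c > 0" "\<And>s. s \<in> S \<Longrightarrow> norm (f (\<Psi> s)) \<ge> c * norm (g s)" and g: "g \<in> borel_measurable borel"
    and fin: "(\<integral>\<^sup>+s\<in>S. ipow (2 * b) (norm (g s)) \<partial>lborel) < \<infinity>"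
  shows "(\<integral>\<^sup>+v\<in>N. ipow (2 * b) (norm (f v)) \<partial>lborel) < \<infinity>"
proof -
  have fm: "f \<in> borel_measurable borel"
    using pfun_continuous[OF f] by (rule borel_measurable_continuous_onI)
  have "(\<integral>\<^sup>+v\<in>N. ipow (2 * b) (norm (f v)) \<partial>lborel) \<le>
    ennreal ((2 * L * DIM(pt)) ^ DIM(pt)) * (\<integral>\<^sup>+s\<in>S. ipow (2 * b) (norm (f (\<Psi> s))) \<partial>lborel)"
    by (rule nn_integral_lipschitz_image_le[OF S lip N])
       (auto intro: measurable_compose[OF _ measurable_ipow] measurable_compose[OF fm])
  also have "(\<integral>\<^sup>+s\<in>S. ipow (2 * b) (norm (f (\<Psi> s))) \<partial>lborel) \<le> (\<integral>\<^sup>+s. ipow (2 * b) c * (ipow (2 * b) (norm (g s)) * indicator S s) \<partial>lborel)"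
  proof (rule nn_integral_mono)
    fix s
    have "ipow (2 * b) (norm (f (\<Psi> s))) \<le> ipow (2 * b) (c * norm (g s))" if "s \<in> S"
      using that b c by (intro ipow_antimono) auto
    then show "ipow (2 * b) (norm (f (\<Psi> s))) * indicator S s \<le> ipow (2 * b) c * (ipow (2 * b) (norm (g s)) * indicator S s)"
      using c(1) by (auto simp: indicator_def ipow_mult)
  qed
  also have "\<dots> = ipow (2 * b) c * (\<integral>\<^sup>+s\<in>S. ipow (2 * b) (norm (g s)) \<partial>lborel)"
    using S g by (intro nn_integral_cmult) (auto intro!: borel_measurable_times_ennreal borel_measurable_indicator
       measurable_compose[OF _ measurable_ipow] measurable_compose[OF g])
  also have "ennreal ((2 * L * DIM(pt)) ^ DIM(pt)) * \<dots> < \<infinity>"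
    using fin c(1) by (simp add: ennreal_mult_less_top ipow_def)
  finally show ?thesis by (simp add: mult_left_mono)
qed

section \<open>Local integrability away from the origin\<close>

lemma norm_fst_le': "norm (fst (d::'a::real_normed_vector \<times> 'b::real_normed_vector)) \<le> norm d"
  and norm_snd_le': "norm (snd d) \<le> norm d"
  by (metis norm_fst_le prod.collapse, metis norm_snd_le prod.collapse)

lemma norm_coords: "norm (fst v) \<le> norm (v::pt)" "norm (fst (snd v)) \<le> norm v" "norm (snd (snd v)) \<le> norm v"
  using norm_fst_le'[of v] norm_snd_le'[of v] norm_fst_le'[of "snd v"] norm_snd_le'[of "snd v"] by auto

text \<open>The two-point form of differentiability is what yields a lower bound on |f v - f v'|,
  and so a Lipschitz inverse of a coordinate map.\<close>

lemma pfun_strict_diff: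
  assumes "pfun f" "\<eta> > 0"
  obtains \<delta> where "\<delta> > 0" "\<And>v v'. v \<in> cball p \<delta> \<Longrightarrow> v' \<in> cball p \<delta> \<Longrightarrow>
    norm (f v - f v' - dd f p (v - v')) \<le> \<eta> * norm (v - v')"
proof -
  let ?N = "\<lambda>v. norm (dX f v - dX f p) + norm (dY f v - dY f p) + norm (dZ f v - dZ f p)"
  have "isCont ?N p"
    using assms(1) by (intro continuous_intros pfun_isCont pfun_partials)
  then have "\<exists>\<delta>>0. \<forall>v. dist v p < \<delta> \<longrightarrow> dist (?N v) (?N p) < \<eta>"
    using assms(2) unfolding continuous_at_eps_delta by blast
  then obtain \<delta> where \<delta>: "\<delta> > 0" "\<And>v. dist v p < \<delta> \<Longrightarrow> ?N v < \<eta>"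
    by (auto simp: dist_real_def)
  show thesis
  proof (rule that[of "\<delta> / 2"])
    fix v v' assume v: "v \<in> cball p (\<delta> / 2)" "v' \<in> cball p (\<delta> / 2)"
    let ?g = "\<lambda>v. f v - dd f p v"
    have lin: "(dd f p has_derivative dd f p) F" for F
      unfolding dd_def by (auto intro!: derivative_eq_intros)
    have "norm (?g v - ?g v') \<le> \<eta> * norm (v - v')"
    proof (rule differentiable_bound[of "cball p (\<delta> / 2)" _ "\<lambda>x d. dd f x d - dd f p d"])
      fix x assume x: "x \<in> cball p (\<delta> / 2)"
      show "(?g has_derivative (\<lambda>d. dd f x d - dd f p d)) (at x within cball p (\<delta> / 2))"
        by (intro has_derivative_diff has_derivative_at_withinI[OF pfun_has_derivative] assms lin)
      show "onorm (\<lambda>d. dd f x d - dd f p d) \<le> \<eta>"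
      proof (rule onorm_bound)
        fix d
        have "dd f x d - dd f p d = (dX f x - dX f p) * fst d + (dY f x - dY f p) * fst (snd d) + (dZ f x - dZ f p) * snd (snd d)"
          by (simp add: dd_def algebra_simps)
        also have "norm \<dots> \<le> norm ((dX f x - dX f p) * fst d) + norm ((dY f x - dY f p) * fst (snd d)) + norm ((dZ f x - dZ f p) * snd (snd d))"
          by (meson norm_triangle_mono norm_triangle_ineq order_refl)
        also have "\<dots> \<le> norm (dX f x - dX f p) * norm d + norm (dY f x - dY f p) * norm d + norm (dZ f x - dZ f p) * norm d"
          unfolding norm_mult by (intro add_mono mult_left_mono norm_coords) auto
        also have "\<dots> = ?N x * norm d" by (simp add: algebra_simps)
        also have "\<dots> \<le> \<eta> * norm d"
          using \<delta>(2)[of x] x \<delta>(1) by (intro mult_right_mono) (auto simp: dist_commute)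
        finally show "norm (dd f x d - dd f p d) \<le> \<eta> * norm d" .
      qed (use assms in auto)
    qed (use v in auto)
    then show "norm (f v - f v' - dd f p (v - v')) \<le> \<eta> * norm (v - v')"
      by (simp add: dd_lin algebra_simps)
  qed (use \<delta> in auto)
qed

text \<open>Here \<kappa> is a coordinate whose partial derivative at p has modulus A > 0, and
  \<rho> collects the other two. The map (f, \<rho>) expands distances near p up to a constant; its
  inverse on the image is Lipschitz and turns f into the first coordinate. Openness of the image is
  irrelevant, so no inverse function theorem enters.\<close>

lemma integrable_near_smooth_aux:
  fixes \<rho> :: "pt \<Rightarrow> complex \<times> complex" and \<kappa> :: "pt \<Rightarrow> complex"
  assumes f: "pfun f" and b: "0 \<le> b" "b < 2 / 3" and A: "A > 0" "M \<ge> 0"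
    and \<rho>: "continuous_on UNIV \<rho>" "\<And>v w. \<rho> (v - w) = \<rho> v - \<rho> w"
    and n: "\<And>d. norm d \<le> norm (\<kappa> d) + norm (\<rho> d)"
    and k: "\<And>d. A * norm (\<kappa> d) \<le> norm (dd f p d) + M * norm (\<rho> d)"
  shows "\<exists>\<delta>>0. (\<integral>\<^sup>+v\<in>cball p \<delta>. ipow (2 * b) (norm (f v)) \<partial>lborel) < \<infinity>"
proof -
  obtain \<delta> where \<delta>: "\<delta> > 0" "\<And>v v'. v \<in> cball p \<delta> \<Longrightarrow> v' \<in> cball p \<delta> \<Longrightarrow>
    norm (f v - f v' - dd f p (v - v')) \<le> A / 2 * norm (v - v')"
    using pfun_strict_diff[OF f half_gt_zero[OF A(1)], of p] by blast
  define \<Phi> where "\<Phi> v = (f v, \<rho> v)" for v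
  \<comment> \<open>The strict estimate is used with error A/2, so half of A |\<kappa> d| can be
    absorbed on the left; solving for |\<kappa> d| and adding |\<rho> d| gives L.\<close>
  define L where "L = 2 / A + 2 + 2 * M / A"
  have L: "L > 0" using A by (simp add: L_def add_pos_nonneg)
  have ex: "norm (v - v') \<le> L * norm (\<Phi> v - \<Phi> v')" if v: "v \<in> cball p \<delta>" "v' \<in> cball p \<delta>" for v v'
  proof -
    define d where "d = v - v'"
    define R where "R = norm (\<Phi> v - \<Phi> v')"
    have R: "norm (f v - f v') \<le> R" "norm (\<rho> d) \<le> R"
      using norm_fst_le'[of "\<Phi> v - \<Phi> v'"] norm_snd_le'[of "\<Phi> v - \<Phi> v'"] by (auto simp: R_def \<Phi>_def d_def \<rho>)
    have "norm (dd f p d) \<le> norm (f v - f v') + norm (f v - f v' - dd f p d)"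
      by (metis norm_minus_commute norm_triangle_sub)
    also have "\<dots> \<le> R + A / 2 * norm d" using R \<delta>(2)[OF v] by (simp add: d_def)
    finally have "A * norm (\<kappa> d) \<le> R + A / 2 * norm d + M * norm (\<rho> d)" using k[of d] by linarith
    also have "\<dots> \<le> R + A / 2 * (norm (\<kappa> d) + R) + M * R"
      using n[of d] A R(2) by (intro add_mono mult_left_mono) auto
    finally have "A / 2 * norm (\<kappa> d) \<le> R + A / 2 * R + M * R" unfolding distrib_left by linarith
    moreover have "norm (\<kappa> d) * A = 2 * (A / 2 * norm (\<kappa> d))" by simp
    moreover have "A * R = 2 * (A / 2 * R)" by simp
    ultimately have "norm (\<kappa> d) * A \<le> 2 * R + A * R + 2 * (M * R)" by linarith
    then have "norm (\<kappa> d) \<le> (2 * R + A * R + 2 * (M * R)) / A"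
      by (rule pos_le_divide_eq[OF A(1), THEN iffD2])
    also have "\<dots> = (2 / A + 1 + 2 * M / A) * R" using A(1) by (simp add: add_divide_distrib distrib_right)
    finally have "norm (\<kappa> d) \<le> (2 / A + 1 + 2 * M / A) * R" .
    then have "norm d \<le> (2 / A + 1 + 2 * M / A) * R + R" using n[of d] R(2) by linarith
    then show ?thesis by (simp add: L_def d_def R_def algebra_simps)
  qed
  have inj: "inj_on \<Phi> (cball p \<delta>)"
  proof (rule inj_onI)
    fix v v' assume "v \<in> cball p \<delta>" "v' \<in> cball p \<delta>" "\<Phi> v = \<Phi> v'"
    then show "v = v'" using ex[of v v'] by simp
  qed
  have cont: "continuous_on S \<Phi>" for S
    unfolding \<Phi>_def using continuous_on_subset[OF \<rho>(1)] by (intro continuous_intros pfun_continuous f) auto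
  define S where "S = \<Phi> ` cball p \<delta>"
  have S: "compact S" unfolding S_def by (intro compact_continuous_image cont compact_cball)
  then obtain R where R: "\<And>s. s \<in> S \<Longrightarrow> norm s \<le> R" using compact_imp_bounded bounded_iff by metis
  define \<Psi> where "\<Psi> = inv_into (cball p \<delta>) \<Phi>"
  have P: "\<Psi> s \<in> cball p \<delta>" "\<Phi> (\<Psi> s) = s" if "s \<in> S" for s
    using that unfolding S_def \<Psi>_def by (auto intro: inv_into_into f_inv_into_f simp del: mem_cball)
  have "(\<integral>\<^sup>+v\<in>cball p \<delta>. ipow (2 * b) (norm (f v)) \<partial>lborel) < \<infinity>"
  proof (rule integrable_transfer[where S = S and \<Psi> = \<Psi> and c = 1 and g = fst and L = L])
    show "norm (\<Psi> x - \<Psi> y) \<le> L * norm (x - y)" if "x \<in> S" "y \<in> S" for x y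
      using ex[of "\<Psi> x" "\<Psi> y"] P that by auto
    show "cball p \<delta> \<subseteq> \<Psi> ` S"
      unfolding S_def \<Psi>_def using inj by (auto simp: image_iff inv_into_f_f intro!: bexI simp del: mem_cball)
    show "1 * norm (fst s) \<le> norm (f (\<Psi> s))" if "s \<in> S" for s
      using arg_cong[OF P(2)[OF that], of fst] by (simp add: \<Phi>_def)
    let ?B = "cball (0::complex) R"
    have "s \<in> ?B \<times> (?B \<times> ?B)" if "s \<in> S" for s
      using R[OF that] norm_coords[of s] by (auto simp: mem_Times_iff intro: order_trans)
    then have "S \<subseteq> ?B \<times> (?B \<times> ?B)" by blast
    then have "(\<integral>\<^sup>+s\<in>S. ipow (2 * b) (norm (fst s)) \<partial>lborel) \<le> (\<integral>\<^sup>+s\<in>?B \<times> (?B \<times> ?B). ipow (2 * b) (norm (fst s)) \<partial>lborel)"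
      by (intro nn_integral_mono) (auto simp: indicator_def)
    then show "(\<integral>\<^sup>+s\<in>S. ipow (2 * b) (norm (fst s)) \<partial>lborel) < \<infinity>"
      using integrable_fst[OF b, of R] by (rule le_less_trans)
    show "fst \<in> borel_measurable borel" by (intro borel_measurable_continuous_onI continuous_intros)
  qed (use b f L S borel_compact[OF S] compact_imp_closed compact_imp_bounded in auto)
  then show ?thesis using \<delta>(1) by auto
qed

lemma integrable_near_smooth:
  assumes f: "pfun f" and b: "0 \<le> b" "b < 2 / 3" and ns: "\<not> (dX f p = 0 \<and> dY f p = 0 \<and> dZ f p = 0)"
  shows "\<exists>\<delta>>0. (\<integral>\<^sup>+v\<in>cball p \<delta>. ipow (2 * b) (norm (f v)) \<partial>lborel) < \<infinity>"
proof -
  define M where "M = norm (dX f p) + norm (dY f p) + norm (dZ f p)"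
  have Mb: "norm x * norm s + norm y * norm t \<le> M * norm (s, t)" if "norm x + norm y \<le> M" for s t x y :: complex
  proof -
    have "norm x * norm s + norm y * norm t \<le> norm x * norm (s, t) + norm y * norm (s, t)"
      using norm_fst_le[of s t] norm_snd_le[of t s] by (intro add_mono mult_left_mono) auto
    also have "\<dots> = (norm x + norm y) * norm (s, t)" by (simp add: algebra_simps)
    also have "\<dots> \<le> M * norm (s, t)" using that by (intro mult_right_mono) auto
    finally show ?thesis .
  qed
  have tri: "norm x \<le> norm (x + y + z) + (norm y + norm z)" for x y z :: complex
    using norm_triangle_ineq4[of "x + y + z" "y + z"] norm_triangle_ineq[of y z] by simp
  consider "dX f p \<noteq> 0" | "dY f p \<noteq> 0" | "dZ f p \<noteq> 0" using ns by auto
  then show ?thesis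
  proof cases
    case 1
    show ?thesis
    proof (rule integrable_near_smooth_aux[where \<kappa> = fst and \<rho> = snd and A = "norm (dX f p)" and M = M])
      fix d :: pt
      show "norm d \<le> norm (fst d) + norm (snd d)" by (metis norm_Pair_le prod.collapse)
      show "norm (dX f p) * norm (fst d) \<le> norm (dd f p d) + M * norm (snd d)"
        using tri[of "dX f p * fst d" "dY f p * fst (snd d)" "dZ f p * snd (snd d)"]
          Mb[of "dY f p" "dZ f p" "fst (snd d)" "snd (snd d)"] by (simp add: M_def norm_mult dd_def)
    qed (use 1 f b in \<open>auto simp: M_def intro!: continuous_intros\<close>)
  next
    case 2
    show ?thesis
    proof (rule integrable_near_smooth_aux[where \<kappa> = "\<lambda>d. fst (snd d)" and \<rho> = "\<lambda>d. (fst d, snd (snd d))" and A = "norm (dY f p)" and M = M])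
      fix d :: pt
      show "norm d \<le> norm (fst (snd d)) + norm (fst d, snd (snd d))"
        using norm_triangle_ineq[of "(0::complex, fst (snd d), 0::complex)" "(fst d, 0, snd (snd d))"] by (simp add: norm_Pair)
      show "norm (dY f p) * norm (fst (snd d)) \<le> norm (dd f p d) + M * norm (fst d, snd (snd d))"
        using tri[of "dY f p * fst (snd d)" "dX f p * fst d" "dZ f p * snd (snd d)"]
          Mb[of "dX f p" "dZ f p" "fst d" "snd (snd d)"] by (simp add: M_def norm_mult dd_def ac_simps)
    qed (use 2 f b in \<open>auto simp: M_def intro!: continuous_intros\<close>)
  next
    case 3
    show ?thesis
    proof (rule integrable_near_smooth_aux[where \<kappa> = "\<lambda>d. snd (snd d)" and \<rho> = "\<lambda>d. (fst d, fst (snd d))" and A = "norm (dZ f p)" and M = M])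
      fix d :: pt
      show "norm d \<le> norm (snd (snd d)) + norm (fst d, fst (snd d))"
        using norm_triangle_ineq[of "(0::complex, 0::complex, snd (snd d))" "(fst d, fst (snd d), 0)"] by (simp add: norm_Pair)
      show "norm (dZ f p) * norm (snd (snd d)) \<le> norm (dd f p d) + M * norm (fst d, fst (snd d))"
        using tri[of "dZ f p * snd (snd d)" "dX f p * fst d" "dY f p * fst (snd d)"]
          Mb[of "dX f p" "dY f p" "fst d" "fst (snd d)"] by (simp add: M_def norm_mult dd_def ac_simps)
    qed (use 3 f b in \<open>auto simp: M_def intro!: continuous_intros\<close>)
  qed
qed

lemma holo2_continuous: "holo2 U g \<Longrightarrow> continuous_on U g"
  unfolding holo2_def by (meson continuous_at_imp_continuous_on has_derivative_continuous)

text \<open>\<open>holo2\<close> asserts pointwise derivatives with no continuity of their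
  coefficients. The local bound on the coefficients comes from the Cauchy inequality on discs in the
  two coordinate directions, the Lipschitz constant from the mean value inequality.\<close>

lemma holo2_lipschitz:
  assumes "holo2 U g" "z0 \<in> U"
  obtains \<delta> L where "\<delta> > 0" "L > 0" "cball z0 \<delta> \<subseteq> U" "\<And>z z'. z \<in> cball z0 \<delta> \<Longrightarrow> z' \<in> cball z0 \<delta> \<Longrightarrow> norm (g z - g z') \<le> L * norm (z - z')"
proof -
  have U: "open U" using assms by (simp add: holo2_def)
  then obtain r0 where r0: "r0 > 0" "cball z0 r0 \<subseteq> U" using assms(2) open_contains_cball by blast
  define r where "r = r0 / 2"
  have r: "r > 0" "cball z0 (2 * r) \<subseteq> U" using r0 by (auto simp: r_def)
  have "compact (g ` cball z0 (2 * r))"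
    using holo2_continuous[OF assms(1)] r by (intro compact_continuous_image) (auto intro: continuous_on_subset)
  then obtain M where M: "M > 0" "\<And>z. z \<in> cball z0 (2 * r) \<Longrightarrow> norm (g z) \<le> M"
    using compact_imp_bounded bounded_pos by (metis image_eqI)
  have "\<forall>z\<in>U. \<exists>a b. (g has_derivative (\<lambda>h. a * fst h + b * snd h)) (at z)" using assms(1) by (simp add: holo2_def)
  then obtain a b where ab: "\<And>z. z \<in> U \<Longrightarrow> (g has_derivative (\<lambda>h. a z * fst h + b z * snd h)) (at z)" by metis
  have bound: "norm c \<le> M / r" if z: "z \<in> cball z0 r" and e: "norm e \<le> 1"
    and c: "\<And>z'. z' \<in> U \<Longrightarrow> \<exists>c'. ((\<lambda>t. g (z' + (t * fst e, t * snd e))) has_field_derivative c') (at 0)"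
    and c0: "((\<lambda>t. g (z + (t * fst e, t * snd e))) has_field_derivative c) (at 0)" for z e c
  proof -
    let ?k = "\<lambda>t. g (z + (t * fst e, t * snd e))"
    have inU: "z + (t * fst e, t * snd e) \<in> cball z0 (2 * r)" if "norm t \<le> r" for t
    proof -
      have "norm (t * fst e, t * snd e) = norm t * norm e"
        by (simp add: norm_prod_def norm_mult power_mult_distrib real_sqrt_mult flip: distrib_left)
      also have "\<dots> \<le> r * 1" using that e r by (intro mult_mono) auto
      finally have "dist z0 (z + (t * fst e, t * snd e)) \<le> dist z0 z + r"
        using dist_triangle[of z0 "z + (t * fst e, t * snd e)" z] dist_add_cancel[of z 0 "(t * fst e, t * snd e)"] by simp
      then show ?thesis using z by simp
    qed
    have hd: "?k field_differentiable at t" if t: "norm t \<le> r" for t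
    proof -
      obtain c' where "((\<lambda>s. g ((z + (t * fst e, t * snd e)) + (s * fst e, s * snd e))) has_field_derivative c') (at 0)"
        using c inU[OF t] r(2) by blast
      then have "((\<lambda>s. ?k (t + s)) has_field_derivative c') (at 0)"
        by (simp add: algebra_simps)
      then have "(?k has_field_derivative c') (at t)"
        using DERIV_shift[of ?k c' 0 t] by (simp add: add.commute)
      then show ?thesis using field_differentiable_def by blast
    qed
    have "norm ((deriv ^^ 1) ?k 0) \<le> fact 1 * M / r ^ 1"
    proof (rule Cauchy_inequality)
      show "?k holomorphic_on ball 0 r"
        using hd by (auto simp: holomorphic_on_def intro: field_differentiable_at_within)
      show "continuous_on (cball 0 r) ?k"
        using hd by (intro continuous_at_imp_continuous_on) (auto intro: field_differentiable_imp_continuous_at)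
      show "norm (?k x) \<le> M" if "norm (0 - x) = r" for x
        using that inU[of x] M(2) by auto
    qed (use r in auto)
    moreover have "deriv ?k 0 = c" using c0 by (rule DERIV_imp_deriv)
    ultimately show ?thesis by simp
  qed
  have la: "((\<lambda>t. g (z + (t * fst e, t * snd e))) has_field_derivative (a z * fst e + b z * snd e)) (at 0)" if "z \<in> U" for z e
  proof -
    have "((\<lambda>t. z + (t * fst e, t * snd e)) has_derivative (\<lambda>h. 0 + (h * fst e, h * snd e))) (at 0)"
      by (intro derivative_intros has_derivative_Pair has_derivative_mult_left)
    moreover have "(g has_derivative (\<lambda>h. a z * fst h + b z * snd h)) (at (z + (0 * fst e, 0 * snd e)))"
      using ab[OF that] by (simp add: zero_prod_def[symmetric])
    ultimately have "((\<lambda>t. g (z + (t * fst e, t * snd e))) has_derivative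
        (\<lambda>h. a z * fst (0 + (h * fst e, h * snd e)) + b z * snd (0 + (h * fst e, h * snd e)))) (at 0)"
      by (rule has_derivative_compose)
    then show ?thesis unfolding has_field_derivative_def
      by (rule has_derivative_eq_rhs) (simp add: fun_eq_iff algebra_simps)
  qed
  have zU: "z \<in> U" if "z \<in> cball z0 r" for z
  proof -
    have "z \<in> cball z0 (2 * r)" using that r(1) by simp
    then show ?thesis using r(2) by blast
  qed
  have na: "norm (a z) \<le> M / r" if "z \<in> cball z0 r" for z
  proof (rule bound[OF that, of "(1, 0)"])
    show "\<exists>c'. ((\<lambda>t. g (z' + (t * fst (1::complex, 0::complex), t * snd (1::complex, 0::complex)))) has_field_derivative c') (at 0)" if "z' \<in> U" for z'
      using la[OF that, of "(1, 0)"] by blast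
    show "((\<lambda>t. g (z + (t * fst (1::complex, 0::complex), t * snd (1::complex, 0::complex)))) has_field_derivative a z) (at 0)"
      using la[of z "(1,0)"] zU[OF that] by simp
  qed simp
  have nb: "norm (b z) \<le> M / r" if "z \<in> cball z0 r" for z
  proof (rule bound[OF that, of "(0, 1)"])
    show "\<exists>c'. ((\<lambda>t. g (z' + (t * fst (0::complex, 1::complex), t * snd (0::complex, 1::complex)))) has_field_derivative c') (at 0)" if "z' \<in> U" for z'
      using la[OF that, of "(0, 1)"] by blast
    show "((\<lambda>t. g (z + (t * fst (0::complex, 1::complex), t * snd (0::complex, 1::complex)))) has_field_derivative b z) (at 0)"
      using la[of z "(0,1)"] zU[OF that] by simp
  qed simp
  show thesis
  proof (rule that[of r "2 * M / r"])
    show "cball z0 r \<subseteq> U" using r by auto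
    fix z z' assume zz: "z \<in> cball z0 r" "z' \<in> cball z0 r"
    show "norm (g z - g z') \<le> 2 * M / r * norm (z - z')"
    proof (rule differentiable_bound[of "cball z0 r" _ "\<lambda>x h. a x * fst h + b x * snd h"])
      fix x assume x: "x \<in> cball z0 r"
      show "(g has_derivative (\<lambda>h. a x * fst h + b x * snd h)) (at x within cball z0 r)"
        by (rule has_derivative_at_withinI[OF ab[OF zU[OF x]]])
      show "onorm (\<lambda>h. a x * fst h + b x * snd h) \<le> 2 * M / r"
      proof (rule onorm_bound)
        fix h
        have "norm (a x * fst h + b x * snd h) \<le> norm (a x) * norm (fst h) + norm (b x) * norm (snd h)"
          by (metis norm_mult norm_triangle_ineq)
        also have "\<dots> \<le> M / r * norm h + M / r * norm h"
          using na[OF x] nb[OF x] by (intro add_mono mult_mono norm_fst_le' norm_snd_le') (use M r in auto)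
        finally show "norm (a x * fst h + b x * snd h) \<le> 2 * M / r * norm h" by (simp add: algebra_simps)
      qed (use M r in auto)
    qed (use zz in auto)
  qed (use M r in auto)
qed

lemma norm_tsmul: "norm (tsmul c v) = norm c * norm v"
  by (simp add: tsmul_def norm_prod_def norm_mult power_mult_distrib real_sqrt_mult flip: distrib_left)

lemma cramer3:
  "tsmul (det3 p e1 e2) v = tsmul (det3 v e1 e2) p + tsmul (det3 p v e2) e1 + tsmul (det3 p e1 v) e2"
  by (cases p, cases e1, cases e2, cases v) (simp add: det3_def algebra_simps)

text \<open>A neighbourhood of p in C^3 is a cone over the chart, parametrized by (\<alpha>, w) ->
  \<alpha> (p + \<phi>1 w e1 + \<phi>2 w e2). By homogeneity f becomes \<alpha>^m u(w) h(w), and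
  \<alpha> and u stay away from 0, so integrability reduces to that of the normal form h.\<close>

lemma integrable_near_sing:
  assumes f: "pfun f" "hom m f" and b: "0 \<le> b" "b < 2 / 3" and h: "tame_nf h" and s: "sing_type f p h"
  shows "\<exists>\<delta>>0. (\<integral>\<^sup>+v\<in>cball p \<delta>. ipow (2 * b) (norm (f v)) \<partial>lborel) < \<infinity>"
proof -
  obtain e1 e2 U \<phi>1 \<phi>2 u where D: "det3 p e1 e2 \<noteq> 0" and bi: "biholo_on U \<phi>1 \<phi>2" and u: "holo2 U u" "u (0, 0) \<noteq> 0"
    and eq: "\<And>w. w \<in> U \<Longrightarrow> f (tadd p (tadd (tsmul (\<phi>1 w) e1) (tsmul (\<phi>2 w) e2))) = u w * h w"
    using s unfolding sing_type_def germ_equiv_def by auto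
  define \<phi> where "\<phi> w = (\<phi>1 w, \<phi>2 w)" for w
  obtain \<psi>1 \<psi>2 where ps: "holo2 (\<phi> ` U) \<psi>1" "holo2 (\<phi> ` U) \<psi>2"
    "\<And>z. z \<in> U \<Longrightarrow> (\<psi>1 (\<phi> z), \<psi>2 (\<phi> z)) = z"
    using bi unfolding biholo_on_def \<phi>_def by blast
  have U: "(0,0) \<in> U" "holo2 U \<phi>1" "holo2 U \<phi>2" "\<phi> (0,0) = (0,0)" "open (\<phi> ` U)" "open U"
    using bi unfolding biholo_on_def \<phi>_def by (auto simp: holo2_def)
  obtain d1 L1 where d1: "d1 > 0" "L1 > 0" "cball (0,0) d1 \<subseteq> U"
    "\<And>z z'. z \<in> cball (0,0) d1 \<Longrightarrow> z' \<in> cball (0,0) d1 \<Longrightarrow> norm (\<phi>1 z - \<phi>1 z') \<le> L1 * norm (z - z')"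
    using holo2_lipschitz[OF U(2,1)] by metis
  obtain d2 L2 where d2: "d2 > 0" "L2 > 0"
    "\<And>z z'. z \<in> cball (0,0) d2 \<Longrightarrow> z' \<in> cball (0,0) d2 \<Longrightarrow> norm (\<phi>2 z - \<phi>2 z') \<le> L2 * norm (z - z')"
    using holo2_lipschitz[OF U(3,1)] by metis
  have "isCont u (0,0)" using holo2_continuous[OF u(1)] U(1,6) continuous_on_eq_continuous_at by blast
  then obtain d3 where d3: "d3 > 0" "\<And>w. dist w (0,0) < d3 \<Longrightarrow> dist (u w) (u (0,0)) < norm (u (0,0)) / 2"
    using u(2) unfolding continuous_at_eps_delta by (meson half_gt_zero zero_less_norm_iff)
  define d where "d = min 1 (min (d1 / 2) (min (d2 / 2) (d3 / 3)))"
  have d: "d > 0" "d \<le> 1" "2 * d \<le> d1" "2 * d \<le> d2" "2 * d < d3" using d1(1) d2(1) d3(1) by (auto simp: d_def min_def)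
  have ball: "norm w \<le> 2 * d" if "norm (fst w) \<le> d" "norm (snd w) \<le> d" for w :: "complex \<times> complex"
    using that norm_Pair_le[of "fst w" "snd w"] by simp
  define Q where "Q = cball (0::complex) d \<times> cball (0::complex) d"
  have Qd: "norm w \<le> d1" "norm w \<le> d2" "norm w < d3" "w \<in> U" if "w \<in> Q" for w
  proof -
    have "norm w \<le> 2 * d" using that ball by (auto simp: Q_def)
    then show "norm w \<le> d1" "norm w \<le> d2" "norm w < d3" using d by linarith+
    then show "w \<in> U" using d1(3) by (auto simp: zero_prod_def[symmetric])
  qed
  define q where "q w = p + tsmul (\<phi>1 w) e1 + tsmul (\<phi>2 w) e2" for w
  define L where "L = L1 * norm e1 + L2 * norm e2"
  have L: "L \<ge> 0" using d1 d2 by (simp add: L_def)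
  have ql: "norm (q w - q w') \<le> L * norm (w - w')" if w: "w \<in> Q" "w' \<in> Q" for w w'
  proof -
    have "q w - q w' = tsmul (\<phi>1 w - \<phi>1 w') e1 + tsmul (\<phi>2 w - \<phi>2 w') e2"
      by (simp add: q_def tsmul_def prod_eq_iff algebra_simps)
    also have "norm \<dots> \<le> norm (\<phi>1 w - \<phi>1 w') * norm e1 + norm (\<phi>2 w - \<phi>2 w') * norm e2"
      by (metis norm_tsmul norm_triangle_ineq)
    also have "\<dots> \<le> (L1 * norm (w - w')) * norm e1 + (L2 * norm (w - w')) * norm e2"
      using Qd w by (intro add_mono mult_right_mono d1(4) d2(3)) (auto simp: zero_prod_def[symmetric])
    finally show ?thesis by (simp add: L_def algebra_simps)
  qed
  have q0: "q (0,0) = p" using U(4) by (simp add: q_def \<phi>_def)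
  have Q0: "(0,0) \<in> Q" using d by (simp add: Q_def)
  define M where "M = norm p + 2 * L + 1"
  have qM: "norm (q w) \<le> M" if w: "w \<in> Q" for w
  proof -
    have "norm (w - (0,0)) \<le> 2" using ball[of w] w d(2) by (auto simp: Q_def zero_prod_def[symmetric])
    then have "L * norm (w - (0,0)) \<le> L * 2" using L by (rule mult_left_mono)
    then have "norm (q w - p) \<le> 2 * L" using ql[OF w Q0] q0 by simp
    then show ?thesis using norm_triangle_ineq2[of "q w" p] by (simp add: M_def)
  qed
  define \<Psi> where "\<Psi> s = tsmul (fst s) (q (snd s))" for s :: pt
  define S where "S = cball (1::complex) (1/2) \<times> Q"
  have S1: "norm (fst s) \<le> 2" "norm (fst s) \<ge> 1 / 2" if "s \<in> S" for s
  proof -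
    have "norm (fst s - 1) \<le> 1 / 2" using that by (auto simp: S_def dist_norm norm_minus_commute)
    then show "norm (fst s) \<le> 2" "norm (fst s) \<ge> 1 / 2"
      using norm_triangle_ineq2[of "fst s" 1] norm_triangle_ineq3[of "fst s" 1] by auto
  qed
  have lip: "norm (\<Psi> s - \<Psi> s') \<le> (2 * L + M) * norm (s - s')" if s: "s \<in> S" "s' \<in> S" for s s'
  proof -
    have "\<Psi> s - \<Psi> s' = tsmul (fst s) (q (snd s) - q (snd s')) + tsmul (fst s - fst s') (q (snd s'))"
      by (simp add: \<Psi>_def tsmul_def prod_eq_iff algebra_simps)
    also have "norm \<dots> \<le> norm (fst s) * norm (q (snd s) - q (snd s')) + norm (fst s - fst s') * norm (q (snd s'))"
      by (metis norm_tsmul norm_triangle_ineq)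
    also have "\<dots> \<le> 2 * (L * norm (snd (s - s'))) + norm (fst (s - s')) * M"
      using S1[OF s(1)] ql[of "snd s" "snd s'"] qM[of "snd s'"] s by (intro add_mono mult_mono) (auto simp: S_def)
    also have "\<dots> \<le> 2 * (L * norm (s - s')) + norm (s - s') * M"
      using L by (intro add_mono mult_mono norm_fst_le' norm_snd_le') (auto simp: M_def)
    finally show ?thesis by (simp add: algebra_simps)
  qed
  define c where "c = (1 / 2) ^ m * (norm (u (0,0)) / 2)"
  have c: "c > 0" using u(2) by (simp add: c_def)
  have fc: "c * norm (h (snd s)) \<le> norm (f (\<Psi> s))" if s: "s \<in> S" for s
  proof -
    have w: "snd s \<in> Q" using s by (auto simp: S_def)
    have "dist (u (snd s)) (u (0,0)) < norm (u (0,0)) / 2"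
      using Qd(3)[OF w] by (intro d3(2)) (simp add: zero_prod_def[symmetric])
    then have un: "norm (u (snd s)) \<ge> norm (u (0,0)) / 2"
      using norm_triangle_ineq2[of "u (0,0)" "u (0,0) - u (snd s)"] by (simp add: dist_norm norm_minus_commute)
    have "f (\<Psi> s) = fst s ^ m * (u (snd s) * h (snd s))"
      using eq[OF Qd(4)[OF w]] by (simp add: \<Psi>_def homD[OF f(2)] q_def tadd_eq add.assoc)
    then have "norm (f (\<Psi> s)) = norm (fst s) ^ m * (norm (u (snd s)) * norm (h (snd s)))"
      by (simp add: norm_mult norm_power)
    moreover have "(1 / 2) ^ m * (norm (u (0,0)) / 2 * norm (h (snd s))) \<le> \<dots>"
      using S1(2)[OF s] un by (intro mult_mono power_mono) auto
    ultimately show ?thesis by (simp add: c_def mult.assoc)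
  qed
  have Lp: "2 * L + M > 0" using L norm_ge_zero[of p] unfolding M_def by linarith
  \<comment> \<open>B must be open so that the chart coordinates of every point near p lie in the
    range of the coordinate change. It is the preimage of a polydisc under the continuous
    inverse.\<close>
  define B where "B = \<phi> ` (ball 0 d \<times> ball 0 d)"
  have BU: "ball (0::complex) d \<times> ball (0::complex) d \<subseteq> U" using Qd(4) by (auto simp: Q_def)
  have oB: "open B"
  proof -
    have "continuous_on (\<phi> ` U) (\<lambda>y. (\<psi>1 y, \<psi>2 y))"
      using ps by (intro continuous_intros holo2_continuous)
    then have "open ((\<phi> ` U) \<inter> (\<lambda>y. (\<psi>1 y, \<psi>2 y)) -` (ball 0 d \<times> ball 0 d))"
      using U(5) by (intro continuous_open_preimage open_Times) auto
    moreover have "(\<phi> ` U) \<inter> (\<lambda>y. (\<psi>1 y, \<psi>2 y)) -` (ball 0 d \<times> ball 0 d) = B"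
      unfolding B_def using ps(3) BU by (auto simp del: mem_ball)
    ultimately show ?thesis by simp
  qed
  define D0 where "D0 = det3 p e1 e2"
  \<comment> \<open>By Cramer's rule \<alpha> v is the coefficient of p in v, and \<kappa> v gives
    the two affine coordinates after division by it.\<close>
  define \<alpha> where "\<alpha> v = det3 v e1 e2 / D0" for v
  define \<kappa> where "\<kappa> v = (det3 p v e2 / D0 / \<alpha> v, det3 p e1 v / D0 / \<alpha> v)" for v
  have dc: "isCont (\<lambda>v. det3 v a b) w" "isCont (\<lambda>v. det3 a v b) w" "isCont (\<lambda>v. det3 a b v) w" for a b w
    unfolding det3_def case_prod_unfold by (intro continuous_intros)+
  have p0: "\<alpha> p = 1" "\<kappa> p = (0, 0)"
    using D unfolding \<alpha>_def \<kappa>_def D0_def by (cases p; cases e1; cases e2; simp add: det3_def algebra_simps)+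
  have D0: "D0 \<noteq> 0" using D by (simp add: D0_def)
  have ca: "isCont \<alpha> p" unfolding \<alpha>_def by (intro continuous_intros dc D0)
  have ck: "isCont \<kappa> p" unfolding \<kappa>_def by (intro continuous_intros dc D0 ca) (auto simp: p0)
  have "open (ball (1::complex) (1/2))" by simp
  then have e1: "\<forall>\<^sub>F v in nhds p. \<alpha> v \<in> ball 1 (1/2)"
    using ca[unfolded isCont_def tendsto_at_iff_tendsto_nhds] p0 by (intro topological_tendstoD[of \<alpha> 1]) auto
  have "(0,0) \<in> B" unfolding B_def using U(4) d(1) by (intro image_eqI[of _ _ "(0,0)"]) auto
  then have e2: "\<forall>\<^sub>F v in nhds p. \<kappa> v \<in> B"
    using ck[unfolded isCont_def tendsto_at_iff_tendsto_nhds] p0 oB by (intro topological_tendstoD[of \<kappa> "(0,0)"]) auto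
  obtain \<delta>0 where \<delta>0: "\<delta>0 > 0" "\<And>v. dist v p < \<delta>0 \<Longrightarrow> \<alpha> v \<in> ball 1 (1/2) \<and> \<kappa> v \<in> B"
    using eventually_conj[OF e1 e2] unfolding eventually_nhds_metric by blast
  have sub: "v \<in> \<Psi> ` S" if v: "v \<in> cball p (\<delta>0 / 2)" for v
  proof -
    have v': "\<alpha> v \<in> ball 1 (1/2)" "\<kappa> v \<in> B" using \<delta>0 v by (auto simp: dist_commute simp del: mem_ball)
    then obtain w where w: "w \<in> ball 0 d \<times> ball 0 d" "\<kappa> v = \<phi> w" unfolding B_def by blast
    have a0: "\<alpha> v \<noteq> 0" using v'(1) by auto
    have E: "D0 * \<alpha> v * \<phi>1 w = det3 p v e2" "D0 * \<alpha> v * \<phi>2 w = det3 p e1 v" "D0 * \<alpha> v = det3 v e1 e2"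
      using w(2) a0 D0 by (auto simp: \<kappa>_def \<phi>_def \<alpha>_def divide_eq_eq mult.commute)
    have "tsmul D0 (\<Psi> (\<alpha> v, w)) = tsmul (D0 * \<alpha> v) p + tsmul (D0 * \<alpha> v * \<phi>1 w) e1 + tsmul (D0 * \<alpha> v * \<phi>2 w) e2"
      by (simp add: \<Psi>_def q_def tsmul_add tsmul_tsmul mult.assoc)
    also have "\<dots> = tsmul D0 v" unfolding E(1,2) unfolding E(3) unfolding D0_def by (rule cramer3[symmetric])
    finally have "tsmul (1 / D0) (tsmul D0 (\<Psi> (\<alpha> v, w))) = tsmul (1 / D0) (tsmul D0 v)" by simp
    then have "\<Psi> (\<alpha> v, w) = v" using D0 by (simp add: tsmul_tsmul)
    moreover have "(\<alpha> v, w) \<in> S" using v'(1) w(1) by (auto simp: S_def Q_def)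
    ultimately show ?thesis by (metis image_eqI)
  qed
  have "(\<integral>\<^sup>+v\<in>cball p (\<delta>0 / 2). ipow (2 * b) (norm (f v)) \<partial>lborel) < \<infinity>"
  proof (rule integrable_transfer[OF b(1) f(1) _ _ Lp lip _ _ c fc])
    have cS: "compact S" unfolding S_def Q_def by (intro compact_Times compact_cball)
    show "S \<in> sets borel" "bounded S" using cS by (auto intro: borel_compact compact_imp_bounded)
    have hc: "continuous_on UNIV h" using h by (auto simp: tame_nf_def)
    show "(\<lambda>s::pt. h (snd s)) \<in> borel_measurable borel"
      by (intro borel_measurable_continuous_onI continuous_on_compose2[OF hc] continuous_intros) auto
    have "S \<subseteq> cball 1 (1/2) \<times> (cball 0 1 \<times> cball 0 1)" using d by (auto simp: S_def Q_def)
    then have "(\<integral>\<^sup>+s\<in>S. ipow (2 * b) (norm (h (snd s))) \<partial>lborel) \<le> (\<integral>\<^sup>+s\<in>cball (1::complex) (1/2) \<times> (cball 0 1 \<times> cball 0 1). ipow (2 * b) (norm (h (snd s))) \<partial>lborel)"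
      by (intro nn_integral_mono) (auto simp: indicator_def)
    then show "(\<integral>\<^sup>+s\<in>S. ipow (2 * b) (norm (h (snd s))) \<partial>lborel) < \<infinity>"
      using integrable_tame_nf[OF h b] by (rule le_less_trans)
    show "cball p (\<delta>0 / 2) \<subseteq> \<Psi> ` S" using sub by blast
  qed auto
  then show ?thesis using \<delta>0(1) by (intro exI[of _ "\<delta>0 / 2"]) auto
qed

lemma integrable_near_nonzero:
  assumes f: "pfun f" and b: "0 \<le> b" and ns: "f p \<noteq> 0"
  shows "\<exists>\<delta>>0. (\<integral>\<^sup>+v\<in>cball p \<delta>. ipow (2 * b) (norm (f v)) \<partial>lborel) < \<infinity>"
proof -
  obtain \<delta> where d: "\<delta> > 0" "\<And>v. dist v p < \<delta> \<Longrightarrow> dist (f v) (f p) < norm (f p) / 2"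
    using pfun_isCont[OF f, of p] ns unfolding continuous_at_eps_delta by (meson half_gt_zero zero_less_norm_iff)
  have n: "norm (f v) \<ge> norm (f p) / 2" if "dist v p < \<delta>" for v
    using d(2)[OF that] norm_triangle_ineq2[of "f p" "f p - f v"] by (simp add: dist_norm norm_minus_commute)
  have "(\<integral>\<^sup>+v\<in>cball p (\<delta> / 2). ipow (2 * b) (norm (f v)) \<partial>lborel) \<le> (\<integral>\<^sup>+v. ipow (2 * b) (norm (f p) / 2) * indicator (cball p (\<delta> / 2)) v \<partial>lborel)"
    using n d(1) b by (intro nn_integral_mono) (auto simp: indicator_def dist_commute intro!: ipow_antimono)
  also have "\<dots> = ipow (2 * b) (norm (f p) / 2) * emeasure lborel (cball p (\<delta> / 2))"
    by (rule nn_integral_cmult_indicator) simp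
  also have "\<dots> < \<infinity>"
    using ns emeasure_lborel_cball_finite[of p "\<delta> / 2"] by (simp add: ennreal_mult_less_top ipow_def)
  finally show ?thesis using d(1) by (intro exI[of _ "\<delta> / 2"]) auto
qed

lemma integrable_sing_compact:
  assumes f: "pfun f" "hom m f" and b: "0 \<le> b" "b < 2 / 3"
    and sings: "\<And>p. sing_point f p \<Longrightarrow> sing_type f p nf_A1 \<or> sing_type f p nf_A5 \<or> sing_type f p nf_D4"
    and K: "compact K" "0 \<notin> K"
  shows "(\<integral>\<^sup>+v\<in>K. ipow (2 * b) (norm (f v)) \<partial>lborel) < \<infinity>"
proof -
  have "\<exists>\<delta>>0. p \<in> K \<longrightarrow> (\<integral>\<^sup>+v\<in>cball p \<delta>. ipow (2 * b) (norm (f v)) \<partial>lborel) < \<infinity>" for p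
  proof (cases "p \<in> K")
    case True
    then have p: "p \<noteq> (0,0,0)" using K(2) by (auto simp: zero_prod_def)
    consider "f p \<noteq> 0" | "\<not> (dX f p = 0 \<and> dY f p = 0 \<and> dZ f p = 0)" | "sing_point f p"
      using p by (auto simp: sing_point_def)
    then show ?thesis
    proof cases
      case 1 then show ?thesis using integrable_near_nonzero[OF f(1) b(1)] by blast
    next
      case 2 then show ?thesis using integrable_near_smooth[OF f(1) b] by blast
    next
      case 3
      then obtain h where "tame_nf h" "sing_type f p h" using sings tame_A1 tame_A5 tame_D4 by blast
      then show ?thesis using integrable_near_sing[OF f b] by blast
    qed
  qed (auto intro: exI[of _ 1])
  then obtain \<delta> where \<delta>: "\<And>p. \<delta> p > 0" "\<And>p. p \<in> K \<Longrightarrow> (\<integral>\<^sup>+v\<in>cball p (\<delta> p). ipow (2 * b) (norm (f v)) \<partial>lborel) < \<infinity>"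
    by metis
  have "K \<subseteq> (\<Union>p\<in>K. ball p (\<delta> p))" using \<delta>(1) by force
  then obtain C where C: "C \<subseteq> K" "finite C" "K \<subseteq> (\<Union>p\<in>C. ball p (\<delta> p))"
    using compactE_image[OF K(1), of K "\<lambda>p. ball p (\<delta> p)"] by auto
  have fm: "f \<in> borel_measurable borel"
    using pfun_continuous[OF f(1)] by (rule borel_measurable_continuous_onI)
  have "(\<integral>\<^sup>+v\<in>K. ipow (2 * b) (norm (f v)) \<partial>lborel) \<le> (\<integral>\<^sup>+v. (\<Sum>p\<in>C. ipow (2 * b) (norm (f v)) * indicator (cball p (\<delta> p)) v) \<partial>lborel)"
  proof (rule nn_integral_mono)
    fix v
    show "ipow (2 * b) (norm (f v)) * indicator K v \<le> (\<Sum>p\<in>C. ipow (2 * b) (norm (f v)) * indicator (cball p (\<delta> p)) v)"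
    proof (cases "v \<in> K")
      case True
      then obtain p where p: "p \<in> C" "v \<in> cball p (\<delta> p)" using C(3) by fastforce
      have "ipow (2 * b) (norm (f v)) * indicator K v = (\<Sum>p\<in>{p}. ipow (2 * b) (norm (f v)) * indicator (cball p (\<delta> p)) v)"
        using True p by simp
      also have "\<dots> \<le> (\<Sum>p\<in>C. ipow (2 * b) (norm (f v)) * indicator (cball p (\<delta> p)) v)"
        using p C(2) by (intro sum_mono2) auto
      finally show ?thesis .
    qed simp
  qed
  also have "\<dots> = (\<Sum>p\<in>C. \<integral>\<^sup>+v\<in>cball p (\<delta> p). ipow (2 * b) (norm (f v)) \<partial>lborel)"
    by (rule nn_integral_sum) (use measurable_ipow_indicator[OF fm] in auto)
  also have "\<dots> < \<infinity>" unfolding infinity_ennreal_def using \<delta>(2) C(1,2) by (subst ennreal_sum_less_top) auto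
  finally show ?thesis .
qed

section \<open>Irreducible components and eigenvalues of syzygies\<close>

text \<open>Points of C^3 stay single variables from here on instead of being split into
  coordinates.\<close>

declare split_paired_All [simp del] split_paired_Ex [simp del]

section \<open>Polynomial functions as elements of the factorial ring C[z][y][x]\<close>

definition ev :: "complex poly poly poly \<Rightarrow> pt \<Rightarrow> complex" where
  "ev P v = poly (poly (poly P [:[:fst v:]:]) [:fst (snd v):]) (snd (snd v))"

lemma ev_mult: "ev (P * Q) v = ev P v * ev Q v" and ev_add: "ev (P + Q) v = ev P v + ev Q v"
  and ev_diff: "ev (P - Q) v = ev P v - ev Q v"
  by (simp_all add: ev_def)

lemma poly_nonzero_at:
  fixes P :: "'a::idom poly" and g :: "complex \<Rightarrow> 'a"
  assumes "P \<noteq> 0" "inj g" shows "\<exists>x. poly P (g x) \<noteq> 0"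
proof (rule ccontr)
  assume "\<not> ?thesis"
  then have "range g \<subseteq> {x. poly P x = 0}" by auto
  then have "finite (range g)" using poly_roots_finite[OF assms(1)] finite_subset by blast
  then show False using assms(2) finite_imageD infinite_UNIV_char_0 by blast
qed

text \<open>One variable after the other is specialized: a nonzero polynomial over a domain has
  finitely many roots, whereas infinitely many constants are available at each level.\<close>

lemma ev_eq_0D: assumes "\<And>v. ev P v = 0" shows "P = 0"
proof (rule ccontr)
  assume "P \<noteq> 0"
  then obtain x where x: "poly P [:[:x:]:] \<noteq> 0"
    using poly_nonzero_at[of P "\<lambda>x. [:[:x:]:]"] by (auto simp: inj_def)
  then obtain y where y: "poly (poly P [:[:x:]:]) [:y:] \<noteq> 0"
    using poly_nonzero_at[of _ "\<lambda>x. [:x:]"] by (metis injI pCons_eq_iff)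
  then obtain z where "poly (poly (poly P [:[:x:]:]) [:y:]) z \<noteq> 0"
    using poly_nonzero_at[of _ "\<lambda>x. x"] by (metis injI)
  then show False using assms[of "(x, y, z)"] by (simp add: ev_def)
qed

lemma ev_inject: "(\<And>v. ev P v = ev Q v) \<Longrightarrow> P = Q"
  using ev_eq_0D[of "P - Q"] by (simp add: ev_diff)

lemma pfun_imp_ev: "pfun f \<Longrightarrow> \<exists>P. f = ev P"
proof (induction rule: pfun.induct)
  case (pfun_const c) show ?case by (rule exI[of _ "[:[:[:c:]:]:]"]) (auto simp: ev_def)
next
  case pfun_X show ?case by (rule exI[of _ "[:0, 1:]"]) (auto simp: ev_def)
next
  case pfun_Y show ?case by (rule exI[of _ "[:[:0, 1:]:]"]) (auto simp: ev_def)
next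
  case pfun_Z show ?case by (rule exI[of _ "[:[:[:0, 1:]:]:]"]) (auto simp: ev_def)
next
  case (pfun_add f g)
  then obtain P Q where "f = ev P" "g = ev Q" by blast
  then show ?case by (intro exI[of _ "P + Q"]) (auto simp: ev_add)
next
  case (pfun_mult f g)
  then obtain P Q where "f = ev P" "g = ev Q" by blast
  then show ?case by (intro exI[of _ "P * Q"]) (auto simp: ev_mult)
qed

lemma pfun_ev: "pfun (ev P)"
proof -
  have "ev P = (\<lambda>v. \<Sum>i\<le>degree P. (\<Sum>j\<le>degree (coeff P i). (\<Sum>k\<le>degree (coeff (coeff P i) j).
      coeff (coeff (coeff P i) j) k * snd (snd v) ^ k) * fst (snd v) ^ j) * fst v ^ i)"
    by (rule ext) (simp add: ev_def poly_altdef[of P] poly_altdef[of "coeff _ _ :: complex poly poly"]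
      poly_altdef[of "coeff _ _ :: complex poly"] poly_sum poly_mult poly_power)
  then show ?thesis by (simp only:) (intro pfun_intros)
qed

text \<open>X is the only prime factor available: as long as the product vanishes at 0, a factor X
  can be removed from p or from q.\<close>

lemma poly_mult_eq_monom:
  fixes p q :: "complex poly"
  assumes "p * q = monom \<kappa> n" "\<kappa> \<noteq> 0" shows "\<exists>i\<le>n. \<exists>\<alpha>. p = monom \<alpha> i"
  using assms(1)
proof (induction n arbitrary: p q)
  case 0
  then have nz: "p \<noteq> 0" "q \<noteq> 0" using assms(2) by auto
  then have "degree p + degree q = 0" using 0 degree_mult_eq[OF nz] by (simp add: monom_0)
  then show ?case using degree_eq_zeroE[of p] by (metis add_is_0 le_refl monom_0)
next
  case (Suc n)
  have X: "monom \<kappa> (Suc n) = [:0, 1:] * monom \<kappa> n" by (simp add: monom_Suc)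
  have "poly p 0 * poly q 0 = 0" using arg_cong[OF Suc.prems, of "\<lambda>r. poly r 0"] by (simp add: poly_monom)
  then consider "[:0, 1:] dvd p" | "[:0, 1:] dvd q"
    using poly_eq_0_iff_dvd[of p 0] poly_eq_0_iff_dvd[of q 0] by auto
  then show ?case
  proof cases
    case 1
    then obtain p' where p': "p = [:0, 1:] * p'" by (elim dvdE)
    then have "[:0, 1:] * (p' * q) = [:0, 1:] * monom \<kappa> n" using Suc.prems X by (simp only: mult.assoc)
    then have "p' * q = monom \<kappa> n" by (subst (asm) mult_left_cancel) auto
    then obtain i \<alpha> where "i \<le> n" "p' = monom \<alpha> i" using Suc.IH by blast
    then show ?thesis using p' by (intro exI[of _ "Suc i"]) (auto simp: monom_Suc)
  next
    case 2
    then obtain q' where q': "q = [:0, 1:] * q'" by (elim dvdE)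
    then have "[:0, 1:] * (p * q') = [:0, 1:] * monom \<kappa> n" using Suc.prems X by (simp only: mult.assoc mult.left_commute)
    then have "p * q' = monom \<kappa> n" by (subst (asm) mult_left_cancel) auto
    then obtain i \<alpha> where "i \<le> n" "p = monom \<alpha> i" using Suc.IH by blast
    then show ?thesis by (intro exI[of _ i]) auto
  qed
qed

lemma pfun_prod_domain:
  assumes "finite I" "\<And>i. i \<in> I \<Longrightarrow> pfun (g i)" "\<And>v. (\<Prod>i\<in>I. g i v) = 0"
  shows "\<exists>i\<in>I. \<forall>v. g i v = 0"
  using assms
proof (induction I rule: finite_induct)
  case (insert i I)
  have "(\<forall>v. g i v = 0) \<or> (\<forall>v. (\<Prod>i\<in>I. g i v) = 0)"
    by (rule pfun_domain) (use insert in \<open>auto intro: pfun_prod\<close>)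
  then show ?case using insert by blast
qed auto

text \<open>The single factor 2 detects the degree, because the powers of 2 are distinct; so the
  restriction to each ray is a monomial of degree i.\<close>

lemma hom_scale2: assumes "pfun a" "\<And>v. a (tsmul 2 v) = 2 ^ i * a v" shows "hom i a"
  unfolding hom_def
proof (intro allI)
  fix t v
  obtain p where p: "\<And>t. a (0 + tsmul t v) = poly p t" using pfun_line[OF assms(1)] by metis
  have "poly (pcompose p [:0, 2:]) t = poly (smult (2 ^ i) p) t" for t
    using assms(2)[of "tsmul t v"] p by (simp add: poly_pcompose tsmul_tsmul mult.commute)
  then have eq: "pcompose p [:0, 2:] = smult (2 ^ i) p" using poly_eq_poly_eq_iff by blast
  have z: "coeff p n = 0" if "n \<noteq> i" for n
  proof -
    have "2 ^ n * coeff p n = 2 ^ i * coeff p n"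
      using arg_cong[OF eq, of "\<lambda>q. coeff q n"] by (simp add: coeff_pcompose_linear)
    moreover have "(2::complex) ^ n \<noteq> 2 ^ i" using that by (metis norm_power norm_numeral power_inject_exp one_less_numeral_iff semiring_norm(76))
    ultimately show ?thesis by simp
  qed
  have "p = monom (coeff p i) i" using z by (intro poly_eqI) auto
  then have "poly p s = coeff p i * s ^ i" for s by (metis poly_monom)
  then have "a (tsmul s v) = coeff p i * s ^ i" for s using p by simp
  from this[of t] this[of 1] show "a (tsmul t v) = t ^ i * a v" by simp
qed

lemma two_power_inject: "(2::complex) ^ n = 2 ^ i \<Longrightarrow> n = i"
  by (metis norm_power norm_numeral power_inject_exp one_less_numeral_iff semiring_norm(76))

lemma hom_unique: assumes "hom i F" "hom j F" "F v \<noteq> 0" shows "i = j"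
  using homD[OF assms(1), of 2 v] homD[OF assms(2), of 2 v] assms(3) two_power_inject by auto

text \<open>On each ray where F is nonzero the product is a monomial, hence so is a, but its degree
  i might depend on the ray. The product over all i <= n of a(2v) - 2^i a(v) therefore vanishes
  identically, and one of its factors must do so for all v.\<close>

lemma hom_factor_aux:
  assumes "pfun a" "pfun b" "pfun F" "hom n F" "F v0 \<noteq> 0" "\<And>v. a v * b v = F v"
  shows "\<exists>i\<le>n. hom i a"
proof -
  have "\<exists>i\<in>{..n}. a (tsmul 2 v) = 2 ^ i * a v" if nz: "F v \<noteq> 0" for v
  proof -
    obtain p q where p: "\<And>t. a (0 + tsmul t v) = poly p t" and q: "\<And>t. b (0 + tsmul t v) = poly q t"
      using pfun_line assms(1,2) by metis
    have "poly (p * q) t = poly (monom (F v) n) t" for t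
      using assms(6)[of "tsmul t v"] homD[OF assms(4), of t v] p q by (simp add: poly_monom mult.commute)
    then have "p * q = monom (F v) n" using poly_eq_poly_eq_iff by blast
    then obtain i \<alpha> where "i \<le> n" "p = monom \<alpha> i" using poly_mult_eq_monom nz by blast
    then show ?thesis using p[of 2] p[of 1] by (intro bexI[of _ i]) (auto simp: poly_monom)
  qed
  then have "F v * (\<Prod>i\<in>{..n}. a (tsmul 2 v) - 2 ^ i * a v) = 0" for v
    by (metis (mono_tags, lifting) finite_atMost mult_eq_0_iff prod_zero right_minus_eq)
  moreover have p2: "pfun (\<lambda>v. a (tsmul 2 v))"
  proof -
    have "(\<lambda>v. a (tsmul 2 v)) = (\<lambda>v. a (0 + tsmul (fst v) (2,0,0) + tsmul (fst (snd v)) (0,2,0) + tsmul (snd (snd v)) (0,0,2)))"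
      by (rule ext, rule arg_cong[where f = a]) (simp add: tsmul_def zero_prod_def mult.commute)
    then show ?thesis by (simp only: pfun_affine[OF assms(1)])
  qed
  ultimately have "(\<forall>v. F v = 0) \<or> (\<forall>v. (\<Prod>i\<in>{..n}. a (tsmul 2 v) - 2 ^ i * a v) = 0)"
    using assms by (intro pfun_domain pfun_prod pfun_intros) 
  then have "\<forall>v. (\<Prod>i\<in>{..n}. a (tsmul 2 v) - 2 ^ i * a v) = 0" using assms(5) by blast
  then have "\<exists>i\<in>{..n}. \<forall>v. a (tsmul 2 v) - 2 ^ i * a v = 0"
    by (intro pfun_prod_domain pfun_diff p2 pfun_mult pfun_const assms(1)) auto
  then obtain i where "i \<le> n" "\<And>v. a (tsmul 2 v) - 2 ^ i * a v = 0" by auto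
  then show ?thesis using hom_scale2[OF assms(1)] by auto
qed

lemma hom_factor:
  assumes "pfun a" "pfun b" "pfun F" "hom n F" "F v0 \<noteq> 0" "\<And>v. a v * b v = F v"
  shows "\<exists>i j. i + j = n \<and> hom i a \<and> hom j b"
proof -
  obtain i where i: "hom i a" using hom_factor_aux[OF assms] by auto
  obtain j where j: "hom j b" using hom_factor_aux[OF assms(2,1,3,4,5)] assms(6) by (auto simp: mult.commute)
  have "hom (i + j) F"
    unfolding hom_def assms(6)[symmetric] homD[OF i] homD[OF j] by (simp add: power_add)
  then have "i + j = n" using hom_unique[OF _ assms(4,5)] by blast
  then show ?thesis using i j by blast
qed

text \<open>The affine line e + t e' contains a zero unless the restriction of b is constant. In
  that case homogeneity gives b(e' + s e) = s^(n+1) times that constant, so e' itself is a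
  zero.\<close>

lemma plane_zero:
  assumes b: "pfun b" "hom (Suc n) b"
  shows "\<exists>s t. (s, t) \<noteq> (0, 0) \<and> b (tsmul s e + tsmul t e') = 0"
proof -
  obtain p where p: "\<And>t. b (e + tsmul t e') = poly p t" using pfun_line[OF b(1)] by metis
  show ?thesis
  proof (cases "\<exists>t. poly p t = 0")
    case True
    then obtain t where "b (tsmul 1 e + tsmul t e') = 0" using p by auto
    then show ?thesis by (intro exI[of _ 1] exI[of _ t]) auto
  next
    case False
    then have "degree p = 0" using alg_closed_imp_poly_has_root[of p] by auto
    then have c: "poly p t = poly p 0" for t by (metis degree_0_id poly_0 poly_const_conv poly_pCons mult_zero_right add.right_neutral degree_eq_zeroE)
    obtain q where q: "\<And>t. b (e' + tsmul t e) = poly q t" using pfun_line[OF b(1)] by metis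
    have "poly q s = s ^ Suc n * poly p 0" if "s \<noteq> 0" for s
    proof -
      have "poly q s = b (tsmul s (e + tsmul (1 / s) e'))"
        using that by (simp add: q[symmetric] tsmul_add tsmul_tsmul add.commute)
      also have "\<dots> = s ^ Suc n * poly p 0" by (simp add: homD[OF b(2)] p c[of "1 / s"] del: power_Suc)
      finally show ?thesis .
    qed
    then have "poly ([:0, 1:] * q) s = poly ([:0, 1:] * monom (poly p 0) (Suc n)) s" for s
      by (cases "s = 0") (auto simp: poly_monom)
    then have "[:0, 1:] * q = [:0, 1:] * monom (poly p 0) (Suc n)" using poly_eq_poly_eq_iff by blast
    then have "q = monom (poly p 0) (Suc n)" by (subst (asm) mult_left_cancel) auto
    then have "b (tsmul 0 e + tsmul 1 e') = 0" using q[of 0] by (simp add: poly_monom)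
    then show ?thesis by (intro exI[of _ 0] exI[of _ 1]) auto
  qed
qed

definition indep2 :: "pt \<Rightarrow> pt \<Rightarrow> bool" where
  "indep2 e e' \<longleftrightarrow> (\<forall>s t. tsmul s e + tsmul t e' = 0 \<longrightarrow> s = 0 \<and> t = 0)"

lemma plane_zero': assumes "pfun b" "hom (Suc n) b" "indep2 e e'"
  obtains s t p where "p = tsmul s e + tsmul t e'" "p \<noteq> 0" "b p = 0"
  using plane_zero[OF assms(1,2), of e e'] assms(3) unfolding indep2_def by metis

lemma kernel_basis: "\<exists>e e'. indep2 e e' \<and> dd f v e = 0 \<and> dd f v e' = 0"
proof -
  consider "dX f v \<noteq> 0" | "dX f v = 0" "dY f v \<noteq> 0" | "dX f v = 0" "dY f v = 0" by blast
  then show ?thesis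
  proof cases
    case 1
    then show ?thesis
      by (intro exI[of _ "(- dY f v, dX f v, 0)"] exI[of _ "(- dZ f v, 0, dX f v)"])
         (auto simp: indep2_def dd_def zero_prod_def)
  next
    case 2
    then show ?thesis
      by (intro exI[of _ "(1, 0, 0)"] exI[of _ "(0, - dZ f v, dY f v)"])
         (auto simp: indep2_def dd_def zero_prod_def)
  next
    case 3
    then show ?thesis
      by (intro exI[of _ "(1, 0, 0)"] exI[of _ "(0, 1, 0)"])
         (auto simp: indep2_def dd_def zero_prod_def)
  qed
qed

lemma smooth_cubicD:
  assumes "smooth_cubic F"
  shows "pfun F" "hom 3 F" "\<exists>v. F v \<noteq> 0" "\<And>p. p \<noteq> 0 \<Longrightarrow> F p = 0 \<Longrightarrow> \<exists>e. dd F p e \<noteq> 0"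
proof -
  show "pfun F" "hom 3 F" using assms hpoly_pfun hpoly_hom unfolding smooth_cubic_def by blast+
  show "\<exists>v. F v \<noteq> 0" using assms unfolding smooth_cubic_def by blast
  fix p assume p: "p \<noteq> 0" "F p = 0"
  then have "\<not> (dX F p = 0 \<and> dY F p = 0 \<and> dZ F p = 0)"
  proof -
    have "\<not> sing_point F p" using assms unfolding smooth_cubic_def by blast
    then show ?thesis using p unfolding sing_point_def by (simp add: zero_prod_def)
  qed
  moreover have "dd F p (1,0,0) = dX F p" "dd F p (0,1,0) = dY F p" "dd F p (0,0,1) = dZ F p"
    by (auto simp: dd_def)
  ultimately show "\<exists>e. dd F p e \<noteq> 0" by metis
qed

text \<open>The line a = 0 and the conic b = 0 meet in the projective plane, and by the product rule
  their intersection point is singular on the cubic.\<close>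

lemma smooth_cubic_no_factor:
  assumes F: "smooth_cubic F" and ab: "pfun a" "pfun b" "\<And>v. a v * b v = F v" "hom (Suc 0) a" "hom 2 b"
  shows False
proof -
  obtain e e' where e: "indep2 e e'" "dd a 0 e = 0" "dd a 0 e' = 0" using kernel_basis by blast
  obtain s t p where p: "p = tsmul s e + tsmul t e'" "p \<noteq> 0" "b p = 0"
    using plane_zero'[OF ab(2) _ e(1), of 1] ab(5) by (metis Suc_1)
  have "a p = 0" using hom_1_linear[OF ab(1,4)] e by (simp add: p(1) dd_lin)
  moreover have "dd F p d = 0" for d
  proof -
    have "F = (\<lambda>v. a v * b v)" using ab(3) by auto
    then show ?thesis using dd_mult[OF ab(1,2), of p d] \<open>a p = 0\<close> p(3) by simp
  qed
  moreover have "F p = 0" using ab(3)[of p] p(3) by simp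
  ultimately show False using smooth_cubicD(4)[OF F p(2)] by blast
qed

lemma smooth_cubic_factor:
  assumes F: "smooth_cubic F" and ab: "pfun a" "pfun b" "\<And>v. a v * b v = F v"
  shows "(\<exists>c. \<forall>v. a v = c) \<or> (\<exists>c. \<forall>v. b v = c)"
proof -
  obtain v0 where "F v0 \<noteq> 0" using smooth_cubicD(3)[OF F] by auto
  from hom_factor[OF ab(1,2) smooth_cubicD(1,2)[OF F] this ab(3)]
  obtain i j where ij: "i + j = 3" "hom i a" "hom j b" by blast
  consider "i = 0" | "j = 0" | "i = 1" "j = 2" | "i = 2" "j = 1" using ij(1) by linarith
  then show ?thesis
  proof cases
    case 1 then show ?thesis using hom_0_const ij ab by metis
  next
    case 2 then show ?thesis using hom_0_const ij ab by metis
  next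
    case 3 then show ?thesis using smooth_cubic_no_factor[OF F ab] ij by auto
  next
    case 4 then show ?thesis using smooth_cubic_no_factor[OF F ab(2,1)] ab(3) ij by (auto simp: mult.commute)
  qed
qed

lemma line_formD:
  assumes "line_form L" shows "pfun L" "hom (Suc 0) L" "\<exists>v. L v \<noteq> 0" "L v = dd L 0 v"
proof -
  show p: "pfun L" using assms hpoly_pfun unfolding line_form_def by blast
  show h: "hom (Suc 0) L" using assms hpoly_hom[of 1 L] unfolding line_form_def by simp
  show "\<exists>v. L v \<noteq> 0" using assms unfolding line_form_def by blast
  show "L v = dd L 0 v" by (rule hom_1_linear[OF p h])
qed

lemma line_form_factor:
  assumes L: "line_form L" and ab: "pfun a" "pfun b" "\<And>v. a v * b v = L v"
  shows "(\<exists>c. \<forall>v. a v = c) \<or> (\<exists>c. \<forall>v. b v = c)"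
proof -
  obtain v0 where "L v0 \<noteq> 0" using line_formD(3)[OF L] by auto
  from hom_factor[OF ab(1,2) line_formD(1,2)[OF L] this ab(3)]
  obtain i j where ij: "i + j = Suc 0" "hom i a" "hom j b" by blast
  then consider "i = 0" | "j = 0" by linarith
  then show ?thesis by cases (use hom_0_const ij ab in metis)+
qed

definition irred_pf :: "(pt \<Rightarrow> complex) \<Rightarrow> bool" where
  "irred_pf F \<longleftrightarrow> pfun F \<and> \<not> (\<exists>c. \<forall>v. F v = c) \<and>
    (\<forall>a b. pfun a \<longrightarrow> pfun b \<longrightarrow> (\<forall>v. a v * b v = F v) \<longrightarrow> (\<exists>c. \<forall>v. a v = c) \<or> (\<exists>c. \<forall>v. b v = c))"

text \<open>The factorization is transported to nested polynomials, where constants are the units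
  and irreducible elements of the factorial ring are prime.\<close>

lemma irred_pf_prime:
  assumes F: "irred_pf F" and AB: "pfun A" "pfun B" "pfun Q" "\<And>v. A v * B v = F v * Q v"
  shows "(\<exists>R. pfun R \<and> (\<forall>v. A v = F v * R v)) \<or> (\<exists>R. pfun R \<and> (\<forall>v. B v = F v * R v))"
proof -
  obtain P where P: "F = ev P" using F pfun_imp_ev unfolding irred_pf_def by blast
  obtain PA PB PQ where PAB: "A = ev PA" "B = ev PB" "Q = ev PQ" using AB pfun_imp_ev by metis
  have const_unit: "a dvd 1" if a: "\<And>v. ev a v = c" and "a \<noteq> 0" for a c
  proof -
    have "a = [:[:[:c:]:]:]" by (rule ev_inject) (subst a, simp add: ev_def)
    moreover from this have "c \<noteq> 0" using that by auto
    ultimately have "a * [:[:[:1 / c:]:]:] = 1" by (simp add: one_pCons)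
    then show ?thesis using dvdI[of 1 a] by metis
  qed
  have nc: "\<not> (\<exists>c. \<forall>v. ev P v = c)" using F P unfolding irred_pf_def by blast
  have "irreducible P"
  proof (rule irreducibleI)
    show "P \<noteq> 0" using nc by (auto simp: ev_def)
    show "\<not> P dvd 1"
    proof
      assume "P dvd 1"
      then obtain q where q: "P * q = 1" by (metis dvdE)
      have "ev P v * ev q v = 1" for v unfolding ev_mult[symmetric] q by (simp add: ev_def)
      then have "\<exists>i\<le>0. hom i (ev P)"
        using hom_factor_aux[of "ev P" "ev q" "\<lambda>_. 1" 0] pfun_ev pfun_const by (auto simp: hom_def)
      then show False using nc hom_0_const[OF pfun_ev] by blast
    qed
    fix a b assume ab: "P = a * b"
    then have "\<And>v. ev a v * ev b v = F v" by (simp add: P ev_mult)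
    then have "(\<exists>c. \<forall>v. ev a v = c) \<or> (\<exists>c. \<forall>v. ev b v = c)"
      using F pfun_ev unfolding irred_pf_def by blast
    moreover have "a \<noteq> 0" "b \<noteq> 0" using \<open>P \<noteq> 0\<close> ab by auto
    ultimately show "a dvd 1 \<or> b dvd 1" using const_unit by metis
  qed
  then have pr: "prime_elem P" by (rule irreducible_imp_prime_elem)
  have "PA * PB = P * PQ" by (rule ev_inject) (use AB(4) P PAB in \<open>simp add: ev_mult\<close>)
  then have "P dvd PA * PB" by simp
  then have "P dvd PA \<or> P dvd PB" using pr prime_elem_dvd_mult_iff by blast
  then show ?thesis
    unfolding P PAB using pfun_ev by (metis dvdE ev_mult)
qed

lemma smooth_cubic_irred: assumes "smooth_cubic F" shows "irred_pf F"
proof -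
  obtain v where v: "F v \<noteq> 0" using smooth_cubicD(3)[OF assms] by auto
  have "F 0 = 0" using smooth_cubicD(2)[OF assms] hom_0[of 2 F] by (simp add: numeral_3_eq_3)
  then have "\<not> (\<exists>c. \<forall>v. F v = c)" using v by metis
  then show ?thesis unfolding irred_pf_def using smooth_cubicD(1)[OF assms] smooth_cubic_factor[OF assms] by blast
qed

lemma line_form_irred: assumes "line_form F" shows "irred_pf F"
proof -
  obtain v where v: "F v \<noteq> 0" using line_formD(3)[OF assms] by auto
  have "F 0 = 0" using line_formD(2)[OF assms] hom_0[of 0 F] by simp
  then have "\<not> (\<exists>c. \<forall>v. F v = c)" using v by metis
  then show ?thesis unfolding irred_pf_def using line_formD(1)[OF assms] line_form_factor[OF assms] by blast
qed

definition component :: "(pt \<Rightarrow> complex) \<Rightarrow> bool" where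
  "component F \<longleftrightarrow> smooth_cubic F \<or> line_form F"

lemma component_irred: "component F \<Longrightarrow> irred_pf F"
  using smooth_cubic_irred line_form_irred unfolding component_def by blast

text \<open>The cofactor of two irreducible polynomials, one dividing the other, is a nonzero
  constant. Used contrapositively: components with different zero sets do not divide each
  other.\<close>

lemma component_not_dvd:
  assumes "component F" "component H" "pfun R" "\<And>v. H v = F v * R v" shows "zero_set H = zero_set F"
proof -
  have F: "irred_pf F" and H: "irred_pf H" using assms component_irred by auto
  have "\<not> (\<exists>c. \<forall>v. F v = c)" "pfun F" using F unfolding irred_pf_def by blast+
  then obtain c where c: "\<And>v. R v = c"
    using H assms(3,4) unfolding irred_pf_def by metis
  have "c \<noteq> 0" using H assms(4) c unfolding irred_pf_def by (metis mult_zero_right)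
  then show ?thesis using assms(4) c by (auto simp: zero_set_def)
qed

text \<open>Writing the product as G_j H, the product rule gives \<theta>(G_j) H = - G_j
  \<theta>(H). The prime G_j does not divide H, so it divides \<theta>(G_j).\<close>

lemma syzygy_component:
  fixes G :: "nat \<Rightarrow> pt \<Rightarrow> complex"
  assumes I: "finite I" "j \<in> I" and G: "\<And>i. i \<in> I \<Longrightarrow> component (G i)"
    and dist: "\<And>i. i \<in> I \<Longrightarrow> i \<noteq> j \<Longrightarrow> zero_set (G i) \<noteq> zero_set (G j)"
    and \<theta>: "pfun a" "pfun b" "pfun c" "\<And>v. dd (\<lambda>v. \<Prod>i\<in>I. G i v) v (a v, b v, c v) = 0"
  shows "\<exists>r. pfun r \<and> (\<forall>v. dd (G j) v (a v, b v, c v) = r v * G j v)"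
proof -
  have pG: "pfun (G i)" if "i \<in> I" for i using component_irred[OF G[OF that]] unfolding irred_pf_def by blast
  define H where "H v = (\<Prod>i\<in>I - {j}. G i v)" for v
  have pH: "pfun H" unfolding H_def using pG by (intro pfun_prod) auto
  have f: "(\<lambda>v. \<Prod>i\<in>I. G i v) = (\<lambda>v. G j v * H v)" using I by (auto simp: H_def prod.remove)
  have "dd (G j) v (a v, b v, c v) * H v = G j v * (- dd H v (a v, b v, c v))" for v
    using \<theta>(4)[of v] unfolding f dd_mult[OF pG[OF I(2)] pH] by (simp add: algebra_simps eq_neg_iff_add_eq_0)
  then have "(\<exists>R. pfun R \<and> (\<forall>v. dd (G j) v (a v, b v, c v) = G j v * R v)) \<or> (\<exists>R. pfun R \<and> (\<forall>v. H v = G j v * R v))"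
    using irred_pf_prime[OF component_irred[OF G[OF I(2)]] dd_pfun[OF pG[OF I(2)] \<theta>(1-3)] pH pfun_uminus[OF dd_pfun[OF pH \<theta>(1-3)]]] by blast
  \<comment> \<open>By primality, divisibility of a product of other components by G_j is pushed
    down to a single factor, where it contradicts distinctness.\<close>
  moreover have "\<not> (\<exists>R. pfun R \<and> (\<forall>v. (\<Prod>i\<in>K. G i v) = G j v * R v))" if "finite K" "K \<subseteq> I - {j}" for K
    using that
  proof (induction K rule: finite_induct)
    case empty
    show ?case
    proof
      assume "\<exists>R. pfun R \<and> (\<forall>v. (\<Prod>i\<in>{}. G i v) = G j v * R v)"
      then obtain R where R: "pfun R" "\<And>v. G j v * R v = 1" by auto
      have "\<exists>i\<le>0. hom i (G j)"
        using hom_factor_aux[of "G j" R "\<lambda>_. 1" 0] pG[OF I(2)] R pfun_const by (auto simp: hom_def)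
      then show False using hom_0_const[OF pG[OF I(2)]] component_irred[OF G[OF I(2)]] unfolding irred_pf_def by blast
    qed
  next
    case (insert i K)
    show ?case
    proof
      assume "\<exists>R. pfun R \<and> (\<forall>v. (\<Prod>i\<in>insert i K. G i v) = G j v * R v)"
      then obtain R where R: "pfun R" "\<And>v. G i v * (\<Prod>i\<in>K. G i v) = G j v * R v" using insert by auto
      have iI: "i \<in> I" "i \<noteq> j" and KI: "K \<subseteq> I - {j}" using insert by auto
      have pK: "pfun (\<lambda>v. \<Prod>i\<in>K. G i v)" using KI pG by (intro pfun_prod) auto
      have "(\<exists>R. pfun R \<and> (\<forall>v. G i v = G j v * R v)) \<or> (\<exists>R. pfun R \<and> (\<forall>v. (\<Prod>i\<in>K. G i v) = G j v * R v))"
        by (rule irred_pf_prime[OF component_irred[OF G[OF I(2)]] pG[OF iI(1)] pK R])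
      then have "\<exists>R. pfun R \<and> (\<forall>v. G i v = G j v * R v)" using insert.IH KI by blast
      then show False using component_not_dvd[OF G[OF I(2)] G[OF iI(1)]] dist[OF iI] by blast
    qed
  qed
  ultimately show ?thesis using I(1) unfolding H_def by (metis finite_Diff mult.commute order_refl)
qed

section \<open>Linear fields annihilating a smooth cubic\<close>

text \<open>By Euler's identity the gradient of a smooth cubic is nonzero also off the curve. This
  version mentions neither coefficients nor the curve, and is easily checked after a linear change
  of coordinates.\<close>

definition smc :: "(pt \<Rightarrow> complex) \<Rightarrow> bool" where
  "smc F \<longleftrightarrow> pfun F \<and> hom 3 F \<and> (\<forall>p. p \<noteq> 0 \<longrightarrow> (\<exists>e. dd F p e \<noteq> 0))"

lemma smooth_cubic_smc: assumes "smooth_cubic F" shows "smc F"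
proof -
  have "\<exists>e. dd F p e \<noteq> 0" if "p \<noteq> 0" for p
  proof (cases "F p = 0")
    case False
    then have "dd F p p \<noteq> 0" using euler[OF smooth_cubicD(1,2)[OF assms], of p] by simp
    then show ?thesis by blast
  qed (use smooth_cubicD(4)[OF assms that] in blast)
  then show ?thesis using smooth_cubicD[OF assms] by (auto simp: smc_def)
qed

lemma smcD: assumes "smc F" shows "pfun F" "hom 3 F" "hom (Suc 2) F" "p \<noteq> 0 \<Longrightarrow> \<exists>e. dd F p e \<noteq> 0"
  using assms by (auto simp: smc_def numeral_3_eq_3)

lemma dd_combine:
  assumes "\<And>v. f v = \<alpha> * g v + \<beta> * k v" "pfun g" "pfun k"
  shows "dd f v d = \<alpha> * dd g v d + \<beta> * dd k v d"
proof -
  have "f = (\<lambda>v. \<alpha> * g v + \<beta> * k v)" using assms(1) by auto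
  then show ?thesis
    by (simp only:) (simp add: dd_add dd_mult dd_const pfun_mult pfun_const assms)
qed

text \<open>Euler's identity is differentiated once more; the diagonal u -> dF(u)u contributes an
  extra dF(v)w from its second argument.\<close>

lemma hess_euler:
  assumes "pfun F" "hom (Suc n) F"
  shows "dd (\<lambda>u. dd F u v) v w = of_nat n * dd F v w"
proof -
  have "dd (\<lambda>u. dd F u u) v w = dd (\<lambda>u. dd F u v) v w + dd F v w"
  proof -
    have "dd (\<lambda>u. dX F u * fst u + dY F u * fst (snd u) + dZ F u * snd (snd u)) v w
      = dd (\<lambda>u. dX F u * fst v + dY F u * fst (snd v) + dZ F u * snd (snd v)) v w + dd F v w"
    proof -
      have c: "dd (\<lambda>v. fst v) v w = fst w" "dd (\<lambda>v. fst (snd v)) v w = fst (snd w)" "dd (\<lambda>v. snd (snd v)) v w = snd (snd w)"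
        using dd_eqI[of "\<lambda>v::pt. fst v" 1 0 0 v w] dd_eqI[of "\<lambda>v::pt. fst (snd v)" 0 1 0 v w] dd_eqI[of "\<lambda>v::pt. snd (snd v)" 0 0 1 v w]
        by (simp_all add: has_derivative_fst has_derivative_snd)
      show ?thesis
        using pfun_partials[OF assms(1)]
        by (simp add: dd_add dd_mult dd_const pfun_intros c) (simp add: dd_def[of F])
    qed
    then show ?thesis by (simp add: dd_def[of F, abs_def])
  qed
  moreover have "dd (\<lambda>u. dd F u u) v w = of_nat (Suc n) * dd F v w + 0 * dd F v w"
    by (rule dd_combine) (use euler[OF assms] assms in auto)
  ultimately show ?thesis by (simp add: algebra_simps)
qed

text \<open>F would be invariant under translation by u, so its gradient at u would equal the one at
  0, which vanishes.\<close>

lemma smc_not_cone: assumes F: "smc F" and u: "u \<noteq> 0" "\<And>v. dd F v u = 0" shows False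
proof -
  have const: "F (v + tsmul t u) = F v" for v t
  proof -
    have "((\<lambda>t. F (v + tsmul t u)) has_field_derivative 0) (at t)" for t
      using pfun_line_deriv[OF smcD(1)[OF F], of v u t] u(2) by simp
    then obtain c where "\<And>t. F (v + tsmul t u) = c"
      using has_field_derivative_zero_constant[OF convex_UNIV, of "\<lambda>t. F (v + tsmul t u)"] by auto
    from this[of t] this[of 0] show ?thesis by simp
  qed
  have "dd F u e = 0" for e
  proof -
    have "((\<lambda>s. F (u + tsmul s e)) has_field_derivative dd F (u + tsmul 0 e) e) (at 0)"
      "((\<lambda>s. F (0 + tsmul s e)) has_field_derivative dd F (0 + tsmul 0 e) e) (at 0)"
      by (rule pfun_line_deriv[OF smcD(1)[OF F]])+
    moreover have "F (u + tsmul s e) = F (0 + tsmul s e)" for s using const[of "tsmul s e" 1] by (simp add: add.commute)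
    ultimately have "dd F u e = dd F 0 e" by simp (rule DERIV_unique)
    moreover have "dd F 0 e = 0"
      using hom_0[of 1 "\<lambda>v. dd F v e"] hom_dd[OF smcD(1,3)[OF F], of e] by (simp add: numeral_2_eq_2)
    ultimately show ?thesis by simp
  qed
  then show False using smcD(4)[OF F u(1)] by blast
qed

lemma basis_expansion: assumes "det3 a b c \<noteq> 0" shows "\<exists>\<alpha> \<beta> \<gamma>. e = tsmul \<alpha> a + tsmul \<beta> b + tsmul \<gamma> c"
proof -
  obtain a1 a2 a3 b1 b2 b3 c1 c2 c3 e1 e2 e3 where c: "a = (a1,a2,a3)" "b = (b1,b2,b3)" "c = (c1,c2,c3)" "e = (e1,e2,e3)" by (cases a, cases b, cases c, cases e)
  have "tsmul (det3 a b c) e = tsmul (det3 e b c) a + tsmul (det3 a e c) b + tsmul (det3 a b e) c"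
    unfolding c by (simp add: det3_def algebra_simps)
  then have "tsmul (1 / det3 a b c) (tsmul (det3 a b c) e) = tsmul (1 / det3 a b c) (tsmul (det3 e b c) a + tsmul (det3 a e c) b + tsmul (det3 a b e) c)" by simp
  then have "e = tsmul (det3 e b c / det3 a b c) a + tsmul (det3 a e c / det3 a b c) b + tsmul (det3 a b e / det3 a b c) c"
    using assms by (simp add: tsmul_tsmul tsmul_add)
  then show ?thesis by blast
qed

lemma indep2_complement: assumes "indep2 u1 u2" shows "\<exists>u3. det3 u1 u2 u3 \<noteq> 0"
proof (rule ccontr)
  assume "\<not> ?thesis"
  then have z: "det3 u1 u2 u3 = 0" for u3 by simp
  obtain a1 a2 a3 b1 b2 b3 where c: "u1 = (a1,a2,a3)" "u2 = (b1,b2,b3)" by (cases u1, cases u2)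
  have e: "a2 * b3 = a3 * b2" "a1 * b3 = a3 * b1" "a1 * b2 = a2 * b1"
    using z[of "(1,0,0)"] z[of "(0,1,0)"] z[of "(0,0,1)"] by (auto simp: c det3_def)
  have ind: "s = 0 \<and> t = 0" if "s * a1 + t * b1 = 0" "s * a2 + t * b2 = 0" "s * a3 + t * b3 = 0" for s t
  proof -
    have "tsmul s u1 + tsmul t u2 = 0" using that by (simp add: c zero_prod_def)
    then show ?thesis using assms unfolding indep2_def by blast
  qed
  have "b1 = 0" "b2 = 0" "b3 = 0" using ind[of b1 "- a1"] ind[of b2 "- a2"] ind[of b3 "- a3"] e by (auto simp: algebra_simps)
  then show False using ind[of 0 1] by auto
qed

lemma linear_irred: assumes L: "pfun L" "hom (Suc 0) L" "L v0 \<noteq> 0" shows "irred_pf L"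
  unfolding irred_pf_def
proof (intro conjI allI impI)
  show "\<not> (\<exists>c. \<forall>v. L v = c)" using L(3) hom_0[OF L(2)] by metis
  fix a b assume ab: "pfun a" "pfun b" "\<forall>v. a v * b v = L v"
  from hom_factor[OF ab(1,2) L] ab(3)
  obtain i j where ij: "i + j = Suc 0" "hom i a" "hom j b" by blast
  then consider "i = 0" | "j = 0" by linarith
  then show "(\<exists>c. \<forall>v. a v = c) \<or> (\<exists>c. \<forall>v. b v = c)" by cases (use hom_0_const ij ab in metis)+
qed (use L in auto)

text \<open>The linear form a is prime and divides b or the derivative F_u2. If b = k a, then F_u1 +
  k F_u2 = 0 and F is a cone. If F_u2 = a R, then F_u1 = - b R with R linear, and all derivatives of
  F vanish where the line R = 0 meets the conic F_u3 = 0.\<close>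

lemma two_term_syzygy:
  assumes F: "smc F" and ab: "pfun a" "pfun b" "hom (Suc 0) a" "hom (Suc 0) b" and u: "indep2 u1 u2"
    and eq: "\<And>v. a v * dd F v u1 + b v * dd F v u2 = 0"
  shows "a v = 0 \<and> b v = 0"
proof -
  have pd: "pfun (\<lambda>v. dd F v u)" for u by (rule pfun_dd_dir[OF smcD(1)[OF F]])
  have hd: "hom 2 (\<lambda>v. dd F v u)" for u by (rule hom_dd[OF smcD(1,3)[OF F]])
  have unz: "tsmul s u1 + tsmul t u2 \<noteq> 0" if "s \<noteq> 0 \<or> t \<noteq> 0" for s t using u that by (auto simp: indep2_def)
  have nc: "\<not> (\<forall>v. s * dd F v u1 + t * dd F v u2 = 0)" if "s \<noteq> 0 \<or> t \<noteq> 0" for s t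
    using smc_not_cone[OF F unz[OF that]] by (auto simp: dd_lin)
  have nc1: "\<not> (\<forall>v. dd F v u1 = 0)" "\<not> (\<forall>v. dd F v u2 = 0)" using nc[of 1 0] nc[of 0 1] by auto
  have z: "(\<forall>v. a v = 0) \<longleftrightarrow> (\<forall>v. b v = 0)"
    using pfun_domain[OF ab(1) pd[of u1]] pfun_domain[OF ab(2) pd[of u2]] eq nc1 by force
  show ?thesis
  proof (rule ccontr)
    assume "\<not> ?thesis"
    then obtain v0 v1 where v0: "a v0 \<noteq> 0" and v1: "b v1 \<noteq> 0" using z by blast
    have pr: "irred_pf a" by (rule linear_irred[OF ab(1,3) v0])
    have e: "b v * dd F v u2 = a v * (- dd F v u1)" for v using eq[of v] by (simp add: eq_neg_iff_add_eq_0 add.commute)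
    from irred_pf_prime[OF pr ab(2) pd pfun_uminus[OF pd] e]
    consider R where "pfun R" "\<And>v. b v = a v * R v" | R where "pfun R" "\<And>v. dd F v u2 = a v * R v" by blast
    then show False
    proof cases
      case (1 R)
      from hom_factor[OF ab(1) 1(1) ab(2,4) v1] 1(2) obtain i j where ij: "i + j = Suc 0" "hom i a" "hom j R" by metis
      have "i = Suc 0" using hom_unique[OF ij(2) ab(3) v0] .
      then have "hom 0 R" using ij by simp
      then obtain k where k: "\<And>v. R v = k" using hom_0_const[OF 1(1)] by blast
      have "a v * (1 * dd F v u1 + k * dd F v u2) = 0" for v using eq[of v] 1(2)[of v] k by (simp add: algebra_simps)
      then have "\<forall>v. 1 * dd F v u1 + k * dd F v u2 = 0"
        using pfun_domain[OF ab(1) pfun_add[OF pfun_mult[OF pfun_const[of 1] pd[of u1]] pfun_mult[OF pfun_const[of k] pd[of u2]]]] v0 by blast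
      then show False using nc[of 1 k] by simp
    next
      case (2 R)
      obtain w where w: "dd F w u2 \<noteq> 0" using nc1 by blast
      have "\<exists>i j. i + j = 2 \<and> hom i a \<and> hom j R"
        by (rule hom_factor[OF ab(1) 2(1) pd hd w]) (use 2(2) in simp)
      then obtain i j where ij: "i + j = 2" "hom i a" "hom j R" by blast
      have "i = Suc 0" using hom_unique[OF ij(2) ab(3) v0] .
      then have R1: "hom (Suc 0) R" using ij by simp
      have e2: "dd F v u1 = - b v * R v" for v
      proof -
        have "dd F v u1 = - b v * R v" if "a v \<noteq> 0" for v
        proof -
          have "a v * (dd F v u1 + b v * R v) = 0" using eq[of v] 2(2)[of v] by (simp add: algebra_simps)
          then show ?thesis using that by (simp add: eq_neg_iff_add_eq_0)
        qed
        moreover have "pfun (\<lambda>v. - b v * R v)" by (intro pfun_mult pfun_uminus ab 2(1))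
        ultimately show ?thesis using pfun_eqI_mult[OF pd _ ab(1) v0] by blast
      qed
      obtain u3 where u3: "det3 u1 u2 u3 \<noteq> 0" using indep2_complement[OF u] by blast
      obtain k k' where kb: "indep2 k k'" "dd R 0 k = 0" "dd R 0 k' = 0" using kernel_basis by blast
      obtain s t p where p: "p = tsmul s k + tsmul t k'" "p \<noteq> 0" "dd F p u3 = 0"
        using plane_zero'[OF pd[of u3] _ kb(1), of 1] hd[of u3] by (metis Suc_1)
      have Rp: "R p = 0" using hom_1_linear[OF 2(1) R1] kb by (simp add: p(1) dd_lin)
      have "dd F p e = 0" for e
      proof -
        obtain \<alpha> \<beta> \<gamma> where "e = tsmul \<alpha> u1 + tsmul \<beta> u2 + tsmul \<gamma> u3" using basis_expansion[OF u3] by blast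
        then show ?thesis using 2(2)[of p] e2[of p] Rp p(3) by (simp add: dd_lin)
      qed
      then show False using smcD(4)[OF F p(2)] by blast
    qed
  qed
qed

lemma det3_kernel: assumes "det3 r1 r2 r3 = 0"
  shows "\<exists>p q s. (p, q, s) \<noteq> (0, 0, 0) \<and> tsmul p r1 + tsmul q r2 + tsmul s r3 = 0"
proof (cases "indep2 r1 r2")
  case True
  then obtain u3 where u3: "det3 r1 r2 u3 \<noteq> 0" using indep2_complement by blast
  obtain \<alpha> \<beta> \<gamma> where e: "r3 = tsmul \<alpha> r1 + tsmul \<beta> r2 + tsmul \<gamma> u3" using basis_expansion[OF u3] by blast
  have "det3 r1 r2 r3 = \<gamma> * det3 r1 r2 u3" unfolding e
    by (cases r1; cases r2; cases u3; simp add: det3_def algebra_simps)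
  then have "\<gamma> = 0" using assms u3 by simp
  then have "tsmul (- \<alpha>) r1 + tsmul (- \<beta>) r2 + tsmul 1 r3 = 0" using e by (simp add: tsmul_def prod_eq_iff)
  then show ?thesis by (intro exI[of _ "- \<alpha>"] exI[of _ "- \<beta>"] exI[of _ 1]) auto
next
  case False
  then obtain s t where "tsmul s r1 + tsmul t r2 = 0" "\<not> (s = 0 \<and> t = 0)" unfolding indep2_def by blast
  then show ?thesis by (intro exI[of _ s] exI[of _ t] exI[of _ 0]) auto
qed

text \<open>If \<open>A v = l v\<close>, differentiating \<open>dF(A v) = 0\<close> at \<open>v\<close> shows that the gradient of \<open>F\<close> at \<open>v\<close> is an eigenvector of the
  transpose of \<open>A\<close> with eigenvalue \<open>-2l\<close>. So \<open>l \<mapsto> -2l\<close> acts on the finite spectrum, and \<open>A\<close> has a kernel.\<close>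
lemma linear_syzygy:
  assumes F: "smc F" and p: "pfun a" "pfun b" "pfun c" and h: "hom (Suc 0) a" "hom (Suc 0) b" "hom (Suc 0) c"
    and syz: "\<And>v. dd F v (a v, b v, c v) = 0"
  shows "a v = 0 \<and> b v = 0 \<and> c v = 0"
proof -
  define A where "A v = (a v, b v, c v)" for v
  have lin: "a v = dd a 0 v" "b v = dd b 0 v" "c v = dd c 0 v" for v
    using hom_1_linear p h by blast+
  have ddl: "dd a v w = a w" "dd b v w = b w" "dd c v w = c w" for v w
    using lin hom_0_const[OF pfun_dd_dir[OF p(1)] hom_dd[OF p(1) h(1)]] hom_0_const[OF pfun_dd_dir[OF p(2)] hom_dd[OF p(2) h(2)]]
      hom_0_const[OF pfun_dd_dir[OF p(3)] hom_dd[OF p(3) h(3)]] by metis+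
  \<comment> \<open>The factor 2 is the degree of the gradient: Euler's identity turns the second
    derivative in direction v at v into 2 dF(v).\<close>
  have eig: "dd F v (A w) = - 2 * l * dd F v w" if "A v = tsmul l v" for v l w
  proof -
    have "dd (\<lambda>u. dX F u * a u + dY F u * b u + dZ F u * c u) v w
      = dd (\<lambda>u. dX F u * a v + dY F u * b v + dZ F u * c v) v w + dd F v (A w)"
      using pfun_partials[OF smcD(1)[OF F]] p
      by (simp add: dd_add dd_mult dd_const pfun_intros ddl) (simp add: dd_def[of F] A_def)
    moreover have "dX F u * a u + dY F u * b u + dZ F u * c u = 0" for u using syz[of u] by (simp add: dd_def)
    moreover have "dd (\<lambda>u. dX F u * a v + dY F u * b v + dZ F u * c v) v w = l * dd (\<lambda>u. dd F u v) v w + 0 * dd F v w"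
      by (rule dd_combine) (use that pfun_dd_dir[OF smcD(1)[OF F]] smcD(1)[OF F] in \<open>auto simp: A_def dd_def tsmul_def prod_eq_iff algebra_simps\<close>)
    ultimately have "l * dd (\<lambda>u. dd F u v) v w + dd F v (A w) = 0" by (simp add: dd_const)
    then show ?thesis using hess_euler[OF smcD(1,3)[OF F], of v w] by (simp add: eq_neg_iff_add_eq_0 algebra_simps)
  qed
  let ?e1 = "(1,0,0)::pt" and ?e2 = "(0,1,0)::pt" and ?e3 = "(0,0,1)::pt"
  have coord: "a (x,y,z) = x * a ?e1 + y * a ?e2 + z * a ?e3" "b (x,y,z) = x * b ?e1 + y * b ?e2 + z * b ?e3" "c (x,y,z) = x * c ?e1 + y * c ?e2 + z * c ?e3" for x y z
    using lin(1)[of "(x,y,z)"] lin(1)[of ?e1] lin(1)[of ?e2] lin(1)[of ?e3] lin(2)[of "(x,y,z)"] lin(2)[of ?e1] lin(2)[of ?e2] lin(2)[of ?e3]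
      lin(3)[of "(x,y,z)"] lin(3)[of ?e1] lin(3)[of ?e2] lin(3)[of ?e3] by (simp_all add: dd_def)
  define chi where "chi t = det3 (A ?e1 - tsmul t ?e1) (A ?e2 - tsmul t ?e2) (A ?e3 - tsmul t ?e3)" for t
  define tr where "tr = a ?e1 + b ?e2 + c ?e3"
  define m2 where "m2 = a ?e1 * b ?e2 - a ?e2 * b ?e1 + a ?e1 * c ?e3 - a ?e3 * c ?e1 + b ?e2 * c ?e3 - b ?e3 * c ?e2"
  define P where "P = [:det3 (A ?e1) (A ?e2) (A ?e3), - m2, tr, -1:]"
  have chiP: "chi t = poly P t" for t
    by (simp add: chi_def P_def A_def det3_def tr_def m2_def algebra_simps)
  have P0: "P \<noteq> 0" by (simp add: P_def)
  have degP: "degree P > 0" by (simp add: P_def)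
  have vec: "\<exists>v. v \<noteq> 0 \<and> A v = tsmul t v" if ch: "chi t = 0" for t
  proof -
    obtain p q s where s: "(p, q, s) \<noteq> (0,0,0)" "tsmul p (A ?e1 - tsmul t ?e1) + tsmul q (A ?e2 - tsmul t ?e2) + tsmul s (A ?e3 - tsmul t ?e3) = 0"
      using det3_kernel[OF ch[unfolded chi_def]] by metis
    have "A (p,q,s) = tsmul t (p,q,s)"
    proof -
      have z: "p * (a ?e1 - t) + q * a ?e2 + s * a ?e3 = 0" "p * b ?e1 + q * (b ?e2 - t) + s * b ?e3 = 0"
        "p * c ?e1 + q * c ?e2 + s * (c ?e3 - t) = 0"
        using s(2) by (simp_all add: A_def zero_prod_def)
      have "a (p,q,s) = (p * (a ?e1 - t) + q * a ?e2 + s * a ?e3) + t * p" unfolding coord[of p q s] by (simp add: algebra_simps)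
      moreover have "b (p,q,s) = (p * b ?e1 + q * (b ?e2 - t) + s * b ?e3) + t * q" unfolding coord[of p q s] by (simp add: algebra_simps)
      moreover have "c (p,q,s) = (p * c ?e1 + q * c ?e2 + s * (c ?e3 - t)) + t * s" unfolding coord[of p q s] by (simp add: algebra_simps)
      ultimately show ?thesis unfolding z A_def by simp
    qed
    then show ?thesis using s(1) by (intro exI[of _ "(p, q, s)"]) (auto simp: zero_prod_def)
  qed
  \<comment> \<open>If -2l were not an eigenvalue, the image of A + 2l would be all of C^3, and
    dF(v), which vanishes on that image, would be 0.\<close>
  have step: "chi (- 2 * l) = 0" if ch: "chi l = 0" for l
  proof (rule ccontr)
    assume n: "chi (- 2 * l) \<noteq> 0"
    obtain v where v: "v \<noteq> 0" "A v = tsmul l v" using vec[OF ch] by blast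
    have z: "dd F v (A w - tsmul (- 2 * l) w) = 0" for w using eig[OF v(2), of w] by (simp add: dd_lin)
    have "dd F v e = 0" for e
    proof -
      obtain \<alpha> \<beta> \<gamma> where "e = tsmul \<alpha> (A ?e1 - tsmul (- 2 * l) ?e1) + tsmul \<beta> (A ?e2 - tsmul (- 2 * l) ?e2) + tsmul \<gamma> (A ?e3 - tsmul (- 2 * l) ?e3)"
        using basis_expansion n unfolding chi_def by blast
      then show ?thesis by (simp only: dd_lin(1) dd_lin(2)[of F v \<alpha>] dd_lin(2)[of F v \<beta>] dd_lin(2)[of F v \<gamma>] z) simp
    qed
    then show False using smcD(4)[OF F v(1)] by blast
  qed
  \<comment> \<open>A nonzero eigenvalue would have an infinite orbit under multiplication by -2
    inside the root set of a cubic polynomial.\<close>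
  have nz: "l = 0" if "chi l = 0" for l
  proof (rule ccontr)
    assume l: "l \<noteq> 0"
    have "chi ((- 2) ^ n * l) = 0" for n
      by (induction n) (use step that in \<open>auto simp: mult.assoc\<close>)
    then have "range (\<lambda>n. (- 2) ^ n * l) \<subseteq> {t. poly P t = 0}" using chiP by auto
    moreover have "inj (\<lambda>n. (- 2) ^ n * l)"
    proof (rule injI)
      fix m n :: nat assume "(- 2) ^ m * l = (- 2) ^ n * l"
      then have "norm ((- 2 :: complex) ^ m) = norm ((- 2 :: complex) ^ n)" using l by simp
      then show "m = n" by (simp add: norm_power)
    qed
    ultimately show False using poly_roots_finite[OF P0] range_inj_infinite finite_subset by metis
  qed
  obtain l where "chi l = 0" using Fundamental_Theorem_Algebra.fundamental_theorem_of_algebra_alt chiP degP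
    by (metis alg_closed_imp_poly_has_root)
  then have "chi 0 = 0" using nz by metis
  then have d0: "det3 (A ?e1) (A ?e2) (A ?e3) = 0" by (simp add: chi_def del: tsmul_simps)
  \<comment> \<open>Passing to the transpose turns singularity of A into a linear relation among the
    forms a, b, c.\<close>
  have "det3 (a ?e1, a ?e2, a ?e3) (b ?e1, b ?e2, b ?e3) (c ?e1, c ?e2, c ?e3) = det3 (A ?e1) (A ?e2) (A ?e3)"
    by (simp add: det3_def A_def algebra_simps)
  then obtain p1 q1 s1 where k: "(p1,q1,s1) \<noteq> (0,0,0)" "tsmul p1 (a ?e1, a ?e2, a ?e3) + tsmul q1 (b ?e1, b ?e2, b ?e3) + tsmul s1 (c ?e1, c ?e2, c ?e3) = 0"
    using det3_kernel d0 by metis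
  have dep: "p1 * a v + q1 * b v + s1 * c v = 0" for v
  proof -
    obtain x y z where v: "v = (x,y,z)" by (cases v)
    have "p1 * a v + q1 * b v + s1 * c v = x * (p1 * a ?e1 + q1 * b ?e1 + s1 * c ?e1) + y * (p1 * a ?e2 + q1 * b ?e2 + s1 * c ?e2) + z * (p1 * a ?e3 + q1 * b ?e3 + s1 * c ?e3)"
      unfolding v coord[of x y z] by (simp add: algebra_simps)
    then show ?thesis using k(2) by (simp add: zero_prod_def)
  qed
  have syz': "a v * dX F v + b v * dY F v + c v * dZ F v = 0" for v using syz[of v] by (simp add: dd_def algebra_simps)
  \<comment> \<open>The relation eliminates one component, which leaves a two-term relation between
    derivatives of F in two independent directions.\<close>
  consider "s1 \<noteq> 0" | "q1 \<noteq> 0" | "p1 \<noteq> 0" using k(1) by auto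
  then show ?thesis
  proof cases
    case 1
    have c: "c v = - (p1 / s1) * a v - (q1 / s1) * b v" for v
    proof -
      have "s1 * c v = - p1 * a v - q1 * b v" using dep[of v] by algebra
      then have "(s1 * c v) / s1 = (- p1 * a v - q1 * b v) / s1" by simp
      then show ?thesis using 1 by (simp add: diff_divide_distrib)
    qed
    have e: "a v * dd F v (1, 0, - (p1 / s1)) + b v * dd F v (0, 1, - (q1 / s1)) = 0" for v
      using syz'[of v] unfolding c[of v] by (simp add: dd_def algebra_simps)
    have "indep2 (1, 0, - (p1 / s1)) (0, 1, - (q1 / s1))" by (auto simp: indep2_def zero_prod_def)
    from two_term_syzygy[OF F p(1,2) h(1,2) this e]
    have "a v = 0 \<and> b v = 0" .
    then show ?thesis using c[of v] by simp
  next
    case 2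
    have c: "b v = - (p1 / q1) * a v - (s1 / q1) * c v" for v
    proof -
      have "q1 * b v = - p1 * a v - s1 * c v" using dep[of v] by algebra
      then have "(q1 * b v) / q1 = (- p1 * a v - s1 * c v) / q1" by simp
      then show ?thesis using 2 by (simp add: diff_divide_distrib)
    qed
    have e: "a v * dd F v (1, - (p1 / q1), 0) + c v * dd F v (0, - (s1 / q1), 1) = 0" for v
      using syz'[of v] unfolding c[of v] by (simp add: dd_def algebra_simps)
    have "indep2 (1, - (p1 / q1), 0) (0, - (s1 / q1), 1)" by (auto simp: indep2_def zero_prod_def)
    from two_term_syzygy[OF F p(1,3) h(1,3) this e]
    have "a v = 0 \<and> c v = 0" .
    then show ?thesis using c[of v] by simp
  next
    case 3
    have c: "a v = - (q1 / p1) * b v - (s1 / p1) * c v" for v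
    proof -
      have "p1 * a v = - q1 * b v - s1 * c v" using dep[of v] by algebra
      then have "(p1 * a v) / p1 = (- q1 * b v - s1 * c v) / p1" by simp
      then show ?thesis using 3 by (simp add: diff_divide_distrib)
    qed
    have e: "b v * dd F v (- (q1 / p1), 1, 0) + c v * dd F v (- (s1 / p1), 0, 1) = 0" for v
      using syz'[of v] unfolding c[of v] by (simp add: dd_def algebra_simps)
    have "indep2 (- (q1 / p1), 1, 0) (- (s1 / p1), 0, 1)" by (auto simp: indep2_def zero_prod_def)
    from two_term_syzygy[OF F p(2,3) h(2,3) this e]
    have "b v = 0 \<and> c v = 0" .
    then show ?thesis using c[of v] by simp
  qed
qed

section \<open>Multiplicity at the singular points\<close>

lemma vector_derivative_quotient:
  fixes F :: "real \<Rightarrow> complex"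
  assumes "(F has_vector_derivative c) (at 0)" "F 0 = 0"
  shows "((\<lambda>t. F t / of_real t) \<longlongrightarrow> c) (at 0)"
proof -
  have l: "((\<lambda>s. norm (F s - s *\<^sub>R c) / norm s) \<longlongrightarrow> 0) (at 0)"
    using assms unfolding has_vector_derivative_def has_derivative_at by simp
  have "((\<lambda>s. norm (F s / of_real s - c)) \<longlongrightarrow> 0) (at 0)"
  proof (rule Lim_transform_eventually[OF l])
    have "norm (X - s *\<^sub>R d) / norm s = norm (X / of_real s - d)" if "s \<noteq> 0" for X d :: complex and s :: real
    proof -
      have "X / of_real s - d = (X - s *\<^sub>R d) / of_real s" using that by (simp add: scaleR_conv_of_real diff_divide_distrib)
      then show ?thesis by (simp add: norm_divide)
    qed
    then show "\<forall>\<^sub>F s in at 0. norm (F s - s *\<^sub>R c) / norm s = norm (F s / of_real s - c)"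
      by (simp add: eventually_at_filter)
  qed
  then show ?thesis by (simp add: tendsto_norm_zero_iff LIM_zero_iff)
qed

text \<open>Along the line \<open>t w\<close> in the source of the coordinate change each factor vanishes at \<open>p\<close> to first order in \<open>t\<close> with a
  coefficient \<open>l i w\<close> that is linear in \<open>w\<close>; so the normal form must be divisible by \<open>t\<^sup>N\<close>.\<close>
lemma sing_type_factor_limits:
  fixes N :: nat
  assumes s: "sing_type f p h" and pf: "\<And>i. i < N \<Longrightarrow> pfun (g i)" "pfun q" and z: "\<And>i. i < N \<Longrightarrow> g i p = 0"
    and f: "\<And>v. f v = (\<Prod>i<N. g i v) * q v"
  shows "\<exists>u0 l. u0 \<noteq> 0 \<and> (\<forall>w. ((\<lambda>t::real. h (t *\<^sub>R w) / of_real t ^ N) \<longlongrightarrow> (\<Prod>i<N. l i w) * q p / u0) (at_right 0))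
    \<and> (\<forall>i a b. l i (a, b) = a * l i (1, 0) + b * l i (0, 1))
    \<and> (\<forall>i j k. (\<forall>d. dd (g i) p d = k * dd (g j) p d) \<longrightarrow> (\<forall>w. l i w = k * l j w))"
proof -
  obtain e1 e2 U \<phi>1 \<phi>2 u where D: "det3 p e1 e2 \<noteq> 0" and bi: "biholo_on U \<phi>1 \<phi>2" and u: "holo2 U u" "u (0, 0) \<noteq> 0"
    and eq: "\<And>w. w \<in> U \<Longrightarrow> f (tadd p (tadd (tsmul (\<phi>1 w) e1) (tsmul (\<phi>2 w) e2))) = u w * h w"
    using s unfolding sing_type_def germ_equiv_def by auto
  have U: "(0,0) \<in> U" "holo2 U \<phi>1" "holo2 U \<phi>2" "\<phi>1 (0,0) = 0" "\<phi>2 (0,0) = 0" "open U"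
    using bi unfolding biholo_on_def by (auto simp: holo2_def)
  obtain a1 b1 where d1: "(\<phi>1 has_derivative (\<lambda>h. a1 * fst h + b1 * snd h)) (at (0,0))" using U(1,2) unfolding holo2_def by blast
  obtain a2 b2 where d2: "(\<phi>2 has_derivative (\<lambda>h. a2 * fst h + b2 * snd h)) (at (0,0))" using U(1,3) unfolding holo2_def by blast
  obtain a3 b3 where d3: "(u has_derivative (\<lambda>h. a3 * fst h + b3 * snd h)) (at (0,0))" using U(1) u(1) unfolding holo2_def by blast
  \<comment> \<open>X and Y are the linear parts of the coordinate change, so the curve \<gamma> w
    leaves p in the direction X w e1 + Y w e2.\<close>
  define X where "X w = a1 * fst w + b1 * snd w" for w :: "complex \<times> complex"
  define Y where "Y w = a2 * fst w + b2 * snd w" for w :: "complex \<times> complex"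
  define \<gamma> where "\<gamma> w t = p + (tsmul (\<phi>1 (t *\<^sub>R w)) e1 + tsmul (\<phi>2 (t *\<^sub>R w)) e2)" for w and t :: real
  have \<gamma>0: "\<gamma> w 0 = p" for w using U by (simp add: \<gamma>_def zero_prod_def)
  have lin: "((\<lambda>t. t *\<^sub>R w) has_derivative (\<lambda>t. t *\<^sub>R w)) (at (0::real))" for w :: "complex \<times> complex"
    by (auto intro!: derivative_eq_intros)
  have at0: "(0::real) *\<^sub>R w = (0,0)" for w :: "complex \<times> complex" by (simp add: zero_prod_def)
  have dph: "((\<lambda>t. \<phi>1 (t *\<^sub>R w)) has_derivative (\<lambda>t. of_real t * X w)) (at (0::real))" "((\<lambda>t. \<phi>2 (t *\<^sub>R w)) has_derivative (\<lambda>t. of_real t * Y w)) (at (0::real))" for w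
    using has_derivative_compose[OF lin, of \<phi>1 _ w] has_derivative_compose[OF lin, of \<phi>2 _ w] d1 d2 unfolding at0
    by (force simp: X_def Y_def scaleR_conv_of_real algebra_simps)+
  have d\<gamma>: "(\<gamma> w has_derivative (\<lambda>t. tsmul (of_real t) (tsmul (X w) e1 + tsmul (Y w) e2))) (at 0)" for w
  proof -
    have "((\<lambda>t. p + (\<phi>1 (t *\<^sub>R w) * fst e1 + \<phi>2 (t *\<^sub>R w) * fst e2, \<phi>1 (t *\<^sub>R w) * fst (snd e1) + \<phi>2 (t *\<^sub>R w) * fst (snd e2), \<phi>1 (t *\<^sub>R w) * snd (snd e1) + \<phi>2 (t *\<^sub>R w) * snd (snd e2)))
      has_derivative (\<lambda>t. 0 + (of_real t * X w * fst e1 + of_real t * Y w * fst e2, of_real t * X w * fst (snd e1) + of_real t * Y w * fst (snd e2), of_real t * X w * snd (snd e1) + of_real t * Y w * snd (snd e2)))) (at 0)"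
      by (intro derivative_intros has_derivative_Pair has_derivative_mult_left dph)
    then show ?thesis unfolding \<gamma>_def[abs_def] by (simp add: tsmul_def algebra_simps)
  qed
  have lim1: "((\<lambda>t. g i (\<gamma> w t) / of_real t) \<longlongrightarrow> dd (g i) p (tsmul (X w) e1 + tsmul (Y w) e2)) (at_right 0)" if "i < N" for i w
  proof -
    let ?c = "dd (g i) p (tsmul (X w) e1 + tsmul (Y w) e2)"
    have "(g i has_derivative dd (g i) p) (at (\<gamma> w 0))" unfolding \<gamma>0 by (rule pfun_has_derivative[OF pf(1)[OF that]])
    from has_derivative_compose[OF d\<gamma> this]
    have "((\<lambda>t. g i (\<gamma> w t)) has_vector_derivative ?c) (at 0)"
      by (simp only: dd_lin(2)) (simp add: has_vector_derivative_def scaleR_conv_of_real)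
    then have "((\<lambda>t. g i (\<gamma> w t) / of_real t) \<longlongrightarrow> ?c) (at 0)"
      by (rule vector_derivative_quotient) (simp add: \<gamma>0 z[OF that])
    then show ?thesis using filterlim_at_split by blast
  qed
  have lim: "((\<lambda>t::real. h (t *\<^sub>R w) / of_real t ^ N) \<longlongrightarrow> (\<Prod>i<N. dd (g i) p (tsmul (X w) e1 + tsmul (Y w) e2)) * q p / u (0,0)) (at_right 0)" for w
  proof -
    have c\<gamma>: "isCont (\<gamma> w) 0" by (rule has_derivative_continuous[OF d\<gamma>])
    have "isCont (\<lambda>t. q (\<gamma> w t)) 0" by (intro isCont_o2[OF c\<gamma>] pfun_isCont pf)
    then have lq: "((\<lambda>t. q (\<gamma> w t)) \<longlongrightarrow> q p) (at_right 0)"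
      using \<gamma>0[of w] unfolding isCont_def by (auto intro: tendsto_mono[OF at_le[of _ UNIV]])
    have "isCont (\<lambda>t::real. t *\<^sub>R w) 0" by (intro continuous_intros)
    then have "isCont (\<lambda>t::real. u (t *\<^sub>R w)) 0"
      by (rule isCont_o2) (use has_derivative_continuous[OF d3] at0 in auto)
    then have lu: "((\<lambda>t. u (t *\<^sub>R w)) \<longlongrightarrow> u (0,0)) (at_right 0)"
      using at0[of w] unfolding isCont_def by (auto intro: tendsto_mono[OF at_le[of _ UNIV]])
    have L: "((\<lambda>t. (\<Prod>i<N. g i (\<gamma> w t) / of_real t) * q (\<gamma> w t) / u (t *\<^sub>R w)) \<longlongrightarrow> (\<Prod>i<N. dd (g i) p (tsmul (X w) e1 + tsmul (Y w) e2)) * q p / u (0,0)) (at_right 0)"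
      by (intro tendsto_intros lim1 lq lu u) auto
    have "\<forall>\<^sub>F t in at_right (0::real). t *\<^sub>R w \<in> U"
    proof -
      have "((\<lambda>t::real. t *\<^sub>R w) \<longlongrightarrow> 0 *\<^sub>R w) (at_right 0)" by (intro tendsto_intros)
      then show ?thesis using U(1,6) at0 by (metis topological_tendstoD)
    qed
    moreover have "\<forall>\<^sub>F t in at_right (0::real). u (t *\<^sub>R w) \<noteq> 0" using lu u(2) by (rule tendsto_imp_eventually_ne)
    moreover have "\<forall>\<^sub>F t in at_right (0::real). t > 0" by (rule eventually_at_right_less)
    ultimately have "\<forall>\<^sub>F t in at_right (0::real). (\<Prod>i<N. g i (\<gamma> w t) / of_real t) * q (\<gamma> w t) / u (t *\<^sub>R w) = h (t *\<^sub>R w) / of_real t ^ N"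
    proof eventually_elim
      case (elim t)
      have "u (t *\<^sub>R w) * h (t *\<^sub>R w) = (\<Prod>i<N. g i (\<gamma> w t)) * q (\<gamma> w t)"
        using eq[OF elim(1)] by (simp add: f \<gamma>_def tadd_eq)
      then show ?case using elim by (simp add: prod_dividef field_simps)
    qed
    then show ?thesis by (rule Lim_transform_eventually[OF L])
  qed
  define l where "l i w = dd (g i) p (tsmul (X w) e1 + tsmul (Y w) e2)" for i w
  have ll: "l i (a, b) = a * l i (1, 0) + b * l i (0, 1)" for i a b
    unfolding l_def X_def Y_def by (simp add: dd_lin algebra_simps)
  show ?thesis
    by (rule exI[of _ "u (0,0)"], rule exI[of _ l], intro conjI allI impI u ll lim[folded l_def]) (simp add: l_def)
qed

lemma tendsto_unique_right: "(F \<longlongrightarrow> a) (at_right (0::real)) \<Longrightarrow> (F \<longlongrightarrow> b) (at_right 0) \<Longrightarrow> a = (b::complex)"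
  by (rule tendsto_unique) auto

lemma not_finite_limit_inverse:
  assumes "((\<lambda>t::real. c / of_real t ^ Suc n) \<longlongrightarrow> (l::complex)) (at_right 0)" shows "c = 0"
proof -
  have "((\<lambda>t::real. (c / of_real t ^ Suc n) * of_real t ^ Suc n) \<longlongrightarrow> l * of_real 0 ^ Suc n) (at_right 0)"
    by (intro tendsto_intros assms)
  then have L: "((\<lambda>t::real. (c / of_real t ^ Suc n) * of_real t ^ Suc n) \<longlongrightarrow> 0) (at_right 0)" by simp
  have "((\<lambda>t::real. c) \<longlongrightarrow> 0) (at_right 0)"
    by (rule Lim_transform_eventually[OF L], rule eventually_mono[OF eventually_at_right_less[of "0::real"]]) simp
  then show ?thesis by (simp add: tendsto_const_iff)
qed

text \<open>With N factors vanishing at p, the normal form divided by t^N has a limit along every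
  real ray through 0. But A1 and A5 equal t^2 on the first axis, which excludes N >= 3, and D4
  equals t^3 on the second, which excludes N >= 4.\<close>

lemma sing_type_three_factors:
  fixes N :: nat
  assumes pf: "\<And>i. i < N \<Longrightarrow> pfun (g i)" "pfun q" and z: "\<And>i. i < N \<Longrightarrow> g i p = 0"
    and f: "\<And>v. f v = (\<Prod>i<N. g i v) * q v" and N: "N \<ge> 3"
  shows "\<not> sing_type f p nf_A1" "\<not> sing_type f p nf_A5" "sing_type f p nf_D4 \<Longrightarrow> N = 3"
proof -
  obtain n where n: "N = Suc (Suc (Suc n))" using N by (metis Suc_le_D numeral_3_eq_3 Suc_le_mono)
  have ev: "((\<lambda>t::real. F t) \<longlongrightarrow> l) (at_right 0)" if "((\<lambda>t::real. G t) \<longlongrightarrow> l) (at_right 0)" "\<And>t. t > 0 \<Longrightarrow> G t = F t" for F G and l :: complex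
    by (rule Lim_transform_eventually[OF that(1)], rule eventually_mono[OF eventually_at_right_less[of "0::real"]]) (rule that(2))
  have no: False if s: "sing_type f p h" and h: "\<And>t::real. h (t *\<^sub>R 1, 0) = (of_real t)\<^sup>2" for h
  proof -
    from sing_type_factor_limits[OF s pf z f] obtain u0 l where
      L: "\<And>w. ((\<lambda>t::real. h (t *\<^sub>R w) / of_real t ^ N) \<longlongrightarrow> (\<Prod>i<N. l i w) * q p / u0) (at_right 0)" by blast
    have "((\<lambda>t::real. 1 / of_real t ^ Suc n) \<longlongrightarrow> (\<Prod>i<N. l i (1,0)) * q p / u0) (at_right 0)"
      by (rule ev[OF L[of "(1,0)"]]) (simp add: h n power2_eq_square)
    then show False using not_finite_limit_inverse[of 1 n] by auto
  qed
  show "\<not> sing_type f p nf_A1" using no[of nf_A1] by (auto simp: nf_A1_def scaleR_conv_of_real)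
  show "\<not> sing_type f p nf_A5" using no[of nf_A5] by (auto simp: nf_A5_def scaleR_conv_of_real)
  show "N = 3" if s: "sing_type f p nf_D4"
  proof (rule ccontr)
    assume "N \<noteq> 3"
    then obtain k where k: "n = Suc k" using n by (cases n) auto
    from sing_type_factor_limits[OF s pf z f] obtain u0 l where
      L: "\<And>w. ((\<lambda>t::real. nf_D4 (t *\<^sub>R w) / of_real t ^ N) \<longlongrightarrow> (\<Prod>i<N. l i w) * q p / u0) (at_right 0)" by blast
    have "((\<lambda>t::real. 1 / of_real t ^ Suc k) \<longlongrightarrow> (\<Prod>i<N. l i (0,1)) * q p / u0) (at_right 0)"
      by (rule ev[OF L[of "(0,1)"]]) (simp add: nf_D4_def scaleR_conv_of_real n k power3_eq_cube)
    then show False using not_finite_limit_inverse[of 1 k] by auto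
  qed
qed

text \<open>In the limit the three linear parts multiply to D4 up to a constant, so they must cover
  its three zero directions (1,0), (1,i), (1,-i). If one is proportional to another, only two lines
  are left to cover three directions.\<close>

lemma D4_tangents:
  fixes g :: "nat \<Rightarrow> pt \<Rightarrow> complex"
  assumes s: "sing_type f p nf_D4" and pf: "\<And>i. i < 3 \<Longrightarrow> pfun (g i)" "pfun q" and z: "\<And>i. i < 3 \<Longrightarrow> g i p = 0"
    and f: "\<And>v. f v = (\<Prod>i<3. g i v) * q v" and tang: "\<And>d. dd (g 2) p d = k * dd (g j) p d" "j < 2"
  shows False
proof -
  from sing_type_factor_limits[OF s pf z f] obtain u0 l where u0: "u0 \<noteq> 0"
    and L: "\<And>w. ((\<lambda>t::real. nf_D4 (t *\<^sub>R w) / of_real t ^ 3) \<longlongrightarrow> (\<Prod>i<3. l i w) * q p / u0) (at_right 0)"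
    and ll: "\<And>i a b. l i (a, b) = a * l i (1, 0) + b * l i (0, 1)"
    and lp: "\<And>i j k w. \<forall>d. dd (g i) p d = k * dd (g j) p d \<Longrightarrow> l i w = k * l j w" by blast
  have eq: "(\<Prod>i<3. l i w) * q p / u0 = nf_D4 w" for w
  proof (rule tendsto_unique_right)
    show "((\<lambda>t::real. nf_D4 (t *\<^sub>R w) / of_real t ^ 3) \<longlongrightarrow> (\<Prod>i<3. l i w) * q p / u0) (at_right 0)"
      by (rule L)
    have e: "nf_D4 w = nf_D4 (t *\<^sub>R w) / of_real t ^ 3" if "t > 0" for t :: real
      using that by (cases w) (simp add: nf_D4_def scaleR_conv_of_real field_simps power2_eq_square power3_eq_cube)
    show "((\<lambda>t::real. nf_D4 (t *\<^sub>R w) / of_real t ^ 3) \<longlongrightarrow> nf_D4 w) (at_right 0)"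
      by (rule Lim_transform_eventually[OF tendsto_const], rule eventually_mono[OF eventually_at_right_less[of "0::real"]]) (rule e)
  qed
  have qp: "q p \<noteq> 0" using eq[of "(0,1)"] by (auto simp: nf_D4_def)
  have p3: "l 0 w * l 1 w * l 2 w = 0 \<longleftrightarrow> nf_D4 w = 0" for w
    using eq[of w] u0 qp by (auto simp: eval_nat_numeral lessThan_Suc mult_ac)
  have l2: "l 2 w = k * l j w" for w using lp tang(1) by blast
  have zero: "l 0 w = 0 \<or> l 1 w = 0" if "nf_D4 w = 0" for w
  proof -
    have "l 0 w * l 1 w * l 2 w = 0" using p3 that by blast
    then show ?thesis
    proof -
      have "k \<noteq> 0"
      proof
        assume "k = 0"
        then have "l 2 (0,1) = 0" using l2 by simp
        then show False using eq[of "(0,1)"] by (simp add: eval_nat_numeral lessThan_Suc nf_D4_def)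
      qed
      moreover have "j = 0 \<or> j = 1" using tang(2) by auto
      ultimately show ?thesis using \<open>l 0 w * l 1 w * l 2 w = 0\<close> l2[of w] by auto
    qed
  qed
  have nz: "\<not> (l i (1,0) = 0 \<and> l i (0,1) = 0)" if "i < 3" for i
  proof
    assume "l i (1,0) = 0 \<and> l i (0,1) = 0"
    then have "l 0 (0,1) * l 1 (0,1) * l 2 (0,1) = 0" using that by (auto simp: numeral_3_eq_3 less_Suc_eq numeral_2_eq_2)
    then show False using p3[of "(0,1)"] by (simp add: nf_D4_def)
  qed
  have two: "\<not> (l i (1,0) = 0 \<and> l i (1,\<i>) = 0)" "\<not> (l i (1,0) = 0 \<and> l i (1,-\<i>) = 0)" "\<not> (l i (1,\<i>) = 0 \<and> l i (1,-\<i>) = 0)" if "i < 3" for i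
    using nz[OF that] ll[of i 1 \<i>] ll[of i 1 "-\<i>"] by (auto simp: algebra_simps eq_neg_iff_add_eq_0)
  have "nf_D4 (1,0) = 0" "nf_D4 (1,\<i>) = 0" "nf_D4 (1,-\<i>) = 0" by (auto simp: nf_D4_def power3_eq_cube)
  then have "l 0 (1,0) = 0 \<or> l 1 (1,0) = 0" "l 0 (1,\<i>) = 0 \<or> l 1 (1,\<i>) = 0" "l 0 (1,-\<i>) = 0 \<or> l 1 (1,-\<i>) = 0"
    using zero by blast+
  then show False using two[of 0] two[of 1] by auto
qed

section \<open>Quadratic fields preserving two lines\<close>

lemma quartic_form_zero:
  fixes A B C D E :: complex
  assumes "\<And>y z. A * y^4 + B * y^3 * z + C * y\<^sup>2 * z\<^sup>2 + D * y * z^3 + E * z^4 = 0"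
  shows "A = 0" "B = 0" "C = 0" "D = 0" "E = 0"
proof -
  have 1: "A = 0" using assms[of 1 0] by simp
  have 2: "E = 0" using assms[of 0 1] by simp
  have 3: "B + C + D = 0" using assms[of 1 1] 1 2 by simp
  have 4: "C = B + D" using assms[of 1 "-1"] 1 2 by (simp add: algebra_simps eq_neg_iff_add_eq_0)
  have "2 * C = 0" using 3 4 by algebra
  then have 5: "C = 0" by simp
  have 6: "2 * B + 8 * D = 0" using assms[of 1 2] 1 2 5 by (simp add: algebra_simps)
  have "6 * D = 0" using 3 5 6 by algebra
  then have 7: "D = 0" by simp
  show "A = 0" "B = 0" "C = 0" "D = 0" "E = 0" using 1 2 3 5 7 by auto
qed

lemma quadric_zero:
  fixes A B C D E G :: complex
  assumes "\<And>x y z. x * y * (A * x\<^sup>2 + B * y\<^sup>2 + C * z\<^sup>2 + D * x * y + E * x * z + G * y * z) = 0"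
  shows "A = 0" "B = 0" "C = 0" "D = 0" "E = 0" "G = 0"
proof -
  have 1: "A + B + D = 0" using assms[of 1 1 0] by simp
  have 2: "A + B - D = 0" using assms[of 1 "-1" 0] by simp
  have 3: "A + 4 * B + 2 * D = 0" 
  proof -
    have "2 * (A + 4 * B + 2 * D) = 0" using assms[of 1 2 0] by (simp add: algebra_simps)
    then show ?thesis by (metis mult_eq_0_iff zero_neq_numeral)
  qed
  have "2 * D = 0" using 1 2 by algebra
  then have D: "D = 0" by simp
  have "3 * B = 0" using 1 3 D by algebra
  then have B: "B = 0" by simp
  have A: "A = 0" using 1 B D by simp
  have 4: "C + E + G = 0" using assms[of 1 1 1] A B D by simp
  have 5: "C - E - G = 0" using assms[of 1 1 "-1"] A B D by simp
  have 6: "C + E + 2 * G = 0"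
  proof -
    have "2 * (C + E + 2 * G) = 0" using assms[of 1 2 1] A B D by (simp add: algebra_simps)
    then show ?thesis by (metis mult_eq_0_iff zero_neq_numeral)
  qed
  have "2 * C = 0" using 4 5 by algebra
  then have C: "C = 0" by simp
  have G: "G = 0" using 4 6 by algebra
  show "A = 0" "B = 0" "C = 0" "D = 0" "E = 0" "G = 0" using A B C D G 4 by auto
qed

text \<open>An injective linear map of C^2 is surjective.\<close>

lemma combination_exists:
  fixes a b c d x y :: complex
  assumes "\<And>\<alpha> \<beta>. \<alpha> * a + \<beta> * b = 0 \<Longrightarrow> \<alpha> * c + \<beta> * d = 0 \<Longrightarrow> \<alpha> = 0 \<and> \<beta> = 0"
  shows "\<exists>\<alpha> \<beta>. \<alpha> * a + \<beta> * b = x \<and> \<alpha> * c + \<beta> * d = y"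
proof -
  define D where "D = a * d - b * c"
  have "D \<noteq> 0"
  proof
    assume D: "D = 0"
    then have "a = 0" "b = 0" "c = 0" "d = 0"
      using assms[of b "- a"] assms[of d "- c"] by (auto simp: D_def algebra_simps)
    then show False using assms[of 1 0] by simp
  qed
  then show ?thesis
    by (intro exI[of _ "(x * d - y * b) / D"] exI[of _ "(y * a - x * c) / D"])
       (simp add: field_simps, simp add: D_def algebra_simps)
qed

text \<open>Two vector fields of degree 2 that annihilate a smooth cubic \<open>F\<close> and preserve the lines \<open>x = 0\<close> and \<open>y = 0\<close> are
  dependent. The coordinate \<open>z\<close> is normalized so that either \<open>F(0,0,1) \<noteq> 0\<close> and \<open>z\<^sup>2x\<close>, \<open>z\<^sup>2y\<close> do not occur in \<open>F\<close>, or \<open>F(0,0,1) = 0\<close>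
  and \<open>x\<^sup>2z\<close>, \<open>y\<^sup>2z\<close> do not occur. A field in which \<open>y\<^sup>2\<close> and \<open>yz\<close> do not occur in the \<open>y\<close>-component is divisible by \<open>x\<close>,
  hence 0; so both coefficients can be prescribed, which pins \<open>F\<close> down to a singular cubic.\<close>

locale normalized_cubic =
  fixes f0 f1 f2 f3 f4 f5 f6 f7 f8 f9 :: complex
  fixes Fx Fy Fz :: "complex \<Rightarrow> complex \<Rightarrow> complex \<Rightarrow> complex"
  fixes sol :: "(nat \<Rightarrow> complex) \<Rightarrow> bool"
  assumes Fx: "Fx x y z = 3 * f1 * x\<^sup>2 + 2 * f2 * x * y + 2 * f3 * x * z + f4 * y\<^sup>2 + f5 * y * z + f6 * z\<^sup>2"
    and Fy: "Fy x y z = f2 * x\<^sup>2 + 2 * f4 * x * y + f5 * x * z + 3 * f7 * y\<^sup>2 + 2 * f8 * y * z + f9 * z\<^sup>2"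
    and Fz: "Fz x y z = f3 * x\<^sup>2 + f5 * x * y + 2 * f6 * x * z + f8 * y\<^sup>2 + 2 * f9 * y * z + 3 * f0 * z\<^sup>2"
    and sol: "sol u \<longleftrightarrow> (\<forall>x y z. x * (u 1 * x + u 2 * y + u 3 * z) * Fx x y z + y * (u 4 * x + u 5 * y + u 6 * z) * Fy x y z
        + (u 7 * x\<^sup>2 + u 8 * x * y + u 9 * x * z + u 10 * y\<^sup>2 + u 11 * y * z + u 12 * z\<^sup>2) * Fz x y z = 0)"
    and smooth: "Fx x y z = 0 \<Longrightarrow> Fy x y z = 0 \<Longrightarrow> Fz x y z = 0 \<Longrightarrow> x = 0 \<and> y = 0 \<and> z = 0"
    and lin: "(\<And>x y z. x * y \<noteq> 0 \<Longrightarrow> (a1 * x + a2 * y + a3 * z) * Fx x y z + (b1 * x + b2 * y + b3 * z) * Fy x y z + (c1 * x + c2 * y + c3 * z) * Fz x y z = 0)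
        \<Longrightarrow> a1 = 0 \<and> a2 = 0 \<and> a3 = 0 \<and> b1 = 0 \<and> b2 = 0 \<and> b3 = 0 \<and> c1 = 0 \<and> c2 = 0 \<and> c3 = 0"
    and norm: "f0 \<noteq> 0 \<and> f6 = 0 \<and> f9 = 0 \<or> f0 = 0 \<and> f3 = 0 \<and> f8 = 0 \<and> f6 \<noteq> 0 \<and> f9 \<noteq> 0"
begin

text \<open>The coefficients of the binary quartic obtained by putting x = 0; \<open>sol_y0\<close>
  is the analogue for y = 0.\<close>

lemma sol_x0:
  assumes "sol u"
  shows "3 * u 5 * f7 + u 10 * f8 = 0" "2 * u 5 * f8 + 3 * u 6 * f7 + 2 * u 10 * f9 + u 11 * f8 = 0"
    "u 5 * f9 + 2 * u 6 * f8 + 3 * u 10 * f0 + 2 * u 11 * f9 + u 12 * f8 = 0"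
    "u 6 * f9 + 3 * u 11 * f0 + 2 * u 12 * f9 = 0" "3 * u 12 * f0 = 0"
proof -
  have "(3 * u 5 * f7 + u 10 * f8) * y^4 + (2 * u 5 * f8 + 3 * u 6 * f7 + 2 * u 10 * f9 + u 11 * f8) * y^3 * z
    + (u 5 * f9 + 2 * u 6 * f8 + 3 * u 10 * f0 + 2 * u 11 * f9 + u 12 * f8) * y\<^sup>2 * z\<^sup>2
    + (u 6 * f9 + 3 * u 11 * f0 + 2 * u 12 * f9) * y * z^3 + (3 * u 12 * f0) * z^4 = 0" for y z
  proof -
    have "0 * (u 1 * 0 + u 2 * y + u 3 * z) * Fx 0 y z + y * (u 4 * 0 + u 5 * y + u 6 * z) * Fy 0 y z
        + (u 7 * 0\<^sup>2 + u 8 * 0 * y + u 9 * 0 * z + u 10 * y\<^sup>2 + u 11 * y * z + u 12 * z\<^sup>2) * Fz 0 y z = 0"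
      using assms unfolding sol by blast
    then show ?thesis unfolding Fx Fy Fz by (simp add: algebra_simps eval_nat_numeral)
  qed
  from quartic_form_zero[OF this] show "3 * u 5 * f7 + u 10 * f8 = 0" "2 * u 5 * f8 + 3 * u 6 * f7 + 2 * u 10 * f9 + u 11 * f8 = 0"
    "u 5 * f9 + 2 * u 6 * f8 + 3 * u 10 * f0 + 2 * u 11 * f9 + u 12 * f8 = 0"
    "u 6 * f9 + 3 * u 11 * f0 + 2 * u 12 * f9 = 0" "3 * u 12 * f0 = 0" .
qed

lemma sol_y0:
  assumes "sol u"
  shows "3 * u 1 * f1 + u 7 * f3 = 0" "2 * u 1 * f3 + 3 * u 3 * f1 + 2 * u 7 * f6 + u 9 * f3 = 0"
    "u 1 * f6 + 2 * u 3 * f3 + 3 * u 7 * f0 + 2 * u 9 * f6 + u 12 * f3 = 0"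
    "u 3 * f6 + 3 * u 9 * f0 + 2 * u 12 * f6 = 0"
proof -
  have "(3 * u 1 * f1 + u 7 * f3) * x^4 + (2 * u 1 * f3 + 3 * u 3 * f1 + 2 * u 7 * f6 + u 9 * f3) * x^3 * z
    + (u 1 * f6 + 2 * u 3 * f3 + 3 * u 7 * f0 + 2 * u 9 * f6 + u 12 * f3) * x\<^sup>2 * z\<^sup>2
    + (u 3 * f6 + 3 * u 9 * f0 + 2 * u 12 * f6) * x * z^3 + (3 * u 12 * f0) * z^4 = 0" for x z
  proof -
    have "x * (u 1 * x + u 2 * 0 + u 3 * z) * Fx x 0 z + 0 * (u 4 * x + u 5 * 0 + u 6 * z) * Fy x 0 z
        + (u 7 * x\<^sup>2 + u 8 * x * 0 + u 9 * x * z + u 10 * 0\<^sup>2 + u 11 * 0 * z + u 12 * z\<^sup>2) * Fz x 0 z = 0"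
      using assms unfolding sol by blast
    then show ?thesis unfolding Fx Fy Fz by (simp add: algebra_simps eval_nat_numeral)
  qed
  from quartic_form_zero[OF this] show "3 * u 1 * f1 + u 7 * f3 = 0" "2 * u 1 * f3 + 3 * u 3 * f1 + 2 * u 7 * f6 + u 9 * f3 = 0"
    "u 1 * f6 + 2 * u 3 * f3 + 3 * u 7 * f0 + 2 * u 9 * f6 + u 12 * f3 = 0"
    "u 3 * f6 + 3 * u 9 * f0 + 2 * u 12 * f6 = 0" by auto
qed

lemma sol_combination:
  assumes "sol s" "sol t" shows "sol (\<lambda>i. \<alpha> * s i + \<beta> * t i)"
  unfolding sol
proof (intro allI)
  fix x y z
  have 1: "x * (s 1 * x + s 2 * y + s 3 * z) * Fx x y z + y * (s 4 * x + s 5 * y + s 6 * z) * Fy x y z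
        + (s 7 * x\<^sup>2 + s 8 * x * y + s 9 * x * z + s 10 * y\<^sup>2 + s 11 * y * z + s 12 * z\<^sup>2) * Fz x y z = 0" (is "?a = 0")
    using assms(1) unfolding sol by blast
  have 2: "x * (t 1 * x + t 2 * y + t 3 * z) * Fx x y z + y * (t 4 * x + t 5 * y + t 6 * z) * Fy x y z
        + (t 7 * x\<^sup>2 + t 8 * x * y + t 9 * x * z + t 10 * y\<^sup>2 + t 11 * y * z + t 12 * z\<^sup>2) * Fz x y z = 0" (is "?b = 0")
    using assms(2) unfolding sol by blast
  have "x * ((\<alpha> * s 1 + \<beta> * t 1) * x + (\<alpha> * s 2 + \<beta> * t 2) * y + (\<alpha> * s 3 + \<beta> * t 3) * z) * Fx x y z +
       y * ((\<alpha> * s 4 + \<beta> * t 4) * x + (\<alpha> * s 5 + \<beta> * t 5) * y + (\<alpha> * s 6 + \<beta> * t 6) * z) * Fy x y z +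
       ((\<alpha> * s 7 + \<beta> * t 7) * x\<^sup>2 + (\<alpha> * s 8 + \<beta> * t 8) * x * y + (\<alpha> * s 9 + \<beta> * t 9) * x * z + (\<alpha> * s 10 + \<beta> * t 10) * y\<^sup>2 +
        (\<alpha> * s 11 + \<beta> * t 11) * y * z + (\<alpha> * s 12 + \<beta> * t 12) * z\<^sup>2) * Fz x y z = \<alpha> * ?a + \<beta> * ?b" (is "?c = _")
    by (simp add: algebra_simps)
  then show "?c = 0" unfolding 1 2 by simp
qed

text \<open>Reading the equations on x = 0 from the top power of z downwards, the coefficients of
  z^2, yz, y^2 in the third component vanish one by one, each thanks to f0 or f9 being nonzero. The
  linear field left after division by x annihilates F off xy = 0 and is excluded by
  \<open>lin\<close>.\<close>

lemma kill_x:
  assumes u: "sol u" "u 5 = 0" "u 6 = 0" shows "\<forall>i\<in>{1..12}. u i = 0"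
proof -
  have z: "u 10 = 0" "u 11 = 0" "u 12 = 0" using sol_x0[OF u(1)] norm u(2,3) by auto
  have "(u 1 * x + u 2 * y + u 3 * z) * Fx x y z + (0 * x + u 4 * y + 0 * z) * Fy x y z + (u 7 * x + u 8 * y + u 9 * z) * Fz x y z = 0"
    if "x * y \<noteq> 0" for x y z
  proof -
    have "x * (u 1 * x + u 2 * y + u 3 * z) * Fx x y z + y * (u 4 * x + u 5 * y + u 6 * z) * Fy x y z
        + (u 7 * x\<^sup>2 + u 8 * x * y + u 9 * x * z + u 10 * y\<^sup>2 + u 11 * y * z + u 12 * z\<^sup>2) * Fz x y z = 0"
      using u(1) unfolding sol by blast
    then have "x * ((u 1 * x + u 2 * y + u 3 * z) * Fx x y z + (0 * x + u 4 * y + 0 * z) * Fy x y z + (u 7 * x + u 8 * y + u 9 * z) * Fz x y z) = 0"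
      unfolding u z by (simp add: algebra_simps power2_eq_square)
    then show ?thesis using that by simp
  qed
  from lin[OF this] show ?thesis using u z by (auto simp: eval_nat_numeral atLeastAtMostSuc_conv)
qed

lemma kill_y:
  assumes u: "sol u" "u 1 = 0" "u 3 = 0" shows "\<forall>i\<in>{1..12}. u i = 0"
proof -
  have z: "u 7 = 0" "u 9 = 0" "u 12 = 0" using sol_y0[OF u(1)] sol_x0(5)[OF u(1)] norm u(2,3) by auto
  have "(0 * x + u 2 * y * 0 + u 2 * x + 0 * z) * Fx x y z + (u 4 * x + u 5 * y + u 6 * z) * Fy x y z + (u 8 * x + u 10 * y + u 11 * z) * Fz x y z = 0"
    if "x * y \<noteq> 0" for x y z
  proof -
    have "x * (u 1 * x + u 2 * y + u 3 * z) * Fx x y z + y * (u 4 * x + u 5 * y + u 6 * z) * Fy x y z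
        + (u 7 * x\<^sup>2 + u 8 * x * y + u 9 * x * z + u 10 * y\<^sup>2 + u 11 * y * z + u 12 * z\<^sup>2) * Fz x y z = 0"
      using u(1) unfolding sol by blast
    then have "y * ((0 * x + u 2 * y * 0 + u 2 * x + 0 * z) * Fx x y z + (u 4 * x + u 5 * y + u 6 * z) * Fy x y z + (u 8 * x + u 10 * y + u 11 * z) * Fz x y z) = 0"
      unfolding u z by (simp add: algebra_simps power2_eq_square)
    then show ?thesis using that by simp
  qed
  then have "(u 2 * x + 0 * y + 0 * z) * Fx x y z + (u 4 * x + u 5 * y + u 6 * z) * Fy x y z + (u 8 * x + u 10 * y + u 11 * z) * Fz x y z = 0"
    if "x * y \<noteq> 0" for x y z using that by simp
  from lin[OF this] show ?thesis using u z by (auto simp: eval_nat_numeral atLeastAtMostSuc_conv)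
qed

text \<open>Otherwise (1,0,0) or (0,1,0) would be a singular point.\<close>

lemma smooth_corners: assumes "f1 = 0" "f3 = 0" "f7 = 0" "f8 = 0" shows "f2 \<noteq> 0" "f4 \<noteq> 0"
  using smooth[of 1 0 0] smooth[of 0 1 0] assms by (auto simp: Fx Fy Fz)

lemma dependent:
  assumes s: "sol s" and t: "sol t"
  shows "\<exists>\<alpha> \<beta>. (\<alpha>, \<beta>) \<noteq> (0, 0) \<and> (\<forall>i\<in>{1..12}. \<alpha> * s i + \<beta> * t i = 0)"
proof (rule ccontr)
  assume "\<not> ?thesis"
  then have H: "\<alpha> = 0 \<and> \<beta> = 0" if "\<forall>i\<in>{1..12}. \<alpha> * s i + \<beta> * t i = 0" for \<alpha> \<beta> using that by auto
  \<comment> \<open>By independence and \<open>kill_x\<close>, reading off (u 5, u 6) is injective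
    on combinations of s and t, hence onto C^2. So individual coefficients can be set to 0 or 1 at
    will.\<close>
  have ex: "\<exists>u. sol u \<and> u 5 = q \<and> u 6 = q'" for q q'
  proof -
    have "\<exists>\<alpha> \<beta>. \<alpha> * s 5 + \<beta> * t 5 = q \<and> \<alpha> * s 6 + \<beta> * t 6 = q'"
      by (rule combination_exists) (rule H, rule kill_x[OF sol_combination[OF s t]])
    then obtain \<alpha> \<beta> where "\<alpha> * s 5 + \<beta> * t 5 = q \<and> \<alpha> * s 6 + \<beta> * t 6 = q'" by blast
    then show ?thesis using sol_combination[OF s t, of \<alpha> \<beta>] by (intro exI[of _ "\<lambda>i. \<alpha> * s i + \<beta> * t i"]) auto
  qed
  have ey: "\<exists>u. sol u \<and> u 1 = q \<and> u 3 = q'" for q q'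
  proof -
    have "\<exists>\<alpha> \<beta>. \<alpha> * s 1 + \<beta> * t 1 = q \<and> \<alpha> * s 3 + \<beta> * t 3 = q'"
      by (rule combination_exists) (rule H, rule kill_y[OF sol_combination[OF s t]])
    then obtain \<alpha> \<beta> where "\<alpha> * s 1 + \<beta> * t 1 = q \<and> \<alpha> * s 3 + \<beta> * t 3 = q'" by blast
    then show ?thesis using sol_combination[OF s t, of \<alpha> \<beta>] by (intro exI[of _ "\<lambda>i. \<alpha> * s i + \<beta> * t i"]) auto
  qed
  obtain x1 where x1: "sol x1" "x1 5 = 1" "x1 6 = 0" using ex by blast
  obtain x2 where x2: "sol x2" "x2 5 = 0" "x2 6 = 1" using ex by blast
  obtain y1 where y1: "sol y1" "y1 1 = 1" "y1 3 = 0" using ey by blast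
  obtain y2 where y2: "sol y2" "y2 1 = 0" "y2 3 = 1" using ey by blast
  show False
  proof (cases "f0 = 0")
    case False
    then have n: "f6 = 0" "f9 = 0" using norm by auto
    note x1' = sol_x0[OF x1(1)] and x2' = sol_x0[OF x2(1)] and y1' = sol_y0[OF y1(1)] and y2' = sol_y0[OF y2(1)]
    have "x1 11 = 0" using x1'(4,5) False n by simp
    then have f8: "f8 = 0" using x1'(2) n x1 by simp
    then have f7: "f7 = 0" using x2'(2) n x2 by simp
    have y12: "y1 12 = 0" using sol_x0(5)[OF y1(1)] False by simp
    then have y9: "y1 9 = 0" using y1'(4) False n by simp
    then have f3: "f3 = 0" using y1'(2) n y1 by simp
    have f1: "f1 = 0" using y2'(2) n y2 f3 by simp
    note z = n f8 f7 f3 f1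
    have f24: "f2 \<noteq> 0" "f4 \<noteq> 0" using smooth_corners f1 f3 f7 f8 by auto
    \<comment> \<open>At this point F = f2 x^2 y + f4 x y^2 + f5 xyz + f0 z^3. The identity for this
      field becomes xy times a quadric, all of whose coefficients must vanish.\<close>
    define u where "u = x2"
    have u: "sol u" "u 5 = 0" "u 6 = 1" using x2 by (auto simp: u_def)
    have u12: "u 12 = 0" using sol_x0(5)[OF u(1)] False by simp
    have u11: "u 11 = 0" using sol_x0(4)[OF u(1)] False z u12 by simp
    have u10: "u 10 = 0" using sol_x0(3)[OF u(1)] False z by simp
    note u0 = u12 u11 u10
    have u9: "u 9 = 0" using sol_y0(4)[OF u(1)] False z by simp
    have u7: "u 7 = 0" using sol_y0(3)[OF u(1)] False z by simp
    note u0' = u9 u7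
    have "x * y * ((2 * f2 * u 1 + f2 * u 4) * x\<^sup>2 + f4 * u 2 * y\<^sup>2 + (f5 * u 3 + f5 + 3 * f0 * u 8) * z\<^sup>2
       + (f4 * u 1 + 2 * f2 * u 2 + 2 * f4 * u 4 + f5 * u 8) * x * y + (f5 * u 1 + 2 * f2 * u 3 + f2 + f5 * u 4) * x * z
       + (f5 * u 2 + f4 * u 3 + 2 * f4) * y * z) = 0" for x y z
    proof -
      have "x * (u 1 * x + u 2 * y + u 3 * z) * Fx x y z + y * (u 4 * x + u 5 * y + u 6 * z) * Fy x y z
        + (u 7 * x\<^sup>2 + u 8 * x * y + u 9 * x * z + u 10 * y\<^sup>2 + u 11 * y * z + u 12 * z\<^sup>2) * Fz x y z = 0"
        using u(1) unfolding sol by blast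
      then show ?thesis unfolding Fx Fy Fz z u(2,3) u0 u0' by algebra
    qed
    note Q = quadric_zero[OF this]
    have p2: "u 2 = 0" using Q(2) f24 by simp
    have p3: "u 3 = - 2"
    proof -
      have "f4 * (u 3 + 2) = 0" using Q(6) p2 by (simp add: algebra_simps)
      then show ?thesis using f24 by (simp add: eq_neg_iff_add_eq_0)
    qed
    have q1: "u 4 = - 2 * u 1"
    proof -
      have "f2 * (u 4 + 2 * u 1) = 0" using Q(1) by (simp add: algebra_simps)
      then show ?thesis using f24 by (simp add: eq_neg_iff_add_eq_0)
    qed
    have r1: "f5 * u 1 = - 3 * f2" using Q(5) p3 q1 by algebra
    have r2: "f5 * u 8 = 3 * f4 * u 1" using Q(4) p2 q1 by algebra
    have r3: "3 * f0 * u 8 = f5" using Q(3) p3 by algebra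
    have key: "f5 ^ 3 + 27 * f0 * f2 * f4 = 0" using r1 r2 r3 by algebra
    have f5: "f5 \<noteq> 0" using r1 f24 by auto
    \<comment> \<open>Fx and Fy factor as y (2 f2 x + f4 y + f5 z) and x (f2 x + 2 f4 y + f5 z). The
      point is the common zero of the two linear factors, and \<open>key\<close> is the condition
      that Fz vanishes there as well.\<close>
    have "Fx (- f5 * f4) (- f5 * f2) (3 * f2 * f4) = 0" "Fy (- f5 * f4) (- f5 * f2) (3 * f2 * f4) = 0"
      unfolding Fx Fy z by algebra+
    moreover have "Fz (- f5 * f4) (- f5 * f2) (3 * f2 * f4) = 0"
      unfolding Fz z using key by algebra
    ultimately show False using smooth[of "- f5 * f4" "- f5 * f2" "3 * f2 * f4"] f24 by simp
  next
    case True
    then have n: "f3 = 0" "f8 = 0" "f6 \<noteq> 0" "f9 \<noteq> 0" using norm by auto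
    have f7: "f7 = 0" using sol_x0(1)[OF x1(1)] n x1 by simp
    have f1: "f1 = 0" using sol_y0(1)[OF y1(1)] n y1 by simp
    note z = True n(1,2) f7 f1
    have f24: "f2 \<noteq> 0" "f4 \<noteq> 0" using smooth_corners z by auto
    \<comment> \<open>Here F = f2 x^2 y + f4 x y^2 + f5 xyz + f6 x z^2 + f9 y z^2, and u 9 and u 11
      are half-integral multiples, so the quadric below is taken twice.\<close>
    define u where "u = x1"
    have u: "sol u" "u 5 = 1" "u 6 = 0" using x1 by (auto simp: u_def)
    have u12: "u 12 = 0" using sol_x0(4)[OF u(1)] z u n by simp
    have u3: "u 3 = 0" using sol_y0(4)[OF u(1)] z u12 n by simp
    have u11: "2 * u 11 = - 1"
    proof -
      have "f9 * (2 * u 11 + 1) = 0" using sol_x0(3)[OF u(1)] z u by (simp add: algebra_simps)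
      then show ?thesis using n by (simp add: eq_neg_iff_add_eq_0)
    qed
    have u10: "u 10 = 0" using sol_x0(2)[OF u(1)] z u n by simp
    have u9: "2 * u 9 = - u 1"
    proof -
      have "f6 * (2 * u 9 + u 1) = 0" using sol_y0(3)[OF u(1)] z u12 u3 by (simp add: algebra_simps)
      then show ?thesis using n by (simp add: eq_neg_iff_add_eq_0)
    qed
    have u7: "u 7 = 0" using sol_y0(2)[OF u(1)] z u n u3 by simp
    have "x * y * ((4 * f2 * u 1 + 2 * f2 * u 4) * x\<^sup>2 + (2 * f4 * u 2 + 4 * f4) * y\<^sup>2 + (2 * f6 * u 2 + 2 * f9 * u 4 - 2 * f6 - 2 * f9 * u 1) * z\<^sup>2
       + (2 * f4 * u 1 + 4 * f2 * u 2 + 4 * f4 * u 4 + 2 * f2 + 2 * f5 * u 8) * x * y + (f5 * u 1 + 2 * f5 * u 4 + 4 * f6 * u 8) * x * z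
       + (2 * f5 * u 2 + f5 + 4 * f9 * u 8) * y * z) = 0" for x y z
    proof -
      have "x * (u 1 * x + u 2 * y + u 3 * z) * Fx x y z + y * (u 4 * x + u 5 * y + u 6 * z) * Fy x y z
        + (u 7 * x\<^sup>2 + u 8 * x * y + u 9 * x * z + u 10 * y\<^sup>2 + u 11 * y * z + u 12 * z\<^sup>2) * Fz x y z = 0"
        using u(1) unfolding sol by blast
      then show ?thesis using u9 u11 unfolding Fx Fy Fz z u(2,3) u12 u3 u10 u7 by algebra
    qed
    note Q = quadric_zero[OF this]
    have p2: "u 2 = - 2"
    proof -
      have "2 * f4 * (u 2 + 2) = 0" using Q(2) by (simp add: algebra_simps)
      then show ?thesis using f24 by (simp add: eq_neg_iff_add_eq_0)
    qed
    have q1: "u 4 = - 2 * u 1"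
    proof -
      have "2 * f2 * (u 4 + 2 * u 1) = 0" using Q(1) by (simp add: algebra_simps)
      then show ?thesis using f24 by (simp add: eq_neg_iff_add_eq_0)
    qed
    have r1: "f6 + f9 * u 1 = 0"
    proof -
      have "6 * (f6 + f9 * u 1) = 0" using Q(3) p2 q1 by algebra
      then show ?thesis by (metis mult_eq_0_iff zero_neq_numeral)
    qed
    have r2: "4 * f9 * u 8 = 3 * f5" using Q(6) p2 by algebra
    have r3: "4 * f6 * u 8 = 3 * f5 * u 1" using Q(5) q1 by algebra
    have f5: "f5 = 0"
    proof -
      have "6 * (f5 * f6) = 0" using r1 r2 r3 by algebra
      then show ?thesis using n by simp
    qed
    have r4: "f4 * f6 = f2 * f9"
    proof -
      have "6 * (f4 * f6 - f2 * f9) = 0" using Q(4) p2 q1 r1 f5 by algebra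
      then show ?thesis by (metis mult_eq_0_iff zero_neq_numeral right_minus_eq)
    qed
    \<comment> \<open>With f5 = 0 and f4 f6 = f2 f9 the cubic splits into the line f6 x + f9 y = 0
      and a conic proportional to f6 z^2 + f2 xy = 0; (f9, -f6, \<zeta>) is a point where they
      meet.\<close>
    obtain \<zeta> where \<zeta>: "\<zeta>\<^sup>2 = f2 * f9" using power2_csqrt by blast
    have "Fx f9 (- f6) \<zeta> = 0" "Fy f9 (- f6) \<zeta> = 0"
      unfolding Fx Fy z f5 using \<zeta> r4 by algebra+
    moreover have "Fz f9 (- f6) \<zeta> = 0" unfolding Fz z f5 by simp
    ultimately
    show False using smooth n by blast
  qed
qed

end

section \<open>Coordinates adapted to a cubic and two lines\<close>

lemma linear_dd: assumes "pfun l" "hom (Suc 0) l" shows "dd l v d = l d"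
  using hom_1_linear[OF assms, of d] hom_0_const[OF pfun_dd_dir[OF assms(1)] hom_dd[OF assms], of v d] by simp

lemma lin_coeffs: assumes "pfun l" "hom (Suc 0) l" shows "\<exists>a b c. \<forall>x y z. l (x, y, z) = a * x + b * y + c * z"
  using hom_1_linear[OF assms] by (auto simp: dd_def intro!: exI)

text \<open>Coefficients are recovered by lowering the degree: Euler's identity writes the form
  through its partials, whose coefficients are known. The cubic case repeats this.\<close>

lemma quad_coeffs: assumes "pfun f" "hom 2 f"
  shows "\<exists>c1 c2 c3 c4 c5 c6. \<forall>x y z. f (x, y, z) = c1 * x\<^sup>2 + c2 * x * y + c3 * x * z + c4 * y\<^sup>2 + c5 * y * z + c6 * z\<^sup>2"
proof -
  have h: "hom (Suc 0) (\<lambda>v. dd f v e)" for e using hom_dd[OF assms(1), of 1] assms(2) by (simp add: numeral_2_eq_2)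
  have c: "\<exists>a b c. \<forall>x y z. dd f (x, y, z) e = a * x + b * y + c * z" for e
    by (rule lin_coeffs[OF pfun_dd_dir[OF assms(1)] h])
  obtain a1 b1 c1 where 1: "\<And>x y z. dd f (x, y, z) (1,0,0) = a1 * x + b1 * y + c1 * z" using c by blast
  obtain a2 b2 c2 where 2: "\<And>x y z. dd f (x, y, z) (0,1,0) = a2 * x + b2 * y + c2 * z" using c by blast
  obtain a3 b3 c3 where 3: "\<And>x y z. dd f (x, y, z) (0,0,1) = a3 * x + b3 * y + c3 * z" using c by blast
  have "2 * f (x, y, z) = x * (a1 * x + b1 * y + c1 * z) + y * (a2 * x + b2 * y + c2 * z) + z * (a3 * x + b3 * y + c3 * z)" for x y z
    using euler[OF assms, of "(x, y, z)"] 1[of x y z] 2[of x y z] 3[of x y z] by (simp add: dd_def mult.commute)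
  then have "f (x, y, z) = (x * (a1 * x + b1 * y + c1 * z) + y * (a2 * x + b2 * y + c2 * z) + z * (a3 * x + b3 * y + c3 * z)) / 2" for x y z
    by (metis mult.commute nonzero_mult_div_cancel_right zero_neq_numeral)
  then have "f (x, y, z) = (a1 / 2) * x\<^sup>2 + ((b1 + a2) / 2) * x * y + ((c1 + a3) / 2) * x * z + (b2 / 2) * y\<^sup>2 + ((c2 + b3) / 2) * y * z + (c3 / 2) * z\<^sup>2" for x y z
    by (simp add: field_simps power2_eq_square)
  then show ?thesis by blast
qed

lemma cubic_coeffs: assumes "pfun f" "hom 3 f"
  shows "\<exists>f1 f2 f3 f4 f5 f6 f7 f8 f9 f0. \<forall>x y z. f (x, y, z) = f1 * x^3 + f2 * x\<^sup>2 * y + f3 * x\<^sup>2 * z + f4 * x * y\<^sup>2 + f5 * x * y * z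
     + f6 * x * z\<^sup>2 + f7 * y^3 + f8 * y\<^sup>2 * z + f9 * y * z\<^sup>2 + f0 * z^3"
proof -
  have h: "hom 2 (\<lambda>v. dd f v e)" for e using hom_dd[OF assms(1), of 2] assms(2) by (simp add: numeral_3_eq_3 numeral_2_eq_2)
  have c: "\<exists>c1 c2 c3 c4 c5 c6. \<forall>x y z. dd f (x, y, z) e = c1 * x\<^sup>2 + c2 * x * y + c3 * x * z + c4 * y\<^sup>2 + c5 * y * z + c6 * z\<^sup>2" for e
    by (rule quad_coeffs[OF pfun_dd_dir[OF assms(1)] h])
  obtain p1 p2 p3 p4 p5 p6 where 1: "\<And>x y z. dd f (x, y, z) (1,0,0) = p1 * x\<^sup>2 + p2 * x * y + p3 * x * z + p4 * y\<^sup>2 + p5 * y * z + p6 * z\<^sup>2" using c by blast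
  obtain q1 q2 q3 q4 q5 q6 where 2: "\<And>x y z. dd f (x, y, z) (0,1,0) = q1 * x\<^sup>2 + q2 * x * y + q3 * x * z + q4 * y\<^sup>2 + q5 * y * z + q6 * z\<^sup>2" using c by blast
  obtain r1 r2 r3 r4 r5 r6 where 3: "\<And>x y z. dd f (x, y, z) (0,0,1) = r1 * x\<^sup>2 + r2 * x * y + r3 * x * z + r4 * y\<^sup>2 + r5 * y * z + r6 * z\<^sup>2" using c by blast
  have "3 * f (x, y, z) = x * dd f (x,y,z) (1,0,0) + y * dd f (x,y,z) (0,1,0) + z * dd f (x,y,z) (0,0,1)" for x y z
    using euler[OF assms, of "(x, y, z)"] by (simp add: dd_def mult.commute)
  then have "f (x, y, z) = (x * dd f (x,y,z) (1,0,0) + y * dd f (x,y,z) (0,1,0) + z * dd f (x,y,z) (0,0,1)) / 3" for x y z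
    by (metis mult.commute nonzero_mult_div_cancel_right zero_neq_numeral)
  then have "f (x, y, z) = (p1 / 3) * x^3 + ((p2 + q1) / 3) * x\<^sup>2 * y + ((p3 + r1) / 3) * x\<^sup>2 * z + ((p4 + q2) / 3) * x * y\<^sup>2 + ((p5 + q3 + r2) / 3) * x * y * z
     + ((p6 + r3) / 3) * x * z\<^sup>2 + (q4 / 3) * y^3 + ((q5 + r4) / 3) * y\<^sup>2 * z + ((q6 + r5) / 3) * y * z\<^sup>2 + (r6 / 3) * z^3" for x y z
    unfolding 1 2 3 by (simp add: field_simps power2_eq_square power3_eq_cube)
  then show ?thesis by blast
qed

text \<open>If the quadratic form v -> dF(v)e3 had no zero on the line e + \<sigma> e3, it would be
  constant there. By homogeneity it would then be a multiple of t^2 at e3 + t e, and its derivative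
  at t = 0, which is 2 dF(e3)e, would vanish.\<close>

lemma tangent_normalization:
  assumes F: "smc F" and p: "F e3 = 0" and n: "dd F e3 e \<noteq> 0"
  shows "\<exists>\<sigma>. dd F (e + tsmul \<sigma> e3) e3 = 0"
proof -
  have pf: "pfun (\<lambda>v. dd F v e3)" by (rule pfun_dd_dir[OF smcD(1)[OF F]])
  have h2: "hom 2 (\<lambda>v. dd F v e3)" by (rule hom_dd[OF smcD(1,3)[OF F]])
  obtain q where q: "\<And>t. dd F (e + tsmul t e3) e3 = poly q t" using pfun_line[OF pf] by metis
  obtain r where r: "\<And>t. dd F (e3 + tsmul t e) e3 = poly r t" using pfun_line[OF pf] by metis
  show ?thesis
  proof (rule ccontr)
    assume "\<not> ?thesis"
    then have "\<not> (\<exists>t. poly q t = 0)" using q by metis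
    then have "degree q = 0" using alg_closed_imp_poly_has_root[of q] by auto
    then obtain k where k: "q = [:k:]" by (rule degree_eq_zeroE)
    have "poly r t = t\<^sup>2 * k" if "t \<noteq> 0" for t
    proof -
      have "poly r t = dd F (tsmul t (e + tsmul (1 / t) e3)) e3" using that by (simp add: r[symmetric] tsmul_add tsmul_tsmul add.commute)
      also have "\<dots> = t\<^sup>2 * k" using homD[OF h2, of t "e + tsmul (1 / t) e3"] by (simp add: q k)
      finally show ?thesis .
    qed
    then have "poly ([:0, 1:] * r) t = poly ([:0, 1:] * monom k 2) t" for t by (cases "t = 0") (auto simp: poly_monom)
    then have "[:0, 1:] * r = [:0, 1:] * monom k 2" using poly_eq_poly_eq_iff by blast
    then have r2: "r = monom k 2" by (subst (asm) mult_left_cancel) auto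
    have "((\<lambda>t. dd F (e3 + tsmul t e) e3) has_field_derivative dd (\<lambda>v. dd F v e3) (e3 + tsmul 0 e) e) (at 0)"
      by (rule pfun_line_deriv[OF pf])
    moreover have "((\<lambda>t. t\<^sup>2 * k) has_field_derivative 0) (at 0)" by (auto intro!: derivative_eq_intros)
    ultimately have "dd (\<lambda>v. dd F v e3) e3 e = 0" by (simp add: r r2 poly_monom mult.commute) (rule DERIV_unique)
    then show False using hess_euler[OF smcD(1,3)[OF F], of e3 e] n by simp
  qed
qed

text \<open>A linear change of coordinates makes l1 = x and l2 = y and puts the cubic into the form
  required by \<open>normalized_cubic\<close>; the two fields become coefficient vectors
  there.\<close>

lemma quad_syzygies_dependent:
  fixes a b c P Q :: "nat \<Rightarrow> pt \<Rightarrow> complex"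
  assumes F: "smc F" and l: "pfun l1" "pfun l2" "hom (Suc 0) l1" "hom (Suc 0) l2"
    and ne: "\<exists>v. l1 v \<noteq> 0 \<and> l2 v = 0" "\<exists>v. l2 v \<noteq> 0 \<and> l1 v = 0"
    and pf: "\<And>i. pfun (a i)" "\<And>i. pfun (b i)" "\<And>i. pfun (c i)" and hm: "\<And>i. hom 2 (a i)" "\<And>i. hom 2 (b i)" "\<And>i. hom 2 (c i)"
    and PQ: "\<And>i. pfun (P i)" "\<And>i. pfun (Q i)" "\<And>i. hom (Suc 0) (P i)" "\<And>i. hom (Suc 0) (Q i)"
    and syz: "\<And>i v. dd F v (a i v, b i v, c i v) = 0"
    and inv: "\<And>i v. l1 (a i v, b i v, c i v) = P i v * l1 v" "\<And>i v. l2 (a i v, b i v, c i v) = Q i v * l2 v"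
    and tang: "\<And>p k. p \<noteq> 0 \<Longrightarrow> l1 p = 0 \<Longrightarrow> l2 p = 0 \<Longrightarrow> F p = 0 \<Longrightarrow> \<not> (\<forall>d. dd F p d = k * l1 d) \<and> \<not> (\<forall>d. dd F p d = k * l2 d)"
  shows "\<exists>\<alpha> \<beta>. (\<alpha>, \<beta>) \<noteq> (0, 0) \<and> (\<forall>v. \<alpha> * a 0 v + \<beta> * a 1 v = 0 \<and> \<alpha> * b 0 v + \<beta> * b 1 v = 0 \<and> \<alpha> * c 0 v + \<beta> * c 1 v = 0)"
proof -
  have ladd: "l1 (v + w) = l1 v + l1 w" "l2 (v + w) = l2 v + l2 w" "l1 (tsmul t v) = t * l1 v" "l2 (tsmul t v) = t * l2 v" for v w t
    using linear_dd[OF l(1,3)] linear_dd[OF l(2,4)] dd_lin by metis+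
  have l0: "l1 0 = 0" "l2 0 = 0" using hom_0 l(3,4) by auto
  obtain e3 where e3: "e3 \<noteq> 0" "l1 e3 = 0" "l2 e3 = 0"
  proof -
    obtain k k' where kb: "indep2 k k'" "dd l1 0 k = 0" "dd l1 0 k' = 0" using kernel_basis by blast
    obtain s t p where "p = tsmul s k + tsmul t k'" "p \<noteq> 0" "l2 p = 0" using plane_zero'[OF l(2,4) kb(1)] by metis
    then show ?thesis using that[of p] kb linear_dd[OF l(1,3)] by (simp add: ladd)
  qed
  \<comment> \<open>The third basis vector spans l1 = l2 = 0, so the freedom lies in adding
    multiples of e3 to e1 and e2. If F(e3) is nonzero, this removes the z^2 x and z^2 y terms, read
    off as dF(e3)e; otherwise it removes the x^2 z and y^2 z terms, read off as dF(e)e3.\<close>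
  have choose: "\<exists>e. g e = 1 \<and> g' e = 0 \<and> (F e3 \<noteq> 0 \<longrightarrow> dd F e3 e = 0) \<and> (F e3 = 0 \<longrightarrow> dd F e3 e \<noteq> 0 \<and> dd F e e3 = 0)"
    if g: "g = l1 \<and> g' = l2 \<or> g = l2 \<and> g' = l1" for g g'
  proof -
    have gl: "g (v + w) = g v + g w" "g (tsmul t v) = t * g v" "g' (v + w) = g' v + g' w" "g' (tsmul t v) = t * g' v" "g e3 = 0" "g' e3 = 0" for v w t
      using g by (elim disjE conjE; simp add: ladd e3)+
    obtain v where v: "g v \<noteq> 0" "g' v = 0" using g ne by blast
    define e where "e = tsmul (1 / g v) v"
    have e: "g e = 1" "g' e = 0" using v by (auto simp: e_def gl)
    have es: "g (e + tsmul \<sigma> e3) = 1" "g' (e + tsmul \<sigma> e3) = 0" for \<sigma> using e by (auto simp: gl)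
    show ?thesis
    proof (cases "F e3 = 0")
      case False
      then have "dd F e3 e3 \<noteq> 0" using euler[OF smcD(1,2)[OF F], of e3] by simp
      then have "dd F e3 (e + tsmul (- (dd F e3 e / dd F e3 e3)) e3) = 0" by (simp add: dd_lin)
      then show ?thesis using False es by blast
    next
      case True
      have d33: "dd F e3 e3 = 0" using euler[OF smcD(1,2)[OF F], of e3] True by simp
      \<comment> \<open>Since dF(e3)e3 = 0 as well, vanishing would make dF(e3) proportional to the
        form g', that is, the cubic tangent to one of the lines at e3.\<close>
      have nz: "dd F e3 e \<noteq> 0"
      proof
        assume z: "dd F e3 e = 0"
        obtain w where w: "g' w \<noteq> 0" "g w = 0" using g ne by blast
        have "det3 e w e3 \<noteq> 0"
        proof
          assume "det3 e w e3 = 0"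
          then obtain p q s where s: "(p, q, s) \<noteq> (0, 0, 0)" "tsmul p e + tsmul q w + tsmul s e3 = 0" using det3_kernel by metis
          have g0: "g 0 = 0" "g' 0 = 0" using g l0 by auto
          have "p = 0" using arg_cong[OF s(2), of g] e w g0 by (simp add: gl)
          moreover from this have "q = 0" using arg_cong[OF s(2), of g'] e w g0 by (simp add: gl)
          ultimately have "tsmul s e3 = 0" "s \<noteq> 0" using s by auto
          then have "tsmul (1 / s) (tsmul s e3) = tsmul (1 / s) 0" by simp
          then show False using \<open>s \<noteq> 0\<close> e3(1) by (simp add: tsmul_tsmul)
        qed
        then have "dd F e3 d = (dd F e3 w / g' w) * g' d" for d
        proof -
          obtain \<alpha> \<beta> \<gamma> where d: "d = tsmul \<alpha> e + tsmul \<beta> w + tsmul \<gamma> e3" using basis_expansion[OF \<open>det3 e w e3 \<noteq> 0\<close>] by blast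
          show ?thesis unfolding d using z d33 w e by (simp add: dd_lin gl)
        qed
        then show False using tang[OF e3 True] g by metis
      qed
      then obtain \<sigma> where "dd F (e + tsmul \<sigma> e3) e3 = 0" using tangent_normalization[OF F True] by blast
      moreover have "dd F e3 (e + tsmul \<sigma> e3) \<noteq> 0" using nz d33 by (simp add: dd_lin)
      ultimately show ?thesis using True es by blast
    qed
  qed
  obtain e1 where e1: "l1 e1 = 1" "l2 e1 = 0" "F e3 \<noteq> 0 \<Longrightarrow> dd F e3 e1 = 0" "F e3 = 0 \<Longrightarrow> dd F e3 e1 \<noteq> 0 \<and> dd F e1 e3 = 0"
    using choose[of l1 l2] by blast
  obtain e2 where e2: "l2 e2 = 1" "l1 e2 = 0" "F e3 \<noteq> 0 \<Longrightarrow> dd F e3 e2 = 0" "F e3 = 0 \<Longrightarrow> dd F e3 e2 \<noteq> 0 \<and> dd F e2 e3 = 0"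
    using choose[of l2 l1] by blast
  have D: "det3 e1 e2 e3 \<noteq> 0"
  proof
    assume "det3 e1 e2 e3 = 0"
    then obtain p q s where s: "(p, q, s) \<noteq> (0, 0, 0)" "tsmul p e1 + tsmul q e2 + tsmul s e3 = 0" using det3_kernel by metis
    have "p = 0" using arg_cong[OF s(2), of l1] e1 e2 e3 l0 by (simp add: ladd)
    moreover have "q = 0" using arg_cong[OF s(2), of l2] e1 e2 e3 l0 by (simp add: ladd)
    ultimately have "tsmul s e3 = 0" "s \<noteq> 0" using s by auto
    then have "tsmul (1 / s) (tsmul s e3) = tsmul (1 / s) 0" by simp
    then show False using \<open>s \<noteq> 0\<close> e3(1) by (simp add: tsmul_tsmul)
  qed
  define T where "T v = tsmul (fst v) e1 + tsmul (fst (snd v)) e2 + tsmul (snd (snd v)) e3" for v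
  have lT: "l1 (T v) = fst v" "l2 (T v) = fst (snd v)" for v using e1 e2 e3 by (auto simp: T_def ladd)
  \<comment> \<open>The third dual coordinate, by Cramer's rule.\<close>
  define l3 where "l3 v = det3 e1 e2 v / det3 e1 e2 e3" for v
  have exp: "v = T (l1 v, l2 v, l3 v)" for v
  proof -
    obtain \<alpha> \<beta> \<gamma> where v: "v = tsmul \<alpha> e1 + tsmul \<beta> e2 + tsmul \<gamma> e3" using basis_expansion[OF D] by blast
    have "l1 v = \<alpha>" "l2 v = \<beta>" unfolding v using e1 e2 e3 by (simp_all add: ladd)
    moreover have "det3 e1 e2 v = \<gamma> * det3 e1 e2 e3" unfolding v by (cases e1; cases e2; cases e3; simp add: det3_def algebra_simps)
    ultimately show ?thesis using v D by (simp add: T_def l3_def)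
  qed
  have pT: "pfun (\<lambda>v. f (T v))" if "pfun f" for f
    using pfun_affine[OF that, of 0 e1 e2 e3] by (simp add: T_def)
  have Ts: "T (tsmul t v) = tsmul t (T v)" for t v by (simp add: T_def tsmul_add tsmul_tsmul)
  have hT: "hom n (\<lambda>v. f (T v))" if "hom n f" for n f using that by (simp add: hom_def Ts)
  have l3: "pfun l3" "hom (Suc 0) l3"
  proof -
    obtain x1 y1 z1 x2 y2 z2 where ee: "e1 = (x1, y1, z1)" "e2 = (x2, y2, z2)" by (cases e1, cases e2)
    have l3e: "l3 = (\<lambda>v. (x1 * (y2 * snd (snd v) - z2 * fst (snd v)) - y1 * (x2 * snd (snd v) - z2 * fst v) + z1 * (x2 * fst (snd v) - y2 * fst v)) * (1 / det3 e1 e2 e3))"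
      by (rule ext) (simp add: l3_def det3_def ee case_prod_unfold)
    show "pfun l3" unfolding l3e by (intro pfun_intros)
    show "hom (Suc 0) l3" unfolding l3e hom_def by (simp add: algebra_simps)
  qed
  have l3lin: "l3 (v + w) = l3 v + l3 w" "l3 (tsmul t v) = t * l3 v" for v w t
    using linear_dd[OF l3] dd_lin by metis+
  have ddT: "dd (\<lambda>v. F (T v)) v d = dd F (T v) (T d)" for v d
  proof -
    have "((\<lambda>t. F (T (v + tsmul t d))) has_field_derivative dd (\<lambda>v. F (T v)) (v + tsmul 0 d) d) (at 0)"
      by (rule pfun_line_deriv[OF pT[OF smcD(1)[OF F]]])
    moreover have "((\<lambda>t. F (T v + tsmul t (T d))) has_field_derivative dd F (T v + tsmul 0 (T d)) (T d)) (at 0)"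
      by (rule pfun_line_deriv[OF smcD(1)[OF F]])
    moreover have "T (v + tsmul t d) = T v + tsmul t (T d)" for t
      by (simp add: T_def tsmul_add tsmul_tsmul tsmul_add_left add_ac)
    ultimately show ?thesis by simp (rule DERIV_unique)
  qed
  have smT: "smc (\<lambda>v. F (T v))"
    unfolding smc_def
  proof (intro conjI allI impI)
    show "pfun (\<lambda>v. F (T v))" "hom 3 (\<lambda>v. F (T v))" using pT hT smcD[OF F] by auto
    fix p :: pt assume p: "p \<noteq> 0"
    have "T p \<noteq> 0"
    proof
      assume z: "T p = 0"
      have "fst p = 0" "fst (snd p) = 0" using lT[of p] z l0 by auto
      moreover from this have "tsmul (snd (snd p)) e3 = 0" using z by (simp add: T_def)
      then have "l3 (tsmul (snd (snd p)) e3) = 0" using hom_0[OF l3(2)] by simp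
      then have "snd (snd p) = 0" using D by (simp add: l3lin) (simp add: l3_def)
      ultimately show False using p by (simp add: prod_eq_iff)
    qed
    then obtain e where "dd F (T p) e \<noteq> 0" using smcD(4)[OF F] by blast
    then show "\<exists>e. dd (\<lambda>v. F (T v)) p e \<noteq> 0" using ddT exp by metis
  qed
  obtain f1 f2 f3 f4 f5 f6 f7 f8 f9 f0 where Fc: "\<And>x y z. F (T (x, y, z)) = f1 * x^3 + f2 * x\<^sup>2 * y + f3 * x\<^sup>2 * z + f4 * x * y\<^sup>2 + f5 * x * y * z
     + f6 * x * z\<^sup>2 + f7 * y^3 + f8 * y\<^sup>2 * z + f9 * y * z\<^sup>2 + f0 * z^3"
    using cubic_coeffs[OF smcD(1,2)[OF smT]] by metis
  define Fx where "Fx x y z = 3 * f1 * x\<^sup>2 + 2 * f2 * x * y + 2 * f3 * x * z + f4 * y\<^sup>2 + f5 * y * z + f6 * z\<^sup>2" for x y z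
  define Fy where "Fy x y z = f2 * x\<^sup>2 + 2 * f4 * x * y + f5 * x * z + 3 * f7 * y\<^sup>2 + 2 * f8 * y * z + f9 * z\<^sup>2" for x y z
  define Fz where "Fz x y z = f3 * x\<^sup>2 + f5 * x * y + 2 * f6 * x * z + f8 * y\<^sup>2 + 2 * f9 * y * z + 3 * f0 * z\<^sup>2" for x y z
  have part: "dX (\<lambda>v. F (T v)) (x, y, z) = Fx x y z" "dY (\<lambda>v. F (T v)) (x, y, z) = Fy x y z" "dZ (\<lambda>v. F (T v)) (x, y, z) = Fz x y z" for x y z
    unfolding dX_def dY_def dZ_def Fx_def Fy_def Fz_def by (auto simp: Fc intro!: DERIV_imp_deriv derivative_eq_intros)
  have ddF: "dd F (T (x, y, z)) (T d) = Fx x y z * fst d + Fy x y z * fst (snd d) + Fz x y z * snd (snd d)" for x y z d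
    unfolding ddT[symmetric] by (simp add: dd_def part)
  have Te: "T (1,0,0) = e1" "T (0,1,0) = e2" "T (0,0,1) = e3" by (auto simp: T_def)
  have co: "f0 = F e3" "f6 = dd F e3 e1" "f9 = dd F e3 e2" "f3 = dd F e1 e3" "f8 = dd F e2 e3"
    using Fc[of 0 0 1] ddF[of 0 0 1 "(1,0,0)"] ddF[of 0 0 1 "(0,1,0)"] ddF[of 1 0 0 "(0,0,1)"] ddF[of 0 1 0 "(0,0,1)"]
    unfolding Te by (auto simp: Fx_def Fy_def Fz_def)
  define sol where "sol u \<longleftrightarrow> (\<forall>x y z. x * (u 1 * x + u 2 * y + u 3 * z) * Fx x y z + y * (u 4 * x + u 5 * y + u 6 * z) * Fy x y z
        + (u 7 * x\<^sup>2 + u 8 * x * y + u 9 * x * z + u 10 * y\<^sup>2 + u 11 * y * z + u 12 * z\<^sup>2) * Fz x y z = 0)" for u :: "nat \<Rightarrow> complex"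
  interpret normalized_cubic f0 f1 f2 f3 f4 f5 f6 f7 f8 f9 Fx Fy Fz sol
  proof
    show "sol u \<longleftrightarrow> (\<forall>x y z. x * (u 1 * x + u 2 * y + u 3 * z) * Fx x y z + y * (u 4 * x + u 5 * y + u 6 * z) * Fy x y z
        + (u 7 * x\<^sup>2 + u 8 * x * y + u 9 * x * z + u 10 * y\<^sup>2 + u 11 * y * z + u 12 * z\<^sup>2) * Fz x y z = 0)" for u by (rule sol_def)
    show "x = 0 \<and> y = 0 \<and> z = 0" if "Fx x y z = 0" "Fy x y z = 0" "Fz x y z = 0" for x y z
    proof -
      have "dd (\<lambda>v. F (T v)) (x, y, z) e = 0" for e by (simp add: dd_def part that)
      then have "(x, y, z) = 0" using smcD(4)[OF smT] by blast
      then show ?thesis by (simp add: zero_prod_def)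
    qed
    show "f0 \<noteq> 0 \<and> f6 = 0 \<and> f9 = 0 \<or> f0 = 0 \<and> f3 = 0 \<and> f8 = 0 \<and> f6 \<noteq> 0 \<and> f9 \<noteq> 0"
      using co e1 e2 by auto
    show "a1 = 0 \<and> a2 = 0 \<and> a3 = 0 \<and> b1 = 0 \<and> b2 = 0 \<and> b3 = 0 \<and> c1 = 0 \<and> c2 = 0 \<and> c3 = 0"
      if H: "\<And>x y z. x * y \<noteq> 0 \<Longrightarrow> (a1 * x + a2 * y + a3 * z) * Fx x y z + (b1 * x + b2 * y + b3 * z) * Fy x y z + (c1 * x + c2 * y + c3 * z) * Fz x y z = 0"
      for a1 a2 a3 b1 b2 b3 c1 c2 c3
    proof -
      define L where "L p q r v = p * fst v + q * fst (snd v) + r * snd (snd v)" for p q r and v :: pt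
      have L: "pfun (L p q r)" "hom (Suc 0) (L p q r)" for p q r
        unfolding L_def by (intro pfun_intros) (simp add: hom_def algebra_simps)
      have "dd (\<lambda>v. F (T v)) v (L a1 a2 a3 v, L b1 b2 b3 v, L c1 c2 c3 v) = 0" for v
      proof (rule pfun_eqI_mult[where f = "\<lambda>v. dd (\<lambda>v. F (T v)) v (L a1 a2 a3 v, L b1 b2 b3 v, L c1 c2 c3 v)" and g = "\<lambda>_. 0" and h = "\<lambda>v. fst v * fst (snd v)" and ?v0.0 = "(1,1,0)"])
        show "pfun (\<lambda>v. dd (\<lambda>v. F (T v)) v (L a1 a2 a3 v, L b1 b2 b3 v, L c1 c2 c3 v))"
          by (intro dd_pfun L smcD(1)[OF smT])
        fix v :: pt assume "fst v * fst (snd v) \<noteq> 0"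
        then show "dd (\<lambda>v. F (T v)) v (L a1 a2 a3 v, L b1 b2 b3 v, L c1 c2 c3 v) = 0"
          using H[of "fst v" "fst (snd v)" "snd (snd v)"] part[of "fst v" "fst (snd v)" "snd (snd v)"]
          by (simp add: dd_def L_def algebra_simps)
      qed (auto intro!: pfun_intros)
      from linear_syzygy[OF smT L(1) L(1) L(1) L(2) L(2) L(2) this]
      have z: "L a1 a2 a3 v = 0 \<and> L b1 b2 b3 v = 0 \<and> L c1 c2 c3 v = 0" for v by blast
      show ?thesis using z[of "(1,0,0)"] z[of "(0,1,0)"] z[of "(0,0,1)"] by (auto simp: L_def)
    qed
  qed (simp_all add: Fx_def Fy_def Fz_def)
  define C where "C i v = l3 (a i v, b i v, c i v)" for i v
  have C: "pfun (\<lambda>v. C i v)" "hom 2 (C i)" for i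
  proof -
    show "pfun (\<lambda>v. C i v)" unfolding C_def by (rule pfun_comp[OF l3(1) pf(1) pf(2) pf(3)])
    have "C i (tsmul t v) = t\<^sup>2 * C i v" for t v
      unfolding C_def l3lin(2)[symmetric] by (simp add: homD[OF hm(1)] homD[OF hm(2)] homD[OF hm(3)])
    then show "hom 2 (C i)" by (simp add: hom_def)
  qed
  have "\<exists>u. sol u \<and> (\<forall>x y z. P i (T (x,y,z)) = u 1 * x + u 2 * y + u 3 * z \<and> Q i (T (x,y,z)) = u 4 * x + u 5 * y + u 6 * z
     \<and> C i (T (x,y,z)) = u 7 * x\<^sup>2 + u 8 * x * y + u 9 * x * z + u 10 * y\<^sup>2 + u 11 * y * z + u 12 * z\<^sup>2)" for i
  proof -
    obtain p1 p2 p3 where p: "\<And>x y z. P i (T (x,y,z)) = p1 * x + p2 * y + p3 * z" using lin_coeffs[OF pT[OF PQ(1)] hT[OF PQ(3)]] by metis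
    obtain q1 q2 q3 where q: "\<And>x y z. Q i (T (x,y,z)) = q1 * x + q2 * y + q3 * z" using lin_coeffs[OF pT[OF PQ(2)] hT[OF PQ(4)]] by metis
    obtain c1 c2 c3 c4 c5 c6 where c: "\<And>x y z. C i (T (x,y,z)) = c1 * x\<^sup>2 + c2 * x * y + c3 * x * z + c4 * y\<^sup>2 + c5 * y * z + c6 * z\<^sup>2"
      using quad_coeffs[OF pT[OF C(1)] hT[OF C(2)]] by metis
    \<comment> \<open>The leading 0 is a dummy, so that indices run from 1 to 12.\<close>
    define u where "u n = [0, p1, p2, p3, q1, q2, q3, c1, c2, c3, c4, c5, c6] ! n" for n
    have us: "u 1 = p1" "u 2 = p2" "u 3 = p3" "u 4 = q1" "u 5 = q2" "u 6 = q3" "u 7 = c1" "u 8 = c2" "u 9 = c3" "u 10 = c4" "u 11 = c5" "u 12 = c6"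
      by (simp_all add: u_def)
    have "sol u"
      unfolding sol_def us
    proof (intro allI)
      fix x y z
      let ?\<theta> = "(a i (T (x,y,z)), b i (T (x,y,z)), c i (T (x,y,z)))"
      have "?\<theta> = T (l1 ?\<theta>, l2 ?\<theta>, l3 ?\<theta>)" by (rule exp)
      then have "dd F (T (x,y,z)) (T (l1 ?\<theta>, l2 ?\<theta>, l3 ?\<theta>)) = 0" using syz by metis
      then have "Fx x y z * l1 ?\<theta> + Fy x y z * l2 ?\<theta> + Fz x y z * l3 ?\<theta> = 0" unfolding ddF by simp
      moreover have "l1 ?\<theta> = x * P i (T (x,y,z))" "l2 ?\<theta> = y * Q i (T (x,y,z))" "l3 ?\<theta> = C i (T (x,y,z))"
        unfolding inv lT by (simp_all add: C_def mult.commute)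
      ultimately show "x * (p1 * x + p2 * y + p3 * z) * Fx x y z + y * (q1 * x + q2 * y + q3 * z) * Fy x y z
        + (c1 * x\<^sup>2 + c2 * x * y + c3 * x * z + c4 * y\<^sup>2 + c5 * y * z + c6 * z\<^sup>2) * Fz x y z = 0"
        by (simp only: p q c) (simp add: mult.commute)
    qed
    then show ?thesis using p q c us by (intro exI[of _ u]) simp
  qed
  then obtain u where u: "\<And>i. sol (u i)" "\<And>i x y z. P i (T (x,y,z)) = u i 1 * x + u i 2 * y + u i 3 * z"
    "\<And>i x y z. Q i (T (x,y,z)) = u i 4 * x + u i 5 * y + u i 6 * z"
    "\<And>i x y z. C i (T (x,y,z)) = u i 7 * x\<^sup>2 + u i 8 * x * y + u i 9 * x * z + u i 10 * y\<^sup>2 + u i 11 * y * z + u i 12 * z\<^sup>2" by metis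
  obtain \<alpha> \<beta> where ab: "(\<alpha>, \<beta>) \<noteq> (0, 0)" "\<forall>i\<in>{1..12}. \<alpha> * u 0 i + \<beta> * u 1 i = 0"
    using dependent[OF u(1)[of 0] u(1)[of 1]] by blast
  have z: "\<alpha> * u 0 i + \<beta> * u 1 i = 0" if "1 \<le> i" "i \<le> 12" for i using ab(2) that by auto
  have "\<alpha> * a 0 v + \<beta> * a 1 v = 0 \<and> \<alpha> * b 0 v + \<beta> * b 1 v = 0 \<and> \<alpha> * c 0 v + \<beta> * c 1 v = 0" for v
  proof -
    define x y w where "x = l1 v" and "y = l2 v" and "w = l3 v"
    have v: "v = T (x, y, w)" using exp unfolding x_def y_def w_def .
    have "\<alpha> * P 0 v + \<beta> * P 1 v = (\<alpha> * u 0 1 + \<beta> * u 1 1) * x + (\<alpha> * u 0 2 + \<beta> * u 1 2) * y + (\<alpha> * u 0 3 + \<beta> * u 1 3) * w"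
      unfolding v u(2) by (simp add: algebra_simps)
    then have P0: "\<alpha> * P 0 v + \<beta> * P 1 v = 0" using z[of 1] z[of 2] z[of 3] by simp
    have "\<alpha> * Q 0 v + \<beta> * Q 1 v = (\<alpha> * u 0 4 + \<beta> * u 1 4) * x + (\<alpha> * u 0 5 + \<beta> * u 1 5) * y + (\<alpha> * u 0 6 + \<beta> * u 1 6) * w"
      unfolding v u(3) by (simp add: algebra_simps)
    then have Q0: "\<alpha> * Q 0 v + \<beta> * Q 1 v = 0" using z[of 4] z[of 5] z[of 6] by simp
    have "\<alpha> * C 0 v + \<beta> * C 1 v = (\<alpha> * u 0 7 + \<beta> * u 1 7) * x\<^sup>2 + (\<alpha> * u 0 8 + \<beta> * u 1 8) * x * y + (\<alpha> * u 0 9 + \<beta> * u 1 9) * x * w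
       + (\<alpha> * u 0 10 + \<beta> * u 1 10) * y\<^sup>2 + (\<alpha> * u 0 11 + \<beta> * u 1 11) * y * w + (\<alpha> * u 0 12 + \<beta> * u 1 12) * w\<^sup>2"
      unfolding v u(4) by (simp add: algebra_simps)
    then have C0: "\<alpha> * C 0 v + \<beta> * C 1 v = 0" using z[of 7] z[of 8] z[of 9] z[of 10] z[of 11] z[of 12] by simp
    let ?w = "tsmul \<alpha> (a 0 v, b 0 v, c 0 v) + tsmul \<beta> (a 1 v, b 1 v, c 1 v)"
    have "l1 ?w = (\<alpha> * P 0 v + \<beta> * P 1 v) * l1 v" unfolding ladd inv by (simp add: algebra_simps)
    moreover have "l2 ?w = (\<alpha> * Q 0 v + \<beta> * Q 1 v) * l2 v" unfolding ladd inv by (simp add: algebra_simps)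
    moreover have "l3 ?w = \<alpha> * C 0 v + \<beta> * C 1 v" unfolding l3lin C_def ..
    ultimately have "?w = T (0, 0, 0)" using exp[of ?w] P0 Q0 C0 by simp
    then have "?w = 0" by (simp add: T_def)
    then show ?thesis by (simp add: zero_prod_def)
  qed
  then show ?thesis using ab(1) by blast
qed

section \<open>The divergence identity\<close>

definition dot :: "pt \<Rightarrow> pt \<Rightarrow> complex" where
  "dot a d = fst a * fst d + fst (snd a) * fst (snd d) + snd (snd a) * snd (snd d)"

definition cj :: "pt \<Rightarrow> pt" where
  "cj d = (cnj (fst d), cnj (fst (snd d)), cnj (snd (snd d)))"

definition gr :: "(pt \<Rightarrow> complex) \<Rightarrow> pt \<Rightarrow> pt" where
  "gr f v = (dX f v, dY f v, dZ f v)"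

lemma dot_gr: "dot (gr f v) d = dd f v d" by (simp add: dot_def gr_def dd_def)

lemma dot_lin: "dot (a + b) d = dot a d + dot b d" "dot (tsmul c a) d = c * dot a d" "dot 0 d = 0"
  by (auto simp: dot_def tsmul_def algebra_simps)

lemma cj_simps [simp]: "cj 0 = 0" "cj (cj a) = a" by (auto simp: cj_def zero_prod_def)

text \<open>\<open>A\<close> and \<open>B\<close> are the vectors of holomorphic and antiholomorphic Wirtinger derivatives of \<open>u\<close>.\<close>
definition wd :: "(pt \<Rightarrow> complex) \<Rightarrow> (pt \<Rightarrow> pt) \<Rightarrow> (pt \<Rightarrow> pt) \<Rightarrow> bool" where
  "wd u A B \<longleftrightarrow> continuous_on UNIV A \<and> continuous_on UNIV B \<and>
     (\<forall>v. (u has_derivative (\<lambda>d. dot (A v) d + dot (B v) (cj d))) (at v))"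

lemma wd_has_derivative: "wd u A B \<Longrightarrow> (u has_derivative (\<lambda>d. dot (A v) d + dot (B v) (cj d))) (at v)"
  by (simp add: wd_def)

lemma wd_continuous: "wd u A B \<Longrightarrow> continuous_on S u"
  by (meson continuous_at_imp_continuous_on has_derivative_continuous wd_has_derivative)

lemma continuous_on_tsmul [continuous_intros]:
  "continuous_on S u \<Longrightarrow> continuous_on S A \<Longrightarrow> continuous_on S (\<lambda>v. tsmul (u v) (A v))"
  unfolding tsmul_def by (intro continuous_intros)

lemma continuous_on_cj [continuous_intros]: "continuous_on S A \<Longrightarrow> continuous_on S (\<lambda>v. cj (A v))"
  unfolding cj_def by (intro continuous_intros)

lemma continuous_on_dot [continuous_intros]:
  "continuous_on S A \<Longrightarrow> continuous_on S B \<Longrightarrow> continuous_on S (\<lambda>v. dot (A v) (B v))"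
  unfolding dot_def by (intro continuous_intros)

lemma wd_pfun: assumes "pfun f" shows "wd f (gr f) (\<lambda>_. 0)"
proof -
  have "(f has_derivative (\<lambda>d. dot (gr f v) d + dot 0 (cj d))) (at v)" for v
    using pfun_has_derivative[OF assms, of v] by (simp add: dot_gr[abs_def] dot_lin)
  moreover have "continuous_on UNIV (gr f)"
    unfolding gr_def by (intro continuous_intros pfun_continuous pfun_partials assms)
  ultimately show ?thesis by (simp add: wd_def)
qed

lemma wd_cnj: assumes "wd u A B" shows "wd (\<lambda>v. cnj (u v)) (\<lambda>v. cj (B v)) (\<lambda>v. cj (A v))"
proof -
  have "((\<lambda>v. cnj (u v)) has_derivative (\<lambda>d. dot (cj (B v)) d + dot (cj (A v)) (cj d))) (at v)" for v
    by (rule has_derivative_eq_rhs[OF has_derivative_cnj[OF wd_has_derivative[OF assms]]])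
       (simp add: fun_eq_iff dot_def cj_def)
  then show ?thesis using assms by (auto simp: wd_def intro!: continuous_intros)
qed

lemma wd_mult:
  assumes u: "wd u A B" and w: "wd w A' B'"
  shows "wd (\<lambda>v. u v * w v) (\<lambda>v. tsmul (u v) (A' v) + tsmul (w v) (A v)) (\<lambda>v. tsmul (u v) (B' v) + tsmul (w v) (B v))"
proof -
  have "((\<lambda>v. u v * w v) has_derivative (\<lambda>d. dot (tsmul (u v) (A' v) + tsmul (w v) (A v)) d + dot (tsmul (u v) (B' v) + tsmul (w v) (B v)) (cj d))) (at v)" for v
    by (rule has_derivative_eq_rhs[OF has_derivative_mult[OF wd_has_derivative[OF u] wd_has_derivative[OF w]]])
       (simp add: fun_eq_iff dot_lin algebra_simps)
  moreover have "continuous_on UNIV u" "continuous_on UNIV w" using wd_continuous u w by auto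
  ultimately show ?thesis using assms by (auto simp: wd_def intro!: continuous_intros)
qed

lemma wd_add:
  assumes u: "wd u A B" and w: "wd w A' B'"
  shows "wd (\<lambda>v. u v + w v) (\<lambda>v. A v + A' v) (\<lambda>v. B v + B' v)"
proof -
  have "((\<lambda>v. u v + w v) has_derivative (\<lambda>d. dot (A v + A' v) d + dot (B v + B' v) (cj d))) (at v)" for v
    by (rule has_derivative_eq_rhs[OF has_derivative_add[OF wd_has_derivative[OF u] wd_has_derivative[OF w]]])
       (simp add: fun_eq_iff dot_lin algebra_simps)
  then show ?thesis using assms by (auto simp: wd_def intro!: continuous_intros)
qed

text \<open>Since r is real, the imaginary part of its derivative vanishes. The real chain rule
  therefore multiplies the full complex expression by \<phi>'.\<close>

lemma wd_real:
  fixes \<phi> \<phi>' :: "real \<Rightarrow> real" and r :: "pt \<Rightarrow> real"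
  assumes u: "wd (\<lambda>v. of_real (r v)) A B"
    and \<phi>: "\<And>v. (\<phi> has_field_derivative \<phi>' (r v)) (at (r v))" and c: "continuous_on UNIV (\<lambda>v. \<phi>' (r v))"
  shows "wd (\<lambda>v. of_real (\<phi> (r v))) (\<lambda>v. tsmul (of_real (\<phi>' (r v))) (A v)) (\<lambda>v. tsmul (of_real (\<phi>' (r v))) (B v))"
proof -
  have "((\<lambda>v. of_real (\<phi> (r v))) has_derivative (\<lambda>d. dot (tsmul (of_real (\<phi>' (r v))) (A v)) d + dot (tsmul (of_real (\<phi>' (r v))) (B v)) (cj d))) (at v)" for v
  proof -
    let ?D = "\<lambda>d. dot (A v) d + dot (B v) (cj d)"
    have D: "((\<lambda>v. of_real (r v)) has_derivative ?D) (at v)" by (rule wd_has_derivative[OF u])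
    have "(r has_derivative (\<lambda>d. Re (?D d))) (at v)" using has_derivative_Re[OF D] by simp
    from has_derivative_compose[OF this, of \<phi> "\<lambda>h. \<phi>' (r v) * h"] \<phi>[of v]
    have "((\<lambda>v. \<phi> (r v)) has_derivative (\<lambda>d. \<phi>' (r v) * Re (?D d))) (at v)"
      by (simp add: has_field_derivative_def)
    then have 1: "((\<lambda>v. complex_of_real (\<phi> (r v))) has_derivative (\<lambda>d. of_real (\<phi>' (r v) * Re (?D d)))) (at v)"
      by (rule has_derivative_of_real)
    have "((\<lambda>v. Im (of_real (r v))) has_derivative (\<lambda>d. Im (?D d))) (at v)" by (rule has_derivative_Im[OF D])
    then have "((\<lambda>v::pt. 0::real) has_derivative (\<lambda>d. Im (?D d))) (at v)" by simp
    then have "(\<lambda>d. Im (?D d)) = (\<lambda>d. 0)" using has_derivative_unique has_derivative_const by blast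
    then have "Im (?D d) = 0" for d by (simp only: fun_eq_iff)
    then have re: "of_real (Re (?D d)) = ?D d" for d by (metis complex_eq_iff complex_of_real_def Im_complex_of_real Re_complex_of_real)
    have "(\<lambda>d. of_real (\<phi>' (r v) * Re (?D d))) = (\<lambda>d. dot (tsmul (of_real (\<phi>' (r v))) (A v)) d + dot (tsmul (of_real (\<phi>' (r v))) (B v)) (cj d))"
      unfolding of_real_mult re by (simp add: fun_eq_iff dot_lin distrib_left)
    then show ?thesis using 1 by simp
  qed
  moreover have "continuous_on UNIV (\<lambda>v. complex_of_real (\<phi>' (r v)))" using c by (intro continuous_intros)
  ultimately show ?thesis using u by (auto simp: wd_def intro!: continuous_intros)
qed

text \<open>The difference quotients have integral 0 by translation invariance, and converge to the
  derivative under a bound M on a fixed ball.\<close>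

lemma integral_derivative_eq_0:
  fixes u :: "'a::euclidean_space \<Rightarrow> complex"
  assumes D: "\<And>v. (u has_derivative D v) (at v)" and c: "continuous_on UNIV (\<lambda>v. D v e)"
    and supp: "\<And>v. norm v > R \<Longrightarrow> u v = 0"
  shows "integrable lborel (\<lambda>v. D v e)" "(\<integral>v. D v e \<partial>lborel) = 0"
proof -
  \<comment> \<open>Steps have length at most |e|: the quotients vanish outside K', and segments
    that start in K' stay inside K, where the derivative is bounded.\<close>
  define K where "K = cball (0::'a) (R + 2 * norm e)"
  define K' where "K' = cball (0::'a) (R + norm e)"
  have cu: "continuous_on S u" for S
    by (meson D continuous_at_imp_continuous_on has_derivative_continuous)
  obtain M where M: "M \<ge> 0" "\<And>v. v \<in> K \<Longrightarrow> norm (D v e) \<le> M"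
  proof -
    have "compact ((\<lambda>v. D v e) ` K)" unfolding K_def by (intro compact_continuous_image continuous_on_subset[OF c]) auto
    then show ?thesis using that compact_imp_bounded bounded_pos by (metis image_eqI less_imp_le)
  qed
  have ui: "integrable lborel u"
  proof -
    have "integrable lborel (\<lambda>x. indicator (cball 0 R) x *\<^sub>R u x)"
      by (intro borel_integrable_compact cu) auto
    moreover have "(\<lambda>x. indicator (cball 0 R) x *\<^sub>R u x) = u" using supp by (auto simp: fun_eq_iff indicator_def)
    ultimately show ?thesis by simp
  qed
  have um: "u \<in> borel_measurable borel" by (rule borel_measurable_continuous_onI[OF cu])
  have trans: "integrable lborel (\<lambda>v. u (w + v))" "(\<integral>v. u (w + v) \<partial>lborel) = (\<integral>v. u v \<partial>lborel)" for w
  proof -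
    have "integrable (distr lborel borel ((+) w)) u" using ui by (simp add: lborel_distr_plus)
    then show "integrable lborel (\<lambda>v. u (w + v))" by (subst (asm) integrable_distr_eq) (use um in auto)
    have "(\<integral>v. u v \<partial>lborel) = (\<integral>v. u v \<partial>distr lborel borel ((+) w))" by (simp add: lborel_distr_plus)
    also have "\<dots> = (\<integral>v. u (w + v) \<partial>lborel)" by (rule integral_distr) (use um in auto)
    finally show "(\<integral>v. u (w + v) \<partial>lborel) = (\<integral>v. u v \<partial>lborel)" by simp
  qed
  define t where "t n = 1 / real (Suc n)" for n
  have t: "0 < t n" "t n \<le> 1" for n by (auto simp: t_def)
  have line: "((\<lambda>s. u (v + s *\<^sub>R e)) has_derivative (\<lambda>h. h *\<^sub>R D (v + s *\<^sub>R e) e)) (at s)" for v s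
  proof -
    have lin: "D w (h *\<^sub>R e) = h *\<^sub>R D w e" for w h
      using linear_scale[OF has_derivative_linear[OF D]] .
    have "((\<lambda>s. v + s *\<^sub>R e) has_derivative (\<lambda>h. h *\<^sub>R e)) (at s)" by (auto intro!: derivative_eq_intros)
    from has_derivative_compose[OF this D] show ?thesis by (simp add: lin)
  qed
  define q where "q n v = (1 / t n) *\<^sub>R (u (t n *\<^sub>R e + v) - u v)" for n v
  have qb: "norm (q n v) \<le> indicator K' v *\<^sub>R M" for n v
  proof (cases "v \<in> K'")
    case True
    have "norm (u (v + t n *\<^sub>R e) - u (v + 0 *\<^sub>R e)) \<le> M * norm (t n - 0)"
    proof (rule differentiable_bound[of "{0..t n}" _ "\<lambda>s h. h *\<^sub>R D (v + s *\<^sub>R e) e"])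
      fix s assume s: "s \<in> {0..t n}"
      show "((\<lambda>s. u (v + s *\<^sub>R e)) has_derivative (\<lambda>h. h *\<^sub>R D (v + s *\<^sub>R e) e)) (at s within {0..t n})"
        by (rule has_derivative_at_withinI[OF line])
      have "norm (v + s *\<^sub>R e) \<le> norm v + \<bar>s\<bar> * norm e" using norm_triangle_ineq[of v "s *\<^sub>R e"] by simp
      also have "\<dots> \<le> (R + norm e) + 1 * norm e"
        using True s t[of n] by (intro add_mono mult_right_mono) (auto simp: K'_def)
      finally have "v + s *\<^sub>R e \<in> K" by (simp add: K_def)
      then have b: "norm (D (v + s *\<^sub>R e) e) \<le> M" by (rule M(2))
      show "onorm (\<lambda>h. h *\<^sub>R D (v + s *\<^sub>R e) e) \<le> M"
      proof (rule onorm_bound[OF M(1)])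
        fix h :: real
        show "norm (h *\<^sub>R D (v + s *\<^sub>R e) e) \<le> M * norm h" using mult_left_mono[OF b, of "\<bar>h\<bar>"] by (simp add: mult.commute)
      qed
    qed (use t[of n] in auto)
    then have "norm (u (t n *\<^sub>R e + v) - u v) \<le> M * t n" using t[of n] by (simp add: add.commute)
    then have "norm (q n v) \<le> M" using t[of n] by (simp add: q_def divide_le_eq)
    then show ?thesis using True by simp
  next
    case False
    then have n: "norm v > R + norm e" by (simp add: K'_def)
    moreover have "norm (t n *\<^sub>R e) \<le> norm e" using t[of n] by (simp add: mult_left_le_one_le)
    moreover have "norm v \<le> norm (t n *\<^sub>R e + v) + norm (t n *\<^sub>R e)"
      using norm_triangle_ineq4[of "t n *\<^sub>R e + v" "t n *\<^sub>R e"] by simp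
    ultimately have "norm (t n *\<^sub>R e + v) > R" by linarith
    moreover have "norm v > R" using n norm_ge_zero[of e] by linarith
    ultimately show ?thesis using supp False by (simp add: q_def)
  qed
  have qlim: "(\<lambda>n. q n v) \<longlonglongrightarrow> D v e" for v
  proof -
    have l: "((\<lambda>s. norm (u (v + s *\<^sub>R e) - u v - s *\<^sub>R D v e) / norm s) \<longlongrightarrow> 0) (at 0)"
      using line[of v 0] unfolding has_derivative_at by simp
    have "((\<lambda>s. norm ((1 / s) *\<^sub>R (u (v + s *\<^sub>R e) - u v) - D v e)) \<longlongrightarrow> 0) (at 0)"
    proof (rule Lim_transform_eventually[OF l])
      have "norm (X - s *\<^sub>R d) / norm s = norm ((1 / s) *\<^sub>R X - d)" if "s \<noteq> 0" for X d :: complex and s :: real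
      proof -
        have "(1 / s) *\<^sub>R X - d = (1 / s) *\<^sub>R (X - s *\<^sub>R d)" using that by (simp add: scaleR_diff_right)
        then show ?thesis by simp
      qed
      then show "\<forall>\<^sub>F s in at 0. norm (u (v + s *\<^sub>R e) - u v - s *\<^sub>R D v e) / norm s = norm ((1 / s) *\<^sub>R (u (v + s *\<^sub>R e) - u v) - D v e)"
        by (simp add: eventually_at_filter)
    qed
    then have "((\<lambda>s. (1 / s) *\<^sub>R (u (v + s *\<^sub>R e) - u v)) \<longlongrightarrow> D v e) (at 0)"
      by (simp add: tendsto_norm_zero_iff LIM_zero_iff)
    moreover have "filterlim t (at 0) sequentially"
    proof -
      have "t \<longlonglongrightarrow> 0"
        using LIMSEQ_inverse_real_of_nat unfolding t_def[abs_def] inverse_eq_divide .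
      then show ?thesis unfolding filterlim_at using t by (auto simp: less_imp_neq[THEN not_sym])
    qed
    ultimately have "(\<lambda>n. (1 / t n) *\<^sub>R (u (v + t n *\<^sub>R e) - u v)) \<longlonglongrightarrow> D v e"
      by (rule filterlim_compose)
    then show ?thesis by (simp add: q_def add.commute)
  qed
  have wi: "integrable lborel (\<lambda>v. indicator K' v *\<^sub>R M)"
    unfolding K'_def by (intro borel_integrable_compact) auto
  have Dm: "(\<lambda>v. D v e) \<in> borel_measurable lborel" using borel_measurable_continuous_onI[OF c] by simp
  have qi: "integrable lborel (q n)" for n
    unfolding q_def by (intro integrable_scaleR_right Bochner_Integration.integrable_diff trans ui)
  have dom1: "AE v in lborel. (\<lambda>n. q n v) \<longlonglongrightarrow> D v e" and dom2: "\<And>n. AE v in lborel. norm (q n v) \<le> indicator K' v *\<^sub>R M"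
    using qlim qb by auto
  show "integrable lborel (\<lambda>v. D v e)"
    by (rule integrable_dominated_convergence[OF Dm _ wi dom1 dom2]) (use qi in auto)
  have "(\<lambda>n. integral\<^sup>L lborel (q n)) \<longlonglongrightarrow> (\<integral>v. D v e \<partial>lborel)"
    by (rule integral_dominated_convergence[OF Dm _ wi dom1 dom2]) (use qi in auto)
  moreover have "integral\<^sup>L lborel (q n) = 0" for n
    unfolding q_def using trans ui by (simp add: Bochner_Integration.integral_diff)
  ultimately show "(\<integral>v. D v e \<partial>lborel) = 0" by (simp add: LIMSEQ_const_iff)
qed

text \<open>The holomorphic part of the derivative in direction e is half of D e - i D(ie), and both
  real directional derivatives integrate to 0.\<close>

lemma wd_integral_eq_0:
  assumes u: "wd u A B" and supp: "\<And>v. norm v > R \<Longrightarrow> u v = 0"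
  shows "integrable lborel (\<lambda>v. dot (A v) e)" "(\<integral>v. dot (A v) e \<partial>lborel) = 0"
proof -
  let ?D = "\<lambda>v d. dot (A v) d + dot (B v) (cj d)"
  have AB: "continuous_on UNIV A" "continuous_on UNIV B" using u by (auto simp: wd_def)
  have c: "continuous_on UNIV (\<lambda>v. ?D v d)" for d
    by (intro continuous_intros AB)
  note I = integral_derivative_eq_0[where D = ?D, OF wd_has_derivative[OF u] c supp]
  have "dot (A v) e = (?D v e - \<i> * ?D v (tsmul \<i> e)) / 2" for v
    by (simp add: dot_def cj_def algebra_simps)
  then have eq: "(\<lambda>v. dot (A v) e) = (\<lambda>v. (?D v e - \<i> * ?D v (tsmul \<i> e)) / 2)" by (rule ext)
  show "integrable lborel (\<lambda>v. dot (A v) e)" unfolding eq using I by (intro integrable_divide Bochner_Integration.integrable_diff integrable_mult_right) auto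
  have "(\<integral>v. (?D v e - \<i> * ?D v (tsmul \<i> e)) / 2 \<partial>lborel) = ((\<integral>v. ?D v e \<partial>lborel) - \<i> * (\<integral>v. ?D v (tsmul \<i> e) \<partial>lborel)) / 2"
    using I(1) by (simp add: Bochner_Integration.integral_diff del: integral_add)
  then show "(\<integral>v. dot (A v) e \<partial>lborel) = 0" unfolding eq using I(2) by simp
qed

text \<open>The integrand is the holomorphic divergence of S (T1, T2, T3), expanded by the product
  rule; only S needs bounded support.\<close>

lemma wd_divergence_eq_0:
  assumes S: "wd S AS BS" and T: "wd T1 A1 B1" "wd T2 A2 B2" "wd T3 A3 B3" and supp: "\<And>v. norm v > R \<Longrightarrow> S v = 0"
  shows "integrable lborel (\<lambda>v. S v * (fst (A1 v) + fst (snd (A2 v)) + snd (snd (A3 v))) + dot (AS v) (T1 v, T2 v, T3 v))"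
    "(\<integral>v. S v * (fst (A1 v) + fst (snd (A2 v)) + snd (snd (A3 v))) + dot (AS v) (T1 v, T2 v, T3 v) \<partial>lborel) = 0"
proof -
  note I1 = wd_integral_eq_0[OF wd_mult[OF S T(1)], of R "(1,0,0)"]
  note I2 = wd_integral_eq_0[OF wd_mult[OF S T(2)], of R "(0,1,0)"]
  note I3 = wd_integral_eq_0[OF wd_mult[OF S T(3)], of R "(0,0,1)"]
  have eq: "S v * (fst (A1 v) + fst (snd (A2 v)) + snd (snd (A3 v))) + dot (AS v) (T1 v, T2 v, T3 v) =
    dot (tsmul (S v) (A1 v) + tsmul (T1 v) (AS v)) (1,0,0) + dot (tsmul (S v) (A2 v) + tsmul (T2 v) (AS v)) (0,1,0)
    + dot (tsmul (S v) (A3 v) + tsmul (T3 v) (AS v)) (0,0,1)" for v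
    by (simp add: dot_def algebra_simps)
  have s: "\<And>v. norm v > R \<Longrightarrow> S v * x v = 0" for x using supp by simp
  show "integrable lborel (\<lambda>v. S v * (fst (A1 v) + fst (snd (A2 v)) + snd (snd (A3 v))) + dot (AS v) (T1 v, T2 v, T3 v))"
    unfolding eq by (intro Bochner_Integration.integrable_add I1(1) I2(1) I3(1) s)
  show "(\<integral>v. S v * (fst (A1 v) + fst (snd (A2 v)) + snd (snd (A3 v))) + dot (AS v) (T1 v, T2 v, T3 v) \<partial>lborel) = 0"
    unfolding eq using I1 I2 I3 s by (simp add: Bochner_Integration.integral_add)
qed

section \<open>Cutoff, regularized weight, and passage from integrals to pointwise
  identities\<close>

definition dv :: "(pt \<Rightarrow> complex) \<Rightarrow> (pt \<Rightarrow> complex) \<Rightarrow> (pt \<Rightarrow> complex) \<Rightarrow> pt \<Rightarrow> complex" where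
  "dv a b c v = dX a v + dY b v + dZ c v"

lemma pfun_dv: "pfun a \<Longrightarrow> pfun b \<Longrightarrow> pfun c \<Longrightarrow> pfun (dv a b c)"
  unfolding dv_def by (intro pfun_intros pfun_partials)

text \<open>A C^1 function of |v|^2, positive exactly for 1 < |v| < 2; the square makes the positive
  part differentiable.\<close>

definition bump :: "real \<Rightarrow> real" where "bump x = (max 0 ((x - 1) * (4 - x)))\<^sup>2"
definition bump' :: "real \<Rightarrow> real" where "bump' x = 2 * max 0 ((x - 1) * (4 - x)) * (5 - 2 * x)"

lemma bump_deriv: "(bump has_field_derivative bump' x) (at x)"
proof -
  have sq: "((\<lambda>y::real. (max 0 y)\<^sup>2) has_field_derivative 2 * max 0 y) (at y)" for y
  proof -
    consider "y > 0" | "y < 0" | "y = 0" by linarith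
    then show ?thesis
    proof cases
      case 1
      have "((\<lambda>y::real. y\<^sup>2) has_field_derivative 2 * max 0 y) (at y)" using 1 by (auto intro!: derivative_eq_intros)
      then show ?thesis
        by (rule DERIV_cong_ev[OF refl _ refl, THEN iffD1, rotated])
           (use 1 eventually_nhds_in_open[of "{0<..}" y] in \<open>auto elim!: eventually_mono\<close>)
    next
      case 2
      have "((\<lambda>y::real. 0) has_field_derivative 2 * max 0 y) (at y)" using 2 by auto
      then show ?thesis
        by (rule DERIV_cong_ev[OF refl _ refl, THEN iffD1, rotated])
           (use 2 eventually_nhds_in_open[of "{..<0}" y] in \<open>auto elim!: eventually_mono\<close>)
    next
      case 3
      have "((\<lambda>h. (max 0 h)\<^sup>2 / h) \<longlongrightarrow> 0) (at (0::real))"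
      proof (rule Lim_null_comparison)
        show "\<forall>\<^sub>F h in at (0::real). norm ((max 0 h)\<^sup>2 / h) \<le> \<bar>h\<bar>"
          by (rule always_eventually) (auto simp: max_def power2_eq_square)
        show "((\<lambda>h. \<bar>h\<bar>) \<longlongrightarrow> 0) (at (0::real))" using tendsto_rabs[OF tendsto_ident_at[of "0::real" UNIV]] by simp
      qed
      then show ?thesis using 3 by (simp add: DERIV_def)
    qed
  qed
  have "((\<lambda>x. (x - 1) * (4 - x)) has_field_derivative (5 - 2 * x)) (at x)"
    by (auto intro!: derivative_eq_intros)
  from DERIV_chain2[OF sq this] show ?thesis by (simp add: bump_def[abs_def] bump'_def)
qed

lemma bump_props: "bump x \<ge> 0" "x \<le> 1 \<Longrightarrow> bump x = 0" "x \<ge> 4 \<Longrightarrow> bump x = 0" "1 < x \<Longrightarrow> x < 4 \<Longrightarrow> bump x > 0"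
proof -
  show "bump x \<ge> 0" by (simp add: bump_def)
  show "bump x = 0" if "x \<le> 1"
    using mult_nonpos_nonneg[of "x - 1" "4 - x"] that by (simp add: bump_def)
  show "bump x = 0" if "x \<ge> 4"
    using mult_nonneg_nonpos[of "x - 1" "4 - x"] that by (simp add: bump_def)
  show "bump x > 0" if "1 < x" "x < 4"
    using mult_pos_pos[of "x - 1" "4 - x"] that by (simp add: bump_def)
qed

lemma continuous_on_bump' [continuous_intros]: "continuous_on S r \<Longrightarrow> continuous_on S (\<lambda>v. bump' (r v))"
  unfolding bump'_def by (intro continuous_intros)

lemma continuous_on_bump [continuous_intros]: "continuous_on S r \<Longrightarrow> continuous_on S (\<lambda>v. bump (r v))"
  unfolding bump_def by (intro continuous_intros)

definition nsq :: "pt \<Rightarrow> real" where "nsq v = (norm v)\<^sup>2"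

lemma nsq_dot: "of_real (nsq v) = dot v (cj v)"
proof -
  have "nsq v = (norm (fst v))\<^sup>2 + (norm (fst (snd v)))\<^sup>2 + (norm (snd (snd v)))\<^sup>2"
    by (simp add: nsq_def norm_prod_def)
  then show ?thesis by (simp add: dot_def cj_def complex_norm_square[symmetric])
qed

lemma wd_nsq: "wd (\<lambda>v. of_real (nsq v)) cj (\<lambda>v. v)"
proof -
  have "((\<lambda>v. dot v (cj v)) has_derivative (\<lambda>d. dot (cj v) d + dot v (cj d))) (at v)" for v
    unfolding dot_def cj_def by (rule has_derivative_eq_rhs, (rule derivative_intros)+) (simp add: fun_eq_iff algebra_simps)
  moreover have "(\<lambda>v. complex_of_real (nsq v)) = (\<lambda>v. dot v (cj v))" by (simp add: nsq_dot)
  ultimately show ?thesis by (auto simp: wd_def intro!: continuous_intros)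
qed

lemma continuous_nsq [continuous_intros]: "continuous_on S nsq"
  unfolding nsq_def[abs_def] by (intro continuous_intros)

lemma wd_bump: "wd (\<lambda>v. of_real (bump (nsq v))) (\<lambda>v. tsmul (of_real (bump' (nsq v))) (cj v)) (\<lambda>v. tsmul (of_real (bump' (nsq v))) v)"
  by (rule wd_real[OF wd_nsq bump_deriv]) (intro continuous_intros)

text \<open>The regularization by \<epsilon> of |f|^(-2\<beta>), which is continuously
  differentiable also on f = 0.\<close>

definition wt :: "real \<Rightarrow> real \<Rightarrow> (pt \<Rightarrow> complex) \<Rightarrow> pt \<Rightarrow> real" where
  "wt \<beta> \<epsilon> f v = ((norm (f v))\<^sup>2 + \<epsilon>) powr (- \<beta>)"

lemma wt_pos: "\<epsilon> > 0 \<Longrightarrow> wt \<beta> \<epsilon> f v > 0" unfolding wt_def by (smt (verit) zero_le_power2 powr_gt_zero)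

lemma wd_wt:
  assumes f: "pfun f" and e: "\<epsilon> > 0"
  shows "\<exists>B. wd (\<lambda>v. of_real (wt \<beta> \<epsilon> f v)) (\<lambda>v. tsmul (of_real (- \<beta> * wt \<beta> \<epsilon> f v / ((norm (f v))\<^sup>2 + \<epsilon>))) (tsmul (cnj (f v)) (gr f v))) B"
proof -
  have pos: "(norm (f v))\<^sup>2 + \<epsilon> > 0" for v using e by (simp add: add_nonneg_pos)
  have ce: "wd (\<lambda>_. of_real \<epsilon>) (\<lambda>_. 0) (\<lambda>_. 0)"
    by (auto simp: wd_def dot_lin)
  have "(\<lambda>v. f v * cnj (f v) + of_real \<epsilon>) = (\<lambda>v. of_real ((norm (f v))\<^sup>2 + \<epsilon>))"
    by (simp add: complex_norm_square del: of_real_power)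
  then have w: "wd (\<lambda>v. of_real ((norm (f v))\<^sup>2 + \<epsilon>)) (\<lambda>v. tsmul (cnj (f v)) (gr f v)) (\<lambda>v. tsmul (f v) (cj (gr f v)))"
    using wd_add[OF wd_mult[OF wd_pfun[OF f] wd_cnj[OF wd_pfun[OF f]]] ce] by (simp add: fun_eq_iff)
  have c: "continuous_on UNIV (\<lambda>v. (norm (f v))\<^sup>2 + \<epsilon>)" by (intro continuous_intros pfun_continuous f)
  have "wd (\<lambda>v. of_real (((norm (f v))\<^sup>2 + \<epsilon>) powr (- \<beta>)))
    (\<lambda>v. tsmul (of_real (- \<beta> * ((norm (f v))\<^sup>2 + \<epsilon>) powr (- \<beta> - 1))) (tsmul (cnj (f v)) (gr f v)))
    (\<lambda>v. tsmul (of_real (- \<beta> * ((norm (f v))\<^sup>2 + \<epsilon>) powr (- \<beta> - 1))) (tsmul (f v) (cj (gr f v))))"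
  proof (rule wd_real[OF w, where \<phi> = "\<lambda>x. x powr (- \<beta>)" and \<phi>' = "\<lambda>x. - \<beta> * x powr (- \<beta> - 1)"])
    show "((\<lambda>x. x powr (- \<beta>)) has_field_derivative - \<beta> * ((norm (f v))\<^sup>2 + \<epsilon>) powr (- \<beta> - 1)) (at ((norm (f v))\<^sup>2 + \<epsilon>))" for v
      using has_real_derivative_powr[where r = "- \<beta>", OF pos[of v]] .
    show "continuous_on UNIV (\<lambda>v. - \<beta> * ((norm (f v))\<^sup>2 + \<epsilon>) powr (- \<beta> - 1))"
      using pos by (intro continuous_intros c) (auto simp: less_imp_neq[THEN not_sym])
  qed
  moreover have "x powr (- \<beta> - 1) = x powr (- \<beta>) / x" if "x > 0" for x :: real
    using that by (simp add: powr_diff)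
  ultimately show ?thesis using pos by (auto simp: wt_def)
qed

lemma continuous_wt: "pfun f \<Longrightarrow> \<epsilon> > 0 \<Longrightarrow> continuous_on S (wt \<beta> \<epsilon> f)"
  unfolding wt_def[abs_def] by (intro continuous_intros pfun_continuous) (auto, metis add_nonneg_pos less_irrefl zero_le_power2)

lemma wt_antimono: assumes "0 \<le> \<beta>" "0 < \<epsilon>" "\<epsilon> \<le> \<epsilon>'" shows "wt \<beta> \<epsilon>' f v \<le> wt \<beta> \<epsilon> f v"
  unfolding wt_def using assms by (intro powr_mono2') (auto simp: add_nonneg_pos)

lemma pfun_open_zero:
  assumes "pfun h" "open V" "v1 \<in> V" "\<And>v. v \<in> V \<Longrightarrow> h v = 0"
  shows "h w = 0"
proof -
  obtain p where p: "\<And>t. h (v1 + tsmul t (w - v1)) = poly p t" using pfun_line[OF assms(1)] by metis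
  have "isCont (\<lambda>t. v1 + tsmul t (w - v1)) 0" by (rule has_derivative_continuous[OF has_derivative_tsmul])
  then have "((\<lambda>t. v1 + tsmul t (w - v1)) \<longlongrightarrow> v1 + tsmul 0 (w - v1)) (nhds 0)"
    unfolding isCont_def by (rule tendsto_at_iff_tendsto_nhds[of "\<lambda>t. v1 + tsmul t (w - v1)" 0, THEN iffD1])
  then have "((\<lambda>t. v1 + tsmul t (w - v1)) \<longlongrightarrow> v1) (nhds 0)" by simp
  then have "\<forall>\<^sub>F t in nhds 0. v1 + tsmul t (w - v1) \<in> V"
    using assms(2,3) by (rule topological_tendstoD)
  then obtain d where d: "d > 0" "\<And>t. dist t 0 < d \<Longrightarrow> v1 + tsmul t (w - v1) \<in> V"
    unfolding eventually_nhds_metric by blast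
  have "poly p t = 0" if "t \<in> ball 0 d" for t
    using d(2)[of t] that p[of t] assms(4) by (simp add: dist_commute)
  then have "ball 0 d \<subseteq> {t. poly p t = 0}" by blast
  moreover have "infinite (ball (0::complex) d)"
    using uncountable_ball[OF d(1)] countable_finite by blast
  ultimately have "p = 0" using poly_roots_finite[of p] finite_subset by blast
  then show ?thesis using p[of 1] by simp
qed

lemma integral_pos_imp_zero:
  fixes k :: "'a::euclidean_space \<Rightarrow> real"
  assumes "continuous_on UNIV k" "\<And>v. k v \<ge> 0" "integrable lborel k" "(\<integral>v. k v \<partial>lborel) \<le> 0"
  shows "k v = 0"
proof -
  have "(\<integral>v. k v \<partial>lborel) = 0" using assms(2,4) by (simp add: antisym Bochner_Integration.integral_nonneg)
  then have "AE v in lborel. k v = 0" using integral_nonneg_eq_0_iff_AE[OF assms(3)] assms(2) by simp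
  have o: "open {v. k v \<noteq> 0}" using assms(1) by (intro open_Collect_neq continuous_intros)
  then have "{v. k v \<noteq> 0} \<in> null_sets lborel"
    using \<open>AE v in lborel. k v = 0\<close> by (subst AE_iff_null_sets) auto
  then have n: "negligible {v. k v \<noteq> 0}"
    by (simp add: negligible_iff_null_sets null_sets_completionI)
  then have "{v. k v \<noteq> 0} = {}" using n o open_not_negligible by blast
  then show ?thesis by blast
qed

lemma continuous_bounded_pos:
  fixes u :: "'a::topological_space \<Rightarrow> 'b::real_normed_vector"
  assumes "compact K" "continuous_on K u"
  obtains M where "M \<ge> 1" "\<And>v. v \<in> K \<Longrightarrow> norm (u v) \<le> M"
proof -
  obtain M where "\<And>v. v \<in> K \<Longrightarrow> norm (u v) \<le> M"
    using compact_imp_bounded[OF compact_continuous_image[OF assms(2,1)]] by (auto simp: bounded_iff)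
  then show ?thesis using that[of "max M 1"] by (auto simp: le_max_iff_disj)
qed

text \<open>With \<open>h = div \<theta> - \<beta>\<^sub>2 c'\<close> and \<open>T = |v|\<^sup>2 \<theta> - \<langle>\<theta>, v\<rangle> v\<close>, which is tangent to the spheres, the field
  \<open>\<psi>(|v|\<^sup>2) (|f|\<^sup>2 + \<epsilon>)^(-\<beta>\<^sub>1) (|g|\<^sup>2 + \<epsilon>)^(-\<beta>\<^sub>2) cnj h T\<close> has compact support away from 0. By the
  degree condition the terms with \<open>\<langle>\<theta>, v\<rangle>\<close> in its divergence cancel up to an error that vanishes with \<open>\<epsilon>\<close>, and what remains is
  a positive multiple of \<open>|h|\<^sup>2\<close>.\<close>
theorem twisted_divergence:
  fixes \<beta>1 \<beta>2 :: real and m mg r :: nat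
  assumes f: "pfun f" "hom m f" and g: "pfun g" "hom mg g" and H: "pfun H" "\<And>v. f v = g v * H v"
    and abc: "pfun a" "pfun b" "pfun c" "hom r a" "hom r b" "hom r c"
    and \<theta>f: "\<And>v. dd f v (a v, b v, c v) = 0" and \<theta>g: "\<And>v. dd g v (a v, b v, c v) = c' v * g v" "pfun c'"
    and \<beta>: "\<beta>1 \<ge> 0" "\<beta>2 \<ge> 0" "\<beta>1 * m + \<beta>2 * mg = r + 2" "\<beta>1 + \<beta>2 < 2 / 3"
    and int: "\<And>b K. 0 \<le> b \<Longrightarrow> b < 2 / 3 \<Longrightarrow> compact K \<Longrightarrow> 0 \<notin> K \<Longrightarrow> (\<integral>\<^sup>+v\<in>K. ipow (2 * b) (norm (f v)) \<partial>lborel) < \<infinity>"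
  shows "dv a b c v = of_real \<beta>2 * c' v"
proof -
  define h where "h v = dv a b c v - of_real \<beta>2 * c' v" for v
  have ph: "pfun h" unfolding h_def by (intro pfun_intros pfun_dv abc \<theta>g)
  \<comment> \<open>The Hermitian product of the field with the position vector v.\<close>
  define \<Theta> where "\<Theta> v = a v * cnj (fst v) + b v * cnj (fst (snd v)) + c v * cnj (snd (snd v))" for v
  define T where "T q p v = of_real (nsq v) * q v + (- 1) * (\<Theta> v * p v)" for q p v
  define Tv where "Tv v = (T a fst v, T b (\<lambda>v. fst (snd v)) v, T c (\<lambda>v. snd (snd v)) v)" for v
  define A\<Theta> where "A\<Theta> v = tsmul (cnj (fst v)) (gr a v) + tsmul (cnj (fst (snd v))) (gr b v) + tsmul (cnj (snd (snd v))) (gr c v)" for v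
  have wd\<Theta>: "\<exists>B. wd \<Theta> A\<Theta> B"
  proof -
    note X = wd_mult[OF wd_pfun[OF abc(1)] wd_cnj[OF wd_pfun[OF pfun_X]]]
    note Y = wd_mult[OF wd_pfun[OF abc(2)] wd_cnj[OF wd_pfun[OF pfun_Y]]]
    note Z = wd_mult[OF wd_pfun[OF abc(3)] wd_cnj[OF wd_pfun[OF pfun_Z]]]
    have "tsmul x 0 + (y::pt) = y" for x y by simp
    then show ?thesis using wd_add[OF wd_add[OF X Y] Z] unfolding \<Theta>_def[abs_def] A\<Theta>_def[abs_def] by (auto simp: cj_simps)
  qed
  have wdT: "\<exists>B. wd (T q p) (\<lambda>v. tsmul (of_real (nsq v)) (gr q v) + tsmul (q v) (cj v) + tsmul (- 1) (tsmul (\<Theta> v) (gr p v) + tsmul (p v) (A\<Theta> v))) B"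
    if "pfun q" "pfun p" for q p
  proof -
    obtain B where B: "wd \<Theta> A\<Theta> B" using wd\<Theta> by blast
    have cst: "wd (\<lambda>_. - 1) (\<lambda>_. 0) (\<lambda>_. 0)" by (auto simp: wd_def dot_lin)
    note W = wd_add[OF wd_mult[OF wd_nsq wd_pfun[OF that(1)]] wd_mult[OF cst wd_mult[OF B wd_pfun[OF that(2)]]]]
    show ?thesis unfolding T_def[abs_def]
      using W by (auto intro!: exI)
  qed
  have grc: "gr (\<lambda>v. fst v) v = (1, 0, 0)" "gr (\<lambda>v. fst (snd v)) v = (0, 1, 0)" "gr (\<lambda>v. snd (snd v)) v = (0, 0, 1)" for v
    by (cases v; simp add: gr_def dX_def dY_def dZ_def)+
  let ?div = "\<lambda>v. fst (tsmul (of_real (nsq v)) (gr a v) + tsmul (a v) (cj v) + tsmul (- 1) (tsmul (\<Theta> v) (gr (\<lambda>v. fst v) v) + tsmul (fst v) (A\<Theta> v)))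
    + fst (snd (tsmul (of_real (nsq v)) (gr b v) + tsmul (b v) (cj v) + tsmul (- 1) (tsmul (\<Theta> v) (gr (\<lambda>v. fst (snd v)) v) + tsmul (fst (snd v)) (A\<Theta> v))))
    + snd (snd (tsmul (of_real (nsq v)) (gr c v) + tsmul (c v) (cj v) + tsmul (- 1) (tsmul (\<Theta> v) (gr (\<lambda>v. snd (snd v)) v) + tsmul (snd (snd v)) (A\<Theta> v))))"
  \<comment> \<open>Origin of r + 2: the divergence of |v|^2 \<theta> contributes +\<Theta>, that of
    \<Theta> v contributes 3 \<Theta> from the dimension and r \<Theta> from Euler's
    identity.\<close>
  have divT: "?div v = of_real (nsq v) * dv a b c v - of_nat (r + 2) * \<Theta> v" for v
  proof -
    have "?div v = of_real (nsq v) * dv a b c v + \<Theta> v - 3 * \<Theta> v -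
      (cnj (fst v) * dd a v v + cnj (fst (snd v)) * dd b v v + cnj (snd (snd v)) * dd c v v)"
      unfolding grc by (simp add: gr_def dv_def A\<Theta>_def dd_def \<Theta>_def cj_def algebra_simps)
    also have "cnj (fst v) * dd a v v + cnj (fst (snd v)) * dd b v v + cnj (snd (snd v)) * dd c v v = of_nat r * \<Theta> v"
      using euler[OF abc(1,4)] euler[OF abc(2,5)] euler[OF abc(3,6)] by (simp add: \<Theta>_def algebra_simps)
    finally show ?thesis by (simp add: algebra_simps)
  qed
  have Tv: "Tv v = tsmul (of_real (nsq v)) (a v, b v, c v) - tsmul (\<Theta> v) v" for v
    by (simp add: Tv_def T_def tsmul_def prod_eq_iff)
  have Tf: "dd f v (Tv v) = - (of_nat m * \<Theta> v * f v)" for v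
    unfolding Tv dd_lin \<theta>f euler[OF f] by simp
  have Tg: "dd g v (Tv v) = (of_real (nsq v) * c' v - of_nat mg * \<Theta> v) * g v" for v
    unfolding Tv dd_lin \<theta>g euler[OF g] by (simp add: algebra_simps)
  \<comment> \<open>Tangency to the spheres: the gradient of the cutoff is a multiple of
    \<open>cj v\<close> and drops out.\<close>
  have Tn: "dot (cj v) (Tv v) = 0" for v
  proof -
    have "dot (cj v) (a v, b v, c v) = \<Theta> v" "dot (cj v) v = of_real (nsq v)"
      by (auto simp: dot_def cj_def \<Theta>_def nsq_dot)
    moreover have "dot (cj v) (x - y) = dot (cj v) x - dot (cj v) y" "dot (cj v) (tsmul s x) = s * dot (cj v) x" for x y s
      by (auto simp: dot_def algebra_simps)
    ultimately show ?thesis unfolding Tv by (simp del: tsmul_simps)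
  qed
  define K where "K = cball (0::pt) 2 - ball 0 1"
  have K: "compact K" "0 \<notin> K" unfolding K_def by (auto intro!: compact_diff)
  have bK: "bump (nsq v) = 0" if "v \<notin> K" for v
  proof -
    have "norm v < 1 \<or> norm v > 2" using that by (auto simp: K_def)
    then have "(norm v)\<^sup>2 \<le> 1\<^sup>2 \<or> (norm v)\<^sup>2 \<ge> 2\<^sup>2" using power_mono[of "norm v" 1 2] power_mono[of 2 "norm v" 2] by auto
    then show ?thesis using bump_props(2,3) by (auto simp: nsq_def)
  qed
  \<comment> \<open>Half of the room left below 2/3: b' exceeds \<beta>1 + \<beta>2 by s and still
    satisfies the integrability hypothesis.\<close>
  define s where "s = (2 / 3 - (\<beta>1 + \<beta>2)) / 2"
  define b' where "b' = \<beta>1 + \<beta>2 + s"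
  have s: "0 < s" "s \<le> 1" "0 \<le> b'" "b' < 2 / 3"
  proof -
    show "0 < s" "s \<le> 1" unfolding s_def using \<beta> by auto
    show "0 \<le> b'" unfolding s_def b'_def using \<beta> by auto
    have "y + (2 / 3 - y) / 2 < 2 / 3" if "y < 2 / 3" for y :: real using that by (simp add: field_simps)
    then show "b' < 2 / 3" unfolding s_def b'_def using \<beta>(4) by blast
  qed
  define W where "W \<epsilon> v = wt \<beta>1 \<epsilon> f v * wt \<beta>2 \<epsilon> g v" for \<epsilon> v
  define xf where "xf \<epsilon> v = \<epsilon> / ((norm (f v))\<^sup>2 + \<epsilon>)" for \<epsilon> v
  define xg where "xg \<epsilon> v = \<epsilon> / ((norm (g v))\<^sup>2 + \<epsilon>)" for \<epsilon> v
  \<comment> \<open>Differentiating the regularized weights produces |f|^2/(|f|^2 + \<epsilon>) = 1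
    - xf, and likewise for g. The parts with 1 cancel all \<Theta> terms through the degree
    condition and leave |v|^2 h; E collects the defects xf and xg.\<close>
  define E where "E \<epsilon> v = - (of_real (\<beta>1 * m) * \<Theta> v * of_real (xf \<epsilon> v)) + (of_real \<beta>2 * (of_real (nsq v) * c' v - of_nat mg * \<Theta> v)) * of_real (xg \<epsilon> v)" for \<epsilon> v
  have main: "integrable lborel (\<lambda>v. of_real (bump (nsq v) * W \<epsilon> v) * cnj (h v) * (of_real (nsq v) * h v + E \<epsilon> v))"
    "(\<integral>v. of_real (bump (nsq v) * W \<epsilon> v) * cnj (h v) * (of_real (nsq v) * h v + E \<epsilon> v) \<partial>lborel) = 0" if e: "\<epsilon> > 0" for \<epsilon>
  proof -
    have pf: "(norm (f v))\<^sup>2 + \<epsilon> > 0" "(norm (g v))\<^sup>2 + \<epsilon> > 0" for v using e by (simp_all add: add_nonneg_pos)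
    define A1 where "A1 v = tsmul (of_real (- \<beta>1 * wt \<beta>1 \<epsilon> f v / ((norm (f v))\<^sup>2 + \<epsilon>))) (tsmul (cnj (f v)) (gr f v))" for v
    define A2 where "A2 v = tsmul (of_real (- \<beta>2 * wt \<beta>2 \<epsilon> g v / ((norm (g v))\<^sup>2 + \<epsilon>))) (tsmul (cnj (g v)) (gr g v))" for v
    obtain B1 where B1: "wd (\<lambda>v. of_real (wt \<beta>1 \<epsilon> f v)) A1 B1" using wd_wt[OF f(1) e] unfolding A1_def by blast
    obtain B2 where B2: "wd (\<lambda>v. of_real (wt \<beta>2 \<epsilon> g v)) A2 B2" using wd_wt[OF g(1) e] unfolding A2_def by blast
    define S where "S v = (of_real (bump (nsq v)) * cnj (h v)) * (of_real (wt \<beta>1 \<epsilon> f v) * of_real (wt \<beta>2 \<epsilon> g v))" for v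
    define AS where "AS v = tsmul (of_real (bump (nsq v)) * cnj (h v)) (tsmul (of_real (wt \<beta>1 \<epsilon> f v)) (A2 v) + tsmul (of_real (wt \<beta>2 \<epsilon> g v)) (A1 v))
      + tsmul (of_real (wt \<beta>1 \<epsilon> f v) * of_real (wt \<beta>2 \<epsilon> g v)) (tsmul (of_real (bump (nsq v))) (cj 0) + tsmul (cnj (h v)) (tsmul (of_real (bump' (nsq v))) (cj v)))" for v
    obtain BS where wS: "wd S AS BS"
      using wd_mult[OF wd_mult[OF wd_bump wd_cnj[OF wd_pfun[OF ph]]] wd_mult[OF B1 B2]] unfolding S_def[abs_def] AS_def[abs_def] by blast
    have S0: "S v = 0" if "norm v > 2" for v using bK[of v] that by (simp add: S_def K_def)
    obtain C1 C2 C3 where wT: "wd (T a (\<lambda>v. fst v)) (\<lambda>v. tsmul (of_real (nsq v)) (gr a v) + tsmul (a v) (cj v) + tsmul (- 1) (tsmul (\<Theta> v) (gr (\<lambda>v. fst v) v) + tsmul (fst v) (A\<Theta> v))) C1"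
      "wd (T b (\<lambda>v. fst (snd v))) (\<lambda>v. tsmul (of_real (nsq v)) (gr b v) + tsmul (b v) (cj v) + tsmul (- 1) (tsmul (\<Theta> v) (gr (\<lambda>v. fst (snd v)) v) + tsmul (fst (snd v)) (A\<Theta> v))) C2"
      "wd (T c (\<lambda>v. snd (snd v))) (\<lambda>v. tsmul (of_real (nsq v)) (gr c v) + tsmul (c v) (cj v) + tsmul (- 1) (tsmul (\<Theta> v) (gr (\<lambda>v. snd (snd v)) v) + tsmul (snd (snd v)) (A\<Theta> v))) C3"
      using wdT[OF abc(1) pfun_X] wdT[OF abc(2) pfun_Y] wdT[OF abc(3) pfun_Z] by blast
    have gen: "(- w * x / D) * (y * (R * z)) = - (x * (w * R * (z * y / D)))" for w x D y R z :: complex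
      by simp
    have d1: "dot (A1 v) (Tv v) = of_real (wt \<beta>1 \<epsilon> f v) * (of_real (\<beta>1 * m) * \<Theta> v * (1 - of_real (xf \<epsilon> v)))" for v
    proof -
      have "dot (A1 v) (Tv v) = of_real (- \<beta>1 * wt \<beta>1 \<epsilon> f v / ((norm (f v))\<^sup>2 + \<epsilon>)) * (cnj (f v) * (- (of_nat m * \<Theta> v * f v)))"
        unfolding A1_def dot_lin dot_gr Tf ..
      also have "\<dots> = of_real (wt \<beta>1 \<epsilon> f v) * (of_real (\<beta>1 * m) * \<Theta> v * (of_real ((norm (f v))\<^sup>2 / ((norm (f v))\<^sup>2 + \<epsilon>))))"
        by (simp only: of_real_divide of_real_mult complex_norm_square of_real_minus) (simp add: algebra_simps)
      also have "(norm (f v))\<^sup>2 / ((norm (f v))\<^sup>2 + \<epsilon>) = 1 - xf \<epsilon> v"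
        using pf(1)[of v] by (simp add: xf_def field_simps)
      finally show ?thesis by simp
    qed
    have d2: "dot (A2 v) (Tv v) = - (of_real (wt \<beta>2 \<epsilon> g v) * (of_real \<beta>2 * (of_real (nsq v) * c' v - of_nat mg * \<Theta> v) * (1 - of_real (xg \<epsilon> v))))" for v
    proof -
      have "dot (A2 v) (Tv v) = of_real (- \<beta>2 * wt \<beta>2 \<epsilon> g v / ((norm (g v))\<^sup>2 + \<epsilon>)) * (cnj (g v) * ((of_real (nsq v) * c' v - of_nat mg * \<Theta> v) * g v))"
        unfolding A2_def dot_lin dot_gr Tg ..
      also have "\<dots> = - (of_real (wt \<beta>2 \<epsilon> g v) * (of_real \<beta>2 * (of_real (nsq v) * c' v - of_nat mg * \<Theta> v) * (of_real ((norm (g v))\<^sup>2 / ((norm (g v))\<^sup>2 + \<epsilon>)))))"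
        unfolding of_real_divide of_real_mult of_real_minus complex_norm_square by (rule gen)
      also have "(norm (g v))\<^sup>2 / ((norm (g v))\<^sup>2 + \<epsilon>) = 1 - xg \<epsilon> v"
        using pf(2)[of v] by (simp add: xg_def field_simps)
      finally show ?thesis by simp
    qed
    have eq: "S v * ?div v + dot (AS v) (T a (\<lambda>v. fst v) v, T b (\<lambda>v. fst (snd v)) v, T c (\<lambda>v. snd (snd v)) v)
      = of_real (bump (nsq v) * W \<epsilon> v) * cnj (h v) * (of_real (nsq v) * h v + E \<epsilon> v)" for v
    proof -
      have "(T a (\<lambda>v. fst v) v, T b (\<lambda>v. fst (snd v)) v, T c (\<lambda>v. snd (snd v)) v) = Tv v" by (simp add: Tv_def)
      then have "S v * ?div v + dot (AS v) (T a (\<lambda>v. fst v) v, T b (\<lambda>v. fst (snd v)) v, T c (\<lambda>v. snd (snd v)) v) =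
         S v * (of_real (nsq v) * dv a b c v - of_nat (r + 2) * \<Theta> v) + dot (AS v) (Tv v)"
        using divT[of v] by (simp only:)
      also have "dot (AS v) (Tv v) = S v * (of_real (\<beta>1 * m) * \<Theta> v * (1 - of_real (xf \<epsilon> v)) - of_real \<beta>2 * (of_real (nsq v) * c' v - of_nat mg * \<Theta> v) * (1 - of_real (xg \<epsilon> v)))"
        unfolding AS_def dot_lin cj_simps Tn d1 d2 S_def by (simp add: algebra_simps)
      also have "of_nat (r + 2) = complex_of_real \<beta>1 * of_nat m + of_real \<beta>2 * of_nat mg"
      proof -
        have "complex_of_real (real (r + 2)) = of_real (\<beta>1 * m + \<beta>2 * mg)" using \<beta>(3) by simp
        then show ?thesis by simp
      qed
      also have "S v * (of_real (nsq v) * dv a b c v - (complex_of_real \<beta>1 * of_nat m + of_real \<beta>2 * of_nat mg) * \<Theta> v) +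
        S v * (of_real (\<beta>1 * m) * \<Theta> v * (1 - of_real (xf \<epsilon> v)) - of_real \<beta>2 * (of_real (nsq v) * c' v - of_nat mg * \<Theta> v) * (1 - of_real (xg \<epsilon> v)))
        = S v * (of_real (nsq v) * h v + E \<epsilon> v)"
        unfolding h_def E_def by (simp add: algebra_simps)
      also have "\<dots> = of_real (bump (nsq v) * W \<epsilon> v) * cnj (h v) * (of_real (nsq v) * h v + E \<epsilon> v)" by (simp add: S_def W_def)
      finally show ?thesis .
    qed
    show "integrable lborel (\<lambda>v. of_real (bump (nsq v) * W \<epsilon> v) * cnj (h v) * (of_real (nsq v) * h v + E \<epsilon> v))"
      using wd_divergence_eq_0(1)[OF wS wT S0] unfolding eq .
    show "(\<integral>v. of_real (bump (nsq v) * W \<epsilon> v) * cnj (h v) * (of_real (nsq v) * h v + E \<epsilon> v) \<partial>lborel) = 0"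
      using wd_divergence_eq_0(2)[OF wS wT S0] unfolding eq .
  qed
  have cont: "continuous_on S h" "continuous_on S \<Theta>" "continuous_on S c'" "continuous_on S f" "continuous_on S g" "continuous_on S H" for S
    using ph \<theta>g(2) f(1) g(1) H(1) wd\<Theta> by (auto intro: pfun_continuous wd_continuous)
  have cW: "continuous_on S (W \<epsilon>)" if "\<epsilon> > 0" for S \<epsilon>
    unfolding W_def[abs_def] by (intro continuous_intros continuous_wt f g that)
  have k1: "continuous_on K (\<lambda>v. (norm (H v))\<^sup>2)" by (intro continuous_intros cont)
  have k2: "continuous_on K (\<lambda>v. of_real (bump (nsq v)) * cnj (h v) * (of_real (\<beta>1 * m) * \<Theta> v))" by (intro continuous_intros cont)
  have k3: "continuous_on K (\<lambda>v. of_real (bump (nsq v)) * cnj (h v) * (of_real \<beta>2 * (of_real (nsq v) * c' v - of_nat mg * \<Theta> v)))" by (intro continuous_intros cont)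
  \<comment> \<open>M bounds |H|^2, so |f|^2 <= M |g|^2 on the shell; negative powers of |g| are
    thus controlled by negative powers of |f|, whose integrability is known.\<close>
  obtain M where M: "M \<ge> 1" "\<And>v. v \<in> K \<Longrightarrow> norm ((norm (H v))\<^sup>2) \<le> M"
    by (rule continuous_bounded_pos[OF K(1) k1]) blast
  obtain C1 where C1: "C1 \<ge> 1" "\<And>v. v \<in> K \<Longrightarrow> norm (of_real (bump (nsq v)) * cnj (h v) * (of_real (\<beta>1 * m) * \<Theta> v)) \<le> C1"
    by (rule continuous_bounded_pos[OF K(1) k2]) blast
  obtain C2 where C2: "C2 \<ge> 1" "\<And>v. v \<in> K \<Longrightarrow> norm (of_real (bump (nsq v)) * cnj (h v) * (of_real \<beta>2 * (of_real (nsq v) * c' v - of_nat mg * \<Theta> v))) \<le> C2"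
    by (rule continuous_bounded_pos[OF K(1) k3]) blast
  define C where "C = C1 * M + C2 * (M * M)"
  have C: "C > 0" using C1(1) C2(1) M(1) by (simp add: C_def add_pos_pos)
  \<comment> \<open>The defects are at most \<epsilon>/F, up to M, and \<epsilon>/F <=
    (\<epsilon>/F)^s because this ratio is at most 1. So a factor \<epsilon>^s is gained for an
    extra power s of 1/F.\<close>
  have err: "norm (of_real (bump (nsq v) * W \<epsilon> v) * cnj (h v) * E \<epsilon> v) \<le> C * \<epsilon> powr s * ((norm (f v))\<^sup>2 + \<epsilon>) powr (- b')"
    if e: "0 < \<epsilon>" "\<epsilon> \<le> 1" and v: "v \<in> K" for \<epsilon> v
  proof -
    define F where "F = (norm (f v))\<^sup>2 + \<epsilon>"
    define Q where "Q = (norm (g v))\<^sup>2 + \<epsilon>"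
    have FQ: "F > 0" "Q > 0" "\<epsilon> \<le> F" "\<epsilon> \<le> Q" using e by (simp_all add: F_def Q_def add_nonneg_pos)
    have "(norm (f v))\<^sup>2 = (norm (g v))\<^sup>2 * (norm (H v))\<^sup>2" by (simp add: H(2) norm_mult power_mult_distrib)
    also have "\<dots> \<le> (norm (g v))\<^sup>2 * M" using M(2)[OF v] by (intro mult_left_mono) auto
    finally have FMQ: "F \<le> M * Q" using M(1) e by (simp add: F_def Q_def algebra_simps add_mono) 
    have Q1: "1 / Q \<le> M / F" using FMQ FQ by (simp add: field_simps)
    have Q2: "Q powr (- \<beta>2) \<le> M * F powr (- \<beta>2)"
    proof -
      have "Q powr (- \<beta>2) \<le> (F / M) powr (- \<beta>2)"
        using FMQ FQ M(1) \<beta>(2) by (intro powr_mono2') (auto simp: field_simps)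
      also have "\<dots> = M powr \<beta>2 * F powr (- \<beta>2)" using FQ M(1) by (simp add: powr_divide powr_minus field_simps)
      also have "\<dots> \<le> M powr 1 * F powr (- \<beta>2)" using M(1) \<beta> by (intro mult_right_mono powr_mono) auto
      finally show ?thesis using M(1) by simp
    qed
    have W1: "W \<epsilon> v \<le> M * F powr (- (\<beta>1 + \<beta>2))" "W \<epsilon> v \<ge> 0"
    proof -
      have "W \<epsilon> v = F powr (- \<beta>1) * Q powr (- \<beta>2)" by (simp add: W_def wt_def F_def Q_def)
      moreover have "\<dots> \<le> F powr (- \<beta>1) * (M * F powr (- \<beta>2))" using Q2 by (intro mult_left_mono) auto
      moreover have "\<dots> = M * F powr (- (\<beta>1 + \<beta>2))" by (simp add: powr_add[symmetric] mult.left_commute)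
      ultimately show "W \<epsilon> v \<le> M * F powr (- (\<beta>1 + \<beta>2))" "W \<epsilon> v \<ge> 0" by simp_all
    qed
    have x: "xf \<epsilon> v \<le> (\<epsilon> / F) powr s" "xg \<epsilon> v \<le> M * (\<epsilon> / F) powr s" "xf \<epsilon> v \<ge> 0" "xg \<epsilon> v \<ge> 0"
    proof -
      have eF: "\<epsilon> / F \<le> (\<epsilon> / F) powr s"
        using powr_mono'[of s 1 "\<epsilon> / F"] s e FQ by simp
      then show "xf \<epsilon> v \<le> (\<epsilon> / F) powr s" by (simp add: xf_def F_def)
      have "xg \<epsilon> v = \<epsilon> * (1 / Q)" by (simp add: xg_def Q_def)
      also have "\<dots> \<le> \<epsilon> * (M / F)" using Q1 e by (intro mult_left_mono) auto
      also have "\<dots> = M * (\<epsilon> / F)" by simp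
      also have "\<dots> \<le> M * (\<epsilon> / F) powr s" using eF M(1) by (intro mult_left_mono) auto
      finally show "xg \<epsilon> v \<le> M * (\<epsilon> / F) powr s" .
      show "xf \<epsilon> v \<ge> 0" "xg \<epsilon> v \<ge> 0" using e by (auto simp: xf_def xg_def)
    qed
    have "of_real (bump (nsq v) * W \<epsilon> v) * cnj (h v) * E \<epsilon> v =
       of_real (W \<epsilon> v) * (- (of_real (bump (nsq v)) * cnj (h v) * (of_real (\<beta>1 * m) * \<Theta> v)) * of_real (xf \<epsilon> v)
        + (of_real (bump (nsq v)) * cnj (h v) * (of_real \<beta>2 * (of_real (nsq v) * c' v - of_nat mg * \<Theta> v))) * of_real (xg \<epsilon> v))"
      unfolding E_def by (simp add: algebra_simps)
    also have "norm \<dots> \<le> W \<epsilon> v * (C1 * (\<epsilon> / F) powr s + C2 * (M * (\<epsilon> / F) powr s))"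
      unfolding norm_mult[of "of_real (W \<epsilon> v)"]
    proof (rule mult_mono)
      show "norm (- (of_real (bump (nsq v)) * cnj (h v) * (of_real (\<beta>1 * m) * \<Theta> v)) * of_real (xf \<epsilon> v)
        + (of_real (bump (nsq v)) * cnj (h v) * (of_real \<beta>2 * (of_real (nsq v) * c' v - of_nat mg * \<Theta> v))) * of_real (xg \<epsilon> v)) \<le> C1 * (\<epsilon> / F) powr s + C2 * (M * (\<epsilon> / F) powr s)"
        using C1(2)[OF v] C2(2)[OF v] x C1(1) C2(1)
        by (intro norm_triangle_mono) (unfold norm_mult[of _ "of_real _ :: complex"] norm_minus_cancel, auto intro!: mult_mono)
    qed (use W1 in auto)
    also have "\<dots> = W \<epsilon> v * (C1 + C2 * M) * (\<epsilon> / F) powr s" by (simp add: algebra_simps)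
    also have "\<dots> \<le> (M * F powr (- (\<beta>1 + \<beta>2))) * (C1 + C2 * M) * (\<epsilon> / F) powr s"
      using W1 C1(1) C2(1) M(1) by (intro mult_right_mono) auto
    also have "(\<epsilon> / F) powr s = \<epsilon> powr s * F powr (- s)" using e FQ by (simp add: powr_divide powr_minus field_simps)
    also have "(M * F powr (- (\<beta>1 + \<beta>2))) * (C1 + C2 * M) * (\<epsilon> powr s * F powr (- s)) = C * \<epsilon> powr s * (F powr (- (\<beta>1 + \<beta>2)) * F powr (- s))"
      by (simp add: C_def algebra_simps)
    also have "F powr (- (\<beta>1 + \<beta>2)) * F powr (- s) = F powr (- b')" by (simp add: powr_add[symmetric] b'_def)
    finally show ?thesis unfolding F_def .
  qed
  define I where "I = enn2real (\<integral>\<^sup>+v\<in>K. ipow (2 * b') (norm (f v)) \<partial>lborel)"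
  have I: "(\<integral>\<^sup>+v\<in>K. ipow (2 * b') (norm (f v)) \<partial>lborel) = ennreal I" "I \<ge> 0"
    using int[OF s(3,4) K] by (auto simp: I_def less_top)
  \<comment> \<open>The main term with \<epsilon> = 1. The weights grow as \<epsilon> decreases, so
    it is a lower bound independent of \<epsilon> for the main terms that the error has to
    cancel.\<close>
  define k where "k v = bump (nsq v) * W 1 v * (nsq v * (norm (h v))\<^sup>2)" for v
  have ck: "continuous_on S k" for S unfolding k_def by (intro continuous_intros cW cont) auto
  have k0: "k v \<ge> 0" for v unfolding k_def W_def using bump_props(1) wt_pos[of 1] by (intro mult_nonneg_nonneg) (auto simp: nsq_def less_imp_le)
  have supp_int: "integrable lborel q" if "continuous_on UNIV q" "\<And>v. v \<notin> K \<Longrightarrow> q v = 0" for q :: "pt \<Rightarrow> real"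
  proof -
    have "integrable lborel (\<lambda>x. indicator K x *\<^sub>R q x)"
      using K by (intro borel_integrable_compact continuous_on_subset[OF that(1)]) auto
    moreover have "(\<lambda>x. indicator K x *\<^sub>R q x) = q" using that(2) by (auto simp: fun_eq_iff indicator_def)
    ultimately show ?thesis by simp
  qed
  have ik: "integrable lborel k" by (rule supp_int[OF ck]) (simp add: k_def bK)
  have le: "(\<integral>v. k v \<partial>lborel) \<le> C * \<epsilon> powr s * I" if e: "0 < \<epsilon>" "\<epsilon> \<le> 1" for \<epsilon>
  proof -
    define k2 where "k2 v = bump (nsq v) * W \<epsilon> v * (nsq v * (norm (h v))\<^sup>2)" for v
    define z where "z v = of_real (bump (nsq v) * W \<epsilon> v) * cnj (h v) * E \<epsilon> v" for v
    have ik2: "integrable lborel k2"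
      by (rule supp_int) (auto simp: k2_def[abs_def] bK intro!: continuous_intros cW cont e)
    have zi: "(\<integral>v. complex_of_real (k2 v) \<partial>lborel) = - (\<integral>v. z v \<partial>lborel)" and iz: "integrable lborel z"
    proof -
      have eq: "of_real (bump (nsq v) * W \<epsilon> v) * cnj (h v) * (of_real (nsq v) * h v + E \<epsilon> v) = complex_of_real (k2 v) + z v" for v
      proof -
        have "cnj (h v) * h v = complex_of_real ((norm (h v))\<^sup>2)" by (simp add: complex_norm_square mult.commute del: of_real_power)
        then have "of_real (bump (nsq v) * W \<epsilon> v) * cnj (h v) * (of_real (nsq v) * h v) = complex_of_real (k2 v)"
          unfolding k2_def of_real_mult by (simp add: algebra_simps del: of_real_power)
        then show ?thesis unfolding z_def by (simp add: distrib_left)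
      qed
      have ic: "integrable lborel (\<lambda>v. complex_of_real (k2 v))" using ik2 by simp
      have isum: "integrable lborel (\<lambda>v. complex_of_real (k2 v) + z v)" using main(1)[OF e(1)] unfolding eq .
      from Bochner_Integration.integrable_diff[OF isum ic] show iz: "integrable lborel z" by simp
      have "(\<integral>v. complex_of_real (k2 v) + z v \<partial>lborel) = 0" using main(2)[OF e(1)] unfolding eq .
      then have "(\<integral>v. complex_of_real (k2 v) \<partial>lborel) + (\<integral>v. z v \<partial>lborel) = 0"
        using Bochner_Integration.integral_add[OF ic iz] by simp
      then show "(\<integral>v. complex_of_real (k2 v) \<partial>lborel) = - (\<integral>v. z v \<partial>lborel)" by (simp add: eq_neg_iff_add_eq_0)
    qed
    have "k v \<le> k2 v" for v
      unfolding k_def k2_def W_def using e bump_props(1) \<beta> wt_pos[of 1 \<beta>2 g v] wt_pos[of \<epsilon> \<beta>1 f v]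
      by (intro mult_right_mono mult_left_mono mult_mono wt_antimono) (auto simp: nsq_def less_imp_le)
    then have "(\<integral>v. k v \<partial>lborel) \<le> (\<integral>v. k2 v \<partial>lborel)" by (intro integral_mono ik ik2)
    also have "\<dots> = norm (\<integral>v. complex_of_real (k2 v) \<partial>lborel)"
    proof -
      have "k2 v \<ge> 0" for v using \<open>k v \<le> k2 v\<close> k0[of v] by linarith
      then have "(\<integral>v. k2 v \<partial>lborel) \<ge> 0" by (intro Bochner_Integration.integral_nonneg) auto
      then show ?thesis by simp
    qed
    also have "(\<integral>v. complex_of_real (k2 v) \<partial>lborel) = - (\<integral>v. z v \<partial>lborel)" by (rule zi)
    also have "norm (- (\<integral>v. z v \<partial>lborel)) \<le> (\<integral>v. norm (z v) \<partial>lborel)" by simp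
    finally have kz: "(\<integral>v. k v \<partial>lborel) \<le> (\<integral>v. norm (z v) \<partial>lborel)" .
    have "ennreal (\<integral>v. norm (z v) \<partial>lborel) = (\<integral>\<^sup>+v. ennreal (norm (z v)) \<partial>lborel)"
      using iz by (intro nn_integral_eq_integral[symmetric]) auto
    also have "\<dots> \<le> (\<integral>\<^sup>+v. ennreal (C * \<epsilon> powr s) * (ipow (2 * b') (norm (f v)) * indicator K v) \<partial>lborel)"
    proof (rule nn_integral_mono)
      fix v
      show "ennreal (norm (z v)) \<le> ennreal (C * \<epsilon> powr s) * (ipow (2 * b') (norm (f v)) * indicator K v)"
      proof (cases "v \<in> K")
        case True
        show ?thesis
        proof (cases "f v = 0")
          \<comment> \<open>On the curve \<open>ipow\<close> is infinite and the bound is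
            trivial.\<close>
          case f0: True
          have "ennreal (C * \<epsilon> powr s) \<noteq> 0" using C e by simp
          then show ?thesis using f0 True by (simp add: ennreal_mult_top)
        next
          case False
          have "((norm (f v))\<^sup>2 + \<epsilon>) powr (- b') \<le> ((norm (f v))\<^sup>2) powr (- b')"
            using e s False by (intro powr_mono2') auto
          also have "\<dots> = norm (f v) powr (- (2 * b'))"
            using False by (simp add: powr_powr flip: powr_numeral)
          finally have "norm (z v) \<le> C * \<epsilon> powr s * norm (f v) powr (- (2 * b'))"
            using err[OF e True] C unfolding z_def by (meson mult_left_mono mult_nonneg_nonneg less_imp_le order_trans powr_ge_zero)
          then have "ennreal (norm (z v)) \<le> ennreal (C * \<epsilon> powr s * norm (f v) powr (- (2 * b')))" by (rule ennreal_leI)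
          also have "\<dots> = ennreal (C * \<epsilon> powr s) * ennreal (norm (f v) powr (- (2 * b')))" using C by (intro ennreal_mult) auto
          finally show ?thesis using True False by (simp add: ipow_def)
        qed
      next
        case False
        then show ?thesis by (simp add: z_def bK)
      qed
    qed
    also have "\<dots> = ennreal (C * \<epsilon> powr s) * ennreal I"
      unfolding I(1)[symmetric]
    proof (rule nn_integral_cmult)
      have "f \<in> borel_measurable borel" using pfun_continuous[OF f(1)] by (rule borel_measurable_continuous_onI)
      from measurable_ipow_indicator[OF this, of K "2 * b'"]
      show "(\<lambda>v. ipow (2 * b') (norm (f v)) * indicator K v) \<in> borel_measurable lborel" using borel_compact[OF K(1)] by simp
    qed
    also have "\<dots> = ennreal (C * \<epsilon> powr s * I)" using C I(2) by (intro ennreal_mult[symmetric]) auto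
    finally have "(\<integral>v. norm (z v) \<partial>lborel) \<le> C * \<epsilon> powr s * I"
      using C I(2) by (simp add: ennreal_le_iff)
    with kz show ?thesis by linarith
  qed
  have "(\<integral>v. k v \<partial>lborel) \<le> 0"
  proof (rule tendsto_lowerbound)
    show "((\<lambda>\<epsilon>. C * \<epsilon> powr s * I) \<longlongrightarrow> 0) (at_right 0)"
    proof -
      have "((\<lambda>\<epsilon>. \<epsilon> powr s) \<longlongrightarrow> 0) (at_right (0::real))" using s(1) by real_asymp
      from tendsto_mult_right[OF tendsto_mult_left[OF this, of C], of I] show ?thesis by simp
    qed
    show "\<forall>\<^sub>F \<epsilon> in at_right 0. (\<integral>v. k v \<partial>lborel) \<le> C * \<epsilon> powr s * I"
      using le by (auto simp: eventually_at_right_field intro!: exI[of _ 1])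
  qed simp
  then have k0: "k v = 0" for v using integral_pos_imp_zero[OF ck k0 ik] by blast
  define V where "V = ball (0::pt) 2 - cball 0 1"
  have "h v = 0" if "v \<in> V" for v
  proof -
    have n: "1 < norm v" "norm v < 2" using that by (auto simp: V_def)
    then have "1\<^sup>2 < (norm v)\<^sup>2" "(norm v)\<^sup>2 < 2\<^sup>2" by (intro power_strict_mono; simp)+
    then have "bump (nsq v) > 0" "nsq v > 0" using bump_props(4) by (auto simp: nsq_def)
    moreover have "W 1 v > 0" unfolding W_def using wt_pos[of 1] by simp
    ultimately show ?thesis using k0[of v] by (simp add: k_def)
  qed
  moreover have "open V" unfolding V_def by auto
  moreover have "(3 / 2, 0, 0) \<in> V" by (simp add: V_def norm_Pair dist_norm)
  ultimately have "h v = 0" using pfun_open_zero[OF ph] by blast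
  then show ?thesis by (simp add: h_def)
qed

section \<open>Arrangements of smooth cubics and lines\<close>

lemma polyfun_const: "polyfun (\<lambda>_. c)"
proof -
  have "hpoly 0 (\<lambda>_. c)" unfolding hpoly_def by (rule exI[of _ "\<lambda>_ _. c"]) simp
  then show ?thesis unfolding polyfun_def by (intro exI[of _ 0] exI[of _ "\<lambda>_ _. c"]) simp
qed

text \<open>Minimality gives independence over C: a nontrivial constant relation either makes the
  first generator 0 or the second a constant multiple of the first. The pair is stored as sequences,
  constant from index 1 on, so that all properties hold for every index.\<close>

lemma free_curveE:
  assumes "free_curve m f"
  obtains A B C :: "nat \<Rightarrow> pt \<Rightarrow> complex" and D :: "nat \<Rightarrow> nat"
  where "1 \<le> D 0" "D 0 \<le> D 1" "D 0 + D 1 = m - 1" "\<And>i. D (Suc i) = D 1"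
    "\<And>i. pfun (A i)" "\<And>i. pfun (B i)" "\<And>i. pfun (C i)"
    "\<And>i. hom (D i) (A i)" "\<And>i. hom (D i) (B i)" "\<And>i. hom (D i) (C i)"
    "\<And>i v. dd f v (A i v, B i v, C i v) = 0"
    "\<And>\<alpha> \<beta>. (\<And>v. \<alpha> * A 0 v + \<beta> * A 1 v = 0 \<and> \<alpha> * B 0 v + \<beta> * B 1 v = 0 \<and> \<alpha> * C 0 v + \<beta> * C 1 v = 0) \<Longrightarrow> \<alpha> = 0 \<and> \<beta> = 0"
proof -
  obtain r1 r2 d1 d2 where d: "1 \<le> d1" "d1 \<le> d2" "d1 + d2 = m - 1" and h: "hsyz d1 r1" "hsyz d2 r2"
    and s: "r1 \<in> syz f" "r2 \<in> syz f" and n1: "\<not> (\<exists>p. polyfun p \<and> r1 = lin1 p r2)" and n2: "\<not> (\<exists>p. polyfun p \<and> r2 = lin1 p r1)"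
    using assms unfolding free_curve_def by blast
  obtain a b c where r1: "r1 = (a, b, c)" by (cases r1)
  obtain a' b' c' where r2: "r2 = (a', b', c')" by (cases r2)
  note h = h[unfolded hsyz_def r1 r2 fst_conv snd_conv]
  have ds: "dd f v (a v, b v, c v) = 0" "dd f v (a' v, b' v, c' v) = 0" for v
    using s unfolding r1 r2 syz_def dd_def by (simp_all add: mult.commute)
  have ind: "\<alpha> = 0 \<and> \<beta> = 0" if H: "\<And>v. \<alpha> * a v + \<beta> * a' v = 0 \<and> \<alpha> * b v + \<beta> * b' v = 0 \<and> \<alpha> * c v + \<beta> * c' v = 0" for \<alpha> \<beta>
  proof (rule ccontr)
    assume nz: "\<not> ?thesis"
    show False
    proof (cases "\<beta> = 0")
      case True
      then have "a v = 0 \<and> b v = 0 \<and> c v = 0" for v using H[of v] nz by auto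
      then have "r1 = lin1 (\<lambda>_. 0) r2" unfolding r1 lin1_def by auto
      then show False using n1 polyfun_const by blast
    next
      case False
      have q: "y = - \<alpha> / \<beta> * x" if "\<alpha> * x + \<beta> * y = 0" for x y
        using that False by (simp add: field_simps add_eq_0_iff)
      have "r2 = lin1 (\<lambda>_. - \<alpha> / \<beta>) r1"
        unfolding r1 r2 lin1_def fst_conv snd_conv using q H by blast
      then show False using n2 polyfun_const by blast
    qed
  qed
  show ?thesis
  proof (rule that[of "\<lambda>i. if i = 0 then d1 else d2" "\<lambda>i. if i = 0 then a else a'" "\<lambda>i. if i = 0 then b else b'" "\<lambda>i. if i = 0 then c else c'"])
    fix \<alpha> \<beta> :: complex
    assume "\<And>v. \<alpha> * (if 0 = (0::nat) then a else a') v + \<beta> * (if 1 = (0::nat) then a else a') v = 0 \<and>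
      \<alpha> * (if 0 = (0::nat) then b else b') v + \<beta> * (if 1 = (0::nat) then b else b') v = 0 \<and>
      \<alpha> * (if 0 = (0::nat) then c else c') v + \<beta> * (if 1 = (0::nat) then c else c') v = 0"
    then show "\<alpha> = 0 \<and> \<beta> = 0" by (intro ind) simp
  qed (use d in simp_all, simp_all add: h ds hpoly_pfun[OF h(1)[THEN conjunct1]] hpoly_pfun[OF h(1)[THEN conjunct2, THEN conjunct1]]
      hpoly_pfun[OF h(1)[THEN conjunct2, THEN conjunct2]] hpoly_pfun[OF h(2)[THEN conjunct1]]
      hpoly_pfun[OF h(2)[THEN conjunct2, THEN conjunct1]] hpoly_pfun[OF h(2)[THEN conjunct2, THEN conjunct2]] hpoly_hom)
qed

lemma hom_dd_field:
  assumes "pfun g" "hom (Suc n) g" "hom r a" "hom r b" "hom r c"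
  shows "hom (n + r) (\<lambda>v. dd g v (a v, b v, c v))"
  unfolding hom_def
proof (intro allI)
  fix t v
  have "dd g (tsmul t v) (a (tsmul t v), b (tsmul t v), c (tsmul t v)) = dd g (tsmul t v) (tsmul (t ^ r) (a v, b v, c v))"
    by (simp add: homD[OF assms(3)] homD[OF assms(4)] homD[OF assms(5)])
  also have "\<dots> = t ^ r * dd g (tsmul t v) (a v, b v, c v)" by (simp only: dd_lin)
  finally show "dd g (tsmul t v) (a (tsmul t v), b (tsmul t v), c (tsmul t v)) = t ^ (n + r) * dd g v (a v, b v, c v)"
    using homD[OF hom_dd[OF assms(1,2)], of t v "(a v, b v, c v)"] by (simp add: power_add)
qed

lemma hom_quotient:
  assumes "pfun c" "pfun g" "hom n g" "g v0 \<noteq> 0" "hom (n + s) (\<lambda>v. c v * g v)"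
  shows "hom s c"
proof (cases "\<forall>v. c v * g v = 0")
  case True
  then have "(\<forall>v. c v = 0) \<or> (\<forall>v. g v = 0)" using pfun_domain[OF assms(1,2)] by blast
  then show ?thesis using assms(4) by (auto simp: hom_def)
next
  case False
  then obtain v1 where v1: "c v1 * g v1 \<noteq> 0" by blast
  obtain i j where "i + j = n + s" "hom i c" "hom j g"
    using hom_factor[OF assms(1,2) pfun_mult[OF assms(1,2)] assms(5) v1] by auto
  then show ?thesis using hom_unique[OF _ assms(3,4)] by (metis add_diff_cancel_left' add_diff_cancel_right')
qed

text \<open>If p were nonzero, its order at a would be some n >= 1; then the left side would have
  order at least n there and the right side exactly n - 1.\<close>

lemma zero_of_log_derivative_eq:
  fixes p q :: "complex poly"
  assumes "p * pderiv q = q * pderiv p" "poly p a = 0" "poly q a \<noteq> 0"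
  shows "p = 0"
proof (rule ccontr)
  assume p: "p \<noteq> 0"
  have dp: "pderiv p \<noteq> 0"
  proof
    assume "pderiv p = 0"
    then have "degree p = 0" by (simp add: pderiv_eq_0_iff)
    then show False using p assms(2) by (auto elim: degree_eq_zeroE)
  qed
  have q: "q \<noteq> 0" "order a q = 0" using assms(3) by (auto simp: order_root)
  have o: "order a p = Suc (order a (pderiv p))" by (rule order_pderiv[OF p assms(2)])
  have "q * pderiv p \<noteq> 0" using q dp by simp
  then have "order a p + order a (pderiv q) = order a q + order a (pderiv p)"
    using assms(1) by (metis order_mult)
  then show False using o q(2) by simp
qed

text \<open>If the kernel of l2 were contained in that of l1, then l1 would be a multiple of l2 and
  the two lines would coincide.\<close>

lemma line_forms_kernels:
  assumes l: "line_form l1" "line_form l2" and z: "zero_set l1 \<noteq> zero_set l2"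
  shows "\<exists>v. l1 v \<noteq> 0 \<and> l2 v = 0"
proof (rule ccontr)
  assume n: "\<not> ?thesis"
  obtain w where w: "l2 w \<noteq> 0" using line_formD(3)[OF l(2)] by blast
  have "l1 v = l2 v * (l1 w / l2 w)" for v
  proof -
    have "l2 (v - tsmul (l2 v / l2 w) w) = 0"
      using w unfolding line_formD(4)[OF l(2), of "v - tsmul (l2 v / l2 w) w"] by (simp add: dd_lin flip: line_formD(4)[OF l(2)])
    then have "l1 (v - tsmul (l2 v / l2 w) w) = 0" using n by blast
    then show ?thesis
      unfolding line_formD(4)[OF l(1), of "v - tsmul (l2 v / l2 w) w"] by (simp add: dd_lin flip: line_formD(4)[OF l(1)])
  qed
  from component_not_dvd[OF _ _ pfun_const this] l z show False by (auto simp: component_def)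
qed

text \<open>A smooth cubic contains no line: along the line all tangential derivatives of F vanish,
  and the remaining derivative, a quadratic form, has a zero on it.\<close>

lemma smc_nonzero_on_plane:
  assumes F: "smc F" and i: "indep2 e e'"
  shows "\<exists>s t. F (tsmul s e + tsmul t e') \<noteq> 0"
proof (rule ccontr)
  assume "\<not> ?thesis"
  then have z: "F (tsmul s e + tsmul t e') = 0" for s t by blast
  obtain u where u: "det3 e e' u \<noteq> 0" using indep2_complement[OF i] by blast
  have "hom (Suc 1) (\<lambda>v. dd F v u)" using hom_dd[OF smcD(1,3)[OF F]] by (simp add: numeral_2_eq_2)
  then obtain s t p where p: "p = tsmul s e + tsmul t e'" "p \<noteq> 0" "dd F p u = 0"
    using plane_zero'[OF pfun_dd_dir[OF smcD(1)[OF F]] _ i] by metis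
  have tang: "dd F p (tsmul x e + tsmul y e') = 0" for x y
  proof -
    have "((\<lambda>\<tau>. F (p + tsmul \<tau> (tsmul x e + tsmul y e'))) has_field_derivative dd F (p + tsmul 0 (tsmul x e + tsmul y e')) (tsmul x e + tsmul y e')) (at 0)"
      by (rule pfun_line_deriv[OF smcD(1)[OF F]])
    moreover have "p + tsmul \<tau> (tsmul x e + tsmul y e') = tsmul (s + \<tau> * x) e + tsmul (t + \<tau> * y) e'" for \<tau>
      by (simp add: p(1) tsmul_add tsmul_tsmul tsmul_add_left add_ac)
    ultimately have "((\<lambda>_. 0) has_field_derivative dd F p (tsmul x e + tsmul y e')) (at 0)" by (simp add: z)
    then show ?thesis using DERIV_const DERIV_unique by metis
  qed
  have "dd F p d = 0" for d
  proof -
    obtain \<alpha> \<beta> \<gamma> where "d = tsmul \<alpha> e + tsmul \<beta> e' + tsmul \<gamma> u" using basis_expansion[OF u] by blast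
    then show ?thesis using tang[of \<alpha> \<beta>] p(3) by (simp only: dd_lin) simp
  qed
  then show False using smcD(4)[OF F p(2)] by blast
qed

locale cubic_line_arrangement =
  fixes k d :: nat and G :: "nat \<Rightarrow> pt \<Rightarrow> complex"
  assumes k: "k \<ge> 1" and d: "d \<ge> 1"
    and cubics: "\<And>i. i < k \<Longrightarrow> smooth_cubic (G i)"
    and lines: "\<And>i. k \<le> i \<Longrightarrow> i < k + d \<Longrightarrow> line_form (G i)"
    and distinct: "\<And>i j. i < k + d \<Longrightarrow> j < k + d \<Longrightarrow> i \<noteq> j \<Longrightarrow> zero_set (G i) \<noteq> zero_set (G j)"
    and sings: "\<And>p. sing_point (\<lambda>v. \<Prod>i<k + d. G i v) p \<Longrightarrow>
        sing_type (\<lambda>v. \<Prod>i<k + d. G i v) p nf_A1 \<or>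
        sing_type (\<lambda>v. \<Prod>i<k + d. G i v) p nf_A5 \<or>
        sing_type (\<lambda>v. \<Prod>i<k + d. G i v) p nf_D4"
begin

abbreviation f :: "pt \<Rightarrow> complex" where "f \<equiv> \<lambda>v. \<Prod>i<k + d. G i v"

lemma component_G: "i < k + d \<Longrightarrow> component (G i)"
  using cubics lines by (cases "i < k") (auto simp: component_def)

text \<open>One less than the degree, to match the \<open>Suc\<close> of
  \<open>hom_dd\<close>.\<close>

definition deg :: "nat \<Rightarrow> nat" where "deg i = (if i < k then 2 else 0)"

lemma G: assumes "i < k + d" shows "pfun (G i)" "hom (Suc (deg i)) (G i)" "\<exists>v. G i v \<noteq> 0"
  using assms smooth_cubicD(1,2,3)[OF cubics, of i] line_formD(1,2,3)[OF lines, of i]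
  by (cases "i < k"; simp add: deg_def numeral_3_eq_3)+

lemma f: "pfun f" "hom (3 * k + d) f" "\<exists>v. f v \<noteq> 0"
proof -
  show "pfun f" using G(1) by (intro pfun_prod) auto
  have "hom (\<Sum>i<n. Suc (deg i)) (\<lambda>v. \<Prod>i<n. G i v)" if "n \<le> k + d" for n
    using that
  proof (induction n)
    case 0 then show ?case by (simp add: hom_def)
  next
    case (Suc n)
    then show ?case using G(2)[of n] by (simp add: hom_def power_add) 
  qed
  moreover have "(\<Sum>i<k + n. Suc (deg i)) = 3 * k + n" for n
  proof (induction n)
    case 0
    have "(\<Sum>i<k. Suc (deg i)) = (\<Sum>i<k. 3)" by (rule sum.cong) (auto simp: deg_def)
    then show ?case by simp
  next
    case (Suc n) then show ?case by (simp add: deg_def)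
  qed
  ultimately show "hom (3 * k + d) f" by (metis order_refl)
  show "\<exists>v. f v \<noteq> 0"
  proof (rule ccontr)
    assume "\<not> ?thesis"
    then have "\<exists>i\<in>{..<k + d}. \<forall>v. G i v = 0" by (intro pfun_prod_domain) (use G(1) in blast)+
    then show False using G(3) by blast
  qed
qed

lemma f_split: assumes "i < k + d" shows "f v = G i v * (\<Prod>j\<in>{..<k + d} - {i}. G j v)"
  using assms by (simp add: prod.remove)

text \<open>Where two components meet, f is singular, so the hypothesis on the singularities
  applies; three or more factors leave only D4 with exactly three.\<close>

lemma triple_point:
  fixes N :: nat and \<sigma> :: "nat \<Rightarrow> nat"
  assumes N: "N \<ge> 3" and \<sigma>: "inj_on \<sigma> {..<N}" "\<And>i. i < N \<Longrightarrow> \<sigma> i < k + d" and p: "p \<noteq> 0" "\<And>i. i < N \<Longrightarrow> G (\<sigma> i) p = 0"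
  shows "N = 3 \<and> sing_type f p nf_D4"
proof -
  define q where "q v = (\<Prod>j\<in>{..<k + d} - \<sigma> ` {..<N}. G j v)" for v
  have eq: "f v = (\<Prod>i<N. G (\<sigma> i) v) * q v" for v
  proof -
    have "f v = (\<Prod>j\<in>\<sigma> ` {..<N}. G j v) * q v"
      unfolding q_def using \<sigma>(2) by (subst mult.commute, intro prod.subset_diff) auto
    then show ?thesis by (simp add: prod.reindex[OF \<sigma>(1)])
  qed
  have pq: "pfun q" unfolding q_def using G(1) by (intro pfun_prod) auto
  have pG: "pfun (G (\<sigma> i))" if "i < N" for i using G(1) \<sigma>(2) that by auto
  define R where "R v = (\<Prod>i\<in>{..<N} - {0}. G (\<sigma> i) v) * q v" for v
  have R: "pfun R" unfolding R_def using pG pq by (intro pfun_mult pfun_prod) auto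
  have "f = (\<lambda>v. G (\<sigma> 0) v * R v)" using N by (simp add: eq R_def prod.remove[of "{..<N}" 0] mult.assoc fun_eq_iff del: prod.lessThan_Suc)
  moreover have "R p = 0" unfolding R_def using N p(2)[of 1] by (auto simp: prod_zero_iff intro: bexI[of _ 1])
  ultimately have dz: "dd f p e = 0" for e using dd_mult[OF pG R, of 0 p e] p(2)[of 0] N by simp
  have "f p = 0" unfolding eq using p(2)[of 0] N by auto
  moreover have "dX f p = 0" "dY f p = 0" "dZ f p = 0" using dz[of "(1,0,0)"] dz[of "(0,1,0)"] dz[of "(0,0,1)"] by (simp_all add: dd_def)
  ultimately have "sing_point f p" using p(1) by (simp add: sing_point_def zero_prod_def)
  from sings[OF this] show ?thesis using sing_type_three_factors[OF pG pq p(2) eq N] by blast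
qed

lemma eigenvalues:
  assumes "pfun a" "pfun b" "pfun c" "hom (Suc r) a" "hom (Suc r) b" "hom (Suc r) c" "\<And>v. dd f v (a v, b v, c v) = 0" and i: "i < k + d"
  shows "\<exists>e. pfun e \<and> hom r e \<and> (\<forall>v. dd (G i) v (a v, b v, c v) = e v * G i v)"
proof -
  obtain e where e: "pfun e" "\<forall>v. dd (G i) v (a v, b v, c v) = e v * G i v"
    using syzygy_component[of "{..<k + d}" i G a b c] component_G distinct i assms(1-3,7) by auto
  obtain v0 where "G i v0 \<noteq> 0" using G(3)[OF i] by blast
  moreover have "hom (Suc (deg i) + r) (\<lambda>v. e v * G i v)"
    using hom_dd_field[OF G(1,2)[OF i] assms(4-6)] e(2) by simp
  ultimately show ?thesis using hom_quotient[OF e(1) G(1,2)[OF i]] e by blast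
qed

text \<open>The divergence identity is applied with two pairs of exponents, one with second exponent
  0 and one with \<delta> > 0. Both compute the same divergence, as 0 and as \<delta> e, so the
  eigenvalue e vanishes.\<close>

lemma small_degree_invariance:
  assumes p: "pfun a" "pfun b" "pfun c" and h: "hom (Suc r) a" "hom (Suc r) b" "hom (Suc r) c" and s: "\<And>v. dd f v (a v, b v, c v) = 0"
    and r: "3 * (r + 3) < 2 * (3 * k + d)" and j: "j < k + d"
  shows "dd (G j) v (a v, b v, c v) = 0"
proof -
  obtain e where e: "pfun e" "\<And>v. dd (G j) v (a v, b v, c v) = e v * G j v"
    using eigenvalues[OF p h s j] by blast
  define m where "m = 3 * k + d"
  define H where "H v = (\<Prod>i\<in>{..<k + d} - {j}. G i v)" for v
  have H: "pfun H" "f v = G j v * H v" for v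
    unfolding H_def by (rule pfun_prod) (use G(1) f_split[OF j] in auto)
  have m: "m > 0" "Suc (deg j) \<le> m" using k d by (auto simp: m_def deg_def)
  \<comment> \<open>The field has degree \<open>Suc r\<close>, so its degree plus 2 is r +
    3.\<close>
  define \<beta> :: real where "\<beta> = (r + 3) / m"
  \<comment> \<open>The first bound keeps the sum of the exponents below 2/3, the second keeps
    \<beta> - \<mu> nonnegative.\<close>
  define \<delta> where "\<delta> = min ((2 / 3 - \<beta>) / 2) \<beta>"
  have "real (3 * (r + 3)) < real (2 * m)" using r unfolding m_def by (simp only: of_nat_less_iff)
  then have "3 * (real r + 3) < 2 * real m" by simp
  then have \<beta>: "\<beta> < 2 / 3" "\<beta> > 0" using m by (auto simp: \<beta>_def field_simps)
  moreover have "\<delta> \<le> (2 / 3 - \<beta>) / 2" unfolding \<delta>_def by (rule min.cobounded1)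
  ultimately have \<delta>: "0 < \<delta>" "\<delta> \<le> \<beta>" "\<beta> + \<delta> < 2 / 3" by (auto simp: \<delta>_def)
  have \<beta>m: "\<beta> * m = r + 3" using m by (simp add: \<beta>_def)
  have int: "(\<integral>\<^sup>+v\<in>K. ipow (2 * b) (norm (f v)) \<partial>lborel) < \<infinity>" if "0 \<le> b" "b < 2 / 3" "compact K" "0 \<notin> K" for b K
    by (rule integrable_sing_compact[OF f(1,2) that(1,2) sings that(3,4)])
  note td = twisted_divergence[OF f(1) f(2)[folded m_def] G(1,2)[OF j] H p h s e(2) e(1) _ _ _ _ int, where v = v]
  have "dv a b c v = of_real 0 * e v"
    by (rule td[where ?\<beta>1.0 = \<beta> and ?\<beta>2.0 = 0]) (use \<beta> \<beta>m in auto)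
  \<comment> \<open>Raising the exponent of G_j to \<delta> is compensated by lowering that of f by
    \<mu>, so the total degree is unchanged.\<close>
  moreover define \<mu> where "\<mu> = \<delta> * Suc (deg j) / m"
  have "\<mu> * m = \<delta> * Suc (deg j)" "0 \<le> \<mu>" "\<mu> \<le> \<delta>"
    using m \<delta> by (auto simp: \<mu>_def field_simps simp del: of_nat_Suc intro!: mult_left_mono)
  then have "dv a b c v = of_real \<delta> * e v"
    by (intro td[where ?\<beta>1.0 = "\<beta> - \<mu>" and ?\<beta>2.0 = \<delta>]) (use \<beta> \<beta>m \<delta> in \<open>auto simp: algebra_simps\<close>)
  ultimately have "e v = 0" using \<delta> by simp
  then show ?thesis by (simp add: e(2))
qed

text \<open>In the case of one line, the cubics restrict to the line with equal logarithmic derivatives, so a common zero of one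
  of them and the line is a zero of all.\<close>
lemma invariant_field_zero:
  assumes p: "pfun a" "pfun b" "pfun c" and z: "\<And>j v. j < k + d \<Longrightarrow> dd (G j) v (a v, b v, c v) = 0" and kd: "d \<ge> 2 \<or> k \<ge> 3"
  shows "(a v, b v, c v) = 0"
proof (rule ccontr)
  assume nz: "(a v, b v, c v) \<noteq> 0"
  \<comment> \<open>g is a component of the field that is not identically zero; polynomial
    identities need checking only where it is nonzero, hence where the field is.\<close>
  obtain g v0 where g: "pfun g" "g v0 \<noteq> 0" "\<And>v. g v \<noteq> 0 \<Longrightarrow> (a v, b v, c v) \<noteq> 0"
  proof -
    consider "a v \<noteq> 0" | "b v \<noteq> 0" | "c v \<noteq> 0" using nz by (auto simp: zero_prod_def)
    then show ?thesis
    proof cases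
      case 1 then show ?thesis by (rule that[OF p(1)]) (simp add: zero_prod_def)
    next
      case 2 then show ?thesis by (rule that[OF p(2)]) (simp add: zero_prod_def)
    next
      case 3 then show ?thesis by (rule that[OF p(3)]) (simp add: zero_prod_def)
    qed
  qed
  have S: "smc (G i)" if "i < k" for i using smooth_cubic_smc[OF cubics[OF that]] .
  have L: "pfun (G i)" "hom (Suc 0) (G i)" if "k \<le> i" "i < k + d" for i using line_formD(1,2)[OF lines[OF that]] by auto
  show False
  proof (cases "d \<ge> 2")
    case True
    let ?l1 = "G k" and ?l2 = "G (k + 1)"
    have l: "line_form ?l1" "line_form ?l2" and zs: "zero_set ?l1 \<noteq> zero_set ?l2" using lines distinct True by auto
    have lin: "?l1 v = dd ?l1 0 v" "?l2 v = dd ?l2 0 v" for v using line_formD(4) l by auto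
    have ldd: "dd ?l1 v w = ?l1 w" "dd ?l2 v w = ?l2 w" for v w using linear_dd line_formD(1,2) l by auto
    obtain e1 where e1: "?l1 e1 \<noteq> 0" "?l2 e1 = 0" using line_forms_kernels[OF l zs] by blast
    obtain e2 where e2: "?l2 e2 \<noteq> 0" "?l1 e2 = 0" using line_forms_kernels[OF l(2,1)] zs by blast
    have "indep2 e1 e2"
      unfolding indep2_def
    proof (intro allI impI)
      fix s t assume 0: "tsmul s e1 + tsmul t e2 = 0"
      have "s * ?l1 e1 + t * ?l1 e2 = 0" "s * ?l2 e1 + t * ?l2 e2 = 0"
        using arg_cong[OF 0, of "dd ?l1 0"] arg_cong[OF 0, of "dd ?l2 0"] unfolding dd_lin ldd by auto
      then show "s = 0 \<and> t = 0" using e1 e2 by simp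
    qed
    then obtain u where u: "det3 e1 e2 u \<noteq> 0" using indep2_complement by blast
    \<comment> \<open>A vector in the kernel of both linear forms. The field annihilates both forms,
      so it is pointwise a multiple of n, and the cubic would be a cone with vertex n.\<close>
    define n where "n = u - tsmul (?l1 u / ?l1 e1) e1 - tsmul (?l2 u / ?l2 e2) e2"
    have n: "dd (G 0) v n = 0" for v
    proof (rule pfun_eqI_mult[where f = "\<lambda>v. dd (G 0) v n" and g = "\<lambda>_. 0", OF pfun_dd_dir[OF smcD(1)[OF S]] pfun_const g(1,2)])
      show "0 < k" using k by simp
      fix v assume "g v \<noteq> 0"
      let ?\<theta> = "(a v, b v, c v)"
      obtain \<alpha> \<beta> \<gamma> where "?\<theta> = tsmul \<alpha> e1 + tsmul \<beta> e2 + tsmul \<gamma> u" using basis_expansion[OF u] by blast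
      moreover have "u = n + tsmul (?l1 u / ?l1 e1) e1 + tsmul (?l2 u / ?l2 e2) e2" by (simp add: n_def)
      ultimately have "?\<theta> = tsmul \<alpha> e1 + tsmul \<beta> e2 + tsmul \<gamma> (n + tsmul (?l1 u / ?l1 e1) e1 + tsmul (?l2 u / ?l2 e2) e2)" by metis
      moreover have "tsmul \<alpha> e1 + tsmul \<beta> e2 + tsmul \<gamma> (n + tsmul x e1 + tsmul y e2) = tsmul (\<alpha> + \<gamma> * x) e1 + tsmul (\<beta> + \<gamma> * y) e2 + tsmul \<gamma> n" for x y
        by (simp add: tsmul_add tsmul_tsmul tsmul_add_left add_ac)
      ultimately obtain \<alpha>' \<beta>' where \<theta>: "?\<theta> = tsmul \<alpha>' e1 + tsmul \<beta>' e2 + tsmul \<gamma> n" by metis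
      have ln: "?l1 n = 0" "?l2 n = 0" unfolding lin[of n] unfolding n_def dd_lin ldd using e1 e2 by simp_all
      have "dd ?l1 v ?\<theta> = 0" "dd ?l2 v ?\<theta> = 0" using z True by auto
      then have "\<alpha>' = 0" "\<beta>' = 0" unfolding \<theta> dd_lin ldd using e1 e2 ln by auto
      then have \<theta>: "?\<theta> = tsmul \<gamma> n" using \<theta> by simp
      then have "\<gamma> \<noteq> 0" using g(3)[OF \<open>g v \<noteq> 0\<close>] by auto
      moreover have "dd (G 0) v (tsmul \<gamma> n) = 0" unfolding \<theta>[symmetric] using z k by auto
      ultimately show "dd (G 0) v n = 0" by (simp add: dd_lin)
    qed
    have "n \<noteq> 0"
    proof
      assume "n = 0"
      then have "u = tsmul (?l1 u / ?l1 e1) e1 + tsmul (?l2 u / ?l2 e2) e2" by (simp add: n_def algebra_simps)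
      moreover have "det3 e1 e2 (tsmul s e1 + tsmul t e2) = 0" for s t
        by (cases e1; cases e2; simp add: det3_def algebra_simps)
      ultimately show False using u by metis
    qed
    then show False using smc_not_cone[OF S _ n] k by auto
  next
    case False
    then have k3: "k \<ge> 3" using kd by simp
    let ?l = "G k"
    have l: "pfun ?l" "hom (Suc 0) ?l" using L d by auto
    obtain e e' where kb: "indep2 e e'" "dd ?l 0 e = 0" "dd ?l 0 e' = 0" using kernel_basis by blast
    have le: "?l e = 0" "?l e' = 0" using kb linear_dd[OF l] by auto
    obtain u where u: "det3 e e' u \<noteq> 0" using indep2_complement[OF kb(1)] by blast
    have lu: "?l u \<noteq> 0"
    proof
      assume "?l u = 0"
      have "?l w = 0" for w
      proof -
        obtain \<alpha> \<beta> \<gamma> where w: "w = tsmul \<alpha> e + tsmul \<beta> e' + tsmul \<gamma> u" using basis_expansion[OF u] by blast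
        have "dd ?l 0 w = 0" unfolding w dd_lin linear_dd[OF l] using le \<open>?l u = 0\<close> by simp
        then show ?thesis using linear_dd[OF l] by simp
      qed
      then show False using G(3)[of k] d by auto
    qed
    \<comment> \<open>The field lies in the plane of the line, and a nonzero vector there is
      annihilated by both gradients; so their restrictions to the plane are proportional.\<close>
    have J: "dd (G i) v e * dd (G j) v e' - dd (G i) v e' * dd (G j) v e = 0" if ij: "i < k" "j < k" for i j v
    proof (rule pfun_eqI_mult[where f = "\<lambda>v. dd (G i) v e * dd (G j) v e' - dd (G i) v e' * dd (G j) v e" and g = "\<lambda>_. 0", OF _ pfun_const g(1,2)])
      show "pfun (\<lambda>v. dd (G i) v e * dd (G j) v e' - dd (G i) v e' * dd (G j) v e)"
        by (intro pfun_intros pfun_dd_dir smcD(1)[OF S] ij)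
      fix v assume "g v \<noteq> 0"
      let ?\<theta> = "(a v, b v, c v)"
      obtain \<alpha> \<beta> \<gamma> where \<theta>: "?\<theta> = tsmul \<alpha> e + tsmul \<beta> e' + tsmul \<gamma> u" using basis_expansion[OF u] by blast
      have "dd ?l v ?\<theta> = 0" using z d by auto
      then have "\<gamma> = 0" unfolding \<theta> dd_lin linear_dd[OF l] using le lu by simp
      then have \<theta>: "?\<theta> = tsmul \<alpha> e + tsmul \<beta> e'" using \<theta> by simp
      have "dd (G i) v ?\<theta> = 0" "dd (G j) v ?\<theta> = 0" using z ij by auto
      then have *: "\<alpha> * dd (G i) v e + \<beta> * dd (G i) v e' = 0" "\<alpha> * dd (G j) v e + \<beta> * dd (G j) v e' = 0" unfolding \<theta> dd_lin by auto
      have "\<alpha> * (dd (G i) v e * dd (G j) v e' - dd (G i) v e' * dd (G j) v e) = 0"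
        "\<beta> * (dd (G i) v e * dd (G j) v e' - dd (G i) v e' * dd (G j) v e) = 0" using * by algebra+
      moreover have "\<alpha> \<noteq> 0 \<or> \<beta> \<noteq> 0" using \<theta> g(3)[OF \<open>g v \<noteq> 0\<close>] by auto
      ultimately show "dd (G i) v e * dd (G j) v e' - dd (G i) v e' * dd (G j) v e = 0" by auto
    qed
    \<comment> \<open>Euler's identity upgrades this proportionality to equality of logarithmic
      derivatives along the plane.\<close>
    have log: "G i v * dd (G j) v w = G j v * dd (G i) v w"
      if ij: "i < k" "j < k" and vw: "v = tsmul x e + tsmul y e'" "w = tsmul x' e + tsmul y' e'" for i j v w x y x' y'
    proof -
      have "dd (G i) v v = 3 * G i v" "dd (G j) v v = 3 * G j v" using euler[OF smcD(1,2)[OF S]] ij by auto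
      then have eu: "x * dd (G i) v e + y * dd (G i) v e' = 3 * G i v" "x * dd (G j) v e + y * dd (G j) v e' = 3 * G j v"
        unfolding vw(1)[symmetric] by (simp_all add: vw(1) dd_lin)
      have "3 * (G i v * dd (G j) v w - G j v * dd (G i) v w) = 0"
        unfolding vw(2) dd_lin using eu J[OF ij, of v] by algebra
      then show ?thesis by (metis mult_eq_0_iff zero_neq_numeral right_minus_eq)
    qed
    have k0: "0 < k" using k by simp
    obtain s t q where q: "q = tsmul s e + tsmul t e'" "q \<noteq> 0" "G 0 q = 0"
      using plane_zero'[OF smcD(1,3)[OF S[OF k0]] kb(1)] by metis
    have other: "G j q = 0" if j: "j < k" for j
    proof (rule ccontr)
      assume nj: "G j q \<noteq> 0"
      have S0: "smc (G 0)" using S k by simp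
      obtain x y where xy: "G 0 (tsmul x e + tsmul y e') \<noteq> 0" using smc_nonzero_on_plane[OF S0 kb(1)] by blast
      define w where "w = tsmul (x - s) e + tsmul (y - t) e'"
      have line: "q + tsmul \<tau> w = tsmul (s + \<tau> * (x - s)) e + tsmul (t + \<tau> * (y - t)) e'" for \<tau>
        by (simp add: q(1) w_def tsmul_add tsmul_tsmul tsmul_add_left add_ac)
      obtain P where P: "\<And>\<tau>. G 0 (q + tsmul \<tau> w) = poly P \<tau>" using pfun_line[OF smcD(1)[OF S0]] by metis
      obtain Q where Q: "\<And>\<tau>. G j (q + tsmul \<tau> w) = poly Q \<tau>" using pfun_line[OF smcD(1)[OF S[OF j]]] by metis
      have dP: "poly (pderiv P) \<tau> = dd (G 0) (q + tsmul \<tau> w) w" for \<tau>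
        using pfun_line_deriv[OF smcD(1)[OF S0], of q w \<tau>] unfolding P using poly_DERIV DERIV_unique by blast
      have dQ: "poly (pderiv Q) \<tau> = dd (G j) (q + tsmul \<tau> w) w" for \<tau>
        using pfun_line_deriv[OF smcD(1)[OF S[OF j]], of q w \<tau>] unfolding Q using poly_DERIV DERIV_unique by blast
      have "poly (P * pderiv Q) \<tau> = poly (Q * pderiv P) \<tau>" for \<tau>
        using log[OF _ j line w_def, of 0 \<tau>] k unfolding poly_mult dP dQ P Q by simp
      then have "P * pderiv Q = Q * pderiv P" using poly_eq_poly_eq_iff by blast
      moreover have "poly P 0 = 0" "poly Q 0 \<noteq> 0" using P[of 0] Q[of 0] q(3) nj by auto
      ultimately have "P = 0" by (rule zero_of_log_derivative_eq)
      then have "G 0 (q + tsmul 1 w) = 0" unfolding P by simp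
      then show False using xy unfolding line by simp
    qed
    have "dd ?l 0 q = 0" unfolding q(1) dd_lin using kb by simp
    then have "?l q = 0" using linear_dd[OF l] by simp
    \<comment> \<open>Three cubics and the line pass through q, one component too many for
      D4.\<close>
    then have "G (if i < 3 then i else k) q = 0" for i using other k3 by simp
    moreover have "(if i < 3 then i else k) < k + d" for i using k3 d by auto
    moreover have "inj_on (\<lambda>i. if i < 3 then i else k) {..<4}" using k3 by (auto simp: inj_on_def)
    ultimately have "(4::nat) = 3" using triple_point[of 4 "\<lambda>i. if i < 3 then i else k" q] q(2) by auto
    then show False by simp
  qed
qed

text \<open>The eigenvalue on the first cubic is a constant 3x, so subtracting x times the Euler
  field gives a linear field that annihilates the cubic, which is 0. The original field is then x
  times Euler, and it kills f only if x = 0.\<close>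

lemma linear_field_zero:
  assumes p: "pfun a" "pfun b" "pfun c" and h: "hom (Suc 0) a" "hom (Suc 0) b" "hom (Suc 0) c" and s: "\<And>v. dd f v (a v, b v, c v) = 0"
  shows "(a v, b v, c v) = 0"
proof -
  have S: "smc (G 0)" using smooth_cubic_smc[OF cubics] k by auto
  obtain e where e: "pfun e" "hom 0 e" "\<And>v. dd (G 0) v (a v, b v, c v) = e v * G 0 v"
    using eigenvalues[OF p h s, of 0] k by auto
  define x where "x = e 0 / 3"
  have x: "e v = 3 * x" for v using hom_0_const[OF e(1,2)] by (simp add: x_def)
  have eq: "(a v - x * fst v, b v - x * fst (snd v), c v - x * snd (snd v)) = (a v, b v, c v) - tsmul x v" for v
    by (simp add: tsmul_def)
  have "dd (G 0) v (a v - x * fst v, b v - x * fst (snd v), c v - x * snd (snd v)) = 0" for v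
    unfolding eq dd_lin e(3) x euler[OF smcD(1,2)[OF S]] by simp
  then have "a v - x * fst v = 0 \<and> b v - x * fst (snd v) = 0 \<and> c v - x * snd (snd v) = 0" for v
    by (intro linear_syzygy[OF S, of "\<lambda>v. a v - x * fst v" "\<lambda>v. b v - x * fst (snd v)" "\<lambda>v. c v - x * snd (snd v)"] pfun_intros p)
       (use h in \<open>auto simp: hom_def algebra_simps\<close>)
  then have \<theta>: "(a v, b v, c v) = tsmul x v" for v by (simp add: tsmul_def)
  obtain v0 where v0: "f v0 \<noteq> 0" using f(3) by blast
  have "dd f v0 (tsmul x v0) = 0" using s[of v0] unfolding \<theta> .
  then have "x * (of_nat (3 * k + d) * f v0) = 0" unfolding dd_lin euler[OF f(1,2)] .
  then have "x = 0" using v0 k by (simp add: add_eq_0_iff del: of_nat_add of_nat_mult)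
  then show ?thesis using \<theta> by simp
qed

text \<open>Subtracting (e/3) times the Euler field, with e the linear eigenvalue on the cubic,
  makes both fields annihilate the cubic and still preserve the lines, so they become
  dependent.\<close>

lemma quadratic_fields_dependent:
  fixes A B C :: "nat \<Rightarrow> pt \<Rightarrow> complex"
  assumes kd: "k = 1" "d = 2" and p: "\<And>i. pfun (A i)" "\<And>i. pfun (B i)" "\<And>i. pfun (C i)"
    and h: "\<And>i. hom 2 (A i)" "\<And>i. hom 2 (B i)" "\<And>i. hom 2 (C i)" and s: "\<And>i v. dd f v (A i v, B i v, C i v) = 0"
  shows "\<exists>\<alpha> \<beta>. (\<alpha>, \<beta>) \<noteq> (0, 0) \<and> (\<forall>v. \<alpha> * A 0 v + \<beta> * A 1 v = 0 \<and> \<alpha> * B 0 v + \<beta> * B 1 v = 0 \<and> \<alpha> * C 0 v + \<beta> * C 1 v = 0)"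
proof -
  have S: "smc (G 0)" using smooth_cubic_smc[OF cubics] k by auto
  have l: "line_form (G 1)" "line_form (G 2)" using lines kd by auto
  have zs: "zero_set (G 1) \<noteq> zero_set (G 2)" using distinct[of 1 2] kd by auto
  have ldd: "dd (G 1) v w = G 1 w" "dd (G 2) v w = G 2 w" for v w using linear_dd line_formD(1,2) l by auto
  have h': "hom (Suc 1) (A i)" "hom (Suc 1) (B i)" "hom (Suc 1) (C i)" for i using h by (auto simp: numeral_2_eq_2)
  have "\<forall>i j. \<exists>e. j < k + d \<longrightarrow> pfun e \<and> hom 1 e \<and> (\<forall>v. dd (G j) v (A i v, B i v, C i v) = e v * G j v)"
    using eigenvalues[OF p h' s] by blast
  then obtain e where "\<forall>i j. j < k + d \<longrightarrow> pfun (e i j) \<and> hom 1 (e i j) \<and> (\<forall>v. dd (G j) v (A i v, B i v, C i v) = e i j v * G j v)"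
    by metis
  then have e: "pfun (e i j)" "hom (Suc 0) (e i j)" "dd (G j) v (A i v, B i v, C i v) = e i j v * G j v" if "j < 3" for i j v
    using that kd by auto
  define a b c where "a i v = A i v - e i 0 v / 3 * fst v" and "b i v = B i v - e i 0 v / 3 * fst (snd v)"
    and "c i v = C i v - e i 0 v / 3 * snd (snd v)" for i v
  have eq: "(a i v, b i v, c i v) = (A i v, B i v, C i v) - tsmul (e i 0 v / 3) v" for i v
    by (simp add: tsmul_def a_def b_def c_def)
  have e3: "pfun (\<lambda>v. e i j v / 3)" if "j < 3" for i j using pfun_mult[OF e(1)[OF that] pfun_const[of "1/3"]] by simp
  have pa: "pfun (a i)" "pfun (b i)" "pfun (c i)" for i
    unfolding a_def b_def c_def by (intro pfun_intros p e3; simp)+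
  have ha: "hom 2 (a i)" "hom 2 (b i)" "hom 2 (c i)" for i
    unfolding a_def b_def c_def using h[of i] e(2)[of 0 i] by (auto simp: hom_def algebra_simps power2_eq_square)
  define P where "P j i v = e i j v - e i 0 v / 3" for i j v
  have P: "pfun (P j i)" "hom (Suc 0) (P j i)" if "j < 3" for i j
    unfolding P_def using e(1)[OF that] e3[of 0] e(2)[OF that] e(2)[of 0] by (auto simp: hom_def algebra_simps intro!: pfun_diff)
  have syz: "dd (G 0) v (a i v, b i v, c i v) = 0" for i v
    unfolding eq dd_lin euler[OF smcD(1,2)[OF S]] using e(3)[of 0 v i] by simp
  have inv: "G j (a i v, b i v, c i v) = P j i v * G j v" if j: "j = 1 \<or> j = 2" for i j v
  proof -
    have dj: "dd (G j) v w = G j w" for w using ldd j by metis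
    have "dd (G j) v ((A i v, B i v, C i v) - tsmul (e i 0 v / 3) v) = P j i v * G j v"
      unfolding dd_lin using e(3)[of j v i] j by (auto simp: P_def dj algebra_simps)
    then show ?thesis unfolding eq dj .
  qed
  have tang: "\<not> (\<forall>w. dd (G 0) q w = x * G 1 w) \<and> \<not> (\<forall>w. dd (G 0) q w = x * G 2 w)"
    if q: "q \<noteq> 0" "G 1 q = 0" "G 2 q = 0" "G 0 q = 0" for q x
  proof -
    have "G i q = 0" if "i < 3" for i 
    proof -
      from that consider "i = 0" | "i = 1" | "i = 2" by linarith
      then show ?thesis by cases (use q in auto)
    qed
    then have D4: "sing_type f q nf_D4" using triple_point[of 3 "\<lambda>i. i" q] kd q by auto
    \<comment> \<open>The cubic is moved to index 2, the factor whose tangent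
      \<open>D4_tangents\<close> compares with the other two.\<close>
    let ?g = "\<lambda>i::nat. if i = 2 then G 0 else G (Suc i)"
    have g: "pfun (?g i)" "?g i q = 0" if "i < 3" for i
      using that q G(1)[of 0] G(1)[of "Suc i"] kd by (auto simp: less_Suc_eq numeral_3_eq_3 numeral_2_eq_2)
    have fg: "f v = (\<Prod>i<3. ?g i v) * 1" for v
      by (simp add: kd numeral_3_eq_3 numeral_2_eq_2 lessThan_Suc)
    have False if "\<And>w. dd (?g 2) q w = x * dd (?g j) q w" "j < 2" for j
      by (rule D4_tangents[OF D4 _ _ _ fg that]) (use g pfun_const in auto)
    from this[of 0] this[of 1] show ?thesis using ldd by (auto simp: numeral_2_eq_2)
  qed
  have "\<exists>\<alpha> \<beta>. (\<alpha>, \<beta>) \<noteq> (0, 0) \<and> (\<forall>v. \<alpha> * a 0 v + \<beta> * a 1 v = 0 \<and> \<alpha> * b 0 v + \<beta> * b 1 v = 0 \<and> \<alpha> * c 0 v + \<beta> * c 1 v = 0)"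
  proof (rule quad_syzygies_dependent[OF S line_formD(1)[OF l(1)] line_formD(1)[OF l(2)] line_formD(2)[OF l(1)] line_formD(2)[OF l(2)]
      line_forms_kernels[OF l zs] line_forms_kernels[OF l(2,1) zs[symmetric]], where P = "P 1" and Q = "P 2"])
    show "G 1 (a i v, b i v, c i v) = P 1 i v * G 1 v" "G 2 (a i v, b i v, c i v) = P 2 i v * G 2 v" for i v
      by (rule inv; simp)+
    show "\<not> (\<forall>w. dd (G 0) q w = x * G 1 w) \<and> \<not> (\<forall>w. dd (G 0) q w = x * G 2 w)"
      if "q \<noteq> 0" "G 1 q = 0" "G 2 q = 0" "G 0 q = 0" for q x
      by (rule tang[OF that])
  qed (rule pa ha syz P; simp)+
  then obtain \<alpha> \<beta> where ab': "(\<alpha>, \<beta>) \<noteq> (0, 0) \<and> (\<forall>v. \<alpha> * a 0 v + \<beta> * a 1 v = 0 \<and> \<alpha> * b 0 v + \<beta> * b 1 v = 0 \<and> \<alpha> * c 0 v + \<beta> * c 1 v = 0)"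
    by (elim exE)
  note ab = conjunct1[OF ab'] conjunct2[OF ab', THEN spec]
  \<comment> \<open>The dependent combination of the original fields is g times the Euler field; it
    annihilates f, so g f = 0 and g = 0.\<close>
  define g where "g v = \<alpha> * (e 0 0 v / 3) + \<beta> * (e 1 0 v / 3)" for v
  have comb: "tsmul \<alpha> (A 0 v, B 0 v, C 0 v) + tsmul \<beta> (A 1 v, B 1 v, C 1 v) = tsmul (g v) v" for v
    using ab(2)[of v] by (simp add: a_def b_def c_def g_def tsmul_def algebra_simps)
  have pg: "pfun g" unfolding g_def by (rule pfun_add; rule pfun_mult[OF pfun_const e3]; simp)
  have "g v * f v = 0" for v
  proof -
    have "dd f v (tsmul (g v) v) = 0" unfolding comb[symmetric] dd_lin s by simp
    then have "g v * (of_nat (3 * k + d) * f v) = 0" unfolding dd_lin euler[OF f(1,2)] .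
    then show ?thesis using kd by simp
  qed
  then have "\<forall>v. g v = 0" using pfun_domain[OF pg f(1)] f(3) by blast
  then have "\<alpha> * A 0 v + \<beta> * A 1 v = 0 \<and> \<alpha> * B 0 v + \<beta> * B 1 v = 0 \<and> \<alpha> * C 0 v + \<beta> * C 1 v = 0" for v
    using comb[of v] by (simp add: zero_prod_def)
  then have "\<forall>v. \<alpha> * A 0 v + \<beta> * A 1 v = 0 \<and> \<alpha> * B 0 v + \<beta> * B 1 v = 0 \<and> \<alpha> * C 0 v + \<beta> * C 1 v = 0" ..
  from conjI[OF ab(1) this] show ?thesis by (intro exI)
qed

end

theorem theorem4:
  fixes k d :: nat and G :: "nat \<Rightarrow> pt \<Rightarrow> complex"
  assumes "k \<ge> 1" and "d \<ge> 1"
    and cubics: "\<forall>i<k. smooth_cubic (G i)"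
    and lines: "\<forall>i. k \<le> i \<and> i < k + d \<longrightarrow> line_form (G i)"
    and distinct: "\<forall>i<k + d. \<forall>j<k + d. i \<noteq> j \<longrightarrow> zero_set (G i) \<noteq> zero_set (G j)"
    and sings: "\<forall>p. sing_point (\<lambda>v. \<Prod>i<k + d. G i v) p \<longrightarrow>
        sing_type (\<lambda>v. \<Prod>i<k + d. G i v) p nf_A1 \<or>
        sing_type (\<lambda>v. \<Prod>i<k + d. G i v) p nf_A5 \<or>
        sing_type (\<lambda>v. \<Prod>i<k + d. G i v) p nf_D4"
    and free: "free_curve (3 * k + d) (\<lambda>v. \<Prod>i<k + d. G i v)"
  shows "3 * k + d \<in> {6, 7, 9}"
proof (rule ccontr)
  assume n: "3 * k + d \<notin> {6, 7, 9}"
  interpret cubic_line_arrangement k d G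
    by unfold_locales (use assms in blast)+
  obtain A B C :: "nat \<Rightarrow> pt \<Rightarrow> complex" and D :: "nat \<Rightarrow> nat"
    where D: "1 \<le> D 0" "D 0 \<le> D 1" "D 0 + D 1 = 3 * k + d - 1" "\<And>i. D (Suc i) = D 1"
      and p: "\<And>i. pfun (A i)" "\<And>i. pfun (B i)" "\<And>i. pfun (C i)"
      and h: "\<And>i. hom (D i) (A i)" "\<And>i. hom (D i) (B i)" "\<And>i. hom (D i) (C i)"
      and s: "\<And>i v. dd f v (A i v, B i v, C i v) = 0"
      and ind: "\<And>\<alpha> \<beta>. (\<And>v. \<alpha> * A 0 v + \<beta> * A 1 v = 0 \<and> \<alpha> * B 0 v + \<beta> * B 1 v = 0 \<and> \<alpha> * C 0 v + \<beta> * C 1 v = 0) \<Longrightarrow> \<alpha> = 0 \<and> \<beta> = 0"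
  proof (rule free_curveE[OF free], goal_cases)
    case (1 A B C D)
    from 1(2-) show ?case by (rule that)
  qed
  have nz: "\<not> (\<forall>v. (A 0 v, B 0 v, C 0 v) = 0)" using ind[of 1 0] by (auto simp: zero_prod_def)
  obtain r where r: "D 0 = Suc r" using D(1) by (cases "D 0") auto
  note h0 = h[of 0, unfolded r]
  have r2: "2 * r + 3 \<le> 3 * k + d" using D(2,3) r by linarith
  \<comment> \<open>With r one less than the smaller degree, these are the three regimes: divergence
    identity, linear field, and two quadratic fields for one cubic and two lines.\<close>
  have "3 * (r + 3) < 2 * (3 * k + d) \<and> (d \<ge> 2 \<or> k \<ge> 3) \<or> r = 0 \<or> k = 1 \<and> d = 2 \<and> r = 1"
  proof (cases "3 * k + d \<ge> 10")
    case True
    have "3 * (r + 3) < 2 * m" if "10 \<le> m" "2 * r + 3 \<le> m" for m using that by simp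
    from this[OF True r2] have "3 * (r + 3) < 2 * (3 * k + d)" .
    moreover have "d \<ge> 2 \<or> k \<ge> 3" using True by linarith
    ultimately show ?thesis by blast
  next
    case False
    have "3 * k + d = 4 \<or> 3 * k + d = 5 \<or> 3 * k + d = 8"
      using False n \<open>k \<ge> 1\<close> \<open>d \<ge> 1\<close> by simp linarith
    moreover have "k = 1 \<and> d = 1" if "3 * k + d = 4" using that \<open>k \<ge> 1\<close> \<open>d \<ge> 1\<close> by linarith
    moreover have "k = 1 \<and> d = 2" if "3 * k + d = 5" using that \<open>k \<ge> 1\<close> \<open>d \<ge> 1\<close> by presburger
    moreover have "d \<ge> 2" if "3 * k + d = 8" using that \<open>d \<ge> 1\<close> by presburger
    ultimately consider "k = 1" "d = 1" | "k = 1" "d = 2" | "3 * k + d = 8" "d \<ge> 2" by blast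
    then show ?thesis
    proof cases
      case 1 then show ?thesis using r2 by simp
    next
      case 2 then show ?thesis using r2 by simp linarith
    next
      case 3
      then have "r \<le> 2" using r2 by simp
      then show ?thesis using 3 by simp
    qed
  qed
  then consider "3 * (r + 3) < 2 * (3 * k + d)" "d \<ge> 2 \<or> k \<ge> 3" | "r = 0" | "k = 1" "d = 2" "r = 1" by blast
  then show False
  proof cases
    case 1
    have "dd (G j) v (A 0 v, B 0 v, C 0 v) = 0" if "j < k + d" for j v
      using small_degree_invariance[OF p h0 s 1(1) that] .
    from invariant_field_zero[OF p this 1(2)] nz show False by blast
  next
    case 2
    from linear_field_zero[OF p h0[unfolded 2] s] nz show False by blast
  next
    case 3
    \<comment> \<open>Total degree 5 forces D 0 + D 1 = 4, and r = 1 means D 0 = 2.\<close>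
    have "D i = 2" for i using 3 r D(3) D(4)[of "i - 1"] by (cases i) auto
    then have h2: "hom 2 (A i)" "hom 2 (B i)" "hom 2 (C i)" for i using h[of i] by simp_all
    from quadratic_fields_dependent[of A B C, OF 3(1,2) p h2 s]
    obtain \<alpha> \<beta> where "(\<alpha>, \<beta>) \<noteq> (0, 0) \<and> (\<forall>v. \<alpha> * A 0 v + \<beta> * A 1 v = 0 \<and> \<alpha> * B 0 v + \<beta> * B 1 v = 0 \<and> \<alpha> * C 0 v + \<beta> * C 1 v = 0)"
      by (elim exE)
    then show False using ind[of \<alpha> \<beta>] by blast
  qed
qed

end
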